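(* Let $\mathcal N$ be either $\mathcal N_{KS}$ or $\mathcal N_{CH}$, where $\mathcal N_{KS}(u)=u\,\partial_x u$ and $\mathcal N_{CH}(u)=-\partial_x^2(u^3)$. Let $s>\tfrac12$ and let $u_0,u_1\in H^s(\mathbb T)$ be real-valued. Consider the control system $$\partial_t u+\partial_x^4u+\partial_x^2u+\mathcal N(u)=\big(p_1(t)+p_2(t)\cos x+p_3(t)\sin x\big)u,\quad t>0,\ x\in\mathbb T,\qquad u(0,\cdot)=u_0.\qquad (\ast)$$ Then: (A) If $\operatorname{sign}(u_0)=\operatorname{sign}(u_1)$ on $\mathbb T$, then $(\ast)$ is small-time $L^2$-approximately controllable from $u_0$ to $u_1$: for every $T>0$ and $\varepsilon>0$ there exist $\tau\in(0,T]$ and $p=(p_1,p_2,p_3)\in L^2((0,\tau);\mathbb R^3)$ such that the solution $u$ of $(\ast)$ with control $p$ and initial datum $u_0$ is well defined on $[0,\tau]$ and satisfies $\|u(\tau)-u_1\|_{L^2(\mathbb T)}<\varepsilon$. (B) If $u_0,u_1>0$ on $\mathbb T$ (respectively $u_0,u_1<0$ on $\mathbb T$), then $(\ast)$ is $H^s$-approximately controllable from $u_0$ to $u_1$: for every $T>0$ and $\varepsilon>0$ there exists $p=(p_1,p_2,p_3)\in L^2((0,T);\mathbb R^3)$ such that the solution $u$ of $(\ast)$ with control $p$ and initial datum $u_0$ is well defined on $[0,T]$ and satisfies $\|u(T)-u_1\|_{H^s(\mathbb T)}<\varepsilon$.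
   Context: $\mathbb T=\mathbb R/2\pi\mathbb Z$. For $s\ge 0$, $H^s(\mathbb T)$ is the space of real-valued functions $u=\sum_{k\in\mathbb Z}\widehat u_k e^{ikx}$ (with $\widehat u_{-k}=\overline{\widehat u_k}$) such that $\|u\|_{H^s(\mathbb T)}^2=\sum_{k\in\mathbb Z}(1+|k|^2)^s|\widehat u_k|^2<\infty$. For $s>1/2$ such functions are identified with their continuous representatives, and $\operatorname{sign}(u_0)=\operatorname{sign}(u_1)$, $u_0>0$, etc. are meant pointwise at every $x\in\mathbb T$, with $\operatorname{sign}\in\{-1,0,1\}$ and $\operatorname{sign}(0)=0$. A solution of $(\ast)$ on $[0,\tau]$ is a (unique) mild solution $u\in C([0,\tau];H^s(\mathbb T))$, i.e. $u(t)=e^{-t\partial_x^4}u_0+\int_0^t e^{-(t-r)\partial_x^4}\big(-\partial_x^2u-\mathcal N(u)+Qu\big)(r)\,dr$ with $Q(t,x)=p_1(t)+p_2(t)\cos x+p_3(t)\sin x$, where $e^{-t\partial_x^4}$ is the Fourier multiplier with symbol $e^{-tk^4}$ and $u\,\partial_xu=\tfrac12\partial_x(u^2)$. *)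

theory Defs
  imports "HOL-Analysis.Analysis"
begin

text \<open>
  Functions on the torus \<open>\<real>/2\<pi>\<int>\<close> are \<open>2\<pi>\<close>-periodic functions on the real line.  Periodic
  distributions are represented by their families of Fourier coefficients, of type
  \<open>int \<Rightarrow> complex\<close>; this is where the derivatives of Sobolev functions live.
\<close>

definition fourier_coeff :: "(real \<Rightarrow> real) \<Rightarrow> int \<Rightarrow> complex" where
  "fourier_coeff u k =
     (LINT x:{0..2*pi}|lborel. complex_of_real (u x) * cis (- (of_int k * x))) / of_real (2*pi)"

text \<open>
  Each class in \<open>H\<^sup>s\<close> is represented by its continuous member, which exists for \<open>s > 1/2\<close>;
  the set below is meant for this range of \<open>s\<close> only.
\<close>

definition sobolev_space :: "real \<Rightarrow> (real \<Rightarrow> real) set" where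
  "sobolev_space s = {u. continuous_on UNIV u \<and> (\<forall>x. u (x + 2*pi) = u x) \<and>
     (\<lambda>k::int. (1 + \<bar>real_of_int k\<bar>^2) powr s * (cmod (fourier_coeff u k))^2) summable_on UNIV}"

definition sobolev_norm :: "real \<Rightarrow> (real \<Rightarrow> real) \<Rightarrow> real" where
  "sobolev_norm s u =
     sqrt (\<Sum>\<^sub>\<infinity>k::int. (1 + \<bar>real_of_int k\<bar>^2) powr s * (cmod (fourier_coeff u k))^2)"

definition L2_norm :: "(real \<Rightarrow> real) \<Rightarrow> real" where
  "L2_norm u = sqrt (LINT x:{0..2*pi}|lborel. (u x)^2)"

definition continuous_into_sobolev :: "real \<Rightarrow> real \<Rightarrow> (real \<Rightarrow> real \<Rightarrow> real) \<Rightarrow> bool" where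
  "continuous_into_sobolev s \<tau> u \<longleftrightarrow>
     (\<forall>t\<in>{0..\<tau>}. u t \<in> sobolev_space s \<and>
        ((\<lambda>r. sobolev_norm s (\<lambda>x. u r x - u t x)) \<longlongrightarrow> 0) (at t within {0..\<tau>}))"

definition dx :: "(int \<Rightarrow> complex) \<Rightarrow> int \<Rightarrow> complex" where
  "dx c k = \<i> * of_int k * c k"

text \<open>\<open>u \<partial>\<^sub>xu\<close> is read as \<open>\<partial>\<^sub>x(u\<^sup>2)/2\<close>.\<close>

definition N_KS :: "(real \<Rightarrow> real) \<Rightarrow> int \<Rightarrow> complex" where
  "N_KS u k = dx (fourier_coeff (\<lambda>x. (u x)^2)) k / 2"

definition N_CH :: "(real \<Rightarrow> real) \<Rightarrow> int \<Rightarrow> complex" where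
  "N_CH u k = - dx (dx (fourier_coeff (\<lambda>x. (u x)^3))) k"

text \<open>
  \<open>semigroup4 t c x\<close> is the value at \<open>x\<close> of \<open>e\<close> to the \<open>-t\<partial>\<^sub>x\<^sup>4\<close> applied to the distribution with
  Fourier coefficients \<open>c\<close>.  For \<open>t > 0\<close> the series converges absolutely as soon as \<open>c\<close> has at most
  polynomial growth.
\<close>

definition semigroup4 :: "real \<Rightarrow> (int \<Rightarrow> complex) \<Rightarrow> real \<Rightarrow> complex" where
  "semigroup4 t c x =
     (\<Sum>\<^sub>\<infinity>k::int. of_real (exp (- t * real_of_int k ^ 4)) * c k * cis (of_int k * x))"

definition control_potential :: "(real \<Rightarrow> real^3) \<Rightarrow> real \<Rightarrow> real \<Rightarrow> real" where
  "control_potential p t x = p t $ 1 + p t $ 2 * cos x + p t $ 3 * sin x"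

definition L2_control :: "real \<Rightarrow> (real \<Rightarrow> real^3) \<Rightarrow> bool" where
  "L2_control \<tau> p \<longleftrightarrow> set_borel_measurable lborel {0<..<\<tau>} p \<and>
     set_integrable lborel {0<..<\<tau>} (\<lambda>t. (norm (p t))^2)"

definition source :: "((real \<Rightarrow> real) \<Rightarrow> int \<Rightarrow> complex) \<Rightarrow> (real \<Rightarrow> real^3) \<Rightarrow>
    (real \<Rightarrow> real \<Rightarrow> real) \<Rightarrow> real \<Rightarrow> int \<Rightarrow> complex" where
  "source N p u r k = - dx (dx (fourier_coeff (u r))) k - N (u r) k
     + fourier_coeff (\<lambda>x. control_potential p r x * u r x) k"

text \<open>
  Since \<open>H\<^sup>s\<close> embeds into the continuous functions for \<open>s > 1/2\<close>, the \<open>H\<^sup>s\<close>-valued Duhamel integral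
  is determined by its values at the points \<open>x\<close>, which are the integrals of the values of the
  integrand.  The value of the integrand at \<open>r = t\<close>, where the series need not converge, is
  immaterial.
\<close>

definition mild_solution :: "((real \<Rightarrow> real) \<Rightarrow> int \<Rightarrow> complex) \<Rightarrow> real \<Rightarrow> (real \<Rightarrow> real) \<Rightarrow>
    real \<Rightarrow> (real \<Rightarrow> real^3) \<Rightarrow> (real \<Rightarrow> real \<Rightarrow> real) \<Rightarrow> bool" where
  "mild_solution N s u0 \<tau> p u \<longleftrightarrow> continuous_into_sobolev s \<tau> u \<and>
     (\<forall>t\<in>{0..\<tau>}. \<forall>x.
        set_integrable lborel {0..t} (\<lambda>r. semigroup4 (t - r) (source N p u r) x) \<and>
        complex_of_real (u t x) = semigroup4 t (fourier_coeff u0) x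
          + (LINT r:{0..t}|lborel. semigroup4 (t - r) (source N p u r) x))"

text \<open>
  That the solution is well defined on \<open>[0,\<tau>]\<close> means that a mild solution exists there and is
  unique; values of \<open>u\<close> at times outside \<open>[0,\<tau>]\<close> are irrelevant.
\<close>

definition is_solution :: "((real \<Rightarrow> real) \<Rightarrow> int \<Rightarrow> complex) \<Rightarrow> real \<Rightarrow> (real \<Rightarrow> real) \<Rightarrow>
    real \<Rightarrow> (real \<Rightarrow> real^3) \<Rightarrow> (real \<Rightarrow> real \<Rightarrow> real) \<Rightarrow> bool" where
  "is_solution N s u0 \<tau> p u \<longleftrightarrow> mild_solution N s u0 \<tau> p u \<and>
     (\<forall>v. mild_solution N s u0 \<tau> p v \<longrightarrow> (\<forall>t\<in>{0..\<tau>}. v t = u t))"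

definition small_time_L2_approx_controllable ::
    "((real \<Rightarrow> real) \<Rightarrow> int \<Rightarrow> complex) \<Rightarrow> real \<Rightarrow> (real \<Rightarrow> real) \<Rightarrow> (real \<Rightarrow> real) \<Rightarrow> bool" where
  "small_time_L2_approx_controllable N s u0 u1 \<longleftrightarrow>
     (\<forall>T>0. \<forall>\<epsilon>>0. \<exists>\<tau>\<in>{0<..T}. \<exists>p u. L2_control \<tau> p \<and> is_solution N s u0 \<tau> p u \<and>
        L2_norm (\<lambda>x. u \<tau> x - u1 x) < \<epsilon>)"

definition Hs_approx_controllable ::
    "((real \<Rightarrow> real) \<Rightarrow> int \<Rightarrow> complex) \<Rightarrow> real \<Rightarrow> (real \<Rightarrow> real) \<Rightarrow> (real \<Rightarrow> real) \<Rightarrow> bool" where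
  "Hs_approx_controllable N s u0 u1 \<longleftrightarrow>
     (\<forall>T>0. \<forall>\<epsilon>>0. \<exists>p u. L2_control T p \<and> is_solution N s u0 T p u \<and>
        sobolev_norm s (\<lambda>x. u T x - u1 x) < \<epsilon>)"

end

theory Submission
  imports Defs "HOL-Probability.Probability" "HOL-Complex_Analysis.Complex_Analysis"
begin

text \<open>
  In Fourier variables the equation reads \<open>c'\<^sub>k = (k\<^sup>2 - k\<^sup>4) c\<^sub>k - \<nu>\<^sub>k (c * \<dots> * c)\<^sub>k + (Q c)\<^sub>k\<close> with
  \<open>m = 2\<close> or \<open>m = 3\<close> factors in the convolution and \<open>|\<nu>\<^sub>k| \<le> k\<^sup>2\<close>; both nonlinearities are treated at
  once.  There are three ideas.

  The nonlinearity can be switched off.  Multiplying a function by a scalar \<open>\<eta>(t)\<close> costs only the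
  control \<open>\<eta>'/\<eta>\<close> in the component \<open>p\<^sub>1\<close>, and \<open>u = \<eta> w\<close> solves the equation if \<open>w\<close> solves it with
  nonlinearity \<open>\<eta>\<^sup>m\<^sup>-\<^sup>1 N(w)\<close>.  With \<open>\<eta> = exp (- M min(t, \<tau> - t))\<close> the factor is tiny except near the
  two ends of \<open>[0,\<tau>]\<close>, while \<open>\<eta>(\<tau>) = 1\<close>.  The parabolic kernel turns this into a nonlinear term of
  size \<open>O(M\<^sup>-\<^sup>1\<^sup>/\<^sup>2)\<close> (\<open>kbound_small\<close>), so that \<open>w\<close> exists on the whole interval
  (\<open>nl_solution_exists\<close>) and \<open>w(\<tau>)\<close> is as close as desired to the linear solution (\<open>nl_close\<close>).
  Hence any final state of the linear equation is approximately attained (\<open>realize_linear\<close>).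

  The linear equation can multiply the state by every \<open>exp \<psi>\<close> in small time.  A large constant
  control on a short interval does it for \<open>\<psi>\<close> in the span of \<open>1, cos, sin\<close> (\<open>impulse_steer\<close>).  If it
  is possible for all real multiples of \<open>\<phi>\<close>, conjugating a free evolution of duration \<open>e\<^sup>4\<close> with
  \<open>exp (\<phi>/e)\<close> produces \<open>exp (- \<phi>'\<^sup>4)\<close> as \<open>e \<rightarrow> 0\<close> (\<open>conjugated_evolution_limit\<close>), because only the
  quartic symbol, evaluated at the imaginary frequency \<open>i \<phi>'/e\<close>, survives.  The sum of the rotates
  of \<open>\<phi>'\<^sup>4\<close> is constant, so \<open>exp (\<phi>'\<^sup>4)\<close> is available as well (\<open>quartic_lmults\<close>); polarization then
  generates all trigonometric polynomials, and by density all continuous exponents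
  (\<open>per_lmults\<close>).  Two functions of equal sign are joined approximately by such a factor
  (\<open>same_sign_small\<close>), which proves the first claim.

  For the second claim the state is steered through a constant.  Constants are equilibria of the
  free evolution, so waiting there makes the total time exact, and a last short free evolution
  upgrades closeness in \<open>L\<^sup>2\<close> to closeness in \<open>H\<^sup>s\<close> (\<open>steer_exact_time\<close>).

  Existence, uniqueness and the mild formulation are handled by coefficientwise estimates in
  weighted sequence spaces.  A mild solution is the same as a solution of the Duhamel equation for
  each Fourier coefficient (\<open>mild_iff_coeff\<close>), for which uniqueness holds among curves that are
  continuous in the space of absolutely convergent Fourier series (\<open>coeff_equation_unique\<close>).
\<close>

section \<open>Weighted square-summable sequences\<close>

definition wt :: "real \<Rightarrow> int \<Rightarrow> real" where
  "wt s k = (1 + (real_of_int k)\<^sup>2) powr (s/2)"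

text \<open>Bounds are stated for finite partial sums, so that \<open>hs s C B\<close> also carries the convergence of the
  \<open>H\<^sup>s\<close> norm of \<open>C\<close>.  Curves of coefficients are controlled by such a \<open>C\<close> that majorizes them at all
  times.\<close>

definition hs :: "real \<Rightarrow> (int \<Rightarrow> real) \<Rightarrow> real \<Rightarrow> bool" where
  "hs s C B \<longleftrightarrow> (\<forall>F. finite F \<longrightarrow> L2_set (\<lambda>k. wt s k * C k) F \<le> B)"

lemma wt_pos [simp]: "wt s k > 0"
proof -
  have "1 + (real_of_int k)\<^sup>2 > 0" by (smt (verit) zero_le_power2)
  then show ?thesis by (simp add: wt_def)
qed

lemma wt_nonneg [simp]: "wt s k \<ge> 0"
  using wt_pos[of s k] by linarith

lemma wt_neq0 [simp]: "wt s k \<noteq> 0"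
  using wt_pos[of s k] by linarith

lemma wt_ge1: "s \<ge> 0 \<Longrightarrow> wt s k \<ge> 1"
  by (auto simp: wt_def intro!: ge_one_powr_ge_zero)

lemma wt_0 [simp]: "wt 0 k = 1"
proof -
  have "1 + (real_of_int k)\<^sup>2 > 0" by (smt (verit) zero_le_power2)
  then show ?thesis by (simp add: wt_def)
qed

lemma wt_sq: "(wt s k)\<^sup>2 = (1 + \<bar>real_of_int k\<bar>^2) powr s"
proof -
  have "(wt s k)\<^sup>2 = wt s k * wt s k" by (simp add: power2_eq_square)
  also have "\<dots> = (1 + (real_of_int k)\<^sup>2) powr s" unfolding wt_def by (subst powr_add[symmetric]) simp
  finally show ?thesis by simp
qed

lemma wt_subadd:
  assumes "s \<ge> 0" shows "wt s (j + l) \<le> 2 powr s * (wt s j + wt s l)"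
proof -
  have *: "wt s (j + l) \<le> 2 powr s * wt s m" if "1 + (real_of_int (j+l))\<^sup>2 \<le> 4 * (1 + (real_of_int m)\<^sup>2)" for m
  proof -
    have "wt s (j+l) \<le> (4 * (1 + (real_of_int m)\<^sup>2)) powr (s/2)"
      unfolding wt_def using that assms by (intro powr_mono2) auto
    also have "\<dots> = (2\<^sup>2) powr (s/2) * wt s m"
      by (subst powr_mult) (auto simp: wt_def)
    also have "((2::real)\<^sup>2) powr (s/2) = 2 powr s"
      by (subst powr_realpow[symmetric]) (simp_all add: powr_powr)
    finally show ?thesis .
  qed
  have sq: "(real_of_int (j+l))\<^sup>2 \<le> 2 * (real_of_int j)\<^sup>2 + 2 * (real_of_int l)\<^sup>2"
    using sum_squares_bound[of "real_of_int j" "real_of_int l"] by (simp add: power2_sum)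
  have "1 + (real_of_int (j+l))\<^sup>2 \<le> 4 * (1 + (real_of_int j)\<^sup>2) \<or> 1 + (real_of_int (j+l))\<^sup>2 \<le> 4 * (1 + (real_of_int l)\<^sup>2)"
    using sq by (smt (verit))
  then have "wt s (j + l) \<le> 2 powr s * wt s j \<or> wt s (j + l) \<le> 2 powr s * wt s l" using * by blast
  moreover have "2 powr s * wt s j \<ge> 0" "2 powr s * wt s l \<ge> 0" by auto
  ultimately show ?thesis unfolding distrib_left by linarith
qed

lemma hs_mono: "hs s D B \<Longrightarrow> (\<And>k. \<bar>C k\<bar> \<le> D k) \<Longrightarrow> B \<le> B' \<Longrightarrow> hs s C B'"
  unfolding hs_def
proof (intro allI impI)
  fix F :: "int set" assume a: "\<forall>F. finite F \<longrightarrow> L2_set (\<lambda>k. wt s k * D k) F \<le> B" "\<And>k. \<bar>C k\<bar> \<le> D k" "B \<le> B'" "finite F"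
  have "L2_set (\<lambda>k. wt s k * C k) F = L2_set (\<lambda>k. wt s k * \<bar>C k\<bar>) F"
    by (simp add: L2_set_def power_mult_distrib)
  also have "\<dots> \<le> L2_set (\<lambda>k. wt s k * D k) F"
    by (intro L2_set_mono mult_left_mono a) auto
  also have "\<dots> \<le> B'" using a by force
  finally show "L2_set (\<lambda>k. wt s k * C k) F \<le> B'" .
qed

lemma hs_nonneg: "hs s C B \<Longrightarrow> B \<ge> 0"
  unfolding hs_def by (drule spec[of _ "{}"]) (simp add: L2_set_def)

lemma hs_zero [simp]: "B \<ge> 0 \<Longrightarrow> hs s (\<lambda>_. 0) B"
  by (auto simp: hs_def L2_set_def)

lemma hs_add: "hs s C B \<Longrightarrow> hs s D B' \<Longrightarrow> hs s (\<lambda>k. C k + D k) (B + B')"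
  unfolding hs_def
proof (intro allI impI)
  fix F :: "int set" assume a: "\<forall>F. finite F \<longrightarrow> L2_set (\<lambda>k. wt s k * C k) F \<le> B"
     "\<forall>F. finite F \<longrightarrow> L2_set (\<lambda>k. wt s k * D k) F \<le> B'" "finite F"
  have "L2_set (\<lambda>k. wt s k * (C k + D k)) F \<le> L2_set (\<lambda>k. wt s k * C k) F + L2_set (\<lambda>k. wt s k * D k) F"
    unfolding distrib_left by (rule L2_set_triangle_ineq)
  then show "L2_set (\<lambda>k. wt s k * (C k + D k)) F \<le> B + B'" using a by force
qed

lemma hs_cmult: assumes "hs s C B" "a \<ge> 0" shows "hs s (\<lambda>k. a * C k) (a * B)"
  unfolding hs_def
proof (intro allI impI)
  fix F :: "int set" assume F: "finite F"
  have "L2_set (\<lambda>k. wt s k * (a * C k)) F = a * L2_set (\<lambda>k. wt s k * C k) F"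
    unfolding L2_set_right_distrib[OF assms(2)] by (simp add: mult_ac)
  also have "\<dots> \<le> a * B" using assms F by (auto simp: hs_def intro!: mult_left_mono)
  finally show "L2_set (\<lambda>k. wt s k * (a * C k)) F \<le> a * B" .
qed

lemma hs_point: assumes "hs s C B" "s \<ge> 0" shows "\<bar>C k\<bar> \<le> B"
proof -
  have "L2_set (\<lambda>k. wt s k * C k) {k} \<le> B" using assms(1)[unfolded hs_def, rule_format, of "{k}"] by simp
  then have "wt s k * \<bar>C k\<bar> \<le> B" by (simp add: L2_set_def abs_mult)
  moreover have "1 * \<bar>C k\<bar> \<le> wt s k * \<bar>C k\<bar>" by (intro mult_right_mono wt_ge1 assms) auto
  ultimately show ?thesis by linarith
qed

lemma L2_set_shift:
  fixes b :: "int \<Rightarrow> real"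
  shows "L2_set (\<lambda>k. b (k + j)) F = L2_set b ((\<lambda>k. k + j) ` F)"
  unfolding L2_set_def by (subst sum.reindex) (auto simp: inj_on_def)

lemma wt_shift:
  assumes "s \<ge> 0" "\<bar>j\<bar> \<le> 1" shows "wt s k \<le> 4 powr s * 2 * wt s (k + j)"
  proof -
    have 1: "wt s k \<le> 2 powr s * (wt s (k+j) + wt s (-j))" using wt_subadd[OF assms(1), of "k+j" "-j"] by simp
    have 2: "wt s (-j) \<le> 2 powr s * wt s (k+j)"
    proof -
      have "(real_of_int j)\<^sup>2 \<le> 1" using assms(2) by (simp add: abs_square_le_1)
      then have "wt s (-j) \<le> 2 powr (s/2)" unfolding wt_def using assms by (intro powr_mono2) auto
      also have "\<dots> \<le> 2 powr s" using assms by (intro powr_mono) auto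
      also have "\<dots> \<le> 2 powr s * wt s (k+j)" using wt_ge1[OF assms(1)] by (simp add: mult_le_cancel_left1)
      finally show ?thesis .
    qed
    have 3: "wt s (k+j) \<le> 2 powr s * wt s (k+j)"
      using mult_right_mono[of 1 "2 powr s" "wt s (k+j)"] ge_one_powr_ge_zero[of 2 s] assms(1) by simp
    have "wt s k \<le> 2 powr s * (2 powr s * wt s (k+j) + 2 powr s * wt s (k+j))"
      by (rule order_trans[OF 1]) (intro mult_left_mono add_mono 2 3, simp)
    also have "\<dots> = (2 powr s * 2 powr s) * 2 * wt s (k+j)" by (simp add: algebra_simps)
    also have "2 powr s * 2 powr s = (4::real) powr s" by (subst powr_mult[symmetric]) auto
    finally show ?thesis .
  qed

lemma hs_shift1:
  assumes "hs s C B" "s \<ge> 0" "\<bar>j\<bar> \<le> 1"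
  shows "hs s (\<lambda>k. C (k + j)) (4 powr s * 2 * B)"
  unfolding hs_def
proof (intro allI impI)
  fix F :: "int set" assume F: "finite F"
  note w = wt_shift[OF assms(2,3)]
  have "L2_set (\<lambda>k. wt s k * C (k + j)) F = L2_set (\<lambda>k. wt s k * \<bar>C (k + j)\<bar>) F"
    by (simp add: L2_set_def power_mult_distrib)
  also have "\<dots> \<le> L2_set (\<lambda>k. (4 powr s * 2) * \<bar>wt s (k+j) * C (k+j)\<bar>) F"
  proof (intro L2_set_mono)
    fix k show "wt s k * \<bar>C (k + j)\<bar> \<le> (4 powr s * 2) * \<bar>wt s (k+j) * C (k+j)\<bar>"
      using mult_right_mono[OF w[of k], of "\<bar>C (k+j)\<bar>"] by (simp add: abs_mult mult_ac)
  qed auto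
  also have "\<dots> = (4 powr s * 2) * L2_set (\<lambda>k. wt s (k+j) * C (k+j)) F"
    by (subst L2_set_right_distrib[symmetric]) (auto simp: L2_set_def)
  also have "L2_set (\<lambda>k. wt s (k+j) * C (k+j)) F = L2_set (\<lambda>k. wt s k * C k) ((\<lambda>k. k + j) ` F)"
    by (rule L2_set_shift)
  also have "\<dots> \<le> B" using assms F by (auto simp: hs_def)
  finally show "L2_set (\<lambda>k. wt s k * C (k + j)) F \<le> 4 powr s * 2 * B" by simp
qed

lemma tendsto_L2_set [tendsto_intros]:
  assumes "\<And>k. k \<in> F \<Longrightarrow> ((\<lambda>n. f n k) \<longlongrightarrow> g k) G"
  shows "((\<lambda>n. L2_set (f n) F) \<longlongrightarrow> L2_set g F) G"
  unfolding L2_set_def by (intro tendsto_intros assms)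

text \<open>Fatou's lemma for these norms: a finite partial sum involves finitely many coordinates only.\<close>

lemma hs_limit:
  assumes "\<And>n::nat. hs s (f n) B" "\<And>k. (\<lambda>n. f n k) \<longlonglongrightarrow> g k"
  shows "hs s g B"
  unfolding hs_def
proof (intro allI impI)
  fix F :: "int set" assume F: "finite F"
  have "(\<lambda>n. L2_set (\<lambda>k. wt s k * f n k) F) \<longlonglongrightarrow> L2_set (\<lambda>k. wt s k * g k) F"
    by (intro tendsto_intros assms)
  then show "L2_set (\<lambda>k. wt s k * g k) F \<le> B"
    by (rule LIMSEQ_le_const2) (use assms(1) F in \<open>auto simp: hs_def\<close>)
qed

lemma hs_suminf:
  fixes D :: "nat \<Rightarrow> int \<Rightarrow> real"
  assumes D: "\<And>i. hs s (D i) (b i)" "\<And>i k. D i k \<ge> 0" and b: "summable b" and s: "s \<ge> 0"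
  shows "summable (\<lambda>i. D i k)" "hs s (\<lambda>k. \<Sum>i. D i k) (suminf b)"
proof -
  have b0: "b i \<ge> 0" for i using hs_nonneg[OF D(1)] .
  show sm: "summable (\<lambda>i. D i k)" for k
    by (rule summable_comparison_test'[OF b, of 0]) (use hs_point[OF D(1) s] D(2) in auto)
  have p: "hs s (\<lambda>k. \<Sum>i<n. D i k) (\<Sum>i<n. b i)" for n
    by (induction n) (auto intro: hs_add D)
  show "hs s (\<lambda>k. \<Sum>i. D i k) (suminf b)"
  proof (rule hs_limit)
    show "hs s (\<lambda>k. \<Sum>i<n. D i k) (suminf b)" for n
      by (rule hs_mono[OF p]) (use D(2) sum_le_suminf[OF b, of "{..<n}"] b0 in \<open>auto simp: sum_nonneg\<close>)
    show "(\<lambda>n. \<Sum>i<n. D i k) \<longlonglongrightarrow> (\<Sum>i. D i k)" for k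
      using sm summable_LIMSEQ by blast
  qed
qed

subsection \<open>Absolutely summable sequences and convolution\<close>

definition l1n :: "(int \<Rightarrow> 'a::real_normed_vector) \<Rightarrow> real" where
  "l1n a = (\<Sum>\<^sub>\<infinity>k. norm (a k))"

abbreviation l1 :: "(int \<Rightarrow> 'a::real_normed_vector) \<Rightarrow> bool" where
  "l1 a \<equiv> (\<lambda>k. norm (a k)) summable_on UNIV"

lemma l1I: assumes "\<And>F. finite F \<Longrightarrow> (\<Sum>k\<in>F. norm (a k)) \<le> B" shows "l1 a" "l1n a \<le> B"
proof -
  show "l1 a" by (rule nonneg_bdd_above_summable_on) (auto intro!: bdd_aboveI2 assms)
  then show "l1n a \<le> B" unfolding l1n_def by (rule infsum_le_finite_sums) (use assms in auto)
qed

lemma l1_sum_le: "l1 a \<Longrightarrow> finite F \<Longrightarrow> (\<Sum>k\<in>F. norm (a k)) \<le> l1n a"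
  unfolding l1n_def by (rule finite_sum_le_infsum) auto

lemma l1n_nonneg [simp]: "l1n a \<ge> 0"
  unfolding l1n_def by (intro infsum_nonneg) auto

lemma l1_point: "l1 a \<Longrightarrow> norm (a k) \<le> l1n a"
  using l1_sum_le[of a "{k}"] by auto

lemma l1_mono:
  fixes b :: "int \<Rightarrow> real"
  assumes "l1 b" "\<And>k. norm (a k) \<le> b k" shows "l1 a" "l1n a \<le> l1n b"
proof -
  have *: "(\<Sum>k\<in>F. norm (a k)) \<le> l1n b" if "finite F" for F
  proof -
    have "(\<Sum>k\<in>F. norm (a k)) \<le> (\<Sum>k\<in>F. norm (b k))"
      by (intro sum_mono) (use assms(2) in \<open>auto intro: order_trans[OF assms(2)]\<close>)
    then show ?thesis using l1_sum_le[OF assms(1) that] by linarith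
  qed
  show "l1 a" "l1n a \<le> l1n b" by (rule l1I(1)[OF *], assumption, rule l1I(2)[OF *], assumption)
qed

lemma l1_add:
  assumes "l1 a" "l1 b" shows "l1 (\<lambda>k. a k + b k)" "l1n (\<lambda>k. a k + b k) \<le> l1n a + l1n b"
proof -
  have *: "(\<Sum>k\<in>F. norm (a k + b k)) \<le> l1n a + l1n b" if "finite F" for F
  proof -
    have "(\<Sum>k\<in>F. norm (a k + b k)) \<le> (\<Sum>k\<in>F. norm (a k)) + (\<Sum>k\<in>F. norm (b k))"
      unfolding sum.distrib[symmetric] by (intro sum_mono norm_triangle_ineq)
    then show ?thesis using l1_sum_le[OF assms(1) that] l1_sum_le[OF assms(2) that] by linarith
  qed
  show "l1 (\<lambda>k. a k + b k)" "l1n (\<lambda>k. a k + b k) \<le> l1n a + l1n b"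
    by (rule l1I(1)[OF *], assumption, rule l1I(2)[OF *], assumption)
qed

lemma l1_diff: "l1 a \<Longrightarrow> l1 b \<Longrightarrow> l1 (\<lambda>k. a k - b k)" "l1 a \<Longrightarrow> l1 b \<Longrightarrow> l1n (\<lambda>k. a k - b k) \<le> l1n a + l1n b"
  using l1_add[of a "\<lambda>k. - b k"] by (simp_all add: l1n_def)

lemma l1_norm: "l1 (\<lambda>k. norm (a k)) \<longleftrightarrow> l1 a" "l1n (\<lambda>k. norm (a k)) = l1n a"
  by (simp_all add: l1n_def)

lemma l1_cmult:
  fixes a :: "int \<Rightarrow> 'a::real_normed_div_algebra"
  shows "l1 a \<Longrightarrow> l1 (\<lambda>k. c * a k)" "l1n (\<lambda>k. c * a k) = norm c * l1n a"
  by (simp_all add: l1n_def norm_mult summable_on_cmult_right infsum_cmult_right')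

lemma l1_shift: "l1 a \<Longrightarrow> l1 (\<lambda>k. a (k + j))" "l1n (\<lambda>k. a (k + j)) = l1n a"
proof -
  have b: "bij_betw (\<lambda>k. k + j) UNIV (UNIV :: int set)" by (rule bij_betwI[where g="\<lambda>k. k - j"]) auto
  show "l1 a \<Longrightarrow> l1 (\<lambda>k. a (k + j))" using summable_on_reindex_bij_betw[OF b, of "\<lambda>k. norm (a k)"] by simp
  show "l1n (\<lambda>k. a (k + j)) = l1n a" unfolding l1n_def using infsum_reindex_bij_betw[OF b, of "\<lambda>k. norm (a k)"] by simp
qed

lemma sum_over_int_pos:
  fixes f :: "nat \<Rightarrow> real"
  assumes "summable f" "\<And>n. f n \<ge> 0" "finite F"
  shows "(\<Sum>k\<in>F. f (nat \<bar>k::int\<bar>)) \<le> 2 * suminf f"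
proof -
  have "(\<Sum>k\<in>F. f (nat (abs k))) = (\<Sum>k\<in>F\<inter>{0..}. f (nat (abs k))) + (\<Sum>k\<in>F\<inter>{..<0}. f (nat (abs k)))"
    by (subst sum.union_disjoint[symmetric]) (auto simp: assms intro!: sum.cong)
  also have "(\<Sum>k\<in>F\<inter>{0..}. f (nat (abs k))) = (\<Sum>n\<in>(\<lambda>k. nat (abs k)) ` (F\<inter>{0..}). f n)"
    by (subst sum.reindex) (auto simp: inj_on_def)
  also have "\<dots> \<le> suminf f" by (intro sum_le_suminf assms) (use assms in auto)
  also have "(\<Sum>k\<in>F\<inter>{..<0}. f (nat (abs k))) = (\<Sum>n\<in>(\<lambda>k. nat (abs k)) ` (F\<inter>{..<0}). f n)"
    by (subst sum.reindex) (auto simp: inj_on_def)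
  also have "\<dots> \<le> suminf f" by (intro sum_le_suminf assms) (use assms in auto)
  finally show ?thesis by simp
qed

text \<open>This is where \<open>s > 1/2\<close> enters: \<open>\<Sum> (1 + k\<^sup>2)\<^sup>-\<^sup>s\<close> converges exactly then.\<close>

lemma wt_inverse_l2:
  assumes s: "s > 1/2"
  obtains K where "K > 0" "\<And>F. finite F \<Longrightarrow> L2_set (\<lambda>k. 1 / wt s k) F \<le> K"
proof -
  define f where "f n = (1 + (real n)\<^sup>2) powr (-s)" for n
  have f0: "f n \<ge> 0" for n by (simp add: f_def)
  have "summable (\<lambda>n. real n powr (-(2 * s)))" using s by (subst summable_real_powr_iff) auto
  moreover have "norm (f n) \<le> real n powr (-(2 * s))" if "n \<ge> 1" for n
  proof -
    have "f n \<le> ((real n)\<^sup>2) powr (-s)" unfolding f_def using s that by (intro powr_mono2') auto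
    also have "(real n)\<^sup>2 = real n powr 2" by simp
    also have "(real n powr 2) powr (-s) = real n powr (-(2 * s))" by (subst powr_powr) simp
    finally show ?thesis using f0 by simp
  qed
  ultimately have sf: "summable f" by (rule summable_comparison_test'[where N=1]) auto
  define K where "K = sqrt (2 * suminf f) + 1"
  have K0: "sqrt (2 * suminf f) \<ge> 0" using suminf_nonneg[OF sf f0] by simp
  have inv: "(1 / wt s k)\<^sup>2 = f (nat \<bar>k\<bar>)" for k
    using wt_sq[of s k] by (simp add: power_divide f_def powr_minus divide_inverse power_inverse)
  show thesis
  proof
    show "K > 0" using K0 unfolding K_def by linarith
    fix F :: "int set" assume F: "finite F"
    have "L2_set (\<lambda>k. 1 / wt s k) F = sqrt (\<Sum>k\<in>F. f (nat \<bar>k\<bar>))"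
      unfolding L2_set_def inv ..
    also have "\<dots> \<le> sqrt (2 * suminf f)"
      by (intro real_sqrt_le_mono sum_over_int_pos sf f0 F)
    finally show "L2_set (\<lambda>k. 1 / wt s k) F \<le> K" by (simp add: K_def)
  qed
qed

lemma hs_l1:
  assumes s: "s > 1/2"
  obtains K where "K > 0" "\<And>C B. hs s C B \<Longrightarrow> l1 C \<and> l1n C \<le> K * B"
proof -
  obtain K where K: "K > 0" "\<And>F. finite F \<Longrightarrow> L2_set (\<lambda>k. 1 / wt s k) F \<le> K"
    using wt_inverse_l2[OF s] by blast
  show thesis
  proof
    show "K > 0" by (rule K)
    fix C B assume C: "hs s C B"
    have *: "(\<Sum>k\<in>F. norm (C k)) \<le> K * B" if F: "finite F" for F
    proof -
      have "(\<Sum>k\<in>F. norm (C k)) = (\<Sum>k\<in>F. \<bar>1 / wt s k\<bar> * \<bar>wt s k * C k\<bar>)"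
        by (intro sum.cong) (auto simp: abs_mult)
      also have "\<dots> \<le> L2_set (\<lambda>k. 1 / wt s k) F * L2_set (\<lambda>k. wt s k * C k) F"
        by (rule L2_set_mult_ineq)
      also have "\<dots> \<le> K * B"
        by (intro mult_mono K(2) F) (use C F K in \<open>auto simp: hs_def intro: L2_set_nonneg\<close>)
      finally show ?thesis .
    qed
    show "l1 C \<and> l1n C \<le> K * B" by (intro conjI l1I(1)[OF *] l1I(2)[OF *])
  qed
qed

definition conv :: "(int \<Rightarrow> 'a) \<Rightarrow> (int \<Rightarrow> 'a) \<Rightarrow> int \<Rightarrow> 'a::{real_normed_field,banach}" where
  "conv a b k = (\<Sum>\<^sub>\<infinity>j. a j * b (k - j))"

lemma conv_summable_bdd:
  fixes a b :: "int \<Rightarrow> 'a::{real_normed_field,banach}"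
  assumes "l1 a" "\<And>j. norm (b j) \<le> B"
  shows "(\<lambda>j. norm (a j * b (k - j))) summable_on UNIV"
proof (rule Infinite_Sum.abs_summable_on_comparison_test)
  show "(\<lambda>j. norm (norm (a j) * B)) summable_on UNIV"
    using assms(1) by (simp add: abs_mult summable_on_cmult_left)
  show "norm (a j * b (k - j)) \<le> norm (norm (a j) * B)" for j
    using mult_left_mono[OF assms(2)[of "k - j"], of "norm (a j)"] by (simp add: norm_mult abs_mult) (smt (verit) mult_left_mono norm_ge_zero)
qed

lemma conv_summable:
  fixes a b :: "int \<Rightarrow> 'a::{real_normed_field,banach}"
  assumes "l1 a" "l1 b"
  shows "(\<lambda>j. norm (a j * b (k - j))) summable_on UNIV"
  by (rule conv_summable_bdd[OF assms(1)]) (rule l1_point[OF assms(2)])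

lemma conv_commute: "conv a b k = conv b a k"
proof -
  have b: "bij_betw (\<lambda>j. k - j) UNIV (UNIV :: int set)" by (rule bij_betwI[where g="\<lambda>j. k - j"]) auto
  have "conv a b k = (\<Sum>\<^sub>\<infinity>j. a (k - j) * b (k - (k - j)))"
    unfolding conv_def using infsum_reindex_bij_betw[OF b, of "\<lambda>j. a j * b (k - j)"] by simp
  then show ?thesis by (simp add: conv_def mult.commute)
qed

lemma norm_conv_le:
  fixes a b :: "int \<Rightarrow> 'a::{real_normed_field,banach}"
  assumes "l1 A" "l1 B" "\<And>k. norm (a k) \<le> A k" "\<And>k. norm (b k) \<le> B k"
  shows "norm (conv a b k) \<le> conv A B k"
proof -
  have s: "(\<lambda>j. norm (a j * b (k - j))) summable_on UNIV"
    by (rule conv_summable) (use l1_mono assms in blast)+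
  have s2: "(\<lambda>j. A j * B (k - j)) summable_on UNIV"
    by (rule abs_summable_summable, rule conv_summable[OF assms(1,2)])
  have A0: "A j \<ge> 0" for j using assms(3)[of j] norm_ge_zero order_trans by blast
  have "norm (conv a b k) \<le> (\<Sum>\<^sub>\<infinity>j. norm (a j * b (k - j)))"
    unfolding conv_def by (rule norm_infsum_bound[OF s])
  also have "\<dots> \<le> conv A B k" unfolding conv_def
    by (intro infsum_mono s s2) (auto simp: norm_mult intro!: mult_mono assms A0)
  finally show ?thesis .
qed

lemma conv_nonneg: "(\<And>k. A k \<ge> 0) \<Longrightarrow> (\<And>k. B k \<ge> 0) \<Longrightarrow> conv A B k \<ge> (0::real)"
  unfolding conv_def by (intro infsum_nonneg) auto

lemma young:
  fixes a b :: "int \<Rightarrow> real"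
  assumes a: "l1 a" "\<And>j. a j \<ge> 0" and b: "\<And>F. finite F \<Longrightarrow> L2_set b F \<le> B" "\<And>j. b j \<ge> 0" and F: "finite F"
  shows "L2_set (conv a b) F \<le> l1n a * B"
proof -
  have B0: "B \<ge> 0" using b(1)[of "{}"] by simp
  have bp: "norm (b j) \<le> B" for j using b(1)[of "{j}"] by (simp add: L2_set_def)
  have sm: "(\<lambda>j. a j * b (k - j)) summable_on UNIV" for k
    by (rule abs_summable_summable, rule conv_summable_bdd[OF a(1) bp])
  have lim: "((\<lambda>J. L2_set (\<lambda>k. \<Sum>j\<in>J. a j * b (k - j)) F) \<longlongrightarrow> L2_set (conv a b) F) (finite_subsets_at_top UNIV)"
    unfolding conv_def using sm by (intro tendsto_intros) (metis has_sum_def has_sum_infsum)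
  show ?thesis
  proof (rule tendsto_upperbound[OF lim])
    show "\<forall>\<^sub>F J in finite_subsets_at_top UNIV. L2_set (\<lambda>k. \<Sum>j\<in>J. a j * b (k - j)) F \<le> l1n a * B"
      unfolding eventually_finite_subsets_at_top
    proof (intro exI conjI allI impI)
      fix J :: "int set" assume J: "finite J \<and> {} \<subseteq> J \<and> J \<subseteq> UNIV"
      then have "finite J" by simp
      then have "L2_set (\<lambda>k. \<Sum>j\<in>J. a j * b (k - j)) F \<le> (\<Sum>j\<in>J. a j * B)"
      proof (induction J)
        case (insert j J)
        have "L2_set (\<lambda>k. \<Sum>j\<in>insert j J. a j * b (k - j)) F
            \<le> L2_set (\<lambda>k. a j * b (k - j)) F + L2_set (\<lambda>k. \<Sum>j\<in>J. a j * b (k - j)) F"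
          using insert L2_set_triangle_ineq by simp
        also have "L2_set (\<lambda>k. a j * b (k - j)) F = a j * L2_set (\<lambda>k. b (k + (- j))) F"
          by (simp add: L2_set_right_distrib[OF a(2)])
        also have "L2_set (\<lambda>k. b (k + (- j))) F \<le> B" unfolding L2_set_shift using F by (intro b) auto
        finally show ?case using insert a(2)[of j] by (simp add: mult_left_mono)
      qed (auto simp: L2_set_def)
      also have "\<dots> = (\<Sum>j\<in>J. norm (a j)) * B" using a by (simp add: sum_distrib_right)
      also have "\<dots> \<le> l1n a * B" using l1_sum_le[OF a(1)] J B0 by (intro mult_right_mono) auto
      finally show "L2_set (\<lambda>k. \<Sum>j\<in>J. a j * b (k - j)) F \<le> l1n a * B" .
    qed auto
  qed auto
qed

text \<open>The algebra property of \<open>H\<^sup>s\<close>: the weight is subadditive up to a constant, so each half of the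
  product is a convolution of a square-summable and an absolutely summable sequence.\<close>

lemma hs_conv:
  assumes s: "s > 1/2"
  obtains K where "K > 0" "\<And>C D B B'. hs s C B \<Longrightarrow> hs s D B' \<Longrightarrow> (\<And>k. C k \<ge> 0) \<Longrightarrow> (\<And>k. D k \<ge> 0) \<Longrightarrow> hs s (conv C D) (K * B * B')"
proof -
  obtain L where L: "L > 0" "\<And>C B. hs s C B \<Longrightarrow> l1 C \<and> l1n C \<le> L * B" using hs_l1[OF s] by blast
  show thesis
  proof
    show "2 powr s * (2 * L) > 0" using L by simp
    fix C D B B' assume C: "hs s C B" and D: "hs s D B'" and C0: "\<And>k. C k \<ge> 0" and D0: "\<And>k. D k \<ge> 0"
    note CL = L(2)[OF C] and DL = L(2)[OF D]
    have B0: "B \<ge> 0" "B' \<ge> 0" using hs_nonneg C D by auto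
    let ?C = "\<lambda>k. wt s k * C k" and ?D = "\<lambda>k. wt s k * D k"
    have bC: "finite F \<Longrightarrow> L2_set ?C F \<le> B" and bD: "finite F \<Longrightarrow> L2_set ?D F \<le> B'" for F
      using C D by (auto simp: hs_def)
    have pC: "norm (?C j) \<le> B" and pD: "norm (?D j) \<le> B'" for j
      using bC[of "{j}"] bD[of "{j}"] by (auto simp: L2_set_def)
    have s1: "(\<lambda>j. D j * ?C (k - j)) summable_on UNIV" "(\<lambda>j. C j * ?D (k - j)) summable_on UNIV" for k
      by (rule abs_summable_summable, rule conv_summable_bdd, use CL DL pC pD in blast, use CL DL pC pD in blast)+
    have s1': "(\<lambda>j. ?C j * D (k - j)) summable_on UNIV" for k
    proof -
      have b: "bij_betw (\<lambda>j. k - j) UNIV (UNIV :: int set)" by (rule bij_betwI[where g="\<lambda>j. k - j"]) auto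
      show ?thesis using s1(1)[of k] summable_on_reindex_bij_betw[OF b, of "\<lambda>j. ?C j * D (k - j)"] by (simp add: mult_ac)
    qed
    have pt: "wt s k * conv C D k \<le> 2 powr s * (conv D ?C k + conv C ?D k)" for k
    proof -
      have "wt s k * conv C D k = (\<Sum>\<^sub>\<infinity>j. wt s k * (C j * D (k - j)))"
        unfolding conv_def by (rule infsum_cmult_right'[symmetric])
      also have "\<dots> \<le> (\<Sum>\<^sub>\<infinity>j. 2 powr s * (?C j * D (k - j) + C j * ?D (k - j)))"
      proof (rule infsum_mono)
        show "(\<lambda>j. wt s k * (C j * D (k - j))) summable_on UNIV"
          by (rule summable_on_cmult_right, rule abs_summable_summable, rule conv_summable) (use CL DL in auto)
        show "(\<lambda>j. 2 powr s * (?C j * D (k - j) + C j * ?D (k - j))) summable_on UNIV"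
          by (intro summable_on_cmult_right summable_on_add s1 s1')
        fix j
        have "wt s k \<le> 2 powr s * (wt s j + wt s (k - j))" using wt_subadd[of s j "k - j"] s by simp
        from mult_right_mono[OF this, of "C j * D (k - j)"]
        show "wt s k * (C j * D (k - j)) \<le> 2 powr s * (?C j * D (k - j) + C j * ?D (k - j))"
          using C0 D0 by (simp add: algebra_simps)
      qed
      also have "\<dots> = 2 powr s * ((\<Sum>\<^sub>\<infinity>j. ?C j * D (k - j)) + (\<Sum>\<^sub>\<infinity>j. C j * ?D (k - j)))"
        by (subst infsum_cmult_right', subst infsum_add[OF s1' s1(2)]) simp
      also have "(\<Sum>\<^sub>\<infinity>j. ?C j * D (k - j)) = conv D ?C k" using conv_commute[of ?C D k] by (simp add: conv_def)
      finally show ?thesis by (simp add: conv_def)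
    qed
    show "hs s (conv C D) (2 powr s * (2 * L) * B * B')"
      unfolding hs_def
    proof (intro allI impI)
      fix F :: "int set" assume F: "finite F"
      have "L2_set (\<lambda>k. wt s k * conv C D k) F \<le> L2_set (\<lambda>k. 2 powr s * (conv D ?C k + conv C ?D k)) F"
        by (intro L2_set_mono pt mult_nonneg_nonneg conv_nonneg C0 D0) auto
      also have "\<dots> = 2 powr s * L2_set (\<lambda>k. conv D ?C k + conv C ?D k) F"
        by (rule L2_set_right_distrib[symmetric]) auto
      also have "\<dots> \<le> 2 powr s * (L2_set (conv D ?C) F + L2_set (conv C ?D) F)"
        by (intro mult_left_mono L2_set_triangle_ineq) auto
      also have "\<dots> \<le> 2 powr s * (l1n D * B + l1n C * B')"
        using CL DL C0 D0 bC bD F by (intro mult_left_mono add_mono young) auto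
      also have "\<dots> \<le> 2 powr s * ((L * B') * B + (L * B) * B')"
        using CL DL B0 by (intro mult_left_mono add_mono mult_right_mono) auto
      finally show "L2_set (\<lambda>k. wt s k * conv C D k) F \<le> 2 powr s * (2 * L) * B * B'" by (simp add: algebra_simps)
    qed
  qed
qed

section \<open>Fourier series of continuous periodic functions\<close>

definition per :: "(real \<Rightarrow> real) set" where
  "per = {u. continuous_on UNIV u \<and> (\<forall>x. u (x + 2*pi) = u x)}"

text \<open>The Fourier coefficients of complex-valued functions, by gauge integrals; on continuous
  periodic functions they agree with \<open>fourier_coeff\<close>.\<close>

definition fcc :: "(real \<Rightarrow> complex) \<Rightarrow> int \<Rightarrow> complex" where
  "fcc f k = integral {0..2*pi} (\<lambda>x. f x * cis (- (of_int k * x))) / of_real (2*pi)"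

lemma continuous_on_cis' [continuous_intros]: "continuous_on S f \<Longrightarrow> continuous_on S (\<lambda>x. cis (f x))"
  unfolding cis_conv_exp by (intro continuous_intros)

lemma per_cont: "u \<in> per \<Longrightarrow> continuous_on S u"
  unfolding per_def using continuous_on_subset by blast

lemma per_cont_of_real: "u \<in> per \<Longrightarrow> continuous_on S (\<lambda>x. complex_of_real (u x))"
  by (intro continuous_intros per_cont)

lemma per_add: "u \<in> per \<Longrightarrow> u (x + 2*pi) = u x"
  by (simp add: per_def)

lemma per_int: assumes "u \<in> per" shows "u (x + 2 * pi * of_int n) = u x"
proof (induction n rule: int_induct[where k=0])
  case (step1 i)
  then show ?case using per_add[OF assms, of "x + 2 * pi * of_int i"] by (simp add: algebra_simps)
next
  case (step2 i)
  then show ?case using per_add[OF assms, of "x + 2 * pi * of_int (i-1)"] by (simp add: algebra_simps)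
qed simp

lemma per_reduce: obtains y n where "x = y + 2 * pi * of_int n" "y \<in> {0..2*pi}"
proof
  define n where "n = \<lfloor>x / (2*pi)\<rfloor>"
  have "of_int n \<le> x / (2*pi)" "x / (2*pi) \<le> of_int n + 1" unfolding n_def by linarith+
  then have "of_int n * (2*pi) \<le> x" "x \<le> (of_int n + 1) * (2*pi)" by (simp_all add: field_simps)
  then show "x - 2 * pi * of_int n \<in> {0..2*pi}" by (simp add: algebra_simps)
  show "x = (x - 2 * pi * of_int n) + 2 * pi * of_int n" by simp
qed

lemma per_bounded: assumes "u \<in> per" obtains B where "B > 0" "\<And>x. \<bar>u x\<bar> \<le> B"
proof -
  have "compact (u ` {0..2*pi})" by (intro compact_continuous_image per_cont assms compact_Icc)
  then have "bounded (u ` {0..2*pi})" by (rule compact_imp_bounded)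
  then obtain B where B: "B > 0" "\<And>y. y \<in> u ` {0..2*pi} \<Longrightarrow> norm y \<le> B" by (auto simp: bounded_pos)
  show thesis
  proof (rule that[OF B(1)])
    fix x obtain y n where "x = y + 2 * pi * of_int n" "y \<in> {0..2*pi}" by (rule per_reduce)
    then show "\<bar>u x\<bar> \<le> B" using B(2) per_int[OF assms] by auto
  qed
qed

lemma fourier_coeff_eq: "u \<in> per \<Longrightarrow> fourier_coeff u k = fcc (\<lambda>x. of_real (u x)) k"
  unfolding fourier_coeff_def fcc_def
  by (subst set_borel_integral_eq_integral) (auto intro!: borel_integrable_atLeastAtMost' continuous_intros per_cont_of_real)

lemma fcc_integrable: "continuous_on {0..2*pi} f \<Longrightarrow> (\<lambda>x. f x * cis (- (of_int k * x))) integrable_on {0..2*pi}"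
  by (intro integrable_continuous_real continuous_intros)

lemma fcc_add: "continuous_on {0..2*pi} f \<Longrightarrow> continuous_on {0..2*pi} g \<Longrightarrow> fcc (\<lambda>x. f x + g x) k = fcc f k + fcc g k"
  unfolding fcc_def by (simp add: distrib_right integral_add fcc_integrable add_divide_distrib)

lemma fcc_diff: "continuous_on {0..2*pi} f \<Longrightarrow> continuous_on {0..2*pi} g \<Longrightarrow> fcc (\<lambda>x. f x - g x) k = fcc f k - fcc g k"
  unfolding fcc_def by (simp add: left_diff_distrib integral_diff fcc_integrable diff_divide_distrib)

lemma fcc_cmult: "fcc (\<lambda>x. c * f x) k = c * fcc f k"
  unfolding fcc_def by (simp add: mult.assoc)

lemma fcc_zero [simp]: "fcc (\<lambda>x. 0) k = 0"
  by (simp add: fcc_def)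

lemma fcc_sum: "finite F \<Longrightarrow> (\<And>j. j \<in> F \<Longrightarrow> continuous_on {0..2*pi} (f j)) \<Longrightarrow> fcc (\<lambda>x. \<Sum>j\<in>F. f j x) k = (\<Sum>j\<in>F. fcc (f j) k)"
  by (induction F rule: finite_induct) (simp_all add: fcc_add continuous_on_sum)

lemma fcc_bound:
  assumes "continuous_on {0..2*pi} f" "\<And>x. x \<in> {0..2*pi} \<Longrightarrow> norm (f x) \<le> B"
  shows "norm (fcc f k) \<le> B"
proof -
  have "norm (integral {0..2*pi} (\<lambda>x. f x * cis (- (of_int k * x)))) \<le> B * (2*pi - 0)"
    by (intro integral_bound continuous_intros assms) (use assms in \<open>auto simp: norm_mult\<close>)
  then show ?thesis unfolding fcc_def by (simp add: norm_divide field_simps)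
qed

lemma cis_has_vector_derivative:
  "((\<lambda>x. cis (a * x)) has_vector_derivative \<i> * of_real a * cis (a * x)) (at x within S)"
proof -
  have eq: "(\<lambda>x. cis (a * x)) = (\<lambda>x. exp (x *\<^sub>R (\<i> * of_real a)))" by (auto simp: cis_conv_exp scaleR_conv_of_real mult_ac)
  show ?thesis unfolding fun_cong[OF eq, of x] unfolding eq
    using exp_scaleR_has_vector_derivative_right[of "\<i> * of_real a" x S] by (simp add: mult.commute)
qed

lemma cis_int_integral: "integral {0..2*pi} (\<lambda>x. cis (of_int k * x)) = (if k = 0 then of_real (2*pi) else 0)"
proof (cases "k = 0")
  case False
  have "((\<lambda>x. cis (of_int k * x)) has_integral
     (cis (of_int k * (2*pi)) / (\<i> * of_int k) - cis (of_int k * 0) / (\<i> * of_int k))) {0..2*pi}"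
  proof (rule fundamental_theorem_of_calculus)
    fix x :: real assume "x \<in> {0..2*pi}"
    have "((\<lambda>x. cis (of_int k * x) / (\<i> * of_int k)) has_vector_derivative
       (\<i> * of_real (of_int k) * cis (of_int k * x)) / (\<i> * of_int k)) (at x within {0..2*pi})"
      by (intro has_vector_derivative_divide cis_has_vector_derivative)
    then show "((\<lambda>x. cis (of_int k * x) / (\<i> * of_int k)) has_vector_derivative cis (of_int k * x)) (at x within {0..2*pi})"
      using False by simp
  qed simp
  moreover have "cis (of_int k * (2*pi)) = 1" using cis_multiple_2pi[of "of_int k"] by (simp add: mult_ac)
  ultimately show ?thesis using False by (simp add: integral_unique)
qed (simp add: scaleR_conv_of_real)

lemma fcc_cis: "fcc (\<lambda>x. c * cis (of_int j * x)) k = (if j = k then c else 0)"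
proof -
  have "(\<lambda>x. c * cis (of_int j * x) * cis (- (of_int k * x))) = (\<lambda>x. c * cis (of_int (j - k) * x))"
    by (auto simp: mult.assoc cis_mult algebra_simps)
  then show ?thesis unfolding fcc_def using cis_int_integral[of "j-k"] by simp
qed

lemma fcc_trig: "finite F \<Longrightarrow> fcc (\<lambda>x. \<Sum>j\<in>F. c j * cis (of_int j * x)) k = (if k \<in> F then c k else 0)"
  by (subst fcc_sum) (auto simp: fcc_cis intro!: continuous_intros)

subsection \<open>Functions with absolutely summable coefficients\<close>

definition synth :: "(int \<Rightarrow> complex) \<Rightarrow> real \<Rightarrow> complex" where
  "synth c x = (\<Sum>\<^sub>\<infinity>k. c k * cis (of_int k * x))"

lemma synth_uniform:
  assumes "l1 c"
  shows "uniform_limit UNIV (\<lambda>F x. \<Sum>k\<in>F. c k * cis (of_int k * x)) (synth c) (finite_subsets_at_top UNIV)"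
  unfolding synth_def by (rule Weierstrass_m_test_general[where M="\<lambda>k. norm (c k)"]) (auto simp: norm_mult assms)

lemma synth_cont: assumes "l1 c" shows "continuous_on S (synth c)"
proof -
  have "continuous_on UNIV (synth c)"
    by (rule uniform_limit_theorem[OF _ synth_uniform[OF assms]])
       (auto intro!: always_eventually continuous_intros)
  then show ?thesis using continuous_on_subset by blast
qed

lemma synth_summable: "l1 c \<Longrightarrow> (\<lambda>k. norm (c k * cis (of_int k * x))) summable_on UNIV"
  by (simp add: norm_mult)

lemma synth_periodic: "synth c (x + 2*pi) = synth c x"
proof -
  have "cis (of_int k * (x + 2*pi)) = cis (of_int k * x)" for k :: int
    using cis_multiple_2pi[of "of_int k"] by (simp add: distrib_left cis_mult[symmetric] mult_ac)
  then show ?thesis by (simp add: synth_def)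
qed

lemma fcc_synth: assumes "l1 c" shows "fcc (synth c) k = c k"
proof -
  have "norm (fcc (synth c) k - c k) \<le> e" if "e > 0" for e
  proof -
    have "\<forall>\<^sub>F F in finite_subsets_at_top UNIV. \<forall>x\<in>UNIV. dist (\<Sum>k\<in>F. c k * cis (of_int k * x)) (synth c x) < e"
      using synth_uniform[OF assms] that by (auto dest: uniform_limitD)
    then obtain X where X: "finite X" "\<And>F x. finite F \<Longrightarrow> X \<subseteq> F \<Longrightarrow> dist (\<Sum>k\<in>F. c k * cis (of_int k * x)) (synth c x) < e"
      unfolding eventually_finite_subsets_at_top by auto
    let ?F = "insert k X" let ?g = "\<lambda>x. \<Sum>k\<in>?F. c k * cis (of_int k * x)"
    have "norm (fcc (\<lambda>x. synth c x - ?g x) k) \<le> e"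
      using X(2)[of ?F, OF _ subset_insertI] X(1) by (intro fcc_bound continuous_intros synth_cont assms) (auto simp: dist_norm norm_minus_commute less_imp_le)
    also have "fcc (\<lambda>x. synth c x - ?g x) k = fcc (synth c) k - fcc ?g k"
      by (intro fcc_diff continuous_intros synth_cont assms)
    also have "fcc ?g k = c k" using fcc_trig[of ?F c k] X(1) by simp
    finally show ?thesis .
  qed
  then show ?thesis using field_le_epsilon[of "norm (fcc (synth c) k - c k)" 0] by auto
qed

subsection \<open>Bessel's inequality\<close>

lemma bessel_integral:
  assumes f: "continuous_on {0..2*pi} f" and F: "finite F"
  shows "L2_set (\<lambda>k. norm (fcc f k)) F \<le> sqrt (integral {0..2*pi} (\<lambda>x. (norm (f x))\<^sup>2) / (2*pi))"
proof -
  define S where "S x = (\<Sum>k\<in>F. fcc f k * cis (of_int k * x))" for x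
  have S: "continuous_on A S" for A unfolding S_def by (intro continuous_intros)
  define T where "T = (\<Sum>k\<in>F. (norm (fcc f k))\<^sup>2)"
  have ort: "integral {0..2*pi} (\<lambda>x. g x * cnj (S x)) = of_real (2*pi) * (\<Sum>k\<in>F. fcc g k * cnj (fcc f k))"
    if g: "continuous_on {0..2*pi} g" for g
  proof -
    have "integral {0..2*pi} (\<lambda>x. g x * cnj (S x)) = integral {0..2*pi} (\<lambda>x. \<Sum>k\<in>F. cnj (fcc f k) * (g x * cis (- (of_int k * x))))"
      unfolding S_def by (simp add: cnj_sum sum_distrib_left cis_cnj mult_ac)
    also have "\<dots> = (\<Sum>k\<in>F. integral {0..2*pi} (\<lambda>x. cnj (fcc f k) * (g x * cis (- (of_int k * x)))))"
      by (intro integral_sum F integrable_on_mult_right fcc_integrable g)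
    also have "\<dots> = of_real (2*pi) * (\<Sum>k\<in>F. fcc g k * cnj (fcc f k))"
      unfolding sum_distrib_left by (intro sum.cong refl) (simp add: fcc_def)
    finally show ?thesis .
  qed
  have "fcc S k = fcc f k" if "k \<in> F" for k
    unfolding S_def using fcc_trig[OF F, of "fcc f" k] that by simp
  then have SS: "integral {0..2*pi} (\<lambda>x. S x * cnj (S x)) = of_real (2*pi * T)"
    by (simp add: ort[OF S] T_def complex_norm_square del: of_real_power)
  have fS: "integral {0..2*pi} (\<lambda>x. f x * cnj (S x)) = of_real (2*pi * T)"
    by (simp add: ort[OF f] T_def complex_norm_square del: of_real_power)
  have int: "(\<lambda>x. f x * cnj (S x)) integrable_on {0..2*pi}" "(\<lambda>x. S x * cnj (S x)) integrable_on {0..2*pi}"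
    by (intro integrable_continuous_real continuous_intros S f)+
  have nn: "(\<lambda>x. (norm (f x))\<^sup>2) integrable_on {0..2*pi}"
    by (intro integrable_continuous_real continuous_intros f)
  have "0 \<le> integral {0..2*pi} (\<lambda>x. (norm (f x - S x))\<^sup>2)"
    by (intro integral_nonneg integrable_continuous_real continuous_intros S f) auto
  also have "(\<lambda>x. (norm (f x - S x))\<^sup>2) = (\<lambda>x. (norm (f x))\<^sup>2 - 2 * Re (f x * cnj (S x)) + Re (S x * cnj (S x)))"
    unfolding cmod_power2 by (auto simp: fun_eq_iff power2_eq_square algebra_simps)
  also have "integral {0..2*pi} \<dots> = integral {0..2*pi} (\<lambda>x. (norm (f x))\<^sup>2) - 2 * Re (integral {0..2*pi} (\<lambda>x. f x * cnj (S x))) + Re (integral {0..2*pi} (\<lambda>x. S x * cnj (S x)))"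
  proof (rule integral_unique)
    have Re: "((\<lambda>x. Re (h x)) has_integral Re (integral A h)) A" if "h integrable_on A" for h :: "real \<Rightarrow> complex" and A
      using has_integral_linear[OF integrable_integral[OF that] bounded_linear_Re] by (simp add: o_def)
    show "((\<lambda>x. (norm (f x))\<^sup>2 - 2 * Re (f x * cnj (S x)) + Re (S x * cnj (S x))) has_integral
       integral {0..2*pi} (\<lambda>x. (norm (f x))\<^sup>2) - 2 * Re (integral {0..2*pi} (\<lambda>x. f x * cnj (S x))) + Re (integral {0..2*pi} (\<lambda>x. S x * cnj (S x)))) {0..2*pi}"
      by (intro has_integral_add has_integral_diff has_integral_mult_right Re int integrable_integral nn)
  qed
  finally have "2 * pi * T \<le> integral {0..2*pi} (\<lambda>x. (norm (f x))\<^sup>2)" unfolding SS fS Re_complex_of_real by linarith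
  then show ?thesis unfolding L2_set_def T_def[symmetric] by (intro real_sqrt_le_mono) (simp add: field_simps)
qed

lemma bessel_sup:
  assumes f: "continuous_on {0..2*pi} f" and "\<And>x. x \<in> {0..2*pi} \<Longrightarrow> norm (f x) \<le> B" "B \<ge> 0"
  shows "hs 0 (\<lambda>k. norm (fcc f k)) B"
  unfolding hs_def
proof (intro allI impI)
  fix F :: "int set" assume F: "finite F"
  have "integral {0..2*pi} (\<lambda>x. (norm (f x))\<^sup>2) \<le> integral {0..2*pi} (\<lambda>x. B\<^sup>2)"
    by (intro integral_le integrable_continuous_real continuous_intros f power_mono assms) auto
  then have "integral {0..2*pi} (\<lambda>x. (norm (f x))\<^sup>2) / (2*pi) \<le> B\<^sup>2" by (simp add: field_simps)
  then have "sqrt (integral {0..2*pi} (\<lambda>x. (norm (f x))\<^sup>2) / (2*pi)) \<le> B"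
    using assms(3) by (intro real_le_lsqrt) (auto intro!: integral_nonneg integrable_continuous_real continuous_intros f divide_nonneg_pos)
  then show "L2_set (\<lambda>k. wt 0 k * norm (fcc f k)) F \<le> B" using bessel_integral[OF f F] by simp
qed

subsection \<open>Density of trigonometric polynomials\<close>

inductive tpoly :: "(real \<Rightarrow> complex) \<Rightarrow> bool" where
  mono: "tpoly (\<lambda>x. c * cis (of_int k * x))"
| add: "tpoly f \<Longrightarrow> tpoly g \<Longrightarrow> tpoly (\<lambda>x. f x + g x)"

lemma tpoly_mult: assumes "tpoly f" "tpoly g" shows "tpoly (\<lambda>x. f x * g x)"
  using assms(1)
proof induction
  case (mono c k)
  from assms(2) show ?case
  proof induction
    case (mono d j)
    have "(\<lambda>x. c * cis (of_int k * x) * (d * cis (of_int j * x))) = (\<lambda>x. (c * d) * cis (of_int (k + j) * x))"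
      by (auto simp: distrib_right cis_mult[symmetric])
    then show ?case using tpoly.mono[of "c * d" "k + j"] by simp
  next
    case (add f g) then show ?case using tpoly.add by (simp add: distrib_left)
  qed
next
  case (add f g) then show ?case using tpoly.add by (simp add: distrib_right)
qed

lemma tpoly_canonical: "tpoly f \<Longrightarrow> \<exists>F c. finite F \<and> f = (\<lambda>x. \<Sum>k\<in>F. c k * cis (of_int k * x))"
proof (induction rule: tpoly.induct)
  case (mono c k)
  show ?case by (rule exI[of _ "{k}"], rule exI[of _ "\<lambda>_. c"]) auto
next
  case (add f g)
  then obtain F c G d where *: "finite F" "f = (\<lambda>x. \<Sum>k\<in>F. c k * cis (of_int k * x))" "finite G" "g = (\<lambda>x. \<Sum>k\<in>G. d k * cis (of_int k * x))" by blast
  have f: "f x = (\<Sum>k\<in>F\<union>G. (if k \<in> F then c k else 0) * cis (of_int k * x))" for x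
    unfolding * using *(1,3) by (intro sum.mono_neutral_cong_left) auto
  have g: "g x = (\<Sum>k\<in>F\<union>G. (if k \<in> G then d k else 0) * cis (of_int k * x))" for x
    unfolding * using *(1,3) by (intro sum.mono_neutral_cong_left) auto
  show ?case unfolding f g
    by (intro exI[of _ "F \<union> G"] exI[of _ "\<lambda>k. (if k \<in> F then c k else 0) + (if k \<in> G then d k else 0)"])
       (use * in \<open>auto simp: sum.distrib distrib_right\<close>)
qed

lemma tpoly_cos: "tpoly (\<lambda>x. of_real (cos (real_of_int k * x)))" and tpoly_sin: "tpoly (\<lambda>x. of_real (sin (real_of_int k * x)))"
proof -
  have "(\<lambda>x. complex_of_real (cos (real_of_int k * x))) = (\<lambda>x. (1/2) * cis (of_int k * x) + (1/2) * cis (of_int (-k) * x))"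
    by (auto simp: fun_eq_iff complex_eq_iff)
  then show "tpoly (\<lambda>x. of_real (cos (real_of_int k * x)))" using tpoly.intros by metis
  have "(\<lambda>x. complex_of_real (sin (real_of_int k * x))) = (\<lambda>x. (-\<i>/2) * cis (of_int k * x) + (\<i>/2) * cis (of_int (-k) * x))"
    by (auto simp: fun_eq_iff complex_eq_iff)
  then show "tpoly (\<lambda>x. of_real (sin (real_of_int k * x)))" using tpoly.intros by metis
qed

lemma tpoly_const: "tpoly (\<lambda>x. c)"
  using tpoly.mono[of c 0] by simp

lemma tpoly_real_polynomial:
  assumes "real_polynomial_function p" shows "tpoly (\<lambda>x. of_real (p (cis x)))"
  using assms
proof induction
  case (linear f)
  then have "f (cis x) = f 1 * cos x + f \<i> * sin x" for x
  proof -
    interpret f: bounded_linear f by fact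
    have "cis x = cos x *\<^sub>R 1 + sin x *\<^sub>R \<i>" by (simp add: complex_eq_iff)
    then show ?thesis by (simp only: f.add f.scaleR) (simp add: mult.commute)
  qed
  then show ?case using tpoly.add[OF tpoly_mult[OF tpoly_const tpoly_cos[of 1]] tpoly_mult[OF tpoly_const tpoly_sin[of 1]]] by simp
next
  case (const c) show ?case by (rule tpoly_const)
next
  case (add f g) then show ?case using tpoly.add by simp
next
  case (mult f g) then show ?case using tpoly_mult by simp
qed

lemma cis_eq_shift: "cis x = cis y \<Longrightarrow> \<exists>n::int. y = x + 2 * pi * of_int n"
  using sin_cos_eq_iff[of y x] by (auto simp: complex_eq_iff)

text \<open>A continuous periodic function is a continuous function on the unit circle; the Stone-Weierstrass
  theorem there gives real polynomials in \<open>cos x\<close> and \<open>sin x\<close>.\<close>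

lemma tpoly_dense:
  assumes u: "u \<in> per" and e: "e > 0"
  obtains g where "tpoly (\<lambda>x. of_real (g x))" "\<And>x. \<bar>u x - g x\<bar> < e"
proof -
  define U where "U z = u (SOME x. cis x = z)" for z
  have U: "U (cis x) = u x" for x
  proof -
    have "cis (SOME y. cis y = cis x) = cis x" by (rule someI) simp
    from cis_eq_shift[OF this] obtain n where n: "x = (SOME y. cis y = cis x) + 2 * pi * real_of_int n" by blast
    show ?thesis unfolding U_def using per_int[OF u, of "SOME y. cis y = cis x" n] n by metis
  qed
  have sph: "sphere 0 1 = cis ` {0..2*pi}"
  proof (intro set_eqI iffI)
    fix z :: complex assume "z \<in> sphere 0 1"
    then have "norm z = 1" "z \<noteq> 0" by auto
    then have "cis (Arg z) = z" by (simp add: cis_Arg sgn_div_norm)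
    moreover obtain y n where "Arg z = y + 2 * pi * of_int n" "y \<in> {0..2*pi}" by (rule per_reduce)
    moreover have "cis (y + 2 * pi * of_int n) = cis y" using cis_multiple_2pi[of "of_int n"] by (simp add: cis_mult[symmetric])
    ultimately show "z \<in> cis ` {0..2*pi}" by (metis imageI)
  qed auto
  have "continuous_on (sphere 0 1) U"
  proof (subst continuous_on_closed_vimage)
    show "\<forall>B. closed B \<longrightarrow> closed (U -` B \<inter> sphere 0 1)"
    proof (intro allI impI)
      fix B :: "real set" assume B: "closed B"
      have "U -` B \<inter> sphere 0 1 = cis ` ({0..2*pi} \<inter> u -` B)" unfolding sph by (auto simp: U)
      moreover have "compact ({0..2*pi} \<inter> u -` B)"
        by (intro compact_Int_closed compact_Icc closed_vimage B) (use per_cont[OF u] in auto)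
      then have "compact (cis ` ({0..2*pi} \<inter> u -` B))"
        by (intro compact_continuous_image continuous_intros)
      ultimately show "closed (U -` B \<inter> sphere 0 1)" using compact_imp_closed by auto
    qed
  qed simp
  then obtain p where p: "real_polynomial_function p" "\<And>z. z \<in> sphere 0 1 \<Longrightarrow> \<bar>U z - p z\<bar> < e"
    using Stone_Weierstrass_real_polynomial_function[of "sphere 0 1" U e] e by auto
  show thesis
  proof (rule that)
    show "tpoly (\<lambda>x. of_real (p (cis x)))" by (rule tpoly_real_polynomial) fact
    show "\<bar>u x - p (cis x)\<bar> < e" for x using p(2)[of "cis x"] U by simp
  qed
qed

lemma integral_square_of_real:
  fixes a b :: real
  assumes "continuous_on {a..b} u"
  shows "Re (integral {a..b} (\<lambda>x. complex_of_real (u x) * of_real (u x))) = integral {a..b} (\<lambda>x. (u x)\<^sup>2)"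
proof -
  have "(\<lambda>x. complex_of_real (u x) * of_real (u x)) integrable_on {a..b}"
    by (intro integrable_continuous_real continuous_intros assms)
  from has_integral_linear[OF integrable_integral[OF this] bounded_linear_Re]
  show ?thesis by (simp add: o_def power2_eq_square integral_unique)
qed

lemma tpoly_cont: "tpoly f \<Longrightarrow> continuous_on S f"
  by (induction rule: tpoly.induct) (auto intro!: continuous_intros)

lemma tpoly_orth:
  assumes "tpoly g" and f: "continuous_on {0..2*pi} f" and z: "\<And>k. fcc f k = 0"
  shows "integral {0..2*pi} (\<lambda>x. f x * g x) = 0"
  using assms(1)
proof induction
  case (mono c k)
  have "integral {0..2*pi} (\<lambda>x. f x * cis (- (of_int (-k) * x))) = 0" using z[of "-k"] by (simp add: fcc_def)
  moreover have "(\<lambda>x. f x * (c * cis (of_int k * x))) = (\<lambda>x. c * (f x * cis (- (of_int (-k) * x))))" by auto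
  ultimately show ?case by simp
next
  case (add g h)
  then show ?case by (simp add: distrib_left integral_add integrable_continuous_real continuous_intros f tpoly_cont)
qed

text \<open>A function orthogonal to all trigonometric polynomials is orthogonal to itself, by density.\<close>

lemma per_unique:
  assumes u: "u \<in> per" and z: "\<And>k. fourier_coeff u k = 0"
  shows "u x = 0"
proof -
  obtain B where B: "B > 0" "\<And>x. \<bar>u x\<bar> \<le> B" using per_bounded[OF u] by blast
  let ?u = "\<lambda>x. complex_of_real (u x)"
  have cu: "continuous_on A ?u" for A by (rule per_cont_of_real[OF u])
  have "norm (integral {0..2*pi} (\<lambda>x. ?u x * ?u x)) \<le> e" if e: "e > 0" for e
  proof -
    have "e / (2 * pi * B) > 0" using e B by simp
    from tpoly_dense[OF u this] obtain g where g: "tpoly (\<lambda>x. of_real (g x))" "\<And>x. \<bar>u x - g x\<bar> < e / (2 * pi * B)" by blast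
    have cg: "continuous_on A (\<lambda>x. complex_of_real (g x))" for A using tpoly_cont[OF g(1)] .
    have "integral {0..2*pi} (\<lambda>x. ?u x * of_real (g x)) = 0"
      by (rule tpoly_orth[OF g(1) cu]) (use z fourier_coeff_eq[OF u] in simp)
    then have "integral {0..2*pi} (\<lambda>x. ?u x * ?u x) = integral {0..2*pi} (\<lambda>x. ?u x * ?u x - ?u x * of_real (g x))"
      by (subst integral_diff) (auto intro!: integrable_continuous_real continuous_intros cu cg)
    also have "norm \<dots> \<le> (B * (e / (2 * pi * B))) * (2*pi - 0)"
    proof (rule integral_bound)
      fix x
      have "norm (?u x * ?u x - ?u x * of_real (g x)) = \<bar>u x\<bar> * \<bar>u x - g x\<bar>"
        by (metis abs_mult norm_of_real of_real_diff of_real_mult right_diff_distrib)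
      also have "\<dots> \<le> B * (e / (2 * pi * B))" using g(2)[of x] B by (intro mult_mono) (auto simp: less_imp_le)
      finally show "norm (?u x * ?u x - ?u x * of_real (g x)) \<le> B * (e / (2 * pi * B))" .
    qed (auto intro!: continuous_intros cu cg)
    also have "\<dots> = e" using B by simp
    finally show ?thesis .
  qed
  then have 0: "integral {0..2*pi} (\<lambda>x. ?u x * ?u x) = 0"
    using field_le_epsilon[of "norm (integral {0..2*pi} (\<lambda>x. ?u x * ?u x))" 0] by auto
  have "integral {0..2*pi} (\<lambda>x. (u x)\<^sup>2) = Re (integral {0..2*pi} (\<lambda>x. ?u x * ?u x))"
    using integral_square_of_real[OF per_cont[OF u]] by simp
  then have "integral {0..2*pi} (\<lambda>x. (u x)\<^sup>2) = 0" using 0 by simp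
  then have "(u y)\<^sup>2 = 0" if "y \<in> {0..2*pi}" for y
    using integral_eq_0_iff[of 0 "2*pi" "\<lambda>x. (u x)\<^sup>2", OF continuous_on_power[OF per_cont[OF u]]] that by auto
  moreover obtain y n where "x = y + 2 * pi * of_int n" "y \<in> {0..2*pi}" by (rule per_reduce)
  ultimately show ?thesis using per_int[OF u] by auto
qed

section \<open>Sobolev spaces and products in Fourier variables\<close>

lemma fourier_coeff_neg: "u \<in> per \<Longrightarrow> fourier_coeff u (-k) = cnj (fourier_coeff u k)"
  by (simp add: fourier_coeff_eq fcc_def integral_cnj cis_cnj)

lemma synth_real:
  assumes "\<And>k. c (-k) = cnj (c k)" shows "of_real (Re (synth c x)) = synth c x"
proof -
  have b: "bij_betw uminus UNIV (UNIV :: int set)" by (rule bij_betwI[where g=uminus]) auto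
  have "cnj (synth c x) = (\<Sum>\<^sub>\<infinity>k. cnj (c k * cis (of_int k * x)))"
    unfolding synth_def by (rule infsum_cnj[symmetric])
  also have "\<dots> = (\<Sum>\<^sub>\<infinity>k. c (-k) * cis (of_int (-k) * x))" by (simp add: assms cis_cnj)
  also have "\<dots> = synth c x" unfolding synth_def
    using infsum_reindex_bij_betw[OF b, of "\<lambda>k. c k * cis (of_int k * x)"] by simp
  finally show ?thesis by (metis Reals_cnj_iff of_real_Re)
qed

lemma synth_per: "l1 c \<Longrightarrow> (\<lambda>x. Re (synth c x)) \<in> per"
  unfolding per_def using synth_periodic by (auto intro!: continuous_intros synth_cont)

lemma fourier_coeff_synth:
  assumes "l1 c" "\<And>k. c (-k) = cnj (c k)" shows "fourier_coeff (\<lambda>x. Re (synth c x)) k = c k"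
  using fourier_coeff_eq[OF synth_per[OF assms(1)]] fcc_synth[OF assms(1)] by (simp add: synth_real[of c, OF assms(2)])

lemma per_diff: "u \<in> per \<Longrightarrow> v \<in> per \<Longrightarrow> (\<lambda>x. u x - v x) \<in> per"
  and per_mult: "u \<in> per \<Longrightarrow> v \<in> per \<Longrightarrow> (\<lambda>x. u x * v x) \<in> per"
  and per_plus: "u \<in> per \<Longrightarrow> v \<in> per \<Longrightarrow> (\<lambda>x. u x + v x) \<in> per"
  and per_const: "(\<lambda>x. a) \<in> per"
  and per_power: "u \<in> per \<Longrightarrow> (\<lambda>x. u x ^ n) \<in> per"
  and per_exp: "u \<in> per \<Longrightarrow> (\<lambda>x. exp (u x)) \<in> per"
  by (auto simp: per_def intro!: continuous_intros)

lemma fourier_coeff_diff: "u \<in> per \<Longrightarrow> v \<in> per \<Longrightarrow> fourier_coeff (\<lambda>x. u x - v x) k = fourier_coeff u k - fourier_coeff v k"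
  by (simp add: fourier_coeff_eq per_diff fcc_diff per_cont_of_real per_cont)

text \<open>Continuous functions are determined by their Fourier coefficients, so that an absolutely
  convergent Fourier series represents its function.\<close>

lemma per_eq_synth:
  assumes u: "u \<in> per" and l: "l1 (fourier_coeff u)"
  shows "of_real (u x) = synth (fourier_coeff u) x"
proof -
  let ?c = "fourier_coeff u" let ?v = "\<lambda>x. Re (synth ?c x)"
  have v: "?v \<in> per" by (rule synth_per[OF l])
  have "u x - ?v x = 0"
    by (rule per_unique[OF per_diff[OF u v]])
       (simp add: fourier_coeff_diff[OF u v] fourier_coeff_synth[OF l fourier_coeff_neg[OF u]])
  then have "of_real (u x) = complex_of_real (?v x)" by simp
  also have "\<dots> = synth ?c x" by (rule synth_real) (rule fourier_coeff_neg[OF u])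
  finally show ?thesis .
qed

lemma pair_summable:
  fixes a b :: "int \<Rightarrow> 'a::{real_normed_field,banach,second_countable_topology}"
  assumes "l1 a" "l1 b"
  shows "(\<lambda>(j,l). norm (a j * b l)) summable_on UNIV \<times> UNIV"
proof -
  have "(\<lambda>j. norm (a j) * l1n b) summable_on UNIV" by (intro summable_on_cmult_left assms)
  then show ?thesis
    using Infinite_Sum.abs_summable_on_Sigma_iff[where f="\<lambda>(j,l). a j * b l" and A=UNIV and B="\<lambda>_. UNIV"] assms
    by (simp add: case_prod_unfold norm_mult summable_on_cmult_right infsum_cmult_right' l1n_def[symmetric] abs_mult)
qed

lemma conv_has_sum:
  fixes a b :: "int \<Rightarrow> 'a::{real_normed_field,banach,second_countable_topology}"
  assumes "l1 a" "l1 b"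
  shows "(\<lambda>(k,j). norm (a j * b (k - j))) summable_on UNIV"
        "(\<Sum>\<^sub>\<infinity>(k,j). norm (a j * b (k - j))) = l1n a * l1n b"
proof -
  have bij: "bij_betw (\<lambda>(j,l). (j + l, j)) UNIV (UNIV :: (int \<times> int) set)"
    by (rule bij_betwI[where g="\<lambda>(k,j). (j, k - j)"]) auto
  have s: "(\<lambda>(j,l). norm (a j) * norm (b l)) summable_on UNIV \<times> UNIV"
    using pair_summable[OF assms] by (simp add: norm_mult case_prod_unfold)
  then have s': "(\<lambda>(j,l). norm (a j) * norm (b l)) summable_on UNIV" by simp
  show "(\<lambda>(k,j). norm (a j * b (k - j))) summable_on UNIV"
    using s' summable_on_reindex_bij_betw[OF bij, of "\<lambda>(k,j). norm (a j * b (k - j))"]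
    by (simp add: case_prod_unfold norm_mult)
  have "(\<Sum>\<^sub>\<infinity>(k,j). norm (a j * b (k - j))) = (\<Sum>\<^sub>\<infinity>(j,l)\<in>UNIV\<times>UNIV. norm (a j) * norm (b l))"
    using infsum_reindex_bij_betw[OF bij, of "\<lambda>(k,j). norm (a j * b (k - j))"]
    by (simp add: case_prod_unfold norm_mult)
  also have "\<dots> = (\<Sum>\<^sub>\<infinity>j. \<Sum>\<^sub>\<infinity>l. norm (a j) * norm (b l))"
    using infsum_Sigma'_banach[OF s] by simp
  also have "\<dots> = l1n a * l1n b"
    by (simp add: infsum_cmult_right' infsum_cmult_left' l1n_def)
  finally show "(\<Sum>\<^sub>\<infinity>(k,j). norm (a j * b (k - j))) = l1n a * l1n b" .
qed

lemma l1_conv: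
  fixes a b :: "int \<Rightarrow> 'a::{real_normed_field,banach,second_countable_topology}"
  assumes "l1 a" "l1 b"
  shows "l1 (conv a b)" "l1n (conv a b) \<le> l1n a * l1n b"
proof -
  have s: "(\<lambda>(k,j). norm (a j * b (k - j))) summable_on (SIGMA k:UNIV. UNIV)" using conv_has_sum(1)[OF assms] by simp
  have s2: "(\<lambda>k. \<Sum>\<^sub>\<infinity>j. norm (a j * b (k - j))) summable_on UNIV"
    using summable_on_Sigma_banach[OF s] by simp
  have e: "(\<Sum>\<^sub>\<infinity>k. \<Sum>\<^sub>\<infinity>j. norm (a j * b (k - j))) = l1n a * l1n b"
    using infsum_Sigma'_banach[OF s] conv_has_sum(2)[OF assms] by simp
  have le: "norm (conv a b k) \<le> (\<Sum>\<^sub>\<infinity>j. norm (a j * b (k - j)))" for k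
    unfolding conv_def by (rule norm_infsum_bound[OF conv_summable[OF assms]])
  have n: "norm (\<Sum>\<^sub>\<infinity>j. norm (a j * b (k - j))) = (\<Sum>\<^sub>\<infinity>j. norm (a j * b (k - j)))" for k
    by (simp add: infsum_nonneg)
  have "l1 (\<lambda>k. \<Sum>\<^sub>\<infinity>j. norm (a j * b (k - j)))" using s2 unfolding n .
  from l1_mono[OF this le] show "l1 (conv a b)" "l1n (conv a b) \<le> l1n a * l1n b"
    by (simp_all add: l1n_def[of "\<lambda>k. \<Sum>\<^sub>\<infinity>j. norm (a j * b (k - j))"] infsum_nonneg e)
qed

lemma synth_conv:
  assumes "l1 a" "l1 b"
  shows "synth (conv a b) x = synth a x * synth b x"
proof -
  let ?e = "\<lambda>k. cis (of_int k * x)"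
  have bij: "bij_betw (\<lambda>(j,l). (j + l, j)) UNIV (UNIV :: (int \<times> int) set)"
    by (rule bij_betwI[where g="\<lambda>(k,j). (j, k - j)"]) auto
  have "(\<lambda>(k,j). norm (a j * b (k - j) * ?e k)) summable_on UNIV"
    using conv_has_sum(1)[OF assms] by (simp add: norm_mult)
  then have s: "(\<lambda>(k,j). a j * b (k - j) * ?e k) summable_on UNIV \<times> UNIV"
    using abs_summable_summable[of "\<lambda>(k,j). a j * b (k - j) * ?e k" UNIV] by (simp add: case_prod_unfold)
  have s': "(\<lambda>(j,l). (a j * ?e j) * (b l * ?e l)) summable_on UNIV \<times> UNIV"
    using abs_summable_summable[of "\<lambda>(j,l). (a j * ?e j) * (b l * ?e l)" "UNIV \<times> UNIV"] pair_summable[of "\<lambda>j. a j * ?e j" "\<lambda>j. b j * ?e j"] assms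
    by (simp add: norm_mult case_prod_unfold)
  have "synth (conv a b) x = (\<Sum>\<^sub>\<infinity>k. \<Sum>\<^sub>\<infinity>j. a j * b (k - j) * ?e k)"
    unfolding synth_def conv_def by (simp add: infsum_cmult_left')
  also have "\<dots> = (\<Sum>\<^sub>\<infinity>(k,j)\<in>UNIV\<times>UNIV. a j * b (k - j) * ?e k)"
    using infsum_Sigma'_banach[OF s] .
  also have "\<dots> = (\<Sum>\<^sub>\<infinity>(j,l)\<in>UNIV\<times>UNIV. a j * b l * ?e (j + l))"
    using infsum_reindex_bij_betw[OF bij, of "\<lambda>(k,j). a j * b (k - j) * ?e k", symmetric]
    by (simp add: case_prod_unfold)
  also have "\<dots> = (\<Sum>\<^sub>\<infinity>(j,l)\<in>UNIV\<times>UNIV. (a j * ?e j) * (b l * ?e l))"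
    by (rule arg_cong[where f="\<lambda>h. infsum h (UNIV \<times> UNIV)"]) (auto simp: fun_eq_iff distrib_right cis_mult[symmetric])
  also have "\<dots> = (\<Sum>\<^sub>\<infinity>j. \<Sum>\<^sub>\<infinity>l. (a j * ?e j) * (b l * ?e l))"
    using infsum_Sigma'_banach[OF s'] by simp
  also have "\<dots> = synth a x * synth b x"
    by (simp add: infsum_cmult_right' infsum_cmult_left' synth_def)
  finally show ?thesis .
qed

lemma fourier_coeff_mult:
  assumes "u \<in> per" "v \<in> per" "l1 (fourier_coeff u)" "l1 (fourier_coeff v)"
  shows "fourier_coeff (\<lambda>x. u x * v x) = conv (fourier_coeff u) (fourier_coeff v)"
proof
  fix k
  have "(\<lambda>x. complex_of_real (u x * v x)) = synth (conv (fourier_coeff u) (fourier_coeff v))"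
    by (simp add: fun_eq_iff synth_conv assms per_eq_synth)
  then show "fourier_coeff (\<lambda>x. u x * v x) k = conv (fourier_coeff u) (fourier_coeff v) k"
    using fourier_coeff_eq[OF per_mult[OF assms(1,2)]] fcc_synth l1_conv(1)[OF assms(3,4)] by simp
qed

primrec cpow :: "nat \<Rightarrow> (int \<Rightarrow> 'a) \<Rightarrow> int \<Rightarrow> 'a::{real_normed_field,banach,second_countable_topology}" where
  "cpow 0 c = (\<lambda>k. if k = 0 then 1 else 0)"
| "cpow (Suc n) c = conv c (cpow n c)"

lemma l1_unit: "l1 (\<lambda>k::int. if k = 0 then 1 else 0 :: 'a::real_normed_field)" "l1n (\<lambda>k::int. if k = 0 then 1 else 0 :: 'a::real_normed_field) \<le> 1"
proof -
  have *: "(\<Sum>k\<in>F. norm (if k = 0 then 1 else 0 :: 'a)) \<le> 1" if "finite F" for F :: "int set"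
    using that by (simp add: if_distrib[of norm] sum.delta cong: if_cong)
  show "l1 (\<lambda>k::int. if k = 0 then 1 else 0 :: 'a)" "l1n (\<lambda>k::int. if k = 0 then 1 else 0 :: 'a) \<le> 1"
    by (rule l1I(1)[OF *], assumption, rule l1I(2)[OF *], assumption)
qed

lemma l1_cpow: "l1 c \<Longrightarrow> l1 (cpow n c)" "l1 c \<Longrightarrow> l1n (cpow n c) \<le> l1n c ^ n"
proof -
  have "l1 (cpow n c) \<and> l1n (cpow n c) \<le> l1n c ^ n" if "l1 c"
  proof (induction n)
    case 0 show ?case using l1_unit by simp
  next
    case (Suc n)
    have "l1n (conv c (cpow n c)) \<le> l1n c * l1n (cpow n c)" using Suc that l1_conv(2) by blast
    also have "\<dots> \<le> l1n c * l1n c ^ n" using Suc by (intro mult_left_mono) auto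
    finally show ?case using Suc l1_conv(1)[OF that] by simp
  qed
  then show "l1 c \<Longrightarrow> l1 (cpow n c)" "l1 c \<Longrightarrow> l1n (cpow n c) \<le> l1n c ^ n" by auto
qed

lemma fourier_coeff_one: "fourier_coeff (\<lambda>x. 1) k = (if k = 0 then 1 else 0)"
  using fcc_cis[of 1 0 k] by (subst fourier_coeff_eq) (auto simp: per_const)

lemma fourier_coeff_power:
  assumes "u \<in> per" "l1 (fourier_coeff u)"
  shows "fourier_coeff (\<lambda>x. u x ^ n) = cpow n (fourier_coeff u)"
proof (induction n)
  case 0 show ?case by (auto simp: fourier_coeff_one)
next
  case (Suc n)
  then show ?case using fourier_coeff_mult[OF assms(1) per_power[OF assms(1), of n] assms(2)] l1_cpow(1)[OF assms(2), of n] by simp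
qed

subsection \<open>Sobolev and Lebesgue norms through coefficients\<close>

lemma hs_iff:
  "(\<exists>B. hs s C B) \<longleftrightarrow> (\<lambda>k. (1 + \<bar>real_of_int k\<bar>^2) powr s * (C k)\<^sup>2) summable_on UNIV"
proof
  assume "\<exists>B. hs s C B"
  then obtain B where B: "hs s C B" by blast
  show "(\<lambda>k. (1 + \<bar>real_of_int k\<bar>^2) powr s * (C k)\<^sup>2) summable_on UNIV"
  proof (rule nonneg_bdd_above_summable_on)
    show "bdd_above (sum (\<lambda>k. (1 + \<bar>real_of_int k\<bar>\<^sup>2) powr s * (C k)\<^sup>2) ` {F. F \<subseteq> UNIV \<and> finite F})"
    proof (rule bdd_aboveI2)
      fix F :: "int set" assume "F \<in> {F. F \<subseteq> UNIV \<and> finite F}"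
      then have "L2_set (\<lambda>k. wt s k * C k) F \<le> B" using B by (auto simp: hs_def)
      then have "(L2_set (\<lambda>k. wt s k * C k) F)\<^sup>2 \<le> B\<^sup>2" by (intro power_mono L2_set_nonneg)
      then show "(\<Sum>k\<in>F. (1 + \<bar>real_of_int k\<bar>\<^sup>2) powr s * (C k)\<^sup>2) \<le> B\<^sup>2"
        by (simp add: L2_set_def power_mult_distrib wt_sq sum_nonneg)
    qed
  qed auto
next
  assume s: "(\<lambda>k. (1 + \<bar>real_of_int k\<bar>^2) powr s * (C k)\<^sup>2) summable_on UNIV"
  have "hs s C (sqrt (\<Sum>\<^sub>\<infinity>k. (1 + \<bar>real_of_int k\<bar>^2) powr s * (C k)\<^sup>2))"
    unfolding hs_def L2_set_def power_mult_distrib wt_sq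
    by (intro allI impI real_sqrt_le_mono finite_sum_le_infsum s) auto
  then show "\<exists>B. hs s C B" by blast
qed

lemma hs_sobolev_norm: "u \<in> sobolev_space s \<Longrightarrow> hs s (\<lambda>k. cmod (fourier_coeff u k)) (sobolev_norm s u)"
    unfolding hs_def L2_set_def power_mult_distrib wt_sq sobolev_norm_def sobolev_space_def
    by (intro allI impI real_sqrt_le_mono finite_sum_le_infsum) auto

lemma sobolev_norm_le:
  assumes "hs s (\<lambda>k. cmod (fourier_coeff u k)) B" shows "sobolev_norm s u \<le> B"
proof -
  have B: "B \<ge> 0" using hs_nonneg[OF assms] .
  have "(\<Sum>\<^sub>\<infinity>k::int. (1 + \<bar>real_of_int k\<bar>^2) powr s * (cmod (fourier_coeff u k))^2) \<le> B\<^sup>2"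
  proof (rule infsum_le_finite_sums)
    show "(\<lambda>k::int. (1 + \<bar>real_of_int k\<bar>^2) powr s * (cmod (fourier_coeff u k))^2) summable_on UNIV"
      by (rule hs_iff[THEN iffD1, OF exI, OF assms])
    fix F :: "int set" assume F: "finite F"
    have "(L2_set (\<lambda>k. wt s k * cmod (fourier_coeff u k)) F)\<^sup>2 \<le> B\<^sup>2" using assms F by (intro power_mono L2_set_nonneg) (auto simp: hs_def)
    then show "(\<Sum>k\<in>F. (1 + \<bar>real_of_int k\<bar>^2) powr s * (cmod (fourier_coeff u k))^2) \<le> B\<^sup>2"
      by (simp add: L2_set_def power_mult_distrib wt_sq sum_nonneg del: power2_abs)
  qed
  then show ?thesis unfolding sobolev_norm_def using B real_le_lsqrt real_sqrt_le_iff
    by (metis real_sqrt_abs abs_of_nonneg real_sqrt_le_mono)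
qed

lemma sobolev_iff: "u \<in> sobolev_space s \<longleftrightarrow> u \<in> per \<and> (\<exists>B. hs s (\<lambda>k. cmod (fourier_coeff u k)) B)"
  by (simp add: sobolev_space_def per_def hs_iff conj_ac)

lemma hs_change: assumes "hs s C B" "r \<le> s" shows "hs r C B"
  unfolding hs_def
proof (intro allI impI)
  fix F :: "int set" assume F: "finite F"
  have "wt r k \<le> wt s k" for k unfolding wt_def using assms(2) by (intro powr_mono) auto
  then have "L2_set (\<lambda>k. wt r k * \<bar>C k\<bar>) F \<le> L2_set (\<lambda>k. wt s k * \<bar>C k\<bar>) F"
    by (intro L2_set_mono mult_right_mono) auto
  also have "\<dots> \<le> B" using assms(1) F by (simp add: hs_def L2_set_def power_mult_distrib)
  finally show "L2_set (\<lambda>k. wt r k * C k) F \<le> B" by (simp add: L2_set_def power_mult_distrib)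
qed

lemma L2_norm_le:
  assumes u: "u \<in> per" and l: "l1 (fourier_coeff u)" and h: "hs 0 (\<lambda>k. cmod (fourier_coeff u k)) B"
  shows "L2_norm u \<le> sqrt (2*pi) * B"
proof -
  let ?c = "fourier_coeff u"
  have B0: "B \<ge> 0" using hs_nonneg[OF h] .
  have cu: "continuous_on A (\<lambda>x. complex_of_real (u x))" for A by (rule per_cont_of_real[OF u])
  define f where "f F x = (\<Sum>k\<in>F. ?c k * cis (of_int k * x))" for F x
  have f: "continuous_on A (f F)" for A F unfolding f_def by (intro continuous_intros)
  have ul: "uniform_limit {0..2*pi} (\<lambda>F x. of_real (u x) * f F x) (\<lambda>x. of_real (u x) * of_real (u x)) (finite_subsets_at_top UNIV)"
  proof (rule uniform_lim_mult)
    have "uniform_limit UNIV f (\<lambda>x. of_real (u x)) (finite_subsets_at_top UNIV)"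
      unfolding f_def per_eq_synth[OF u l] using synth_uniform[OF l] by simp
    then show "uniform_limit {0..2*pi} f (\<lambda>x. complex_of_real (u x)) (finite_subsets_at_top UNIV)"
      by (rule uniform_limit_on_subset) simp
    show "bounded ((\<lambda>x. complex_of_real (u x)) ` {0..2 * pi})"
      by (intro compact_imp_bounded compact_continuous_image cu compact_Icc)
    then show "bounded ((\<lambda>x. complex_of_real (u x)) ` {0..2 * pi})" .
  qed (auto intro: uniform_limit_const)
  have "((\<lambda>F. integral {0..2*pi} (\<lambda>x. of_real (u x) * f F x)) \<longlongrightarrow> integral {0..2*pi} (\<lambda>x. complex_of_real (u x) * of_real (u x))) (finite_subsets_at_top UNIV)"
  proof (rule uniform_limit_integral[OF ul])
    fix I J
    assume "\<And>F. ((\<lambda>x. of_real (u x) * f F x) has_integral I F) {0..2*pi}"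
      "((\<lambda>x. complex_of_real (u x) * of_real (u x)) has_integral J) {0..2*pi}" "(I \<longlongrightarrow> J) (finite_subsets_at_top UNIV)"
    then have "integral {0..2*pi} (\<lambda>x. of_real (u x) * f F x) = I F" "integral {0..2*pi} (\<lambda>x. complex_of_real (u x) * of_real (u x)) = J" for F
      by (auto intro: integral_unique)
    then show ?thesis using \<open>(I \<longlongrightarrow> J) (finite_subsets_at_top UNIV)\<close> by simp
  qed (auto intro!: continuous_intros cu f)
  then have "((\<lambda>F. norm (integral {0..2*pi} (\<lambda>x. of_real (u x) * f F x))) \<longlongrightarrow> norm (integral {0..2*pi} (\<lambda>x. complex_of_real (u x) * of_real (u x)))) (finite_subsets_at_top UNIV)"
    by (rule tendsto_norm)
  moreover have "\<forall>\<^sub>F F in finite_subsets_at_top UNIV. norm (integral {0..2*pi} (\<lambda>x. of_real (u x) * f F x)) \<le> 2*pi*B\<^sup>2"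
  proof (rule eventually_finite_subsets_at_top_weakI)
    fix F :: "int set" assume F: "finite F"
    have "integral {0..2*pi} (\<lambda>x. of_real (u x) * f F x) = integral {0..2*pi} (\<lambda>x. \<Sum>k\<in>F. ?c k * (of_real (u x) * cis (- (of_int (- k) * x))))"
      unfolding f_def by (simp add: sum_distrib_left mult_ac)
    also have "\<dots> = (\<Sum>k\<in>F. integral {0..2*pi} (\<lambda>x. ?c k * (of_real (u x) * cis (- (of_int (- k) * x)))))"
      by (intro integral_sum F integrable_on_mult_right fcc_integrable cu)
    also have "\<dots> = (\<Sum>k\<in>F. ?c k * (of_real (2*pi) * fourier_coeff u (-k)))"
      by (intro sum.cong refl) (simp add: fourier_coeff_eq[OF u] fcc_def)
    also have "\<dots> = of_real (2*pi * (\<Sum>k\<in>F. (cmod (?c k))\<^sup>2))"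
      by (simp add: fourier_coeff_neg[OF u] sum_distrib_left mult_ac complex_norm_square del: of_real_power)
    also have "norm \<dots> = 2*pi * (\<Sum>k\<in>F. (cmod (?c k))\<^sup>2)" by (subst norm_of_real) (simp add: sum_nonneg)
    also have "(\<Sum>k\<in>F. (cmod (?c k))\<^sup>2) = (L2_set (\<lambda>k. wt 0 k * cmod (?c k)) F)\<^sup>2" by (simp add: L2_set_def sum_nonneg)
    also have "\<dots> \<le> B\<^sup>2" using h F by (intro power_mono L2_set_nonneg) (auto simp: hs_def)
    finally show "norm (integral {0..2*pi} (\<lambda>x. of_real (u x) * f F x)) \<le> 2*pi*B\<^sup>2" by simp
  qed
  ultimately have le: "norm (integral {0..2*pi} (\<lambda>x. complex_of_real (u x) * of_real (u x))) \<le> 2*pi*B\<^sup>2"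
    by (rule tendsto_upperbound) simp
  have "(LINT x:{0..2*pi}|lborel. (u x)^2) = integral {0..2*pi} (\<lambda>x. (u x)\<^sup>2)"
    by (intro set_borel_integral_eq_integral borel_integrable_atLeastAtMost' continuous_intros per_cont[OF u])
  also have "\<dots> = Re (integral {0..2*pi} (\<lambda>x. complex_of_real (u x) * of_real (u x)))"
    using integral_square_of_real[OF per_cont[OF u]] by simp
  also have "\<dots> \<le> 2*pi*B\<^sup>2" using le complex_Re_le_cmod order_trans by blast
  finally have "L2_norm u \<le> sqrt (2*pi*B\<^sup>2)" unfolding L2_norm_def by (rule real_sqrt_le_mono)
  then show ?thesis using B0 by (simp add: real_sqrt_mult)
qed

subsection \<open>The control potential in Fourier variables\<close>

text \<open>Multiplication by \<open>p\<^sub>1 + p\<^sub>2 cos x + p\<^sub>3 sin x\<close> couples a frequency to its two neighbours only.\<close>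

definition pot :: "real^3 \<Rightarrow> (int \<Rightarrow> complex) \<Rightarrow> int \<Rightarrow> complex" where
  "pot p c k = of_real (p $ 1) * c k + of_real (p $ 2) / 2 * (c (k - 1) + c (k + 1))
     + of_real (p $ 3) / (2 * \<i>) * (c (k - 1) - c (k + 1))"

definition pfun :: "real^3 \<Rightarrow> real \<Rightarrow> real" where
  "pfun p x = p $ 1 + p $ 2 * cos x + p $ 3 * sin x"

lemma pfun_per: "pfun p \<in> per"
  by (auto simp: per_def pfun_def intro!: continuous_intros)

lemma fcc_pfun:
  assumes f: "continuous_on {0..2*pi} f" shows "fcc (\<lambda>x. of_real (pfun p x) * f x) k = pot p (fcc f) k"
proof -
  have sh: "fcc (\<lambda>x. cis (of_int j * x) * f x) k = fcc f (k - j)" for j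
    unfolding fcc_def
    by (intro arg_cong2[where f="(/)"] arg_cong[where f="integral {0..2*pi}"])
       (auto simp: fun_eq_iff mult_ac left_diff_distrib right_diff_distrib cis_mult minus_mult_left[symmetric] )
  have "(\<lambda>x. of_real (pfun p x) * f x) = (\<lambda>x. (of_real (p $ 1) * f x + of_real (p $ 2) / 2 * (cis (of_int 1 * x) * f x + cis (of_int (-1) * x) * f x))
     + of_real (p $ 3) / (2 * \<i>) * (cis (of_int 1 * x) * f x - cis (of_int (-1) * x) * f x))"
  proof
    fix x
    have "cis (of_int 1 * x) + cis (of_int (-1) * x) = 2 * of_real (cos x)" "cis (of_int 1 * x) - cis (of_int (-1) * x) = 2 * \<i> * of_real (sin x)"
      by (simp_all add: complex_eq_iff)
    then show "of_real (pfun p x) * f x = (of_real (p $ 1) * f x + of_real (p $ 2) / 2 * (cis (of_int 1 * x) * f x + cis (of_int (-1) * x) * f x))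
     + of_real (p $ 3) / (2 * \<i>) * (cis (of_int 1 * x) * f x - cis (of_int (-1) * x) * f x)"
      unfolding distrib_right[symmetric] left_diff_distrib[symmetric] by (simp add: pfun_def field_simps)
  qed
  then have "fcc (\<lambda>x. of_real (pfun p x) * f x) k = (of_real (p $ 1) * fcc f k + of_real (p $ 2) / 2 * (fcc f (k - 1) + fcc f (k - (-1))))
     + of_real (p $ 3) / (2 * \<i>) * (fcc f (k - 1) - fcc f (k - (-1)))"
    by (simp only: fcc_add fcc_diff fcc_cmult sh continuous_intros f)
  then show ?thesis by (simp add: pot_def)
qed

lemma fourier_coeff_control:
  assumes u: "u \<in> per"
  shows "fourier_coeff (\<lambda>x. control_potential p r x * u x) k = pot (p r) (fourier_coeff u) k"
proof -
  have e: "control_potential p r x = pfun (p r) x" for x by (simp add: control_potential_def pfun_def)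
  have "fourier_coeff (\<lambda>x. pfun (p r) x * u x) k = fcc (\<lambda>x. of_real (pfun (p r) x) * of_real (u x)) k"
    by (subst fourier_coeff_eq) (auto intro: per_mult pfun_per u)
  also have "\<dots> = pot (p r) (fcc (\<lambda>x. of_real (u x))) k" by (rule fcc_pfun) (rule per_cont_of_real[OF u])
  also have "fcc (\<lambda>x. of_real (u x)) = fourier_coeff u" using fourier_coeff_eq[OF u] by auto
  finally show ?thesis unfolding e .
qed

lemma norm_pot_le:
  assumes "\<bar>(p::real^3) $ 1\<bar> \<le> P" "\<bar>(p::real^3) $ 2\<bar> \<le> P" "\<bar>(p::real^3) $ 3\<bar> \<le> P" "\<And>k. norm (c k) \<le> C k"
  shows "norm (pot p c k) \<le> P * (C k + (C (k - 1) + C (k + 1)))"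
proof -
  have P: "P \<ge> 0" using assms(1) by linarith
  have "norm (pot p c k) \<le> \<bar>p $ 1\<bar> * norm (c k) + \<bar>p $ 2\<bar> / 2 * norm (c (k - 1) + c (k + 1)) + \<bar>p $ 3\<bar> / 2 * norm (c (k - 1) - c (k + 1))"
    unfolding pot_def by (intro norm_triangle_le add_mono) (auto simp: norm_mult norm_divide)
  also have "\<dots> \<le> P * C k + P / 2 * (C (k-1) + C (k+1)) + P / 2 * (C (k-1) + C (k+1))"
    using assms(4)[of k] norm_triangle_mono[OF assms(4)[of "k-1"] assms(4)[of "k+1"]]
      order_trans[OF norm_triangle_ineq4 add_mono[OF assms(4)[of "k-1"] assms(4)[of "k+1"]]] assms(1-3) P
    by (intro add_mono mult_mono) auto
  also have "\<dots> = P * (C k + (C (k - 1) + C (k + 1)))" by (simp add: algebra_simps)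
  finally show ?thesis .
qed

lemma pot_diff: "pot p (\<lambda>k. c k - d k) k = pot p c k - pot p d k"
  by (simp add: pot_def algebra_simps add_divide_distrib diff_divide_distrib)

lemma pot_cmult: "pot p (\<lambda>k. a * c k) k = a * pot p c k"
  by (simp add: pot_def algebra_simps add_divide_distrib diff_divide_distrib)

lemma pot_scaleR: "pot (a *\<^sub>R p) c k = of_real a * pot p c k"
  by (simp add: pot_def algebra_simps add_divide_distrib diff_divide_distrib)

section \<open>The kernel of the free evolution\<close>

abbreviation gauss :: "real \<Rightarrow> real" where "gauss x \<equiv> exp (- (x\<^sup>2 / 2))"

lemma gauss_density: "gauss x = sqrt (2*pi) * std_normal_density x"
  by (simp add: std_normal_density_def)

lemma integrable_gauss: "integrable lborel gauss"
  unfolding gauss_density by (intro integrable_mult_right integrable_normal_density) simp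

lemma gauss_fourier: "(LINT y|lborel. cis (a * y) * gauss y) = of_real (sqrt (2*pi) * gauss a)"
proof -
  have "(LINT y|lborel. cis (a * y) * gauss y) = (LINT y|lborel. sqrt (2*pi) * (std_normal_density y *\<^sub>R cis (a * y)))"
    unfolding gauss_density by (intro Bochner_Integration.integral_cong) (auto simp: scaleR_conv_of_real mult_ac)
  also have "\<dots> = sqrt (2*pi) * (LINT y|lborel. (std_normal_density y *\<^sub>R cis (a * y)))"
    by (rule integral_mult_right_zero)
  also have "(LINT y|lborel. (std_normal_density y *\<^sub>R cis (a * y))) = char std_normal_distribution a"
    unfolding char_def cis_conv_exp
    by (subst integral_density) (auto simp: mult_ac)
  finally show ?thesis by (simp add: char_std_normal_distribution)
qed

lemma integrable_exp_abs: "integrable lborel (\<lambda>z::real. exp (- \<bar>z\<bar>))"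
proof -
  let ?g = "\<lambda>z::real. indicator {0<..} z * exp (- z) :: real"
  have g: "integrable lborel ?g"
    using integrable_I0i_exp_mscale[of 1] by (simp add: set_integrable_def)
  have g': "integrable lborel (\<lambda>z. ?g (0 + (-1) * z))" using lborel_integrable_real_affine[OF g, of "-1" 0] by simp
  show ?thesis
  proof (rule Bochner_Integration.integrable_bound[OF Bochner_Integration.integrable_add[OF g g']])
    have "AE z in lborel. z \<noteq> (0::real)" by (rule AE_lborel_singleton)
    then show "AE z in lborel. norm (exp (- \<bar>z\<bar>)) \<le> norm (?g z + ?g (0 + (-1) * z))"
      by eventually_elim (auto simp: indicator_def)
  qed simp
qed

text \<open>The difference of the two integrals over \<open>[-n,n]\<close> is the contribution of the two vertical sides of
  a rectangle, which the Gaussian bound sends to zero; a primitive replaces the contour.\<close>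

lemma contour_shift:
  fixes F :: "complex \<Rightarrow> complex"
  assumes hol: "F holomorphic_on UNIV" and B: "B \<ge> 0"
    and bd: "\<And>\<xi> \<eta>. \<bar>\<eta>\<bar> \<le> B \<Longrightarrow> norm (F (Complex \<xi> \<eta>)) \<le> M * gauss \<xi>"
    and \<eta>: "\<bar>\<eta>\<bar> \<le> B"
  shows "(LINT \<xi>|lborel. F (Complex \<xi> \<eta>)) = (LINT \<xi>|lborel. F (of_real \<xi>))"
proof -
  have contF: "continuous_on A F" for A using hol holomorphic_on_imp_continuous_on continuous_on_subset by blast
  obtain P where P: "\<And>x. (P has_field_derivative F x) (at x)"
    using holomorphic_convex_primitive'[OF convex_UNIV open_UNIV hol] by auto
  have M0: "M \<ge> 0" using order_trans[OF norm_ge_zero bd[of 0 0]] B by simp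
  have cC: "continuous_on A (\<lambda>\<xi>. F (Complex \<xi> y))" for A y
    unfolding Complex_eq by (intro continuous_on_compose2[OF contF[of UNIV]] continuous_intros) auto
  have FTC: "(LINT \<xi>:{- real n..real n}|lborel. F (Complex \<xi> y)) = P (Complex (real n) y) - P (Complex (- real n) y)" for n y
  proof -
    have "((\<lambda>\<xi>. F (Complex \<xi> y)) has_integral P (Complex (real n) y) - P (Complex (- real n) y)) {- real n..real n}"
    proof (rule fundamental_theorem_of_calculus)
      fix \<xi> :: real
      have "((\<lambda>\<xi>. Complex \<xi> y) has_vector_derivative 1) (at \<xi> within {- real n..real n})"
        unfolding Complex_eq by (auto intro!: derivative_eq_intros simp: has_vector_derivative_def scaleR_conv_of_real)
      from field_vector_diff_chain_within[OF this has_field_derivative_at_within[OF P]]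
      show "((\<lambda>\<xi>. P (Complex \<xi> y)) has_vector_derivative F (Complex \<xi> y)) (at \<xi> within {- real n..real n})"
        by (simp add: o_def)
    qed simp
    then show ?thesis
      using set_borel_integral_eq_integral(2)[OF borel_integrable_atLeastAtMost'[OF cC]] by (simp add: integral_unique)
  qed
  have lim: "(\<lambda>n. LINT \<xi>:{- real n..real n}|lborel. F (Complex \<xi> y)) \<longlonglongrightarrow> (LINT \<xi>|lborel. F (Complex \<xi> y))" if y: "\<bar>y\<bar> \<le> B" for y
    unfolding set_lebesgue_integral_def
  proof (rule integral_dominated_convergence)
    show "integrable lborel (\<lambda>\<xi>. M * gauss \<xi>)" by (intro integrable_mult_right integrable_gauss)
    show "(\<lambda>\<xi>. F (Complex \<xi> y)) \<in> borel_measurable lborel"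
      using borel_measurable_continuous_onI[OF cC] by simp
    then show "(\<lambda>\<xi>. indicat_real {- real n..real n} \<xi> *\<^sub>R F (Complex \<xi> y)) \<in> borel_measurable lborel" for n
      by simp
    show "AE \<xi> in lborel. norm (indicat_real {- real n..real n} \<xi> *\<^sub>R F (Complex \<xi> y)) \<le> M * gauss \<xi>" for n
      using bd[OF y] M0 by (auto simp: indicator_def)
    show "AE \<xi> in lborel. (\<lambda>n. indicat_real {- real n..real n} \<xi> *\<^sub>R F (Complex \<xi> y)) \<longlonglongrightarrow> F (Complex \<xi> y)"
    proof (rule AE_I2)
      fix \<xi> :: real
      obtain N where N: "real N \<ge> \<bar>\<xi>\<bar>" using real_arch_simple by blast
      have "\<forall>\<^sub>F n in sequentially. indicat_real {- real n..real n} \<xi> *\<^sub>R F (Complex \<xi> y) = F (Complex \<xi> y)"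
        by (rule eventually_sequentiallyI[of N]) (use N in \<open>auto simp: indicator_def\<close>)
      then show "(\<lambda>n. indicat_real {- real n..real n} \<xi> *\<^sub>R F (Complex \<xi> y)) \<longlonglongrightarrow> F (Complex \<xi> y)"
        by (rule tendsto_eventually)
    qed
  qed
  have vert: "norm (P (Complex x \<eta>) - P (Complex x 0)) \<le> M * gauss x * B" for x
  proof -
    have "norm (P (Complex x \<eta>) - P (Complex x 0)) \<le> M * gauss x * norm (Complex x \<eta> - Complex x 0)"
    proof (rule field_differentiable_bound)
      show "convex (closed_segment (Complex x 0) (Complex x \<eta>))" by simp
      show "(P has_field_derivative F z) (at z within closed_segment (Complex x 0) (Complex x \<eta>))" for z
        by (rule has_field_derivative_at_within[OF P])
      fix z assume "z \<in> closed_segment (Complex x 0) (Complex x \<eta>)"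
      then obtain u where u: "0 \<le> u" "u \<le> 1" "z = (1 - u) *\<^sub>R Complex x 0 + u *\<^sub>R Complex x \<eta>"
        by (auto simp: closed_segment_def)
      then have z: "z = Complex x (u * \<eta>)" by (simp add: complex_eq_iff algebra_simps)
      have "\<bar>u * \<eta>\<bar> \<le> B" using u \<eta> mult_mono[of u 1 "\<bar>\<eta>\<bar>" B] by (simp add: abs_mult)
      then show "norm (F z) \<le> M * gauss x" unfolding z by (rule bd)
    qed auto
    also have "\<dots> \<le> M * gauss x * B" using \<eta> M0 by (intro mult_left_mono) (auto simp: cmod_def)
    finally show ?thesis .
  qed
  have g0: "(\<lambda>n. gauss (real n)) \<longlonglongrightarrow> 0" by real_asymp
  have "(\<lambda>n. (LINT \<xi>:{- real n..real n}|lborel. F (Complex \<xi> \<eta>)) - (LINT \<xi>:{- real n..real n}|lborel. F (Complex \<xi> 0))) \<longlonglongrightarrow> 0"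
  proof (rule Lim_null_comparison)
    have "(\<lambda>n. 2 * (M * gauss (real n) * B)) \<longlonglongrightarrow> 2 * (M * 0 * B)" by (intro tendsto_mult tendsto_const g0)
    then show "(\<lambda>n. 2 * (M * gauss (real n) * B)) \<longlonglongrightarrow> 0" by simp
    show "\<forall>\<^sub>F n in sequentially. norm ((LINT \<xi>:{- real n..real n}|lborel. F (Complex \<xi> \<eta>)) - (LINT \<xi>:{- real n..real n}|lborel. F (Complex \<xi> 0))) \<le> 2 * (M * gauss (real n) * B)"
    proof (rule always_eventually, rule allI)
      fix n
      have "norm ((P (Complex (real n) \<eta>) - P (Complex (real n) 0)) - (P (Complex (- real n) \<eta>) - P (Complex (- real n) 0)))
         \<le> M * gauss (real n) * B + M * gauss (- real n) * B"
        by (rule order_trans[OF norm_triangle_ineq4 add_mono[OF vert vert]])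
      then show "norm ((LINT \<xi>:{- real n..real n}|lborel. F (Complex \<xi> \<eta>)) - (LINT \<xi>:{- real n..real n}|lborel. F (Complex \<xi> 0))) \<le> 2 * (M * gauss (real n) * B)"
        unfolding FTC by (simp add: algebra_simps)
    qed
  qed
  moreover have "(\<lambda>n. (LINT \<xi>:{- real n..real n}|lborel. F (Complex \<xi> \<eta>)) - (LINT \<xi>:{- real n..real n}|lborel. F (Complex \<xi> 0))) \<longlonglongrightarrow>
     (LINT \<xi>|lborel. F (Complex \<xi> \<eta>)) - (LINT \<xi>|lborel. F (Complex \<xi> 0))"
    by (intro tendsto_diff lim \<eta>) (use B in auto)
  ultimately have "(LINT \<xi>|lborel. F (Complex \<xi> \<eta>)) - (LINT \<xi>|lborel. F (Complex \<xi> 0)) = 0"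
    using LIMSEQ_unique by blast
  then show ?thesis by (simp add: complex_of_real_def)
qed

text \<open>A Gaussian regularization of the transform is an average of \<open>H\<close> against a concentrating Gaussian.\<close>

lemma fourier_inversion:
  fixes H :: "real \<Rightarrow> complex"
  assumes cH: "continuous_on UNIV H" and bH: "\<And>\<xi>. norm (H \<xi>) \<le> M * gauss \<xi>"
    and Hc: "\<And>z. Hc z = (LINT \<xi>|lborel. H \<xi> * cis (\<xi> * z)) / (2*pi)"
    and int: "integrable lborel Hc"
  shows "(LINT z|lborel. Hc z * cis (- (\<xi>0 * z))) = H \<xi>0"
proof -
  have M0: "M \<ge> 0" using bH[of 0] norm_ge_zero[of "H 0"] by (simp del: norm_ge_zero)
  define g where "g n z = gauss (z / real (Suc n))" for n z
  have gm [measurable]: "g n \<in> borel_measurable borel" for n unfolding g_def by measurable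
  have Hm [measurable]: "H \<in> borel_measurable borel" by (rule borel_measurable_continuous_onI[OF cH])
  have cism [measurable]: "(\<lambda>x. cis (f x)) \<in> borel_measurable N" if "f \<in> borel_measurable N" for f :: "'a \<Rightarrow> real" and N
    using measurable_compose[OF that borel_measurable_continuous_onI[OF continuous_on_cis'[OF continuous_on_id]]] by simp
  have Hcm [measurable]: "Hc \<in> borel_measurable borel" using borel_measurable_integrable[OF int] by simp
  have gint: "integrable lborel (g n)" for n
    using lborel_integrable_real_affine[OF integrable_gauss, of "1 / real (Suc n)" 0] by (simp add: g_def[abs_def])
  have gf: "(LINT z|lborel. cis (a * z) * g n z) = real (Suc n) * sqrt (2*pi) * gauss (a * real (Suc n))" for a n
  proof -
    have "(LINT z|lborel. cis (a * z) * g n z) = \<bar>real (Suc n)\<bar> *\<^sub>R (LINT y|lborel. cis (a * (0 + real (Suc n) * y)) * g n (0 + real (Suc n) * y))"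
      by (rule lborel_integral_real_affine) auto
    also have "(LINT y|lborel. cis (a * (0 + real (Suc n) * y)) * g n (0 + real (Suc n) * y)) = (LINT y|lborel. cis ((a * real (Suc n)) * y) * gauss y)"
      by (simp add: g_def mult.assoc)
    finally show ?thesis by (simp only: gauss_fourier) (simp add: scaleR_conv_of_real)
  qed
  have lim1: "(\<lambda>n. LINT z|lborel. Hc z * cis (- (\<xi>0 * z)) * g n z) \<longlonglongrightarrow> (LINT z|lborel. Hc z * cis (- (\<xi>0 * z)))"
  proof (rule integral_dominated_convergence)
    show "integrable lborel (\<lambda>z. norm (Hc z))" using int by simp
    show "AE z in lborel. norm (Hc z * cis (- (\<xi>0 * z)) * of_real (g n z)) \<le> norm (Hc z)" for n
      by (auto simp: norm_mult g_def mult_left_le)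
    have "(\<lambda>n. g n z) \<longlonglongrightarrow> 1" for z
    proof -
      have "(\<lambda>n. z / real (Suc n)) \<longlonglongrightarrow> 0" by real_asymp
      then have "(\<lambda>n. g n z) \<longlonglongrightarrow> gauss 0" unfolding g_def by (intro tendsto_intros) simp_all
      then show ?thesis by simp
    qed
    from tendsto_mult[OF tendsto_const tendsto_of_real[OF this]]
    have "(\<lambda>n. Hc z * cis (- (\<xi>0 * z)) * of_real (g n z)) \<longlonglongrightarrow> Hc z * cis (- (\<xi>0 * z)) * of_real 1" for z .
    then show "AE z in lborel. (\<lambda>n. Hc z * cis (- (\<xi>0 * z)) * of_real (g n z)) \<longlonglongrightarrow> Hc z * cis (- (\<xi>0 * z))" by simp
  qed measurable
  have eq: "(LINT z|lborel. Hc z * cis (- (\<xi>0 * z)) * g n z) = (LINT y|lborel. H (\<xi>0 + y / real (Suc n)) * std_normal_density y)" for n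
  proof -
    let ?f = "\<lambda>\<xi> z. H \<xi> * (cis ((\<xi> - \<xi>0) * z) * g n z)"
    have nf: "norm (?f \<xi> z) = norm (H \<xi>) * g n z" for \<xi> z by (simp add: norm_mult g_def)
    have Hint: "integrable lborel H"
      by (rule Bochner_Integration.integrable_bound[OF integrable_mult_right[OF integrable_gauss, of M]])
         (use bH M0 in \<open>auto simp: abs_mult\<close>)
    have "(LINT z|lborel. Hc z * cis (- (\<xi>0 * z)) * g n z) = (LINT z|lborel. (LINT \<xi>|lborel. ?f \<xi> z) / (2*pi))"
    proof (rule Bochner_Integration.integral_cong[OF refl])
      fix z
      have "Hc z * cis (- (\<xi>0 * z)) * g n z = (LINT \<xi>|lborel. H \<xi> * cis (\<xi> * z)) * (cis (- (\<xi>0 * z)) * g n z) / (2*pi)"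
        unfolding Hc by simp
      also have "(LINT \<xi>|lborel. H \<xi> * cis (\<xi> * z)) * (cis (- (\<xi>0 * z)) * g n z) = (LINT \<xi>|lborel. H \<xi> * cis (\<xi> * z) * (cis (- (\<xi>0 * z)) * g n z))"
        by (rule integral_mult_left_zero[symmetric])
      also have "\<dots> = (LINT \<xi>|lborel. ?f \<xi> z)"
        by (intro Bochner_Integration.integral_cong refl) (simp add: cis_mult algebra_simps)
      finally show "Hc z * cis (- (\<xi>0 * z)) * g n z = (LINT \<xi>|lborel. ?f \<xi> z) / (2*pi)" .
    qed
    also have "\<dots> = (LINT z|lborel. (LINT \<xi>|lborel. ?f \<xi> z)) / (2*pi)" by (rule integral_divide_zero)
    also have "(LINT z|lborel. (LINT \<xi>|lborel. ?f \<xi> z)) = (LINT \<xi>|lborel. (LINT z|lborel. ?f \<xi> z))"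
    proof (rule lborel_pair.Fubini_integral, rule lborel_pair.Fubini_integrable)
      show "case_prod ?f \<in> borel_measurable (lborel \<Otimes>\<^sub>M lborel)" by measurable
      show "integrable lborel (\<lambda>\<xi>. LINT z|lborel. norm (case (\<xi>, z) of (\<xi>, z) \<Rightarrow> ?f \<xi> z))"
        by (simp add: nf Hint)
      show "AE \<xi> in lborel. integrable lborel (\<lambda>z. case (\<xi>, z) of (\<xi>, z) \<Rightarrow> ?f \<xi> z)"
      proof (rule AE_I2)
        fix \<xi>
        have "integrable lborel (\<lambda>z. norm (H \<xi>) * g n z)" by (intro integrable_mult_right gint)
        then show "integrable lborel (\<lambda>z. case (\<xi>, z) of (\<xi>, z) \<Rightarrow> ?f \<xi> z)"
          by (rule Bochner_Integration.integrable_bound) (auto simp: nf g_def norm_mult)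
      qed
    qed
    also have "\<dots> = (LINT \<xi>|lborel. H \<xi> * (real (Suc n) * sqrt (2*pi) * gauss ((\<xi> - \<xi>0) * real (Suc n))))"
      by (simp only: integral_mult_right_zero gf)
    also have "\<dots> = \<bar>1 / real (Suc n)\<bar> *\<^sub>R (LINT y|lborel. H (\<xi>0 + 1 / real (Suc n) * y) * (real (Suc n) * sqrt (2*pi) * gauss ((\<xi>0 + 1 / real (Suc n) * y - \<xi>0) * real (Suc n))))"
      by (rule lborel_integral_real_affine) auto
    also have "\<dots> = \<bar>1 / real (Suc n)\<bar> *\<^sub>R (LINT y|lborel. (H (\<xi>0 + y / real (Suc n)) * std_normal_density y) * (real (Suc n) * (2 * pi)))"
      by (intro arg_cong2[where f="scaleR"] refl Bochner_Integration.integral_cong)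
         (simp_all only: gauss_density, simp add: mult_ac flip: of_real_mult)
    also have "\<dots> / (2*pi) = (LINT y|lborel. H (\<xi>0 + y / real (Suc n)) * std_normal_density y)"
      by (simp only: integral_mult_left_zero) (simp add: scaleR_conv_of_real del: of_nat_Suc)
    finally show ?thesis .
  qed
  have lim2: "(\<lambda>n. LINT y|lborel. H (\<xi>0 + y / real (Suc n)) * std_normal_density y) \<longlonglongrightarrow> (LINT y|lborel. H \<xi>0 * std_normal_density y)"
  proof (rule integral_dominated_convergence)
    show "integrable lborel (\<lambda>y. M * std_normal_density y)" by (intro integrable_mult_right integrable_normal_density) simp
    have "norm (H \<xi>) \<le> M" for \<xi> using bH[of \<xi>] M0 mult_left_le[of "gauss \<xi>" M] by (simp add: order_trans)
    then show "AE y in lborel. norm (H (\<xi>0 + y / real (Suc n)) * complex_of_real (std_normal_density y)) \<le> M * std_normal_density y" for n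
      by (auto simp: norm_mult intro!: mult_right_mono)
    show "AE y in lborel. (\<lambda>n. H (\<xi>0 + y / real (Suc n)) * complex_of_real (std_normal_density y)) \<longlonglongrightarrow> H \<xi>0 * complex_of_real (std_normal_density y)"
    proof (rule AE_I2)
      fix y
      have "(\<lambda>n. \<xi>0 + y / real (Suc n)) \<longlonglongrightarrow> \<xi>0" by real_asymp
      moreover have "isCont H \<xi>0" using cH by (simp add: continuous_on_eq_continuous_at)
      ultimately have "(\<lambda>n. H (\<xi>0 + y / real (Suc n))) \<longlonglongrightarrow> H \<xi>0" by (rule isCont_tendsto_compose[rotated])
      then show "(\<lambda>n. H (\<xi>0 + y / real (Suc n)) * complex_of_real (std_normal_density y)) \<longlonglongrightarrow> H \<xi>0 * complex_of_real (std_normal_density y)"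
        by (intro tendsto_intros)
    qed
  qed measurable
  have "(LINT y|lborel. H \<xi>0 * complex_of_real (std_normal_density y)) = H \<xi>0"
    by (simp only: integral_mult_right_zero integral_complex_of_real integral_normal_density) simp
  then show ?thesis using LIMSEQ_unique[OF lim1] lim2 unfolding eq by simp
qed

text \<open>After rescaling space by \<open>e\<close>, the free evolution over time \<open>e\<^sup>4\<close> has the symbol
  \<open>exp (- \<xi>\<^sup>4 + e\<^sup>2 \<xi>\<^sup>2)\<close>, which extends to an entire function and stays bounded as \<open>e \<rightarrow> 0\<close>.\<close>

definition kern_symbol :: "real \<Rightarrow> complex \<Rightarrow> complex" where
  "kern_symbol e \<zeta> = exp (- (\<zeta> ^ 4) + of_real (e\<^sup>2) * \<zeta>\<^sup>2)"

lemma kern_symbol_bound: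
  assumes "0 \<le> e" "e \<le> 1" "\<bar>\<eta>\<bar> \<le> B"
  shows "norm (kern_symbol e (Complex \<xi> \<eta>)) \<le> exp ((6 * B\<^sup>2 + 2)\<^sup>2) * gauss \<xi>"
proof -
  have B: "\<eta>\<^sup>2 \<le> B\<^sup>2" using assms(3) by (metis abs_ge_zero power2_abs power_mono)
  have e: "e\<^sup>2 \<le> 1" using assms by (simp add: power_le_one)
  have Re_sq: "Re (w\<^sup>2) = (Re w)\<^sup>2 - (Im w)\<^sup>2" for w by (simp add: power2_eq_square)
  have sq: "Re ((Complex \<xi> \<eta>)\<^sup>2) = \<xi>\<^sup>2 - \<eta>\<^sup>2" "Im ((Complex \<xi> \<eta>)\<^sup>2) = 2 * \<xi> * \<eta>"
    by (simp_all add: power2_eq_square)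
  have "(Complex \<xi> \<eta>) ^ 4 = ((Complex \<xi> \<eta>)\<^sup>2)\<^sup>2" by (simp flip: power_mult)
  then have "Re ((Complex \<xi> \<eta>) ^ 4) = (\<xi>\<^sup>2 - \<eta>\<^sup>2)\<^sup>2 - (2 * \<xi> * \<eta>)\<^sup>2"
    using sq Re_sq[of "(Complex \<xi> \<eta>)\<^sup>2"] by simp
  then have Re: "Re (- ((Complex \<xi> \<eta>) ^ 4) + of_real (e\<^sup>2) * (Complex \<xi> \<eta>)\<^sup>2) = - ((\<xi>\<^sup>2 - \<eta>\<^sup>2)\<^sup>2 - (2 * \<xi> * \<eta>)\<^sup>2) + e\<^sup>2 * (\<xi>\<^sup>2 - \<eta>\<^sup>2)"
    using sq by simp
  define X where "X = \<xi>\<^sup>2" define Y where "Y = \<eta>\<^sup>2"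
  have XY: "X \<ge> 0" "Y \<ge> 0" "Y \<le> B\<^sup>2" using B by (auto simp: X_def Y_def)
  have "- ((X - Y)\<^sup>2 - 4 * X * Y) + e\<^sup>2 * (X - Y) = - X\<^sup>2 + 6 * (Y * X) - Y\<^sup>2 + e\<^sup>2 * X - e\<^sup>2 * Y"
    by (simp add: power2_eq_square algebra_simps)
  also have "\<dots> \<le> - X\<^sup>2 + 6 * (B\<^sup>2 * X) - 0 + 1 * X - 0"
    using XY e by (intro diff_mono add_mono mult_left_mono mult_right_mono) auto
  also have "\<dots> = - X\<^sup>2 + (6 * B\<^sup>2 + 2) * X - X" by (simp add: algebra_simps)
  also have "\<dots> \<le> (6 * B\<^sup>2 + 2)\<^sup>2 - X"
  proof -
    have "(X - (6 * B\<^sup>2 + 2) / 2)\<^sup>2 \<ge> 0" by simp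
    then have "X\<^sup>2 - (6 * B\<^sup>2 + 2) * X + (6 * B\<^sup>2 + 2)\<^sup>2 / 4 \<ge> 0" by (simp add: power2_eq_square field_simps)
    moreover have "(6 * B\<^sup>2 + 2)\<^sup>2 \<ge> 0" by simp
    ultimately show ?thesis by linarith
  qed
  also have "\<dots> \<le> (6 * B\<^sup>2 + 2)\<^sup>2 - \<xi>\<^sup>2 / 2" using XY by (simp add: X_def)
  finally have "Re (- ((Complex \<xi> \<eta>) ^ 4) + of_real (e\<^sup>2) * (Complex \<xi> \<eta>)\<^sup>2) \<le> (6 * B\<^sup>2 + 2)\<^sup>2 + - (\<xi>\<^sup>2 / 2)"
    unfolding Re X_def Y_def by (simp add: power_mult_distrib mult.assoc)
  then have "exp (Re (- ((Complex \<xi> \<eta>) ^ 4) + of_real (e\<^sup>2) * (Complex \<xi> \<eta>)\<^sup>2)) \<le> exp ((6 * B\<^sup>2 + 2)\<^sup>2 + - (\<xi>\<^sup>2 / 2))" by simp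
  also have "\<dots> = exp ((6 * B\<^sup>2 + 2)\<^sup>2) * gauss \<xi>" by (rule exp_add)
  finally show ?thesis unfolding kern_symbol_def norm_exp_eq_Re .
qed

definition kern :: "real \<Rightarrow> real \<Rightarrow> complex" where
  "kern e z = (LINT \<xi>|lborel. kern_symbol e (of_real \<xi>) * cis (\<xi> * z)) / (2*pi)"

lemma cis_complex: "cis (\<xi> * z) = exp (\<i> * of_real \<xi> * of_real z)"
  by (simp add: cis_conv_exp mult_ac)

text \<open>Multiplying the kernel by an exponential amounts to moving the frequency off the real axis.\<close>

lemma kern_shift:
  assumes e: "0 \<le> e" "e \<le> 1"
  shows "kern e z * exp (\<eta> * z) = (LINT \<xi>|lborel. kern_symbol e (Complex \<xi> \<eta>) * cis (\<xi> * z)) / (2*pi)"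
proof -
  let ?F = "\<lambda>\<zeta>. kern_symbol e \<zeta> * exp (\<i> * \<zeta> * of_real z)"
  have hol: "?F holomorphic_on UNIV" unfolding kern_symbol_def by (intro holomorphic_intros)
  have "norm (?F (Complex x y)) \<le> (exp ((6 * \<bar>\<eta>\<bar>\<^sup>2 + 2)\<^sup>2) * exp (\<bar>\<eta>\<bar> * \<bar>z\<bar>)) * gauss x" if "\<bar>y\<bar> \<le> \<bar>\<eta>\<bar>" for x y
  proof -
    have "- (y * z) \<le> \<bar>\<eta>\<bar> * \<bar>z\<bar>" using mult_right_mono[OF that, of "\<bar>z\<bar>"] by (simp add: abs_mult[symmetric])
    then have "norm (exp (\<i> * Complex x y * of_real z)) \<le> exp (\<bar>\<eta>\<bar> * \<bar>z\<bar>)"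
      by (simp add: norm_exp_eq_Re)
    then have "norm (kern_symbol e (Complex x y)) * norm (exp (\<i> * Complex x y * of_real z)) \<le> (exp ((6 * \<bar>\<eta>\<bar>\<^sup>2 + 2)\<^sup>2) * gauss x) * exp (\<bar>\<eta>\<bar> * \<bar>z\<bar>)"
      by (intro mult_mono kern_symbol_bound e that) auto
    then show ?thesis by (simp only: norm_mult) (simp add: mult_ac)
  qed
  from contour_shift[where B="\<bar>\<eta>\<bar>" and \<eta>=\<eta>, OF hol _ this]
  have "(LINT \<xi>|lborel. ?F (Complex \<xi> \<eta>)) = (LINT \<xi>|lborel. ?F (of_real \<xi>))" by simp
  then have "kern e z = (LINT \<xi>|lborel. ?F (Complex \<xi> \<eta>)) / (2*pi)" by (simp add: kern_def cis_complex)
  also have "(LINT \<xi>|lborel. ?F (Complex \<xi> \<eta>)) = (LINT \<xi>|lborel. kern_symbol e (Complex \<xi> \<eta>) * cis (\<xi> * z) * exp (- (\<eta> * z)))"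
  proof (rule Bochner_Integration.integral_cong[OF refl])
    fix \<xi>
    have "\<i> * Complex \<xi> \<eta> * of_real z = \<i> * of_real \<xi> * of_real z + of_real (- (\<eta> * z))"
      by (simp add: complex_eq_iff)
    then show "?F (Complex \<xi> \<eta>) = kern_symbol e (Complex \<xi> \<eta>) * cis (\<xi> * z) * exp (- (\<eta> * z))"
      by (simp only: exp_add cis_complex) (simp add: exp_of_real[symmetric])
  qed
  also have "\<dots> = (LINT \<xi>|lborel. kern_symbol e (Complex \<xi> \<eta>) * cis (\<xi> * z)) * exp (- (\<eta> * z))"
    by (rule integral_mult_left_zero)
  finally show ?thesis by (simp add: exp_minus field_simps)
qed

lemma kern_symbol_cont: "continuous_on A (\<lambda>\<xi>. kern_symbol e (Complex \<xi> \<eta>))"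
  unfolding kern_symbol_def Complex_eq by (intro continuous_intros)

lemma kern_symbol_integrable:
  assumes e: "0 \<le> e" "e \<le> 1" shows "integrable lborel (\<lambda>\<xi>. kern_symbol e (Complex \<xi> \<eta>) * cis (\<xi> * z))"
proof (rule Bochner_Integration.integrable_bound[OF integrable_mult_right[OF integrable_gauss]])
  show "AE \<xi> in lborel. norm (kern_symbol e (Complex \<xi> \<eta>) * cis (\<xi> * z)) \<le> norm (exp ((6 * \<bar>\<eta>\<bar>\<^sup>2 + 2)\<^sup>2) * gauss \<xi>)"
    using kern_symbol_bound[OF e, of \<eta> "\<bar>\<eta>\<bar>"] by (simp add: norm_mult)
  have "continuous_on UNIV (\<lambda>\<xi>. kern_symbol e (Complex \<xi> \<eta>) * cis (\<xi> * z))" by (intro continuous_intros kern_symbol_cont)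
  then show "(\<lambda>\<xi>. kern_symbol e (Complex \<xi> \<eta>) * cis (\<xi> * z)) \<in> borel_measurable lborel"
    using borel_measurable_continuous_onI by simp
qed

text \<open>The integral of the Gaussian bound of the symbol on the strip \<open>|Im \<zeta>| \<le> B\<close>.\<close>

definition kbd :: "real \<Rightarrow> real" where
  "kbd B = exp ((6 * B\<^sup>2 + 2)\<^sup>2) * sqrt (2*pi) / (2*pi)"

lemma kern_bound1:
  assumes e: "0 \<le> e" "e \<le> 1" and \<eta>: "\<bar>\<eta>\<bar> \<le> B"
  shows "norm (kern e z) * exp (\<eta> * z) \<le> kbd B"
proof -
  have "norm (LINT \<xi>|lborel. kern_symbol e (Complex \<xi> \<eta>) * cis (\<xi> * z)) \<le> (LINT \<xi>|lborel. norm (kern_symbol e (Complex \<xi> \<eta>) * cis (\<xi> * z)))"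
    by (rule integral_norm_bound)
  also have "\<dots> \<le> (LINT \<xi>|lborel. exp ((6 * B\<^sup>2 + 2)\<^sup>2) * gauss \<xi>)"
    by (intro integral_mono integrable_norm kern_symbol_integrable e integrable_mult_right integrable_gauss)
       (use kern_symbol_bound[OF e \<eta>] in \<open>simp add: norm_mult\<close>)
  also have "\<dots> = exp ((6 * B\<^sup>2 + 2)\<^sup>2) * sqrt (2*pi)"
    unfolding gauss_density by (simp add: mult.assoc[symmetric])
  finally have "norm (kern e z * exp (\<eta> * z)) \<le> kbd B"
    unfolding kern_shift[OF e] kbd_def by (simp add: norm_divide divide_right_mono)
  then show ?thesis by (simp add: norm_mult)
qed

text \<open>The decay rate \<open>B\<close> is arbitrary because the symbol is entire, and the constant does not depend
  on \<open>e\<close>; this is what dominates the exponentially growing factors in the conjugated evolution.\<close>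

lemma kern_bound:
  assumes e: "0 \<le> e" "e \<le> 1" and B: "B \<ge> 0"
  shows "norm (kern e z) \<le> kbd B * exp (- (B * \<bar>z\<bar>))"
proof -
  have "norm (kern e z) * exp (B * \<bar>z\<bar>) \<le> kbd B"
    using kern_bound1[OF e, of B B z] kern_bound1[OF e, of "-B" B z] B by (cases "z \<ge> 0") auto
  then show ?thesis by (simp add: exp_minus field_simps)
qed

lemma kbd_nonneg: "kbd B \<ge> 0" by (simp add: kbd_def)

lemma kern_cont: assumes e: "0 \<le> e" "e \<le> 1" shows "continuous_on UNIV (kern e)"
proof -
  have "isCont (kern e) z" for z
    unfolding continuous_within_sequentially
  proof (intro allI impI)
    fix x :: "nat \<Rightarrow> real" assume x: "(\<forall>n. x n \<in> UNIV) \<and> x \<longlonglongrightarrow> z"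
    have "(\<lambda>n. LINT \<xi>|lborel. kern_symbol e (Complex \<xi> 0) * cis (\<xi> * x n)) \<longlonglongrightarrow> (LINT \<xi>|lborel. kern_symbol e (Complex \<xi> 0) * cis (\<xi> * z))"
    proof (rule integral_dominated_convergence)
      show "integrable lborel (\<lambda>\<xi>. norm (kern_symbol e (Complex \<xi> 0) * cis (\<xi> * 0)))" by (intro integrable_norm kern_symbol_integrable e)
      show "(\<lambda>\<xi>. kern_symbol e (Complex \<xi> 0) * cis (\<xi> * w)) \<in> borel_measurable lborel" for w
        by (rule borel_measurable_integrable, rule kern_symbol_integrable[OF e])
      then show "(\<lambda>\<xi>. kern_symbol e (Complex \<xi> 0) * cis (\<xi> * x n)) \<in> borel_measurable lborel" for n .
      show "AE \<xi> in lborel. norm (kern_symbol e (Complex \<xi> 0) * cis (\<xi> * x n)) \<le> norm (kern_symbol e (Complex \<xi> 0) * cis (\<xi> * 0))" for n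
        by (simp add: norm_mult)
      show "AE \<xi> in lborel. (\<lambda>n. kern_symbol e (Complex \<xi> 0) * cis (\<xi> * x n)) \<longlonglongrightarrow> kern_symbol e (Complex \<xi> 0) * cis (\<xi> * z)"
        unfolding cis_conv_exp using x by (intro AE_I2 tendsto_intros) auto
    qed
    then show "(kern e \<circ> x) \<longlonglongrightarrow> kern e z"
      unfolding kern_def o_def complex_of_real_def by (intro tendsto_divide tendsto_const) (auto simp: complex_eq_iff)
  qed
  then show ?thesis by (simp add: continuous_on_eq_continuous_at)
qed

lemma kern_exp_integrable:
  assumes e: "0 \<le> e" "e \<le> 1" and B: "B \<ge> 0" and g: "g \<in> borel_measurable borel" "\<And>z. norm (g z) \<le> M * exp (B * \<bar>z\<bar>)"
  shows "integrable lborel (\<lambda>z. kern e z * g z)"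
proof (rule Bochner_Integration.integrable_bound[OF integrable_mult_right[OF integrable_exp_abs, of "kbd (B+1) * M"]])
  have M0: "M \<ge> 0" using order_trans[OF norm_ge_zero g(2)[of 0]] by simp
  show "AE z in lborel. norm (kern e z * g z) \<le> norm (kbd (B+1) * M * exp (- \<bar>z\<bar>))"
  proof (rule AE_I2)
    fix z
    have "norm (kern e z * g z) \<le> (kbd (B+1) * exp (- ((B+1) * \<bar>z\<bar>))) * (M * exp (B * \<bar>z\<bar>))"
      unfolding norm_mult by (intro mult_mono kern_bound e g) (use B kbd_nonneg in auto)
    also have "\<dots> = kbd (B+1) * M * (exp (- ((B+1) * \<bar>z\<bar>)) * exp (B * \<bar>z\<bar>))" by simp
    also have "exp (- ((B+1) * \<bar>z\<bar>)) * exp (B * \<bar>z\<bar>) = exp (- \<bar>z\<bar>)" by (simp add: exp_add[symmetric] algebra_simps)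
    finally show "norm (kern e z * g z) \<le> norm (kbd (B+1) * M * exp (- \<bar>z\<bar>))"
      using kbd_nonneg M0 by simp
  qed
  show "(\<lambda>z. kern e z * g z) \<in> borel_measurable lborel"
    using borel_measurable_continuous_onI[OF kern_cont[OF e]] g(1) by measurable
qed

text \<open>The Fourier transform of the kernel at an arbitrary complex frequency.\<close>

lemma kern_fourier:
  assumes e: "0 \<le> e" "e \<le> 1"
  shows "(LINT z|lborel. kern e z * (of_real (exp (\<eta> * z)) * cis (- (\<xi>0 * z)))) = kern_symbol e (Complex \<xi>0 \<eta>)"
proof -
  have m: "(\<lambda>z. complex_of_real (exp (\<eta> * z))) \<in> borel_measurable borel" by measurable
  have "(LINT z|lborel. (kern e z * exp (\<eta> * z)) * cis (- (\<xi>0 * z))) = kern_symbol e (Complex \<xi>0 \<eta>)"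
  proof (rule fourier_inversion)
    show "continuous_on UNIV (\<lambda>\<xi>. kern_symbol e (Complex \<xi> \<eta>))" by (rule kern_symbol_cont)
    show "norm (kern_symbol e (Complex \<xi> \<eta>)) \<le> exp ((6 * \<bar>\<eta>\<bar>\<^sup>2 + 2)\<^sup>2) * gauss \<xi>" for \<xi> by (rule kern_symbol_bound[OF e]) simp
    show "kern e z * exp (\<eta> * z) = (LINT \<xi>|lborel. kern_symbol e (Complex \<xi> \<eta>) * cis (\<xi> * z)) / (2*pi)" for z
      by (rule kern_shift[OF e])
    show "integrable lborel (\<lambda>z. kern e z * complex_of_real (exp (\<eta> * z)))"
    proof (rule kern_exp_integrable[OF e _ m, of "\<bar>\<eta>\<bar>" 1])
      fix z have "\<eta> * z \<le> \<bar>\<eta>\<bar> * \<bar>z\<bar>" by (simp add: abs_mult[symmetric])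
      then show "norm (complex_of_real (exp (\<eta> * z))) \<le> 1 * exp (\<bar>\<eta>\<bar> * \<bar>z\<bar>)" by simp
    qed simp
  qed
  then show ?thesis by (simp add: mult.assoc)
qed

lemma kern_symbol_real: "kern_symbol e (of_real \<xi>) = of_real (exp (- (\<xi> ^ 4) + e\<^sup>2 * \<xi>\<^sup>2))"
  by (simp add: kern_symbol_def exp_of_real[symmetric])

lemma kern_real: assumes e: "0 \<le> e" "e \<le> 1" shows "kern e z = of_real (Re (kern e z))"
proof -
  have "cnj (LINT \<xi>|lborel. kern_symbol e (of_real \<xi>) * cis (\<xi> * z)) = (LINT \<xi>|lborel. cnj (kern_symbol e (of_real \<xi>) * cis (\<xi> * z)))"
    by (rule Bochner_Integration.integral_cnj[symmetric])
  also have "\<dots> = \<bar>-1\<bar> *\<^sub>R (LINT \<xi>|lborel. cnj (kern_symbol e (of_real (0 + (-1) * \<xi>)) * cis ((0 + (-1) * \<xi>) * z)))"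
    by (rule lborel_integral_real_affine) simp
  also have "\<dots> = (LINT \<xi>|lborel. kern_symbol e (of_real \<xi>) * cis (\<xi> * z))"
    by (simp add: kern_symbol_real cis_cnj flip: of_real_minus)
  finally have "cnj (kern e z) = kern e z" by (simp add: kern_def)
  then show ?thesis by (metis Reals_cnj_iff of_real_Re)
qed

section \<open>The conjugated free evolution\<close>

text \<open>The free evolution over time \<open>e\<^sup>4\<close>, written as a convolution on the line.\<close>

definition evo :: "real \<Rightarrow> (real \<Rightarrow> complex) \<Rightarrow> real \<Rightarrow> complex" where
  "evo e u x = (LINT z|lborel. kern e z * u (x - e * z))"

definition kmass :: real where "kmass = kbd 1 * (LINT z|lborel. exp (- \<bar>z::real\<bar>))"

lemma bounded_comp_measurable:
  assumes "continuous_on UNIV (u :: real \<Rightarrow> complex)" shows "(\<lambda>z. u (x - e * z)) \<in> borel_measurable borel"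
  by (intro borel_measurable_continuous_onI continuous_on_compose2[OF assms] continuous_intros) auto

lemma evo_integrable:
  assumes e: "0 \<le> e" "e \<le> 1" and u: "continuous_on UNIV u" "\<And>x. norm (u x) \<le> M"
  shows "integrable lborel (\<lambda>z. kern e z * u (x - e * z))"
  by (rule kern_exp_integrable[OF e, of 0 _ M]) (use bounded_comp_measurable u in auto)

lemma evo_bound:
  assumes e: "0 \<le> e" "e \<le> 1" and u: "continuous_on UNIV u" "\<And>x. norm (u x) \<le> M"
  shows "norm (evo e u x) \<le> kmass * M"
proof -
  have M0: "M \<ge> 0" using order_trans[OF norm_ge_zero u(2)[of 0]] by simp
  have "norm (evo e u x) \<le> (LINT z|lborel. norm (kern e z * u (x - e * z)))"
    unfolding evo_def by (rule integral_norm_bound)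
  also have "\<dots> \<le> (LINT z|lborel. (kbd 1 * M) * exp (- \<bar>z\<bar>))"
  proof (intro integral_mono integrable_norm evo_integrable[OF e u] integrable_mult_right integrable_exp_abs)
    fix z
    have "norm (kern e z * u (x - e * z)) \<le> (kbd 1 * exp (- (1 * \<bar>z\<bar>))) * M"
      unfolding norm_mult by (intro mult_mono kern_bound e u) (use kbd_nonneg in auto)
    then show "norm (kern e z * u (x - e * z)) \<le> (kbd 1 * M) * exp (- \<bar>z\<bar>)" by (simp add: mult_ac)
  qed
  also have "\<dots> = kmass * M" by (simp add: kmass_def)
  finally show ?thesis .
qed

lemma evo_cont:
  assumes e: "0 \<le> e" "e \<le> 1" and u: "continuous_on UNIV u" "\<And>x. norm (u x) \<le> M"
  shows "continuous_on A (evo e u)"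
proof -
  have M0: "M \<ge> 0" using order_trans[OF norm_ge_zero u(2)[of 0]] by simp
  have "isCont (evo e u) z" for z
    unfolding continuous_within_sequentially
  proof (intro allI impI)
    fix x :: "nat \<Rightarrow> real" assume x: "(\<forall>n. x n \<in> UNIV) \<and> x \<longlonglongrightarrow> z"
    show "(evo e u \<circ> x) \<longlonglongrightarrow> evo e u z"
      unfolding evo_def o_def
    proof (rule integral_dominated_convergence)
      show "integrable lborel (\<lambda>z. norm (kern e z * of_real M))"
        by (intro integrable_norm kern_exp_integrable[OF e, of 0 _ M]) (use M0 in auto)
      show "(\<lambda>y. kern e y * u (w - e * y)) \<in> borel_measurable lborel" for w
        by (rule borel_measurable_integrable, rule evo_integrable[OF e u])
      then show "(\<lambda>y. kern e y * u (x n - e * y)) \<in> borel_measurable lborel" for n .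
      show "AE y in lborel. norm (kern e y * u (x n - e * y)) \<le> norm (kern e y * complex_of_real M)" for n
        using u(2) M0 by (auto simp: norm_mult intro!: mult_left_mono)
      have c: "isCont u w" for w using u(1) by (simp add: continuous_on_eq_continuous_at)
      have "(\<lambda>n. u (x n - e * y)) \<longlonglongrightarrow> u (z - e * y)" for y
        by (rule isCont_tendsto_compose[OF c]) (intro tendsto_intros, use x in auto)
      then show "AE y in lborel. (\<lambda>n. kern e y * u (x n - e * y)) \<longlonglongrightarrow> kern e y * u (z - e * y)"
        by (intro AE_I2 tendsto_intros)
    qed
  qed
  then have "continuous_on UNIV (evo e u)" by (simp add: continuous_on_eq_continuous_at)
  then show ?thesis using continuous_on_subset by blast
qed

definition decay :: "real \<Rightarrow> int \<Rightarrow> complex" where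
  "decay d k = of_real (exp (- (d * (real_of_int k ^ 4 - (real_of_int k)\<^sup>2))))"

lemma int_power_4_ge: "(real_of_int k)\<^sup>2 \<le> real_of_int k ^ 4"
proof -
  have "k = 0 \<or> 1 \<le> k\<^sup>2" using zero_less_power2[of k] by linarith
  then have "k\<^sup>2 * 1 \<le> k\<^sup>2 * k\<^sup>2" by (elim disjE) (simp, intro mult_left_mono, auto)
  then have "k\<^sup>2 \<le> k ^ 4" by (simp add: power4_eq_xxxx power2_eq_square mult.assoc)
  then show ?thesis by (metis of_int_le_iff of_int_power)
qed

lemma norm_decay_le: "d \<ge> 0 \<Longrightarrow> norm (decay d k) \<le> 1"
  using int_power_4_ge[of k] by (simp add: decay_def)

lemma evo_cis:
  assumes e: "0 \<le> e" "e \<le> 1"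
  shows "evo e (\<lambda>x. c * cis (of_int k * x)) = (\<lambda>x. (decay (e^4) k * c) * cis (of_int k * x))"
proof
  fix x
  have "evo e (\<lambda>x. c * cis (of_int k * x)) x = (LINT z|lborel. (kern e z * (of_real (exp (0 * z)) * cis (- ((e * of_int k) * z)))) * (c * cis (of_int k * x)))"
    unfolding evo_def by (intro Bochner_Integration.integral_cong refl) (simp add: algebra_simps cis_mult)
  also have "\<dots> = kern_symbol e (Complex (e * of_int k) 0) * (c * cis (of_int k * x))"
    by (simp only: integral_mult_left_zero kern_fourier[OF e])
  also have "kern_symbol e (Complex (e * of_int k) 0) = decay (e^4) k"
    unfolding complex_of_real_def[symmetric] kern_symbol_real decay_def
    by (simp add: power_mult_distrib algebra_simps power4_eq_xxxx power2_eq_square)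
  finally show "evo e (\<lambda>x. c * cis (of_int k * x)) x = (decay (e^4) k * c) * cis (of_int k * x)" by simp
qed

lemma tpoly_bounded: "tpoly f \<Longrightarrow> \<exists>M. \<forall>x. norm (f x) \<le> M"
proof (induction rule: tpoly.induct)
  case (mono c k) show ?case by (auto simp: norm_mult)
next
  case (add f g)
  then obtain M N where "\<And>x. norm (f x) \<le> M" "\<And>x. norm (g x) \<le> N" by blast
  then show ?case using norm_triangle_mono by blast
qed

lemma evo_diff:
  assumes e: "0 \<le> e" "e \<le> 1" and u: "continuous_on UNIV u" "\<And>x. norm (u x) \<le> M"
     and v: "continuous_on UNIV v" "\<And>x. norm (v x) \<le> N"
  shows "evo e (\<lambda>x. u x - v x) x = evo e u x - evo e v x"
  unfolding evo_def right_diff_distrib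
  by (rule Bochner_Integration.integral_diff[OF evo_integrable[OF e u] evo_integrable[OF e v]])

lemma evo_add:
  assumes e: "0 \<le> e" "e \<le> 1" and u: "continuous_on UNIV u" "\<And>x. norm (u x) \<le> M"
     and v: "continuous_on UNIV v" "\<And>x. norm (v x) \<le> N"
  shows "evo e (\<lambda>x. u x + v x) x = evo e u x + evo e v x"
  unfolding evo_def distrib_left
  by (rule Bochner_Integration.integral_add[OF evo_integrable[OF e u] evo_integrable[OF e v]])

lemma evo_coeff_tpoly:
  assumes e: "0 \<le> e" "e \<le> 1" and "tpoly g"
  shows "fcc (evo e g) j = decay (e^4) j * fcc g j"
  using assms(3)
proof induction
  case (mono c k) show ?case unfolding evo_cis[OF e] fcc_cis by simp
next
  case (add f g)
  obtain M N where b: "\<And>x. norm (f x) \<le> M" "\<And>x. norm (g x) \<le> N" using tpoly_bounded add(1,2) by meson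
  note c = tpoly_cont[OF add(1)] tpoly_cont[OF add(2)]
  have "evo e (\<lambda>x. f x + g x) = (\<lambda>x. evo e f x + evo e g x)"
    using evo_add[OF e c(1) b(1) c(2) b(2)] by blast
  then show ?case
    using add(3,4) fcc_add[OF evo_cont[OF e c(1) b(1)] evo_cont[OF e c(2) b(2)]] fcc_add[OF c] by (simp add: distrib_left)
qed

lemma kmass_nonneg: "kmass \<ge> 0"
  unfolding kmass_def by (intro mult_nonneg_nonneg kbd_nonneg integral_nonneg_AE) auto

text \<open>Since the kernel is integrable and has the right action on exponentials, convolution with
  it is the Fourier multiplier on every continuous periodic function.\<close>

lemma evo_coeff:
  assumes e: "0 \<le> e" "e \<le> 1" and u: "u \<in> per"
  shows "fcc (evo e (\<lambda>x. of_real (u x))) j = decay (e^4) j * fcc (\<lambda>x. of_real (u x)) j"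
proof -
  let ?U = "\<lambda>x. complex_of_real (u x)"
  obtain B where B: "\<And>x. norm (?U x) \<le> B" using per_bounded[OF u] by (metis norm_of_real)
  have cU: "continuous_on A ?U" for A by (rule per_cont_of_real[OF u])
  have "norm (fcc (evo e ?U) j - decay (e^4) j * fcc ?U j) \<le> \<epsilon>" if \<epsilon>: "\<epsilon> > 0" for \<epsilon>
  proof -
    define d where "d = \<epsilon> / (kmass + 1)"
    have d: "d > 0" using \<epsilon> kmass_nonneg by (simp add: d_def)
    obtain g where g: "tpoly (\<lambda>x. of_real (g x))" "\<And>x. \<bar>u x - g x\<bar> < d" using tpoly_dense[OF u d] by blast
    let ?G = "\<lambda>x. complex_of_real (g x)"
    have cG: "continuous_on A ?G" for A by (rule tpoly_cont[OF g(1)])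
    obtain N where N: "\<And>x. norm (?G x) \<le> N" using tpoly_bounded[OF g(1)] by blast
    have dd: "norm (?U x - ?G x) \<le> d" for x using g(2)[of x] by (metis less_imp_le norm_of_real of_real_diff real_norm_def)
    have cD: "continuous_on A (\<lambda>x. ?U x - ?G x)" for A by (intro continuous_intros cU cG)
    have 1: "norm (fcc (evo e (\<lambda>x. ?U x - ?G x)) j) \<le> kmass * d"
      by (intro fcc_bound evo_bound[OF e cD dd] evo_cont[OF e cD dd])
    have 2: "norm (fcc (\<lambda>x. ?U x - ?G x) j) \<le> d" by (intro fcc_bound cD dd)
    have e1: "fcc (evo e (\<lambda>x. ?U x - ?G x)) j = fcc (evo e ?U) j - decay (e^4) j * fcc ?G j"
    proof -
      have "evo e (\<lambda>x. ?U x - ?G x) = (\<lambda>x. evo e ?U x - evo e ?G x)" using evo_diff[OF e cU B cG N] by blast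
      then show ?thesis
        using fcc_diff[OF evo_cont[OF e cU B] evo_cont[OF e cG N]] evo_coeff_tpoly[OF e g(1)] by simp
    qed
    have e2: "fcc (\<lambda>x. ?U x - ?G x) j = fcc ?U j - fcc ?G j" by (rule fcc_diff[OF cU cG])
    have "fcc (evo e ?U) j - decay (e^4) j * fcc ?U j = fcc (evo e (\<lambda>x. ?U x - ?G x)) j - decay (e^4) j * fcc (\<lambda>x. ?U x - ?G x) j"
      unfolding e1 e2 by (simp add: algebra_simps)
    also have "norm \<dots> \<le> kmass * d + 1 * d"
      by (rule order_trans[OF norm_triangle_ineq4], unfold norm_mult, intro add_mono mult_mono 1 2 norm_decay_le) (use e in auto)
    also have "\<dots> = (kmass + 1) * d" by (simp add: algebra_simps)
    also have "\<dots> = \<epsilon>" using kmass_nonneg by (simp add: d_def)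
    finally show ?thesis .
  qed
  then show ?thesis using field_le_epsilon[of "norm (fcc (evo e ?U) j - decay (e^4) j * fcc ?U j)" 0] by auto
qed

lemma L2_dominated_null:
  fixes G :: "nat \<Rightarrow> real \<Rightarrow> real"
  assumes G: "\<And>n. G n \<in> per" "\<And>n x. \<bar>G n x\<bar> \<le> B" "\<And>x. (\<lambda>n. G n x) \<longlonglongrightarrow> 0" and \<epsilon>: "\<epsilon> > 0"
  shows "\<exists>N. \<forall>n\<ge>N. hs 0 (\<lambda>k. cmod (fourier_coeff (G n) k)) \<epsilon>"
proof -
  have B0: "B \<ge> 0" using order_trans[OF abs_ge_zero G(2)] .
  have c: "continuous_on A (\<lambda>x. complex_of_real (G n x))" for A n by (rule per_cont_of_real[OF G(1)])
  have "(\<lambda>n. integral {0..2*pi} (\<lambda>x. (norm (complex_of_real (G n x)))\<^sup>2)) \<longlonglongrightarrow> integral {0..2*pi} (\<lambda>x. 0)"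
  proof (rule dominated_convergence(2))
    show "(\<lambda>x. (norm (complex_of_real (G n x)))\<^sup>2) integrable_on {0..2*pi}" for n
      by (intro integrable_continuous_real continuous_intros c)
    show "(\<lambda>x. B\<^sup>2) integrable_on {0..2*pi}" by (intro integrable_continuous_real continuous_intros)
    show "norm ((norm (complex_of_real (G n x)))\<^sup>2) \<le> B\<^sup>2" for n x
      using power_mono[OF G(2)[of n x], of 2] by simp
    have "(\<lambda>n. (G n x)\<^sup>2) \<longlonglongrightarrow> 0\<^sup>2" for x by (intro tendsto_intros G)
    then show "(\<lambda>n. (norm (complex_of_real (G n x)))\<^sup>2) \<longlonglongrightarrow> 0" for x by simp
  qed
  then have "(\<lambda>n. sqrt (integral {0..2*pi} (\<lambda>x. (norm (complex_of_real (G n x)))\<^sup>2) / (2*pi))) \<longlonglongrightarrow> sqrt (0 / (2*pi))"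
    by (intro tendsto_intros) auto
  then have "\<forall>\<^sub>F n in sequentially. sqrt (integral {0..2*pi} (\<lambda>x. (norm (complex_of_real (G n x)))\<^sup>2) / (2*pi)) < \<epsilon>"
    using \<epsilon> by (auto dest: order_tendstoD(2))
  then obtain N where N: "\<And>n. n \<ge> N \<Longrightarrow> sqrt (integral {0..2*pi} (\<lambda>x. (norm (complex_of_real (G n x)))\<^sup>2) / (2*pi)) < \<epsilon>"
    by (auto simp: eventually_sequentially)
  show ?thesis
  proof (intro exI allI impI)
    fix n assume "n \<ge> N"
    then show "hs 0 (\<lambda>k. cmod (fourier_coeff (G n) k)) \<epsilon>"
      using bessel_integral[OF c] N[of n] unfolding hs_def
      by (auto simp: fourier_coeff_eq[OF G(1)] intro: order_trans[OF bessel_integral[OF c] less_imp_le])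
  qed
qed

text \<open>Pointwise, the conjugated evolution is
  \<open>\<integral> K\<^sub>e(z) exp ((\<phi>(x - e z) - \<phi>(x)) / e) f(x - e z) dz\<close> with \<open>e = 1/(n+1)\<close>.  The exponent tends to
  \<open>- b(x) z\<close>, so the limit involves the transform of the kernel at the imaginary frequency \<open>- \<i> b(x)\<close>, whose
  fourth power is again positive: the result is \<open>exp (- b(x)\<^sup>4) f(x)\<close>.  The Lipschitz bound of \<open>\<phi>\<close> against the decay of the kernel justifies the limit, uniformly
  bounded in \<open>x\<close>, and dominated convergence on a period turns it into a limit in \<open>L\<^sup>2\<close>.\<close>

lemma conjugated_evolution_limit:
  assumes f: "f \<in> per" and \<phi>: "\<phi> \<in> per" and b: "b \<in> per"
    and d\<phi>: "\<And>x. (\<phi> has_real_derivative b x) (at x)" and \<epsilon>: "\<epsilon> > 0"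
  shows "\<exists>N. \<forall>n\<ge>N. \<exists>E\<in>per. (\<forall>k. fourier_coeff E k = decay ((1 / real (Suc n))^4) k * fourier_coeff (\<lambda>x. exp (real (Suc n) * \<phi> x) * f x) k)
     \<and> hs 0 (\<lambda>k. cmod (fourier_coeff (\<lambda>x. exp (- real (Suc n) * \<phi> x) * E x - exp (- (b x ^ 4)) * f x) k)) \<epsilon>"
proof -
  define e where "e n = 1 / real (Suc n)" for n
  have e: "0 \<le> e n" "e n \<le> 1" "e n > 0" for n by (auto simp: e_def)
  have e1: "1 / e n = real (Suc n)" for n by (simp add: e_def)
  have e0: "e \<longlonglongrightarrow> 0" unfolding e_def by real_asymp
  obtain Mf where Mf: "Mf > 0" "\<And>x. \<bar>f x\<bar> \<le> Mf" using per_bounded[OF f] by blast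
  obtain B where B: "B > 0" "\<And>x. \<bar>b x\<bar> \<le> B" using per_bounded[OF b] by blast
  have lip: "\<bar>\<phi> y - \<phi> x\<bar> \<le> B * \<bar>y - x\<bar>" for x y
    using field_differentiable_bound[of UNIV \<phi> b B y x] d\<phi> B by auto
  define u where "u n x = exp (real (Suc n) * \<phi> x) * f x" for n x
  have u: "u n \<in> per" for n unfolding u_def by (intro per_mult per_exp per_const f \<phi>)
  let ?U = "\<lambda>n x. complex_of_real (u n x)"
  define E where "E n x = Re (evo (e n) (?U n) x)" for n x
  have bu: "\<exists>M. \<forall>x. norm (?U n x) \<le> M" for n using per_bounded[OF u[of n]] by (metis norm_of_real)
  have cu: "continuous_on A (?U n)" for A n by (rule per_cont_of_real[OF u])
  have ereal: "evo (e n) (?U n) x = of_real (E n x)" for n x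
  proof -
    have "evo (e n) (?U n) x = (LINT z|lborel. of_real (Re (kern (e n) z) * u n (x - e n * z)))"
      unfolding evo_def by (intro Bochner_Integration.integral_cong refl) (metis kern_real[OF e(1,2)] of_real_mult)
    then show ?thesis unfolding E_def by (simp only: integral_complex_of_real Re_complex_of_real)
  qed
  have Eper: "E n \<in> per" for n
  proof -
    obtain M where "\<And>x. norm (?U n x) \<le> M" using bu by blast
    then have "continuous_on UNIV (evo (e n) (?U n))" by (rule evo_cont[OF e(1,2) cu])
    moreover have "evo (e n) (?U n) (x + 2*pi) = evo (e n) (?U n) x" for x
      unfolding evo_def using per_add[OF u[of n], of "x - e n * z" for z] by (simp add: algebra_simps)
    ultimately show ?thesis unfolding E_def per_def by (auto intro!: continuous_intros)
  qed
  have Ec: "fourier_coeff (E n) k = decay ((e n)^4) k * fourier_coeff (u n) k" for n k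
  proof -
    have "evo (e n) (?U n) = (\<lambda>x. of_real (E n x))" using ereal by blast
    then show ?thesis using evo_coeff[OF e(1,2) u, of n n k] fourier_coeff_eq[OF Eper] fourier_coeff_eq[OF u] by simp
  qed
  define G where "G n x = exp (- real (Suc n) * \<phi> x) * E n x - exp (- (b x ^ 4)) * f x" for n x
  have Gper: "G n \<in> per" for n unfolding G_def
  proof (intro per_diff per_mult per_exp per_const f \<phi> Eper)
    have "(\<lambda>x. (-1) * b x ^ 4) \<in> per" by (intro per_mult per_const per_power b)
    then show "(\<lambda>x. - (b x ^ 4)) \<in> per" by simp
  qed
  define r where "r n x z = complex_of_real (exp (real (Suc n) * (\<phi> (x - e n * z) - \<phi> x)) * f (x - e n * z))" for n x z
  have rb: "norm (r n x z) \<le> Mf * exp (B * \<bar>z\<bar>)" for n x z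
  proof -
    have "real (Suc n) * (\<phi> (x - e n * z) - \<phi> x) \<le> real (Suc n) * (B * \<bar>e n * z\<bar>)"
      using lip[of "x - e n * z" x] by (intro mult_left_mono) auto
    also have "\<dots> = B * \<bar>z\<bar>" by (simp add: e_def abs_mult)
    finally have "exp (real (Suc n) * (\<phi> (x - e n * z) - \<phi> x)) * \<bar>f (x - e n * z)\<bar> \<le> exp (B * \<bar>z\<bar>) * Mf"
      by (intro mult_mono Mf) auto
    then show ?thesis unfolding r_def by (simp add: norm_mult abs_mult mult_ac del: of_nat_Suc)
  qed
  have rm: "r n x \<in> borel_measurable borel" for n x
    unfolding r_def
    by (intro borel_measurable_continuous_onI continuous_intros continuous_on_compose2[OF per_cont[OF f, of UNIV]] continuous_on_compose2[OF per_cont[OF \<phi>, of UNIV]]) auto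
  have Gr: "of_real (exp (- real (Suc n) * \<phi> x) * E n x) = (LINT z|lborel. kern (e n) z * r n x z)" for n x
  proof -
    have "of_real (exp (- real (Suc n) * \<phi> x) * E n x) = of_real (exp (- real (Suc n) * \<phi> x)) * (LINT z|lborel. kern (e n) z * ?U n (x - e n * z))"
      using ereal[of n x] by (simp add: evo_def)
    also have "\<dots> = (LINT z|lborel. of_real (exp (- real (Suc n) * \<phi> x)) * (kern (e n) z * ?U n (x - e n * z)))"
      by (rule integral_mult_right_zero[symmetric])
    also have "\<dots> = (LINT z|lborel. kern (e n) z * r n x z)"
    proof (intro Bochner_Integration.integral_cong refl)
      fix z
      have "exp (real (Suc n) * (\<phi> (x - e n * z) - \<phi> x)) = exp (- real (Suc n) * \<phi> x) * exp (real (Suc n) * \<phi> (x - e n * z))"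
        by (simp add: exp_add[symmetric] algebra_simps del: of_nat_Suc)
      then show "of_real (exp (- real (Suc n) * \<phi> x)) * (kern (e n) z * ?U n (x - e n * z)) = kern (e n) z * r n x z"
        unfolding r_def u_def by (simp add: mult_ac del: of_nat_Suc)
    qed
    finally show ?thesis .
  qed
  have Gbd: "\<bar>G n x\<bar> \<le> kbd (B+1) * Mf * (LINT z|lborel. exp (- \<bar>z::real\<bar>)) + Mf" for n x
  proof -
    have "norm (LINT z|lborel. kern (e n) z * r n x z) \<le> (LINT z|lborel. norm (kern (e n) z * r n x z))" by (rule integral_norm_bound)
    also have "\<dots> \<le> (LINT z|lborel. (kbd (B+1) * Mf) * exp (- \<bar>z\<bar>))"
    proof (intro integral_mono integrable_norm integrable_mult_right integrable_exp_abs)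
      show "integrable lborel (\<lambda>z. kern (e n) z * r n x z)" by (rule kern_exp_integrable[OF e(1,2) _ rm rb]) (use B in auto)
      fix z
      have "norm (kern (e n) z * r n x z) \<le> (kbd (B+1) * exp (- ((B+1) * \<bar>z\<bar>))) * (Mf * exp (B * \<bar>z\<bar>))"
        unfolding norm_mult by (intro mult_mono kern_bound e rb) (use B kbd_nonneg in auto)
      also have "\<dots> = kbd (B+1) * Mf * (exp (- ((B+1) * \<bar>z\<bar>)) * exp (B * \<bar>z\<bar>))" by simp
      also have "exp (- ((B+1) * \<bar>z\<bar>)) * exp (B * \<bar>z\<bar>) = exp (- \<bar>z\<bar>)" by (simp add: exp_add[symmetric] algebra_simps)
      finally show "norm (kern (e n) z * r n x z) \<le> (kbd (B+1) * Mf) * exp (- \<bar>z\<bar>)" .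
    qed
    finally have "norm (complex_of_real (exp (- real (Suc n) * \<phi> x) * E n x)) \<le> kbd (B+1) * Mf * (LINT z|lborel. exp (- \<bar>z\<bar>))"
      unfolding Gr by simp
    then have 1: "\<bar>exp (- real (Suc n) * \<phi> x) * E n x\<bar> \<le> kbd (B+1) * Mf * (LINT z|lborel. exp (- \<bar>z\<bar>))" by (simp only: norm_of_real)
    have "exp (- (b x ^ 4)) * \<bar>f x\<bar> \<le> 1 * Mf" by (intro mult_mono Mf) auto
    then have 2: "\<bar>exp (- (b x ^ 4)) * f x\<bar> \<le> Mf" by (simp add: abs_mult)
    show ?thesis unfolding G_def using 1 2 abs_triangle_ineq4[of "exp (- real (Suc n) * \<phi> x) * E n x" "exp (- (b x ^ 4)) * f x"] by linarith
  qed
  have Glim: "(\<lambda>n. G n x) \<longlonglongrightarrow> 0" for x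
  proof -
    \<comment> \<open>the limit of the integrand: an exponential, integrated by the transform of the kernel\<close>
    define l where "l z = of_real (exp (- (b x) * z)) * cis (- (0 * z)) * of_real (f x)" for z
    have lm: "l \<in> borel_measurable borel" unfolding l_def by (intro borel_measurable_continuous_onI continuous_intros)
    have lb: "norm (l z) \<le> Mf * exp (B * \<bar>z\<bar>)" for z
    proof -
      have "- (b x) * z \<le> B * \<bar>z\<bar>" using mult_right_mono[OF B(2)[of x], of "\<bar>z\<bar>"] by (simp add: abs_mult[symmetric])
      then have "exp (- (b x) * z) * \<bar>f x\<bar> \<le> exp (B * \<bar>z\<bar>) * Mf" by (intro mult_mono Mf) auto
      then show ?thesis by (simp add: l_def norm_mult mult_ac)
    qed
    have lint: "(LINT z|lborel. kern (e n) z * l z) = of_real (exp (- (b x ^ 4) - (e n)\<^sup>2 * (b x)\<^sup>2) * f x)" for n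
    proof -
      have "(LINT z|lborel. kern (e n) z * l z) = (LINT z|lborel. kern (e n) z * (of_real (exp (- (b x) * z)) * cis (- (0 * z))) * of_real (f x))"
        unfolding l_def by (intro Bochner_Integration.integral_cong refl) (simp only: mult.assoc)
      also have "\<dots> = kern_symbol (e n) (Complex 0 (- (b x))) * of_real (f x)"
        by (simp only: integral_mult_left_zero kern_fourier[OF e(1,2)])
      also have "Complex 0 (- (b x)) = \<i> * of_real (- (b x))" by (simp add: complex_eq_iff)
      also have "kern_symbol (e n) (\<i> * of_real (- (b x))) = of_real (exp (- (b x ^ 4) - (e n)\<^sup>2 * (b x)\<^sup>2))"
        by (simp add: kern_symbol_def power_mult_distrib exp_of_real[symmetric])
      finally show ?thesis by simp
    qed
    have "(\<lambda>n. LINT z|lborel. kern (e n) z * (r n x z - l z)) \<longlonglongrightarrow> (LINT z::real|lborel. 0 :: complex)"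
    proof (rule integral_dominated_convergence)
      show "integrable lborel (\<lambda>z. (kbd (B+1) * (2 * Mf)) * exp (- \<bar>z\<bar>))" by (intro integrable_mult_right integrable_exp_abs)
      have nd: "norm (r n x z - l z) \<le> (2 * Mf) * exp (B * \<bar>z\<bar>)" for n z
        using norm_triangle_ineq4[of "r n x z" "l z"] rb[of n x z] lb[of z] by (simp add: algebra_simps)
      show "(\<lambda>z. kern (e n) z * (r n x z - l z)) \<in> borel_measurable lborel" for n
        by (rule borel_measurable_integrable, rule kern_exp_integrable[OF e(1,2), of B _ "2 * Mf"]) (use B rm lm nd in auto)
      show "AE z in lborel. norm (kern (e n) z * (r n x z - l z)) \<le> (kbd (B+1) * (2 * Mf)) * exp (- \<bar>z\<bar>)" for n
      proof (rule AE_I2)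
        fix z
        have "norm (kern (e n) z * (r n x z - l z)) \<le> (kbd (B+1) * exp (- ((B+1) * \<bar>z\<bar>))) * ((2 * Mf) * exp (B * \<bar>z\<bar>))"
          unfolding norm_mult by (intro mult_mono kern_bound e nd) (use B kbd_nonneg in auto)
        also have "\<dots> = kbd (B+1) * (2 * Mf) * (exp (- ((B+1) * \<bar>z\<bar>)) * exp (B * \<bar>z\<bar>))" by simp
        also have "exp (- ((B+1) * \<bar>z\<bar>)) * exp (B * \<bar>z\<bar>) = exp (- \<bar>z\<bar>)" by (simp add: exp_add[symmetric] algebra_simps)
        finally show "norm (kern (e n) z * (r n x z - l z)) \<le> (kbd (B+1) * (2 * Mf)) * exp (- \<bar>z\<bar>)" .
      qed
      show "AE z in lborel. (\<lambda>n. kern (e n) z * (r n x z - l z)) \<longlonglongrightarrow> 0"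
      proof (rule AE_I2)
        fix z
        have "(\<lambda>n. real (Suc n) * (\<phi> (x - e n * z) - \<phi> x)) \<longlonglongrightarrow> - (b x) * z"
        proof (cases "z = 0")
          case False
          have *: "(\<lambda>n. (\<phi> (x + (- e n * z)) - \<phi> x) / (- e n * z)) \<longlonglongrightarrow> b x"
          proof (rule filterlim_compose[OF DERIV_def[THEN iffD1, OF d\<phi>[of x]]])
            show "filterlim (\<lambda>n. - e n * z) (at 0) sequentially"
            proof -
              have "e n \<noteq> 0" for n using e(3)[of n] by simp
              then show ?thesis
                unfolding filterlim_at using tendsto_mult[OF tendsto_minus[OF e0] tendsto_const[of z]] False by auto
            qed
          qed
          have "real (Suc n) * (\<phi> (x - e n * z) - \<phi> x) = (\<phi> (x + (- e n * z)) - \<phi> x) / (- e n * z) * (- z)" for n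
            using False by (simp add: e_def field_simps del: of_nat_Suc)
          then show ?thesis using tendsto_mult[OF * tendsto_const[of "-z"]] by simp
        qed simp
        moreover have "(\<lambda>n. f (x - e n * z)) \<longlonglongrightarrow> f x"
        proof (rule isCont_tendsto_compose[where g=f and l=x])
          show "isCont f x" using per_cont[OF f, of UNIV] by (simp add: continuous_on_eq_continuous_at)
          have "(\<lambda>n. x - e n * z) \<longlonglongrightarrow> x - 0 * z" by (intro tendsto_intros e0)
          then show "(\<lambda>n. x - e n * z) \<longlonglongrightarrow> x" by simp
        qed
        ultimately have "(\<lambda>n. r n x z) \<longlonglongrightarrow> of_real (exp (- (b x) * z) * f x)"
          unfolding r_def by (intro tendsto_of_real tendsto_mult[of "\<lambda>n. exp (real (Suc n) * (\<phi> (x - e n * z) - \<phi> x))"] tendsto_exp)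
        then have "(\<lambda>n. r n x z - l z) \<longlonglongrightarrow> of_real (exp (- (b x) * z) * f x) - l z" by (intro tendsto_intros)
        then have rl: "(\<lambda>n. r n x z - l z) \<longlonglongrightarrow> 0" by (simp add: l_def)
        show "(\<lambda>n. kern (e n) z * (r n x z - l z)) \<longlonglongrightarrow> 0"
        proof (rule Lim_null_comparison)
          show "\<forall>\<^sub>F n in sequentially. norm (kern (e n) z * (r n x z - l z)) \<le> kbd 0 * norm (r n x z - l z)"
            using kern_bound[OF e(1,2), of 0] by (intro always_eventually allI) (simp add: norm_mult mult_right_mono)
          show "(\<lambda>n. kbd 0 * norm (r n x z - l z)) \<longlonglongrightarrow> 0" using tendsto_mult[OF tendsto_const tendsto_norm[OF rl], of "kbd 0"] by simp
        qed
      qed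
    qed simp
    moreover have "(LINT z|lborel. kern (e n) z * (r n x z - l z)) = of_real (exp (- real (Suc n) * \<phi> x) * E n x - exp (- (b x ^ 4) - (e n)\<^sup>2 * (b x)\<^sup>2) * f x)" for n
      unfolding right_diff_distrib
      by (subst Bochner_Integration.integral_diff[OF kern_exp_integrable[OF e(1,2) _ rm rb] kern_exp_integrable[OF e(1,2) _ lm lb]])
         (use B in \<open>auto simp: Gr[symmetric] lint simp del: of_nat_Suc\<close>)
    ultimately have "(\<lambda>n. complex_of_real (exp (- real (Suc n) * \<phi> x) * E n x - exp (- (b x ^ 4) - (e n)\<^sup>2 * (b x)\<^sup>2) * f x)) \<longlonglongrightarrow> of_real 0" by simp
    then have l1: "(\<lambda>n. exp (- real (Suc n) * \<phi> x) * E n x - exp (- (b x ^ 4) - (e n)\<^sup>2 * (b x)\<^sup>2) * f x) \<longlonglongrightarrow> 0"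
      by (simp only: tendsto_of_real_iff)
    have "(\<lambda>n. exp (- (b x ^ 4) - (e n)\<^sup>2 * (b x)\<^sup>2) * f x - exp (- (b x ^ 4)) * f x) \<longlonglongrightarrow> exp (- (b x ^ 4) - 0\<^sup>2 * (b x)\<^sup>2) * f x - exp (- (b x ^ 4)) * f x"
      by (intro tendsto_intros e0)
    from tendsto_add[OF l1 this] show ?thesis unfolding G_def by simp
  qed
  obtain N where N: "\<And>n. n \<ge> N \<Longrightarrow> hs 0 (\<lambda>k. cmod (fourier_coeff (G n) k)) \<epsilon>"
    using L2_dominated_null[OF Gper Gbd Glim \<epsilon>] by blast
  show ?thesis
  proof (intro exI[of _ N] allI impI)
    fix n assume "n \<ge> N"
    then show "\<exists>E\<in>per. (\<forall>k. fourier_coeff E k = decay ((1 / real (Suc n))^4) k * fourier_coeff (\<lambda>x. exp (real (Suc n) * \<phi> x) * f x) k)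
     \<and> hs 0 (\<lambda>k. cmod (fourier_coeff (\<lambda>x. exp (- real (Suc n) * \<phi> x) * E x - exp (- (b x ^ 4)) * f x) k)) \<epsilon>"
      using Eper[of n] Ec[of n] N[of n] unfolding G_def u_def e_def by (intro bexI[of _ "E n"]) auto
  qed
qed

section \<open>Steering the linear equation\<close>

text \<open>Bounded and continuous off a finite set: all controls that are constructed are of this kind.\<close>

definition pcont :: "real \<Rightarrow> (real \<Rightarrow> 'a::real_normed_vector) \<Rightarrow> bool" where
  "pcont \<tau> g \<longleftrightarrow> (\<exists>B. \<forall>t\<in>{0..\<tau>}. norm (g t) \<le> B) \<and> (\<exists>S. finite S \<and> (\<forall>t\<in>{0<..<\<tau>} - S. isCont g t))"

text \<open>The symbol of \<open>\<partial>\<^sub>x\<^sup>4 + \<partial>\<^sub>x\<^sup>2\<close>; on the integers it is nonnegative, which keeps every free mode bounded.\<close>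

definition dsp :: "int \<Rightarrow> real" where
  "dsp k = real_of_int k ^ 4 - (real_of_int k)\<^sup>2"

lemma dsp_nonneg [simp]: "dsp k \<ge> 0"
  using int_power_4_ge[of k] by (simp add: dsp_def)

lemma dsp_minus [simp]: "dsp (- k) = dsp k"
  by (simp add: dsp_def)

lemma decay_dsp: "decay d k = of_real (exp (- (d * dsp k)))"
  by (simp add: decay_def dsp_def)

lemma duhamel:
  fixes y g :: "real \<Rightarrow> complex"
  assumes "continuous_on {0..\<tau>} y" "finite S"
    and "\<And>t. t \<in> {0<..<\<tau>} - S \<Longrightarrow> (y has_vector_derivative (- of_real \<alpha> * y t + g t)) (at t)"
    and t: "t \<in> {0..\<tau>}"
  shows "((\<lambda>r. of_real (exp (- (\<alpha> * (t - r)))) * g r) has_integral (y t - of_real (exp (- (\<alpha> * t))) * y 0)) {0..t}"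
proof -
  let ?E = "\<lambda>r. complex_of_real (exp (- (\<alpha> * (t - r))))"
  have "((\<lambda>r. ?E r * g r) has_integral (?E t * y t - ?E 0 * y 0)) {0..t}"
  proof (rule fundamental_theorem_of_calculus_interior_strong[OF assms(2)])
    fix r assume r: "r \<in> {0<..<t} - S"
    have "((\<lambda>r. exp (- (\<alpha> * (t - r)))) has_real_derivative \<alpha> * exp (- (\<alpha> * (t - r)))) (at r)"
      by (auto intro!: derivative_eq_intros)
    then have "((\<lambda>r. ?E r) has_vector_derivative of_real (\<alpha> * exp (- (\<alpha> * (t - r))))) (at r)"
      by (intro has_vector_derivative_of_real) (simp add: has_real_derivative_iff_has_vector_derivative)
    then have "((\<lambda>r. ?E r * y r) has_vector_derivative ?E r * (- of_real \<alpha> * y r + g r) + of_real (\<alpha> * exp (- (\<alpha> * (t - r)))) * y r) (at r)"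
      using assms(3)[of r] r t by (intro has_vector_derivative_mult) auto
    then show "((\<lambda>r. ?E r * y r) has_vector_derivative ?E r * g r) (at r)"
      by (simp add: algebra_simps)
  next
    show "continuous_on {0..t} (\<lambda>r. ?E r * y r)"
      using t by (intro continuous_intros continuous_on_subset[OF assms(1)]) auto
  qed (use t in auto)
  then show ?thesis by simp
qed

lemma duhamel_bound:
  fixes y g :: "real \<Rightarrow> complex"
  assumes "continuous_on {0..\<tau>} y" "finite S"
    and "\<And>t. t \<in> {0<..<\<tau>} - S \<Longrightarrow> (y has_vector_derivative (- of_real \<alpha> * y t + g t)) (at t)"
    and t: "t \<in> {0..\<tau>}" and b: "\<And>r. r \<in> {0<..<t} - S \<Longrightarrow> exp (- (\<alpha> * (t - r))) * norm (g r) \<le> b r"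
    and I: "(b has_integral I) {0..t}"
  shows "norm (y t - of_real (exp (- (\<alpha> * t))) * y 0) \<le> I"
proof -
  let ?S = "S \<union> {0,t}"
  let ?f = "\<lambda>r. of_real (exp (- (\<alpha> * (t - r)))) * g r"
  have 1: "((\<lambda>r. if r \<in> ?S then 0 else ?f r) has_integral (y t - of_real (exp (- (\<alpha> * t))) * y 0)) {0..t}"
    by (rule has_integral_spike_finite[OF _ _ duhamel[OF assms(1-4)], where S="?S"]) (use assms(2) in auto)
  have 2: "((\<lambda>r. if r \<in> ?S then 0 else b r) has_integral I) {0..t}"
    by (rule has_integral_spike_finite[OF _ _ I, where S="?S"]) (use assms(2) in auto)
  have "norm (integral {0..t} (\<lambda>r. if r \<in> ?S then 0 else ?f r)) \<le> integral {0..t} (\<lambda>r. if r \<in> ?S then 0 else b r)"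
  proof (rule integral_norm_bound_integral)
    fix r assume "r \<in> {0..t}"
    then show "norm (if r \<in> ?S then 0 else ?f r) \<le> (if r \<in> ?S then 0 else b r)"
      using b[of r] by (auto simp: norm_mult)
  qed (use 1 2 in \<open>blast+\<close>)
  then show ?thesis using 1 2 by (simp only: integral_unique)
qed

text \<open>Up to the size of the control, this majorizes the action of the potential on a sequence that
  is majorized by \<open>C\<close>; \<open>nbc s\<close> below bounds its norm in the weighted space.\<close>

definition nbs :: "(int \<Rightarrow> real) \<Rightarrow> int \<Rightarrow> real" where
  "nbs C k = C k + (C (k - 1) + C (k + 1))"

definition nbc :: "real \<Rightarrow> real" where "nbc s = 1 + 4 * 4 powr s"

lemma nbc_pos: "nbc s > 0" by (simp add: nbc_def add_pos_nonneg)

lemma hs_nbs: assumes "hs s C B" "s \<ge> 0" shows "hs s (nbs C) (nbc s * B)"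
proof -
  have "hs s (nbs C) (B + (4 powr s * 2 * B + 4 powr s * 2 * B))"
    unfolding nbs_def using hs_shift1[OF assms, of "-1"] hs_shift1[OF assms, of 1] by (intro hs_add assms) auto
  then show ?thesis by (simp add: nbc_def algebra_simps)
qed

lemma nbs_nonneg: "(\<And>k. C k \<ge> 0) \<Longrightarrow> nbs C k \<ge> 0" by (simp add: nbs_def)

lemma hs_le_limit: "(\<And>n::nat. hs s C (b n)) \<Longrightarrow> b \<longlonglongrightarrow> L \<Longrightarrow> hs s C L"
  unfolding hs_def by (meson LIMSEQ_le_const)

lemma exp_has_integral:
  fixes L t c :: real
  assumes "L > 0" "t \<ge> 0" shows "((\<lambda>r. c * exp (L * r)) has_integral c * ((exp (L * t) - 1) / L)) {0..t}"
proof -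
  have "((\<lambda>r. exp (L * r)) has_integral (exp (L * t) / L - exp (L * 0) / L)) {0..t}"
    by (rule fundamental_theorem_of_calculus)
       (use assms in \<open>auto intro!: derivative_eq_intros simp: has_real_derivative_iff_has_vector_derivative[symmetric]\<close>)
  then show ?thesis by (intro has_integral_mult_right) (simp add: diff_divide_distrib)
qed

definition growth :: "real \<Rightarrow> real \<Rightarrow> real" where
  "growth s P = 2 * P * nbc s + 1"

lemma growth_pos: "P \<ge> 0 \<Longrightarrow> growth s P > 0"
  using nbc_pos[of s] by (simp add: growth_def add_nonneg_pos less_imp_le)

text \<open>The potential is absorbed by an exponential time weight: if \<open>|e\<^sub>k(t)| \<le> exp (L t) D\<^sub>k\<close> then Duhamel's
  formula improves \<open>D\<close> to the data plus \<open>P/L\<close> times \<open>nbs D\<close>, a map of factor one half.  Iterating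
  from any majorant, however large, leaves twice the data.\<close>

lemma linear_apriori:
  assumes s: "s \<ge> 0" and P: "P \<ge> 0"
    and cont: "\<And>k. continuous_on {0..\<tau>} (\<lambda>t. e t k)" and S: "finite S"
    and ode: "\<And>t k. t \<in> {0<..<\<tau>} - S \<Longrightarrow> ((\<lambda>t. e t k) has_vector_derivative (- of_real (\<alpha> k) * e t k + (pot (q t) (e t) k + g t k))) (at t)"
    and \<alpha>: "\<And>k. \<alpha> k \<ge> 0"
    and q: "\<And>t i. t \<in> {0<..<\<tau>} - S \<Longrightarrow> \<bar>(q t :: real^3) $ i\<bar> \<le> P"
    and maj: "\<And>t k. t \<in> {0..\<tau>} \<Longrightarrow> norm (e t k) \<le> C0 k" "hs s C0 B"
    and g: "\<And>t k. t \<in> {0<..<\<tau>} - S \<Longrightarrow> norm (g t k) \<le> h k t"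
    and hI: "\<And>t k. t \<in> {0..\<tau>} \<Longrightarrow> \<exists>I\<le>H k. ((\<lambda>r. exp (- (\<alpha> k * (t - r))) * h k r) has_integral I) {0..t}"
    and X: "hs s (\<lambda>k. norm (e 0 k)) X" and Y: "hs s H Y" and t: "t \<in> {0..\<tau>}"
  shows "hs s (\<lambda>k. norm (e t k)) (exp (growth s P * \<tau>) * (2 * (X + Y)))"
proof -
  define L where "L = growth s P"
  have L: "L > 0" unfolding L_def by (rule growth_pos[OF P])
  have C00: "C0 k \<ge> 0" for k using order_trans[OF norm_ge_zero maj(1)[OF t]] .
  have H0: "H k \<ge> 0" for k
  proof -
    have "0 \<in> {0..\<tau>}" using t by auto
    from hI[OF this, of k] obtain I where I: "I \<le> H k" "((\<lambda>r. exp (- (\<alpha> k * (0 - r))) * h k r) has_integral I) {0..0}" by blast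
    then show ?thesis using integral_unique[OF I(2)] by simp
  qed
  define C where "C = rec_nat C0 (\<lambda>_ D k. norm (e 0 k) + H k + (P / L) * nbs D k)"
  have C0: "C 0 = C0" and CS: "\<And>n. C (Suc n) = (\<lambda>k. norm (e 0 k) + H k + (P / L) * nbs (C n) k)" by (auto simp: C_def)
  have main: "(\<forall>k. C n k \<ge> 0) \<and> (\<forall>t\<in>{0..\<tau>}. \<forall>k. norm (e t k) \<le> exp (L * t) * C n k) \<and> hs s (C n) (2 * (X + Y) + B / 2 ^ n)" for n
  proof (induction n)
    case 0
    have XY: "X \<ge> 0" "Y \<ge> 0" using hs_nonneg X Y by auto
    have "norm (e t k) \<le> exp (L * t) * C0 k" if "t \<in> {0..\<tau>}" for t k
    proof -
      have "1 * C0 k \<le> exp (L * t) * C0 k" using that L by (intro mult_right_mono C00) auto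
      then show ?thesis using maj(1)[OF that, of k] by linarith
    qed
    then show ?case using C00 hs_mono[OF maj(2), of C0] XY by (auto simp: C0)
  next
    case (Suc n)
    then have Cn: "C n k \<ge> 0" and bn: "t \<in> {0..\<tau>} \<Longrightarrow> norm (e t k) \<le> exp (L * t) * C n k" for t k by auto
    have "norm (e t k) \<le> exp (L * t) * C (Suc n) k" if t: "t \<in> {0..\<tau>}" for t k
    proof -
      obtain I where I: "I \<le> H k" "((\<lambda>r. exp (- (\<alpha> k * (t - r))) * h k r) has_integral I) {0..t}" using hI[OF t] by blast
      let ?b = "\<lambda>r. exp (- (\<alpha> k * (t - r))) * h k r + (P * nbs (C n) k) * exp (L * r)"
      have "norm (e t k - of_real (exp (- (\<alpha> k * t))) * e 0 k) \<le> I + (P * nbs (C n) k) * ((exp (L * t) - 1) / L)"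
      proof (rule duhamel_bound[OF cont S ode t])
        show "(?b has_integral (I + (P * nbs (C n) k) * ((exp (L * t) - 1) / L))) {0..t}"
          by (intro has_integral_add I exp_has_integral L) (use t in auto)
        fix r assume r: "r \<in> {0<..<t} - S"
        have nbs_eq: "P * nbs (C n) k * exp (L * r) = 1 * (P * (exp (L * r) * C n k + (exp (L * r) * C n (k - 1) + exp (L * r) * C n (k + 1))))"
          by (simp add: nbs_def algebra_simps)
        from r have r': "r \<in> {0<..<\<tau>} - S" "r \<in> {0..\<tau>}" using t by auto
        have pot: "norm (pot (q r) (e r) k) \<le> P * (exp (L * r) * C n k + (exp (L * r) * C n (k - 1) + exp (L * r) * C n (k + 1)))"
          by (rule norm_pot_le) (use q[OF r'(1)] bn[OF r'(2)] in auto)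
        have "exp (- (\<alpha> k * (t - r))) \<le> 1" using r \<alpha>[of k] by simp
        then have "exp (- (\<alpha> k * (t - r))) * norm (pot (q r) (e r) k) \<le> 1 * (P * (exp (L * r) * C n k + (exp (L * r) * C n (k - 1) + exp (L * r) * C n (k + 1))))"
          by (intro mult_mono pot) auto
        moreover have "exp (- (\<alpha> k * (t - r))) * norm (g r k) \<le> exp (- (\<alpha> k * (t - r))) * h k r"
          by (intro mult_left_mono g r') auto
        moreover have "exp (- (\<alpha> k * (t - r))) * norm (pot (q r) (e r) k + g r k) \<le> exp (- (\<alpha> k * (t - r))) * norm (pot (q r) (e r) k) + exp (- (\<alpha> k * (t - r))) * norm (g r k)"
          unfolding distrib_left[symmetric] by (intro mult_left_mono norm_triangle_ineq) auto
        ultimately show "exp (- (\<alpha> k * (t - r))) * norm (pot (q r) (e r) k + g r k) \<le> ?b r"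
          unfolding nbs_eq by linarith
      qed
      then have "norm (e t k) \<le> norm (of_real (exp (- (\<alpha> k * t))) * e 0 k) + (I + (P * nbs (C n) k) * ((exp (L * t) - 1) / L))"
        using norm_triangle_sub[of "e t k" "of_real (exp (- (\<alpha> k * t))) * e 0 k"] by linarith
      also have "\<dots> \<le> norm (e 0 k) + (H k + (P * nbs (C n) k) * (exp (L * t) / L))"
      proof (intro add_mono I mult_left_mono)
        have "exp (- (\<alpha> k * t)) * norm (e 0 k) \<le> 1 * norm (e 0 k)" using t \<alpha>[of k] by (intro mult_right_mono) auto
        then show "norm (complex_of_real (exp (- (\<alpha> k * t))) * e 0 k) \<le> norm (e 0 k)" by (simp add: norm_mult)
      qed (use L P nbs_nonneg[of "C n", OF Cn] in \<open>auto simp: divide_right_mono\<close>)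
      also have "\<dots> \<le> exp (L * t) * norm (e 0 k) + (exp (L * t) * H k + (P * nbs (C n) k) * (exp (L * t) / L))"
      proof -
        have "1 \<le> exp (L * t)" using L t by simp
        then have "1 * norm (e 0 k) \<le> exp (L * t) * norm (e 0 k)" "1 * H k \<le> exp (L * t) * H k"
          by (intro mult_right_mono H0; simp)+
        then show ?thesis by simp
      qed
      finally show ?thesis by (simp add: CS algebra_simps)
    qed
    moreover have C1: "C (Suc n) k \<ge> 0" for k unfolding CS using H0 L P nbs_nonneg[of "C n", OF Cn] by simp
    moreover have "hs s (C (Suc n)) (2 * (X + Y) + B / 2 ^ Suc n)"
    proof -
      have "(P / L) * nbc s \<le> 1 / 2"
      proof -
        have "2 * (P * nbc s) \<le> L" by (simp add: L_def growth_def)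
        then show ?thesis using L by (simp add: field_simps)
      qed
      then have "(P / L) * nbc s * (2 * (X + Y) + B / 2 ^ n) \<le> 1 / 2 * (2 * (X + Y) + B / 2 ^ n)"
        using hs_nonneg[of s "C n"] Suc by (intro mult_right_mono) auto
      then have "(P / L) * (nbc s * (2 * (X + Y) + B / 2 ^ n)) \<le> 1 / 2 * (2 * (X + Y) + B / 2 ^ n)"
        by (simp only: mult.assoc)
      moreover have "X + Y + 1 / 2 * (2 * (X + Y) + B / 2 ^ n) = 2 * (X + Y) + B / 2 ^ Suc n" by simp
      ultimately have "X + Y + (P / L) * (nbc s * (2 * (X + Y) + B / 2 ^ n)) \<le> 2 * (X + Y) + B / 2 ^ Suc n"
        by (metis add_left_mono)
      moreover have "\<bar>C (Suc n) k\<bar> \<le> C (Suc n) k" for k using C1 by simp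
      moreover have "hs s (C (Suc n)) (X + Y + (P / L) * (nbc s * (2 * (X + Y) + B / 2 ^ n)))"
        unfolding CS using Suc L P s by (intro hs_add hs_cmult hs_nbs X Y) auto
      ultimately show ?thesis using hs_mono by blast
    qed
    ultimately show ?case by auto
  qed
  show ?thesis
  proof (rule hs_le_limit)
    show "hs s (\<lambda>k. norm (e t k)) (exp (L * \<tau>) * (2 * (X + Y) + B / 2 ^ n))" for n
    proof (rule hs_mono[OF hs_cmult[of s "C n" _ "exp (L * \<tau>)"] _ order_refl])
      show "hs s (C n) (2 * (X + Y) + B / 2 ^ n)" using main by blast
      fix k
      have "norm (e t k) \<le> exp (L * t) * C n k" using main t by blast
      also have "\<dots> \<le> exp (L * \<tau>) * C n k" using main t L by (intro mult_right_mono) auto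
      finally show "\<bar>norm (e t k)\<bar> \<le> exp (L * \<tau>) * C n k" by simp
    qed simp
    have *: "(\<lambda>n. exp (L * \<tau>) * (2 * (X + Y) + B * (1 / 2) ^ n)) \<longlonglongrightarrow> exp (L * \<tau>) * (2 * (X + Y) + B * 0)"
      by (intro tendsto_mult tendsto_add tendsto_const LIMSEQ_realpow_zero) simp_all
    show "(\<lambda>n. exp (L * \<tau>) * (2 * (X + Y) + B / 2 ^ n)) \<longlonglongrightarrow> exp (growth s P * \<tau>) * (2 * (X + Y))"
    proof -
      have "B / 2 ^ n = B * (1 / 2) ^ n" for n :: nat by (simp add: power_one_over)
      then show ?thesis using * unfolding L_def[symmetric] by (simp only: mult_zero_right add_0_right)
    qed
  qed
qed

text \<open>Solutions of the linear equation, with a majorant in \<open>\<ell>\<^sup>2\<close>, away from finitely many switching times.\<close>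

definition lin_sol :: "real \<Rightarrow> (real \<Rightarrow> real^3) \<Rightarrow> (real \<Rightarrow> int \<Rightarrow> complex) \<Rightarrow> bool" where
  "lin_sol \<tau> q w \<longleftrightarrow> (\<forall>k. continuous_on {0..\<tau>} (\<lambda>t. w t k)) \<and>
     (\<exists>C B. hs 0 C B \<and> (\<forall>t\<in>{0..\<tau>}. \<forall>k. norm (w t k) \<le> C k)) \<and>
     (\<exists>S. finite S \<and> (\<forall>t\<in>{0<..<\<tau>} - S. \<forall>k.
        ((\<lambda>t. w t k) has_vector_derivative (- of_real (dsp k) * w t k + pot (q t) (w t) k)) (at t)))"

text \<open>Approximate steering, robust in the initial state: all solutions that start \<open>\<delta>\<close>-close to \<open>c\<close> end
  \<open>\<epsilon>\<close>-close to \<open>d\<close>.  In this form steering composes without an appeal to continuous dependence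
  on the data.\<close>

definition steer :: "real \<Rightarrow> (int \<Rightarrow> complex) \<Rightarrow> (int \<Rightarrow> complex) \<Rightarrow> bool" where
  "steer T c d \<longleftrightarrow> (\<forall>\<epsilon>>0. \<exists>\<tau> q \<delta>. 0 < \<tau> \<and> \<tau> \<le> T \<and> pcont \<tau> q \<and> \<delta> > 0 \<and>
     (\<forall>w. lin_sol \<tau> q w \<longrightarrow> hs 0 (\<lambda>k. norm (w 0 k - c k)) \<delta> \<longrightarrow> hs 0 (\<lambda>k. norm (w \<tau> k - d k)) \<epsilon>))"

definition glue :: "real \<Rightarrow> (real \<Rightarrow> 'a) \<Rightarrow> (real \<Rightarrow> 'a) \<Rightarrow> real \<Rightarrow> 'a" where
  "glue \<tau> f g t = (if t < \<tau> then f t else g (t - \<tau>))"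

lemma pcont_glue:
  assumes "pcont \<tau>1 q1" "pcont \<tau>2 q2" "\<tau>1 > 0" "\<tau>2 > 0"
  shows "pcont (\<tau>1 + \<tau>2) (glue \<tau>1 q1 q2)"
proof -
  obtain B1 S1 B2 S2 where 1: "\<And>t. t \<in> {0..\<tau>1} \<Longrightarrow> norm (q1 t) \<le> B1" "finite S1" "\<And>t. t \<in> {0<..<\<tau>1} - S1 \<Longrightarrow> isCont q1 t"
    and 2: "\<And>t. t \<in> {0..\<tau>2} \<Longrightarrow> norm (q2 t) \<le> B2" "finite S2" "\<And>t. t \<in> {0<..<\<tau>2} - S2 \<Longrightarrow> isCont q2 t"
    using assms(1,2) unfolding pcont_def by metis
  show ?thesis unfolding pcont_def
  proof (intro conjI exI ballI)
    fix t assume "t \<in> {0..\<tau>1+\<tau>2}"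
    then show "norm (glue \<tau>1 q1 q2 t) \<le> max B1 B2" using 1(1)[of t] 2(1)[of "t - \<tau>1"] by (auto simp: glue_def le_max_iff_disj)
  next
    show "finite (insert \<tau>1 (S1 \<union> (\<lambda>t. t + \<tau>1) ` S2))" using 1 2 by auto
  next
    fix t assume t: "t \<in> {0<..<\<tau>1+\<tau>2} - (insert \<tau>1 (S1 \<union> (\<lambda>t. t + \<tau>1) ` S2))"
    show "isCont (glue \<tau>1 q1 q2) t"
    proof (cases "t < \<tau>1")
      case True
      then have "\<forall>\<^sub>F x in nhds t. glue \<tau>1 q1 q2 x = q1 x"
        by (intro eventually_mono[OF eventually_nhds_in_open[of "{..<\<tau>1}"]]) (auto simp: glue_def)
      then show ?thesis using isCont_cong 1(3)[of t] t True by force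
    next
      case False
      then have "\<forall>\<^sub>F x in nhds t. glue \<tau>1 q1 q2 x = q2 (x - \<tau>1)"
        using t by (intro eventually_mono[OF eventually_nhds_in_open[of "{\<tau>1<..}"]]) (auto simp: glue_def)
      moreover have "isCont (\<lambda>x. q2 (x - \<tau>1)) t"
      proof (rule isCont_o2[where g=q2])
        have "t - \<tau>1 \<notin> S2" using t by (auto simp: image_iff)
        then show "isCont q2 (t - \<tau>1)" using t False by (intro 2(3)) auto
      qed auto
      ultimately show ?thesis using isCont_cong by force
    qed
  qed
qed

lemma lin_sol_split:
  assumes w: "lin_sol (\<tau>1 + \<tau>2) (glue \<tau>1 q1 q2) w" and "\<tau>1 > 0" "\<tau>2 > 0"
  shows "lin_sol \<tau>1 q1 w" "lin_sol \<tau>2 q2 (\<lambda>t. w (\<tau>1 + t))"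
proof -
  obtain C B S where c: "\<And>k. continuous_on {0..\<tau>1+\<tau>2} (\<lambda>t. w t k)" and m: "hs 0 C B" "\<And>t k. t \<in> {0..\<tau>1+\<tau>2} \<Longrightarrow> norm (w t k) \<le> C k"
    and S: "finite S" "\<And>t k. t \<in> {0<..<\<tau>1+\<tau>2} - S \<Longrightarrow> ((\<lambda>t. w t k) has_vector_derivative (- of_real (dsp k) * w t k + pot (glue \<tau>1 q1 q2 t) (w t) k)) (at t)"
    using w unfolding lin_sol_def by metis
  show "lin_sol \<tau>1 q1 w" unfolding lin_sol_def
  proof (intro conjI allI exI ballI)
    show "continuous_on {0..\<tau>1} (\<lambda>t. w t k)" for k using assms by (intro continuous_on_subset[OF c]) auto
    show "hs 0 C B" by fact
    show "norm (w t k) \<le> C k" if "t \<in> {0..\<tau>1}" for t k using that assms by (intro m) auto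
    show "finite S" by fact
    fix t k assume "t \<in> {0<..<\<tau>1} - S"
    then show "((\<lambda>t. w t k) has_vector_derivative (- of_real (dsp k) * w t k + pot (q1 t) (w t) k)) (at t)"
      using S(2)[of t k] assms by (auto simp: glue_def)
  qed
  show "lin_sol \<tau>2 q2 (\<lambda>t. w (\<tau>1 + t))" unfolding lin_sol_def
  proof (intro conjI allI exI ballI)
    show "continuous_on {0..\<tau>2} (\<lambda>t. w (\<tau>1 + t) k)" for k
      using assms by (intro continuous_on_compose2[OF c] continuous_intros) auto
    show "hs 0 C B" by fact
    show "norm (w (\<tau>1 + t) k) \<le> C k" if "t \<in> {0..\<tau>2}" for t k using that assms by (intro m) auto
    show "finite ((\<lambda>t. t - \<tau>1) ` S)" using S by simp
    fix t k assume t: "t \<in> {0<..<\<tau>2} - (\<lambda>t. t - \<tau>1) ` S"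
    then have "\<tau>1 + t \<notin> S" by (auto simp: image_iff)
    then have d: "((\<lambda>t. w t k) has_vector_derivative (- of_real (dsp k) * w (\<tau>1 + t) k + pot (q2 t) (w (\<tau>1 + t)) k)) (at (\<tau>1 + t))"
      using S(2)[of "\<tau>1 + t" k] t assms by (auto simp: glue_def)
    have "((\<lambda>t. \<tau>1 + t) has_vector_derivative 1) (at t)" by (auto intro!: derivative_eq_intros simp: has_vector_derivative_def)
    from vector_diff_chain_at[OF this d]
    show "((\<lambda>t. w (\<tau>1 + t) k) has_vector_derivative (- of_real (dsp k) * w (\<tau>1 + t) k + pot (q2 t) (w (\<tau>1 + t)) k)) (at t)"
      by (simp add: o_def)
  qed
qed

text \<open>The tolerance of the second stage serves as the accuracy of the first.\<close>

lemma steer_trans: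
  assumes "steer T1 c d" "steer T2 d e" "T1 + T2 \<le> T" shows "steer T c e"
  unfolding steer_def
proof (intro allI impI)
  fix \<epsilon> :: real assume "\<epsilon> > 0"
  then obtain \<tau>2 q2 \<delta>2 where 2: "0 < \<tau>2" "\<tau>2 \<le> T2" "pcont \<tau>2 q2" "\<delta>2 > 0"
    "\<And>w. lin_sol \<tau>2 q2 w \<Longrightarrow> hs 0 (\<lambda>k. norm (w 0 k - d k)) \<delta>2 \<Longrightarrow> hs 0 (\<lambda>k. norm (w \<tau>2 k - e k)) \<epsilon>"
    using assms(2) unfolding steer_def by blast
  obtain \<tau>1 q1 \<delta>1 where 1: "0 < \<tau>1" "\<tau>1 \<le> T1" "pcont \<tau>1 q1" "\<delta>1 > 0"
    "\<And>w. lin_sol \<tau>1 q1 w \<Longrightarrow> hs 0 (\<lambda>k. norm (w 0 k - c k)) \<delta>1 \<Longrightarrow> hs 0 (\<lambda>k. norm (w \<tau>1 k - d k)) \<delta>2"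
    using assms(1) \<open>\<delta>2 > 0\<close> unfolding steer_def by blast
  show "\<exists>\<tau> q \<delta>. 0 < \<tau> \<and> \<tau> \<le> T \<and> pcont \<tau> q \<and> \<delta> > 0 \<and>
     (\<forall>w. lin_sol \<tau> q w \<longrightarrow> hs 0 (\<lambda>k. norm (w 0 k - c k)) \<delta> \<longrightarrow> hs 0 (\<lambda>k. norm (w \<tau> k - e k)) \<epsilon>)"
  proof (intro exI conjI allI impI)
    show "0 < \<tau>1 + \<tau>2" "\<tau>1 + \<tau>2 \<le> T" "\<delta>1 > 0" using 1 2 assms by auto
    show "pcont (\<tau>1 + \<tau>2) (glue \<tau>1 q1 q2)" by (intro pcont_glue 1 2)
    fix w assume w: "lin_sol (\<tau>1 + \<tau>2) (glue \<tau>1 q1 q2) w" "hs 0 (\<lambda>k. norm (w 0 k - c k)) \<delta>1"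
    note sp = lin_sol_split[OF w(1) 1(1) 2(1)]
    show "hs 0 (\<lambda>k. norm (w (\<tau>1 + \<tau>2) k - e k)) \<epsilon>"
      using 2(5)[OF sp(2)] 1(5)[OF sp(1) w(2)] by simp
  qed
qed

lemma hs_norm_triangle:
  assumes "hs s (\<lambda>k. norm (a k - b k)) A" "hs s (\<lambda>k. norm (b k - c k)) B"
  shows "hs s (\<lambda>k. norm (a k - c k)) (A + B)"
  by (rule hs_mono[OF hs_add[OF assms]]) (auto intro: norm_diff_triangle_ineq norm_diff_triangle_le)

lemma steer_close:
  assumes "\<And>\<epsilon>. \<epsilon> > 0 \<Longrightarrow> \<exists>d'. steer T c d' \<and> hs 0 (\<lambda>k. norm (d' k - d k)) \<epsilon>"
  shows "steer T c d"
  unfolding steer_def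
proof (intro allI impI)
  fix \<epsilon> :: real assume "\<epsilon> > 0"
  then have e2: "\<epsilon> / 2 > 0" by simp
  then obtain d' where d': "steer T c d'" "hs 0 (\<lambda>k. norm (d' k - d k)) (\<epsilon>/2)" using assms by blast
  then obtain \<tau> q \<delta> where 2: "0 < \<tau>" "\<tau> \<le> T" "pcont \<tau> q" "\<delta> > 0"
    "\<And>w. lin_sol \<tau> q w \<Longrightarrow> hs 0 (\<lambda>k. norm (w 0 k - c k)) \<delta> \<Longrightarrow> hs 0 (\<lambda>k. norm (w \<tau> k - d' k)) (\<epsilon>/2)"
    using e2 unfolding steer_def by blast
  then show "\<exists>\<tau> q \<delta>. 0 < \<tau> \<and> \<tau> \<le> T \<and> pcont \<tau> q \<and> \<delta> > 0 \<and>
     (\<forall>w. lin_sol \<tau> q w \<longrightarrow> hs 0 (\<lambda>k. norm (w 0 k - c k)) \<delta> \<longrightarrow> hs 0 (\<lambda>k. norm (w \<tau> k - d k)) \<epsilon>)"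
    using hs_norm_triangle[OF _ d'(2), where A="\<epsilon>/2"] by (metis field_sum_of_halves)
qed

lemma lin_sol_free:
  assumes "lin_sol \<tau> (\<lambda>_. 0) w" "t \<in> {0..\<tau>}" shows "w t k = decay t k * w 0 k"
proof -
  obtain S where S: "continuous_on {0..\<tau>} (\<lambda>t. w t k)" "finite S"
     "\<And>t. t \<in> {0<..<\<tau>} - S \<Longrightarrow> ((\<lambda>t. w t k) has_vector_derivative (- of_real (dsp k) * w t k + pot 0 (w t) k)) (at t)"
    using assms(1) unfolding lin_sol_def by metis
  have "norm (w t k - of_real (exp (- (dsp k * t))) * w 0 k) \<le> 0"
    by (rule duhamel_bound[OF S assms(2), of "\<lambda>_. 0"]) (auto simp: pot_def)
  then show ?thesis by (simp add: decay_dsp mult.commute)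
qed

lemma pcont_const: "pcont \<tau> (\<lambda>_. c)"
  unfolding pcont_def by auto

lemma steer_free: assumes "\<tau> > 0" shows "steer \<tau> c (\<lambda>k. decay \<tau> k * c k)"
  unfolding steer_def
proof (intro allI impI)
  fix \<epsilon> :: real assume "\<epsilon> > 0"
  show "\<exists>\<tau>' q \<delta>. 0 < \<tau>' \<and> \<tau>' \<le> \<tau> \<and> pcont \<tau>' q \<and> \<delta> > 0 \<and>
     (\<forall>w. lin_sol \<tau>' q w \<longrightarrow> hs 0 (\<lambda>k. norm (w 0 k - c k)) \<delta> \<longrightarrow> hs 0 (\<lambda>k. norm (w \<tau>' k - decay \<tau> k * c k)) \<epsilon>)"
  proof (rule exI[of _ \<tau>], rule exI[of _ "\<lambda>_. 0"], rule exI[of _ \<epsilon>], intro conjI allI impI)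
    fix w assume w: "lin_sol \<tau> (\<lambda>_. 0) w" "hs 0 (\<lambda>k. norm (w 0 k - c k)) \<epsilon>"
    have "\<bar>norm (w \<tau> k - decay \<tau> k * c k)\<bar> \<le> norm (w 0 k - c k)" for k
    proof -
      have "w \<tau> k - decay \<tau> k * c k = decay \<tau> k * (w 0 k - c k)" using lin_sol_free[OF w(1), of \<tau> k] assms by (simp add: algebra_simps)
      then show ?thesis using norm_decay_le[of \<tau> k] assms mult_right_mono[of "norm (decay \<tau> k)" 1 "norm (w 0 k - c k)"] by (simp add: norm_mult)
    qed
    then show "hs 0 (\<lambda>k. norm (w \<tau> k - decay \<tau> k * c k)) \<epsilon>" by (intro hs_mono[OF w(2)]) auto
  qed (use assms \<open>\<epsilon> > 0\<close> in \<open>auto simp: pcont_const\<close>)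
qed

subsection \<open>Impulses\<close>

lemma fcc_uniform_limit:
  assumes "uniform_limit {0..2*pi} F f sequentially" "\<And>n. continuous_on {0..2*pi} (F n)" "continuous_on {0..2*pi} f"
  shows "(\<lambda>n. fcc (F n) k) \<longlonglongrightarrow> fcc f k"
proof (rule tendstoI)
  fix e :: real assume e: "e > 0"
  then have "\<forall>\<^sub>F n in sequentially. \<forall>x\<in>{0..2*pi}. dist (F n x) (f x) < e / 2"
    using uniform_limitD[OF assms(1), of "e/2"] by simp
  then show "\<forall>\<^sub>F n in sequentially. dist (fcc (F n) k) (fcc f k) < e"
  proof eventually_elim
    case (elim n)
    have "norm (fcc (\<lambda>x. F n x - f x) k) \<le> e / 2"
      using elim by (intro fcc_bound continuous_intros assms) (auto simp: dist_norm less_imp_le)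
    then show ?case using fcc_diff[OF assms(2,3)] e by (simp add: dist_norm)
  qed
qed

text \<open>A bound for the neighbour coupling in terms of the bounds \<open>G / wt 12 k\<close>.  Order 12 leaves enough decay
  for applying the quartic symbol and then summing squares.\<close>

definition shc :: real where "shc = 1 + 2 * (4 powr 12 * 2)"

lemma pot_weighted:
  assumes "\<And>k. norm (c k) \<le> G / wt 12 k" and P: "\<And>i. \<bar>(p::real^3) $ i\<bar> \<le> P"
  shows "norm (pot p c k) \<le> (P * shc * G) / wt 12 k"
proof -
  have P0: "P \<ge> 0" using order_trans[OF abs_ge_zero P] .
  have G0: "G \<ge> 0" using order_trans[OF norm_ge_zero assms(1)[of 0]] wt_pos[of 12 0] by (simp add: zero_le_divide_iff)
  have sh: "G / wt 12 (k + j) \<le> (4 powr 12 * 2) * (G / wt 12 k)" if "\<bar>j\<bar> \<le> 1" for j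
  proof -
    have "wt 12 k \<le> 4 powr 12 * 2 * wt 12 (k + j)" by (rule wt_shift) (use that in auto)
    then have "G * wt 12 k \<le> G * (4 powr 12 * 2 * wt 12 (k + j))" using G0 by (intro mult_left_mono)
    then show ?thesis by (simp add: field_simps)
  qed
  have "norm (pot p c k) \<le> P * (G / wt 12 k + (G / wt 12 (k - 1) + G / wt 12 (k + 1)))"
    by (rule norm_pot_le) (use assms in auto)
  also have "\<dots> \<le> P * (G / wt 12 k + ((4 powr 12 * 2) * (G / wt 12 k) + (4 powr 12 * 2) * (G / wt 12 k)))"
    using sh[of "-1"] sh[of 1] P0 by (intro mult_left_mono add_mono) auto
  also have "\<dots> = (P * shc * G) / wt 12 k" unfolding shc_def by (simp add: algebra_simps add_divide_distrib)
  finally show ?thesis .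
qed

lemma pfun_bound: assumes P: "\<And>i. \<bar>(p::real^3) $ i\<bar> \<le> P" shows "\<bar>pfun p x\<bar> \<le> 3 * P"
proof -
  have P0: "P \<ge> 0" using order_trans[OF abs_ge_zero P] .
  have "\<bar>p $ 2 * cos x\<bar> \<le> P * 1" "\<bar>p $ 3 * sin x\<bar> \<le> P * 1"
    unfolding abs_mult by (intro mult_mono P abs_cos_le_one abs_sin_le_one P0; simp)+
  then show ?thesis unfolding pfun_def using P[of 1] by linarith
qed

lemma pfun_cont: "continuous_on (S :: 'a::t2_space set) f \<Longrightarrow> continuous_on S (\<lambda>x. pfun p (f x))"
  unfolding pfun_def by (intro continuous_intros)

text \<open>Each multiplication by the potential costs the factor \<open>P * shc\<close>, so the exponential series
  costs its exponential.\<close>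

lemma exp_pot_weighted:
  assumes g: "continuous_on UNIV g" and G: "\<And>k. norm (fcc g k) \<le> G / wt 12 k" and P: "\<And>i. \<bar>(p::real^3) $ i\<bar> \<le> P"
    and t: "t \<in> {0..1}"
  shows "norm (fcc (\<lambda>x. of_real (exp (t * pfun p x)) * g x) k) \<le> (exp (P * shc) * G) / wt 12 k"
proof -
  have P0: "P \<ge> 0" using order_trans[OF abs_ge_zero P] .
  have sh0: "shc \<ge> 0" by (simp add: shc_def)
  have G0: "G \<ge> 0" using order_trans[OF norm_ge_zero G[of 0]] wt_pos[of 12 0] by (simp add: zero_le_divide_iff)
  have gc: "continuous_on A g" for A using g continuous_on_subset by blast
  have cn: "continuous_on A (\<lambda>x. of_real (pfun p x) ^ n * g x)" for n A by (intro continuous_intros gc pfun_cont)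
  have b: "norm (fcc (\<lambda>x. of_real (pfun p x) ^ n * g x) k) \<le> ((P * shc) ^ n * G) / wt 12 k" for n k
  proof (induction n arbitrary: k)
    case (Suc n)
    have "norm (pot p (fcc (\<lambda>x. of_real (pfun p x) ^ n * g x)) k) \<le> (P * shc * ((P * shc) ^ n * G)) / wt 12 k"
      by (rule pot_weighted[OF Suc P])
    then show ?case using fcc_pfun[OF cn, of p n k] by (simp add: mult.assoc)
  qed (use G in simp)
  define F where "F n x = (\<Sum>i<n. ((of_real (t * pfun p x)) ^ i /\<^sub>R fact i) * g x)" for n x
  have cF: "continuous_on A (F n)" for A n unfolding F_def by (intro continuous_intros gc pfun_cont)
  obtain Mg where Mg: "\<And>x. x \<in> {0..2*pi} \<Longrightarrow> norm (g x) \<le> Mg"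
    using compact_imp_bounded[OF compact_continuous_image[OF gc compact_Icc, of 0 "2*pi"]] unfolding bounded_iff by blast
  have "uniform_limit {0..2*pi} F (\<lambda>x. \<Sum>i. ((of_real (t * pfun p x)) ^ i /\<^sub>R fact i) * g x) sequentially"
    unfolding F_def
  proof (rule Weierstrass_m_test)
    show "summable (\<lambda>n. ((3 * P) ^ n /\<^sub>R fact n) * Mg)"
      using exp_converges[of "3 * P"] by (intro summable_mult2) (auto simp: sums_iff)
    fix n x assume x: "x \<in> {0..2*pi}"
    have "\<bar>t * pfun p x\<bar> \<le> 1 * (3 * P)" unfolding abs_mult using t by (intro mult_mono pfun_bound P) auto
    then have "\<bar>t * pfun p x\<bar> ^ n \<le> (3 * P) ^ n" by (intro power_mono) auto
    then show "norm (((complex_of_real (t * pfun p x)) ^ n /\<^sub>R fact n) * g x) \<le> ((3 * P) ^ n /\<^sub>R fact n) * Mg"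
      unfolding norm_mult norm_scaleR norm_power norm_of_real
      by (intro mult_mono Mg x) (use P0 in \<open>auto simp: mult_left_mono\<close>)
  qed
  moreover have "(\<Sum>i. ((of_real (t * pfun p x)) ^ i /\<^sub>R fact i) * g x) = of_real (exp (t * pfun p x)) * g x" for x
    using sums_unique[OF sums_mult2[OF exp_converges[of "complex_of_real (t * pfun p x)"], of "g x"]] unfolding exp_of_real by (rule sym)
  ultimately have ul: "uniform_limit {0..2*pi} F (\<lambda>x. of_real (exp (t * pfun p x)) * g x) sequentially" by simp
  have lim: "(\<lambda>n. fcc (F n) k) \<longlonglongrightarrow> fcc (\<lambda>x. of_real (exp (t * pfun p x)) * g x) k"
    by (rule fcc_uniform_limit[OF ul cF]) (intro continuous_intros gc pfun_cont)
  have "norm (fcc (F n) k) \<le> (exp (P * shc) * G) / wt 12 k" for n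
  proof -
    have "F n = (\<lambda>x. \<Sum>i<n. of_real (t ^ i / fact i) * (of_real (pfun p x) ^ i * g x))"
      unfolding F_def by (auto simp: fun_eq_iff power_mult_distrib scaleR_conv_of_real divide_inverse mult_ac intro!: sum.cong)
    then have "fcc (F n) k = (\<Sum>i<n. of_real (t ^ i / fact i) * fcc (\<lambda>x. of_real (pfun p x) ^ i * g x) k)"
      using fcc_sum[of "{..<n}" "\<lambda>i x. of_real (t ^ i / fact i) * (of_real (pfun p x) ^ i * g x)" k]
      by (simp only: fcc_cmult continuous_on_mult_left cn finite_lessThan)
    also have "norm \<dots> \<le> (\<Sum>i<n. (1 / fact i) * (((P * shc) ^ i * G) / wt 12 k))"
    proof (intro sum_norm_le)
      fix i
      have "\<bar>t ^ i / fact i\<bar> \<le> 1 / fact i" using t by (simp add: abs_mult power_le_one divide_right_mono)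
      then show "norm (of_real (t ^ i / fact i) * fcc (\<lambda>x. of_real (pfun p x) ^ i * g x) k) \<le> (1 / fact i) * (((P * shc) ^ i * G) / wt 12 k)"
        unfolding norm_mult norm_of_real by (intro mult_mono b) auto
    qed
    also have "\<dots> = (\<Sum>i<n. (P * shc) ^ i /\<^sub>R fact i) * (G / wt 12 k)"
      unfolding sum_distrib_right by (intro sum.cong refl) (simp add: divide_inverse mult_ac)
    also have "\<dots> \<le> exp (P * shc) * (G / wt 12 k)"
    proof (intro mult_right_mono)
      show "(\<Sum>i<n. (P * shc) ^ i /\<^sub>R fact i) \<le> exp (P * shc)"
        unfolding exp_def using P0 sh0 by (intro sum_le_suminf summable_exp_generic) auto
    qed (use G0 in simp)
    finally show ?thesis by simp
  qed
  then show ?thesis using LIMSEQ_le_const2[OF tendsto_norm[OF lim]] by blast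
qed

lemma exp_pot_ode:
  assumes g: "continuous_on UNIV g"
  shows "((\<lambda>t. fcc (\<lambda>x. of_real (exp (t * pfun p x)) * g x) k) has_vector_derivative
     pot p (fcc (\<lambda>x. of_real (exp (t * pfun p x)) * g x)) k) (at t)"
proof -
  have gc: "continuous_on A g" for A using g continuous_on_subset by blast
  let ?h = "\<lambda>t x. of_real (exp (t * pfun p x)) * g x"
  have c: "continuous_on A (?h t)" for A t by (intro continuous_intros gc pfun_cont)
  have "((\<lambda>t. integral (cbox 0 (2*pi)) (\<lambda>x. ?h t x * cis (- (of_int k * x)))) has_vector_derivative
      integral (cbox 0 (2*pi)) (\<lambda>x. (of_real (pfun p x) * ?h t x) * cis (- (of_int k * x)))) (at t within UNIV)"
  proof (rule leibniz_rule_vector_derivative)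
    show "((\<lambda>t. ?h t x * cis (- (of_int k * x))) has_vector_derivative (of_real (pfun p x) * ?h t x) * cis (- (of_int k * x))) (at t within UNIV)" for t x
    proof -
      have "((\<lambda>t. exp (t * pfun p x)) has_real_derivative pfun p x * exp (t * pfun p x)) (at t)"
        by (auto intro!: derivative_eq_intros)
      then have "((\<lambda>t. complex_of_real (exp (t * pfun p x))) has_vector_derivative of_real (pfun p x * exp (t * pfun p x))) (at t)"
        by (intro has_vector_derivative_of_real) (simp add: has_real_derivative_iff_has_vector_derivative)
      from has_vector_derivative_mult_left[OF has_vector_derivative_mult_left[OF this, of "g x"], of "cis (- (of_int k * x))"]
      show ?thesis by (simp add: mult_ac)
    qed
    show "(\<lambda>x. ?h t x * cis (- (of_int k * x))) integrable_on cbox 0 (2*pi)" for t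
      by (intro integrable_continuous continuous_intros c)
    show "continuous_on (UNIV \<times> cbox 0 (2*pi)) (\<lambda>(t, x). (of_real (pfun p x) * ?h t x) * cis (- (of_int k * x)))"
      unfolding split_beta by (intro continuous_intros pfun_cont continuous_on_compose2[OF g]) auto
  qed auto
  then have "((\<lambda>t. fcc (?h t) k) has_vector_derivative fcc (\<lambda>x. of_real (pfun p x) * ?h t x) k) (at t)"
    unfolding fcc_def by (intro has_vector_derivative_divide) simp
  then show ?thesis using fcc_pfun[OF c] by simp
qed

lemma const_kernel_integral:
  assumes "\<alpha> \<ge> 0" "c \<ge> 0" "0 \<le> t" "t \<le> \<tau>"
  shows "\<exists>I\<le>\<tau> * c. ((\<lambda>r. exp (- (\<alpha> * (t - r))) * c) has_integral I) {0..t::real}"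
proof (intro exI conjI)
  have c: "(\<lambda>r. exp (- (\<alpha> * (t - r))) * c) integrable_on {0..t}" by (intro integrable_continuous_real continuous_intros)
  then show "((\<lambda>r. exp (- (\<alpha> * (t - r))) * c) has_integral integral {0..t} (\<lambda>r. exp (- (\<alpha> * (t - r))) * c)) {0..t}"
    by (rule integrable_integral)
  have "integral {0..t} (\<lambda>r. exp (- (\<alpha> * (t - r))) * c) \<le> integral {0..t} (\<lambda>r. c)"
  proof (intro integral_le c integrable_const_ivl)
    fix r assume "r \<in> {0..t}"
    then have "exp (- (\<alpha> * (t - r))) \<le> 1" using assms by simp
    then show "exp (- (\<alpha> * (t - r))) * c \<le> c" using assms(2) by (simp add: mult_left_le_one_le)
  qed
  also have "\<dots> = t * c" using assms by simp
  also have "\<dots> \<le> \<tau> * c" using assms by (intro mult_right_mono)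
  finally show "integral {0..t} (\<lambda>r. exp (- (\<alpha> * (t - r))) * c) \<le> \<tau> * c" .
qed

lemma dsp_le_wt: "dsp k \<le> wt 4 k"
proof -
  have "wt 4 k = (1 + (real_of_int k)\<^sup>2) powr 2" by (simp add: wt_def)
  also have "\<dots> = (1 + (real_of_int k)\<^sup>2)\<^sup>2" by (simp add: add_pos_nonneg)
  also have "\<dots> = 1 + 2 * (real_of_int k)\<^sup>2 + real_of_int k ^ 4" by (simp add: power2_eq_square power4_eq_xxxx algebra_simps)
  finally show ?thesis using zero_le_power2[of "real_of_int k"] unfolding dsp_def by linarith
qed

lemma wt_add: "wt (r + s) k = wt r k * wt s k"
  by (simp add: wt_def powr_add[symmetric] add_divide_distrib)

text \<open>On the interval \<open>[0,\<sigma>]\<close> with control \<open>p/\<sigma>\<close> the potential acts with full strength, whereas the free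
  evolution has no time to act.  The solution is compared with \<open>exp ((t/\<sigma>) Q) g\<close>, where \<open>g\<close> is a
  trigonometric polynomial close to \<open>f\<close>: there the omitted symbol costs only \<open>O(\<sigma>)\<close>, and the a priori
  bound does not degenerate because control times duration is fixed.\<close>

lemma impulse_steer:
  assumes f: "f \<in> per" and T: "T > 0"
  shows "steer T (fourier_coeff f) (fourier_coeff (\<lambda>x. exp (pfun p x) * f x))"
  unfolding steer_def
proof (intro allI impI)
  fix \<epsilon> :: real assume \<epsilon>: "\<epsilon> > 0"
  define P where "P = norm p"
  have P: "\<bar>p $ i\<bar> \<le> P" for i unfolding P_def using component_le_norm_cart[of p i] by simp
  have P0: "P \<ge> 0" by (simp add: P_def)
  define M1 where "M1 = exp (2 * P * nbc 0 + 1) * 2"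
  define Z where "Z = M1 + exp (3 * P)"
  have M1: "M1 > 0" by (simp add: M1_def)
  have Z: "Z > 0" using M1 by (simp add: Z_def add_pos_pos)
  define d where "d = \<epsilon> / (4 * Z)"
  have d: "d > 0" using \<epsilon> Z by (simp add: d_def)
  obtain g0 where g0: "tpoly (\<lambda>x. of_real (g0 x))" "\<And>x. \<bar>f x - g0 x\<bar> < d" using tpoly_dense[OF f d] by blast
  define g where "g = (\<lambda>x. complex_of_real (g0 x))"
  have gc: "continuous_on A g" for A unfolding g_def by (rule tpoly_cont[OF g0(1)])
  obtain F c where Fc: "finite F" "g = (\<lambda>x. \<Sum>k\<in>F. c k * cis (of_int k * x))" using tpoly_canonical[OF g0(1)] unfolding g_def by blast
  define G where "G = (\<Sum>k\<in>F. norm (c k) * wt 12 k)"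
  have G0: "G \<ge> 0" unfolding G_def by (intro sum_nonneg) auto
  have gG: "norm (fcc g k) \<le> G / wt 12 k" for k
  proof (cases "k \<in> F")
    case True
    have "norm (c k) * wt 12 k \<le> G" unfolding G_def by (rule member_le_sum[OF True]) (use Fc in auto)
    then show ?thesis using True fcc_trig[OF Fc(1), of c k] by (simp add: Fc(2) field_simps)
  next
    case False
    then show ?thesis using fcc_trig[OF Fc(1), of c k] G0 by (simp add: Fc(2))
  qed
  define V where "V t = fcc (\<lambda>x. of_real (exp (t * pfun p x)) * g x)" for t
  define G' where "G' = exp (P * shc) * G"
  have G'0: "G' \<ge> 0" using G0 by (simp add: G'_def)
  define W where "W k = G' / wt 12 k" for k
  have VW: "norm (V t k) \<le> W k" if "t \<in> {0..1}" for t k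
    unfolding V_def W_def G'_def by (rule exp_pot_weighted[OF gc gG P that])
  have Vd: "((\<lambda>t. V t k) has_vector_derivative pot p (V t) k) (at t)" for t k
    unfolding V_def by (rule exp_pot_ode[OF gc])
  obtain K where K: "K > 0" "\<And>F. finite F \<Longrightarrow> L2_set (\<lambda>k. 1 / wt 8 k) F \<le> K" using wt_inverse_l2[of 8] by auto
  then have K': "hs 0 (\<lambda>k. 1 / wt 8 k) K" by (simp add: hs_def)
  define Y where "Y = G' * K"
  have Y0: "Y \<ge> 0" using G'0 K by (simp add: Y_def)
  have w12: "wt 12 k = wt 4 k * wt 8 k" for k using wt_add[of 4 8 k] by simp
  have hY: "hs 0 (\<lambda>k. dsp k * W k) Y"
  proof (rule hs_mono[OF hs_cmult[OF K' G'0]])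
    fix k
    have "dsp k * W k = (dsp k / wt 4 k) * (G' * (1 / wt 8 k))" by (simp add: W_def w12)
    also have "\<dots> \<le> 1 * (G' * (1 / wt 8 k))" using dsp_le_wt[of k] G'0 by (intro mult_right_mono) auto
    finally show "\<bar>dsp k * W k\<bar> \<le> G' * (1 / wt 8 k)" using G'0 by (simp add: W_def)
  qed (simp add: Y_def)
  have hW: "hs 0 W Y"
  proof (rule hs_mono[OF hs_cmult[OF K' G'0]])
    fix k
    have "W k = (1 / wt 4 k) * (G' * (1 / wt 8 k))" by (simp add: W_def w12)
    also have "\<dots> \<le> 1 * (G' * (1 / wt 8 k))" using wt_ge1[of 4 k] G'0 by (intro mult_right_mono) auto
    finally show "\<bar>W k\<bar> \<le> G' * (1 / wt 8 k)" using G'0 by (simp add: W_def)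
  qed (simp add: Y_def)
  define \<sigma> where "\<sigma> = min T (min 1 (d / (Y + 1)))"
  have \<sigma>: "\<sigma> > 0" "\<sigma> \<le> T" "\<sigma> \<le> 1" "\<sigma> \<le> d / (Y + 1)" using T d Y0 by (auto simp: \<sigma>_def)
  have \<sigma>Y: "\<sigma> * Y \<le> d"
  proof -
    have "\<sigma> * Y \<le> \<sigma> * (Y + 1)" using \<sigma> by simp
    also have "\<dots> \<le> d" using \<sigma>(4) Y0 by (simp add: field_simps)
    finally show ?thesis .
  qed
  define q where "q = (\<lambda>_::real. (1 / \<sigma>) *\<^sub>R p)"
  show "\<exists>\<tau> q \<delta>. 0 < \<tau> \<and> \<tau> \<le> T \<and> pcont \<tau> q \<and> \<delta> > 0 \<and>
     (\<forall>w. lin_sol \<tau> q w \<longrightarrow> hs 0 (\<lambda>k. norm (w 0 k - fourier_coeff f k)) \<delta> \<longrightarrow>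
       hs 0 (\<lambda>k. norm (w \<tau> k - fourier_coeff (\<lambda>x. exp (pfun p x) * f x) k)) \<epsilon>)"
  proof (rule exI[of _ \<sigma>], rule exI[of _ q], rule exI[of _ d], intro conjI allI impI)
    show "pcont \<sigma> q" unfolding q_def by (rule pcont_const)
    fix w assume w: "lin_sol \<sigma> q w" and w0: "hs 0 (\<lambda>k. norm (w 0 k - fourier_coeff f k)) d"
    obtain C B S where wc: "\<And>k. continuous_on {0..\<sigma>} (\<lambda>t. w t k)" and wm: "hs 0 C B" "\<And>t k. t \<in> {0..\<sigma>} \<Longrightarrow> norm (w t k) \<le> C k"
      and S: "finite S" "\<And>t k. t \<in> {0<..<\<sigma>} - S \<Longrightarrow> ((\<lambda>t. w t k) has_vector_derivative (- of_real (dsp k) * w t k + pot (q t) (w t) k)) (at t)"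
      using w unfolding lin_sol_def by metis
    define e where "e t k = w t k - V (t / \<sigma>) k" for t k
    have V\<sigma>: "((\<lambda>t. V (t / \<sigma>) k) has_vector_derivative pot (q t) (V (t / \<sigma>)) k) (at t)" for t k
    proof -
      have "((\<lambda>t. t / \<sigma>) has_real_derivative 1 / \<sigma>) (at t)" using \<sigma> by (auto intro!: derivative_eq_intros)
      then have "((\<lambda>t. t / \<sigma>) has_vector_derivative 1 / \<sigma>) (at t)" by (simp add: has_real_derivative_iff_has_vector_derivative)
      from vector_diff_chain_at[OF this Vd] show ?thesis by (simp add: o_def q_def pot_scaleR) (simp add: scaleR_conv_of_real)
    qed
    have t1: "t / \<sigma> \<in> {0..1}" if "t \<in> {0..\<sigma>}" for t using that \<sigma> by auto
    have tpd: "hs 0 (\<lambda>k. norm (fourier_coeff f k - fcc g k)) d"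
    proof -
      have "continuous_on {0..2*pi} (\<lambda>x. of_real (f x) - g x)" by (intro continuous_intros per_cont_of_real f gc)
      moreover have "norm (of_real (f x) - g x) \<le> d" for x unfolding g_def using g0(2)[of x] by (metis less_imp_le norm_of_real of_real_diff real_norm_def)
      ultimately have "hs 0 (\<lambda>k. norm (fcc (\<lambda>x. of_real (f x) - g x) k)) d" by (intro bessel_sup) (use d in auto)
      then show ?thesis using fcc_diff[OF per_cont_of_real[OF f] gc] by (simp add: fourier_coeff_eq[OF f])
    qed
    have e0: "hs 0 (\<lambda>k. norm (e 0 k)) (d + d)"
      using hs_norm_triangle[OF w0 tpd] by (simp add: e_def V_def)
    have "hs 0 (\<lambda>k. norm (e \<sigma> k)) (exp (growth 0 (P / \<sigma>) * \<sigma>) * (2 * ((d + d) + \<sigma> * Y)))"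
    proof (rule linear_apriori[where e=e and \<alpha>=dsp and S=S and q=q and ?C0.0="\<lambda>k. C k + W k" and B="B + Y" and P="P / \<sigma>"
          and g="\<lambda>t k. - of_real (dsp k) * V (t / \<sigma>) k" and h="\<lambda>k t. dsp k * W k" and H="\<lambda>k. \<sigma> * (dsp k * W k)"])
      show "P / \<sigma> \<ge> 0" using P0 \<sigma> by simp
      have Vc: "continuous_on A (\<lambda>t. V (t / \<sigma>) k)" for k A
        by (rule continuous_at_imp_continuous_on) (use V\<sigma> has_vector_derivative_continuous in blast)
      show "continuous_on {0..\<sigma>} (\<lambda>t. e t k)" for k unfolding e_def by (intro continuous_intros wc Vc)
      show "((\<lambda>t. e t k) has_vector_derivative (- of_real (dsp k) * e t k + (pot (q t) (e t) k + - of_real (dsp k) * V (t / \<sigma>) k))) (at t)"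
        if "t \<in> {0<..<\<sigma>} - S" for t k
      proof -
        have "e t = (\<lambda>k. w t k - V (t / \<sigma>) k)" by (auto simp: e_def fun_eq_iff)
        then have "pot (q t) (e t) k = pot (q t) (w t) k - pot (q t) (V (t / \<sigma>)) k" by (simp add: pot_diff)
        moreover have "((\<lambda>t. e t k) has_vector_derivative ((- of_real (dsp k) * w t k + pot (q t) (w t) k) - pot (q t) (V (t / \<sigma>)) k)) (at t)"
          unfolding e_def by (intro has_vector_derivative_diff S that V\<sigma>)
        ultimately show ?thesis
          by (elim has_vector_derivative_eq_rhs) (simp add: e_def algebra_simps)
      qed
      show "\<bar>q t $ i\<bar> \<le> P / \<sigma>" for t i using P[of i] \<sigma> by (simp add: q_def abs_mult divide_right_mono)
      show "norm (e t k) \<le> C k + W k" if "t \<in> {0..\<sigma>}" for t k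
        unfolding e_def by (intro order_trans[OF norm_triangle_ineq4] add_mono wm VW t1 that)
      show "hs 0 (\<lambda>k. C k + W k) (B + Y)" by (intro hs_add wm hW)
      show "norm (- of_real (dsp k) * V (t / \<sigma>) k) \<le> dsp k * W k" if "t \<in> {0<..<\<sigma>} - S" for t k
        using that t1[of t] by (auto simp: norm_mult intro!: mult_left_mono VW)
      show "\<exists>I\<le>\<sigma> * (dsp k * W k). ((\<lambda>r. exp (- (dsp k * (t - r))) * (dsp k * W k)) has_integral I) {0..t}" if "t \<in> {0..\<sigma>}" for t k
        using that G'0 by (intro const_kernel_integral) (auto simp: W_def)
      show "hs 0 (\<lambda>k. \<sigma> * (dsp k * W k)) (\<sigma> * Y)" using \<sigma> by (intro hs_cmult hY) auto
    qed (use S \<sigma> e0 in auto)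
    moreover have "exp (growth 0 (P / \<sigma>) * \<sigma>) * (2 * ((d + d) + \<sigma> * Y)) \<le> M1 * (3 * d)"
    proof -
      have "growth 0 (P / \<sigma>) * \<sigma> = 2 * P * nbc 0 + \<sigma>" using \<sigma> by (simp add: growth_def field_simps)
      then have "exp (growth 0 (P / \<sigma>) * \<sigma>) * 2 \<le> M1" using \<sigma> by (simp add: M1_def)
      then have "(exp (growth 0 (P / \<sigma>) * \<sigma>) * 2) * ((d + d) + \<sigma> * Y) \<le> M1 * (3 * d)"
        using \<sigma>Y d M1 \<sigma> Y0 by (intro mult_mono) auto
      then show ?thesis by (simp only: mult.assoc)
    qed
    ultimately have h1: "hs 0 (\<lambda>k. norm (w \<sigma> k - V 1 k)) (M1 * (3 * d))"
      using hs_mono[where C="\<lambda>k. norm (e \<sigma> k)" and D="\<lambda>k. norm (e \<sigma> k)"] \<sigma> by (simp add: e_def)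
    have h2: "hs 0 (\<lambda>k. norm (V 1 k - fourier_coeff (\<lambda>x. exp (pfun p x) * f x) k)) (exp (3 * P) * d)"
    proof -
      have cf: "continuous_on {0..2*pi} (\<lambda>x. complex_of_real (exp (pfun p x) * f x))"
        by (intro per_cont_of_real per_mult per_exp pfun_per f)
      have ch: "continuous_on {0..2*pi} (\<lambda>x. complex_of_real (exp (1 * pfun p x)) * g x)"
        by (intro continuous_intros gc pfun_cont)
      have "norm (of_real (exp (1 * pfun p x)) * g x - complex_of_real (exp (pfun p x) * f x)) \<le> exp (3 * P) * d" for x
      proof -
        have "of_real (exp (1 * pfun p x)) * g x - complex_of_real (exp (pfun p x) * f x) = of_real (exp (pfun p x) * - (f x - g0 x))"
          by (simp add: g_def algebra_simps)
        also have "norm \<dots> = exp (pfun p x) * \<bar>f x - g0 x\<bar>" by (simp only: norm_of_real abs_mult abs_minus_cancel) simp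
        also have "\<dots> \<le> exp (3 * P) * d" using pfun_bound[OF P, of x] g0(2)[of x] by (intro mult_mono) auto
        finally show ?thesis .
      qed
      then have "hs 0 (\<lambda>k. norm (fcc (\<lambda>x. of_real (exp (1 * pfun p x)) * g x - complex_of_real (exp (pfun p x) * f x)) k)) (exp (3 * P) * d)"
        by (intro bessel_sup continuous_intros gc pfun_cont cf) (use d in auto)
      then show ?thesis unfolding V_def using fcc_diff[OF ch cf] fourier_coeff_eq[OF per_mult[OF per_exp[OF pfun_per] f]] by simp
    qed
    have "M1 * (3 * d) + exp (3 * P) * d \<le> 4 * Z * d" using d M1 unfolding Z_def by (simp add: algebra_simps)
    also have "4 * Z * d = \<epsilon>" using Z by (simp add: d_def)
    finally show "hs 0 (\<lambda>k. norm (w \<sigma> k - fourier_coeff (\<lambda>x. exp (pfun p x) * f x) k)) \<epsilon>"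
      by (intro hs_mono[OF hs_norm_triangle[OF h1 h2]]) auto
  qed (use \<sigma> d in auto)
qed

section \<open>The exponents generated by the controls\<close>

definition small :: "(int \<Rightarrow> complex) \<Rightarrow> (int \<Rightarrow> complex) \<Rightarrow> bool" where
  "small c d \<longleftrightarrow> (\<forall>T>0. steer T c d)"

lemma small_trans: assumes "small c d" "small d e" shows "small c e"
  unfolding small_def
proof (intro allI impI)
  fix T :: real assume "T > 0"
  then have "steer (T/2) c d" "steer (T/2) d e" using assms unfolding small_def by auto
  then show "steer T c e" by (rule steer_trans) simp
qed

text \<open>The functions \<open>\<psi>\<close> for which multiplication by \<open>exp \<psi>\<close> is achieved in small time from every continuous state.\<close>

definition mults :: "(real \<Rightarrow> real) set" where
  "mults = {\<psi>. \<psi> \<in> per \<and> (\<forall>f\<in>per. small (fourier_coeff f) (fourier_coeff (\<lambda>x. exp (\<psi> x) * f x)))}"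

text \<open>The exponents all of whose real multiples are available; unlike \<open>mults\<close>, this set is a vector space.\<close>

definition lmults :: "(real \<Rightarrow> real) set" where
  "lmults = {\<psi>. \<psi> \<in> per \<and> (\<forall>a. (\<lambda>x. a * \<psi> x) \<in> mults)}"

lemma per_uminus: "u \<in> per \<Longrightarrow> (\<lambda>x. - u x) \<in> per"
  using per_mult[OF per_const[of "-1"]] by simp

lemma mults_per: "\<psi> \<in> mults \<Longrightarrow> \<psi> \<in> per" by (simp add: mults_def)
lemma lmults_per: "\<psi> \<in> lmults \<Longrightarrow> \<psi> \<in> per" by (simp add: lmults_def)
lemma lmults_mults: "\<psi> \<in> lmults \<Longrightarrow> (\<lambda>x. a * \<psi> x) \<in> mults" by (simp add: lmults_def)

lemma mults_add: assumes "\<phi> \<in> mults" "\<psi> \<in> mults" shows "(\<lambda>x. \<phi> x + \<psi> x) \<in> mults"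
  unfolding mults_def
proof (intro CollectI conjI ballI)
  show "(\<lambda>x. \<phi> x + \<psi> x) \<in> per" using assms mults_per per_plus by blast
  fix f assume f: "f \<in> per"
  have g: "(\<lambda>x. exp (\<phi> x) * f x) \<in> per" using f assms mults_per by (intro per_mult per_exp) auto
  have "small (fourier_coeff f) (fourier_coeff (\<lambda>x. exp (\<psi> x) * (exp (\<phi> x) * f x)))"
    using small_trans assms f g unfolding mults_def by blast
  then show "small (fourier_coeff f) (fourier_coeff (\<lambda>x. exp (\<phi> x + \<psi> x) * f x))" by (simp add: exp_add mult_ac)
qed

lemma mults_sum: "finite J \<Longrightarrow> (\<And>j. j \<in> J \<Longrightarrow> g j \<in> mults) \<Longrightarrow> (\<lambda>x. 0) \<in> mults \<Longrightarrow> (\<lambda>x. \<Sum>j\<in>J. g j x) \<in> mults"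
  by (induction J rule: finite_induct) (auto intro: mults_add)

lemma lmults_add: assumes "\<phi> \<in> lmults" "\<psi> \<in> lmults" shows "(\<lambda>x. \<phi> x + \<psi> x) \<in> lmults"
  using assms mults_add[OF lmults_mults[OF assms(1)] lmults_mults[OF assms(2)]] per_plus
  by (auto simp: lmults_def distrib_left)

lemma lmults_scale: "\<phi> \<in> lmults \<Longrightarrow> (\<lambda>x. a * \<phi> x) \<in> lmults"
  using per_mult[OF per_const] by (auto simp: lmults_def mult.assoc[symmetric])

lemma lmults_diff: assumes "\<phi> \<in> lmults" "\<psi> \<in> lmults" shows "(\<lambda>x. \<phi> x - \<psi> x) \<in> lmults"
  using lmults_add[OF assms(1) lmults_scale[OF assms(2), of "-1"]] by simp

lemma pfun_lmults: "pfun p \<in> lmults"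
proof -
  have "(\<lambda>x. a * pfun p x) = pfun (a *\<^sub>R p)" for a by (auto simp: pfun_def algebra_simps)
  moreover have "pfun r \<in> mults" for r using impulse_steer by (auto simp: mults_def small_def pfun_per)
  ultimately show ?thesis by (auto simp: lmults_def pfun_per)
qed

lemma const_lmults: "(\<lambda>x. a) \<in> lmults"
  using pfun_lmults[of "vector [a, 0, 0]"] by (simp add: pfun_def[abs_def] vector_3)
lemma cos_lmults: "cos \<in> lmults"
  using pfun_lmults[of "vector [0, 1, 0]"] by (simp add: pfun_def[abs_def] vector_3)
lemma sin_lmults: "sin \<in> lmults"
  using pfun_lmults[of "vector [0, 0, 1]"] by (simp add: pfun_def[abs_def] vector_3)

lemma steer_per_close:
  assumes g: "g \<in> per" and "\<And>\<epsilon>. \<epsilon> > 0 \<Longrightarrow> \<exists>h\<in>per. steer T c (fourier_coeff h) \<and> hs 0 (\<lambda>k. cmod (fourier_coeff (\<lambda>x. h x - g x) k)) \<epsilon>"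
  shows "steer T c (fourier_coeff g)"
proof (rule steer_close)
  fix \<epsilon> :: real assume "\<epsilon> > 0"
  then obtain h where "h \<in> per" "steer T c (fourier_coeff h)" "hs 0 (\<lambda>k. cmod (fourier_coeff (\<lambda>x. h x - g x) k)) \<epsilon>" using assms(2) by blast
  then show "\<exists>d'. steer T c d' \<and> hs 0 (\<lambda>k. cmod (d' k - fourier_coeff g k)) \<epsilon>"
    using fourier_coeff_diff[OF _ g] by auto
qed

lemma bessel_per: "u \<in> per \<Longrightarrow> (\<And>x. \<bar>u x\<bar> \<le> B) \<Longrightarrow> hs 0 (\<lambda>k. cmod (fourier_coeff u k)) B"
  using bessel_sup[OF per_cont_of_real, of u B] order_trans[OF abs_ge_zero] by (auto simp: fourier_coeff_eq)

lemma abs_exp_diff_le: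
  fixes a b R :: real
  assumes "a \<le> R" "b \<le> R" shows "\<bar>exp a - exp b\<bar> \<le> exp R * \<bar>a - b\<bar>"
proof -
  have "exp x - exp y \<le> exp R * (x - y)" if "y \<le> x" "x \<le> R" for x y :: real
  proof -
    have "exp x * (1 + (y - x)) \<le> exp x * exp (y - x)" by (intro mult_left_mono exp_ge_add_one_self) auto
    then have "exp x - exp y \<le> exp x * (x - y)" by (simp add: exp_diff algebra_simps)
    also have "\<dots> \<le> exp R * (x - y)" using that by (intro mult_right_mono) auto
    finally show ?thesis .
  qed
  from this[of a b] this[of b a] show ?thesis using assms by (cases "a \<le> b") (auto simp: abs_if)
qed

lemma lmults_closed:
  assumes u: "u \<in> per" and "\<And>e. e > 0 \<Longrightarrow> \<exists>g\<in>lmults. \<forall>x. \<bar>u x - g x\<bar> < e"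
  shows "u \<in> lmults"
  unfolding lmults_def mults_def
proof (intro CollectI conjI allI ballI u)
  fix a show "(\<lambda>x. a * u x) \<in> per" by (intro per_mult per_const u)
  fix f assume f: "f \<in> per"
  show "small (fourier_coeff f) (fourier_coeff (\<lambda>x. exp (a * u x) * f x))"
    unfolding small_def
  proof (intro allI impI steer_per_close per_mult per_exp per_const u f)
    fix T \<epsilon> :: real assume T: "T > 0" and \<epsilon>: "\<epsilon> > 0"
    obtain B where B: "B > 0" "\<And>x. \<bar>u x\<bar> \<le> B" using per_bounded[OF u] by blast
    obtain M where M: "M > 0" "\<And>x. \<bar>f x\<bar> \<le> M" using per_bounded[OF f] by blast
    define E where "E = exp (\<bar>a\<bar> * (B + 1)) * (\<bar>a\<bar> + 1) * M"
    have E: "E > 0" using M by (simp add: E_def add_nonneg_pos)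
    define d where "d = min 1 (\<epsilon> / E)"
    have d: "d > 0" "d \<le> 1" "d \<le> \<epsilon> / E" using E \<epsilon> by (auto simp: d_def)
    obtain g where g: "g \<in> lmults" "\<And>x. \<bar>u x - g x\<bar> < d" using assms(2)[OF d(1)] by blast
    have gp: "g \<in> per" using g lmults_per by blast
    have ag: "(\<lambda>x. a * g x) \<in> mults" using g(1) lmults_mults by blast
    show "\<exists>h\<in>per. steer T (fourier_coeff f) (fourier_coeff h) \<and> hs 0 (\<lambda>k. cmod (fourier_coeff (\<lambda>x. h x - exp (a * u x) * f x) k)) \<epsilon>"
    proof (intro bexI conjI)
      show p: "(\<lambda>x. exp (a * g x) * f x) \<in> per" by (intro per_mult per_exp per_const gp f)
      show "steer T (fourier_coeff f) (fourier_coeff (\<lambda>x. exp (a * g x) * f x))"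
        using ag f T unfolding mults_def small_def by blast
      show "hs 0 (\<lambda>k. cmod (fourier_coeff (\<lambda>x. exp (a * g x) * f x - exp (a * u x) * f x) k)) \<epsilon>"
      proof (rule bessel_per)
        show "(\<lambda>x. exp (a * g x) * f x - exp (a * u x) * f x) \<in> per" by (intro per_diff p per_mult per_exp per_const u f)
        fix x
        have gb: "\<bar>g x\<bar> \<le> B + 1" using g(2)[of x] B(2)[of x] d by linarith
        have "a * g x \<le> \<bar>a\<bar> * (B + 1)" "a * u x \<le> \<bar>a\<bar> * (B + 1)"
          using mult_left_mono[OF gb, of "\<bar>a\<bar>"] mult_left_mono[of "\<bar>u x\<bar>" "B + 1" "\<bar>a\<bar>"] B(2)[of x] abs_le_D1[of "a * g x"] abs_le_D1[of "a * u x"]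
          by (auto simp: abs_mult intro: order_trans)
        then have "\<bar>exp (a * g x) - exp (a * u x)\<bar> \<le> exp (\<bar>a\<bar> * (B + 1)) * \<bar>a * g x - a * u x\<bar>" by (rule abs_exp_diff_le)
        also have "\<dots> \<le> exp (\<bar>a\<bar> * (B + 1)) * ((\<bar>a\<bar> + 1) * d)"
        proof (intro mult_left_mono)
          have "\<bar>a * g x - a * u x\<bar> = \<bar>a\<bar> * \<bar>u x - g x\<bar>" by (metis abs_minus_commute abs_mult right_diff_distrib)
          also have "\<dots> \<le> (\<bar>a\<bar> + 1) * d" using g(2)[of x] by (intro mult_mono) auto
          finally show "\<bar>a * g x - a * u x\<bar> \<le> (\<bar>a\<bar> + 1) * d" .
        qed auto
        finally have "\<bar>exp (a * g x) - exp (a * u x)\<bar> * \<bar>f x\<bar> \<le> (exp (\<bar>a\<bar> * (B + 1)) * ((\<bar>a\<bar> + 1) * d)) * M"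
          using d by (intro mult_mono M) auto
        also have "\<dots> = E * d" by (simp add: E_def)
        also have "\<dots> \<le> \<epsilon>" using d(3) E by (simp add: field_simps)
        finally show "\<bar>exp (a * g x) * f x - exp (a * u x) * f x\<bar> \<le> \<epsilon>" by (simp add: left_diff_distrib[symmetric] abs_mult)
      qed
    qed
  qed
qed

text \<open>Three stages: multiplication by \<open>exp (l \<phi>)\<close>, a free evolution of duration \<open>l\<^sup>-\<^sup>4\<close>, multiplication by
  \<open>exp (- l \<phi>)\<close>, for a large \<open>l = n + 1\<close>.\<close>

lemma quartic_mults:
  assumes \<phi>: "\<phi> \<in> lmults" and b: "b \<in> per" and d: "\<And>x. (\<phi> has_real_derivative b x) (at x)"
  shows "(\<lambda>x. - (b x ^ 4)) \<in> mults"
  unfolding mults_def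
proof (intro CollectI conjI ballI)
  have "(\<lambda>x. (-1) * b x ^ 4) \<in> per" by (intro per_mult per_const per_power b)
  then show p: "(\<lambda>x. - (b x ^ 4)) \<in> per" by simp
  note \<phi>p = lmults_per[OF \<phi>]
  fix f assume f: "f \<in> per"
  show "small (fourier_coeff f) (fourier_coeff (\<lambda>x. exp (- (b x ^ 4)) * f x))"
    unfolding small_def
  proof (intro allI impI steer_per_close per_mult per_exp p f)
    fix T \<epsilon> :: real assume T: "T > 0" and \<epsilon>: "\<epsilon> > 0"
    obtain N where N: "\<And>n. n \<ge> N \<Longrightarrow> \<exists>E\<in>per. (\<forall>k. fourier_coeff E k = decay ((1 / real (Suc n))^4) k * fourier_coeff (\<lambda>x. exp (real (Suc n) * \<phi> x) * f x) k)
     \<and> hs 0 (\<lambda>k. cmod (fourier_coeff (\<lambda>x. exp (- real (Suc n) * \<phi> x) * E x - exp (- (b x ^ 4)) * f x) k)) \<epsilon>"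
      using conjugated_evolution_limit[OF f \<phi>p b d \<epsilon>] by blast
    have "(\<lambda>n. (1 / real (Suc n))^4) \<longlonglongrightarrow> 0" by real_asymp
    then have "\<forall>\<^sub>F n in sequentially. (1 / real (Suc n))^4 < T / 3"
      by (rule order_tendstoD(2)) (use T in simp)
    then obtain n0 where "\<And>n. n \<ge> n0 \<Longrightarrow> (1 / real (Suc n))^4 < T / 3" by (auto simp: eventually_sequentially)
    then obtain n where n: "n \<ge> N" "(1 / real (Suc n))^4 < T / 3" by (metis max.cobounded1 max.cobounded2)
    define \<tau> where "\<tau> = (1 / real (Suc n))^4"
    have \<tau>: "\<tau> > 0" "\<tau> \<le> T / 3" using n by (auto simp: \<tau>_def)
    define l where "l = real (Suc n)"
    obtain E where E: "E \<in> per" "\<And>k. fourier_coeff E k = decay \<tau> k * fourier_coeff (\<lambda>x. exp (l * \<phi> x) * f x) k"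
      "hs 0 (\<lambda>k. cmod (fourier_coeff (\<lambda>x. exp (- l * \<phi> x) * E x - exp (- (b x ^ 4)) * f x) k)) \<epsilon>"
      using N[OF n(1)] unfolding \<tau>_def l_def by blast
    have "steer (T/3) (fourier_coeff f) (fourier_coeff (\<lambda>x. exp (l * \<phi> x) * f x))"
      using lmults_mults[OF \<phi>, of l] f T unfolding mults_def small_def by auto
    moreover have "steer \<tau> (fourier_coeff (\<lambda>x. exp (l * \<phi> x) * f x)) (fourier_coeff E)"
    proof -
      have "fourier_coeff E = (\<lambda>k. decay \<tau> k * fourier_coeff (\<lambda>x. exp (l * \<phi> x) * f x) k)" using E(2) by blast
      then show ?thesis using steer_free[OF \<tau>(1)] by metis
    qed
    ultimately have "steer (2 * T/3) (fourier_coeff f) (fourier_coeff E)" by (rule steer_trans) (use \<tau> in auto)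
    moreover have "steer (T/3) (fourier_coeff E) (fourier_coeff (\<lambda>x. exp (- l * \<phi> x) * E x))"
      using lmults_mults[OF \<phi>, of "-l"] E(1) T unfolding mults_def small_def by auto
    ultimately have "steer T (fourier_coeff f) (fourier_coeff (\<lambda>x. exp (- l * \<phi> x) * E x))" by (rule steer_trans) simp
    then show "\<exists>h\<in>per. steer T (fourier_coeff f) (fourier_coeff h) \<and> hs 0 (\<lambda>k. cmod (fourier_coeff (\<lambda>x. h x - exp (- (b x ^ 4)) * f x) k)) \<epsilon>"
      using E(3) by (intro bexI[of _ "\<lambda>x. exp (- l * \<phi> x) * E x"]) (auto intro!: per_mult per_exp per_const per_uminus \<phi>p E)
  qed
qed

subsection \<open>Trigonometric polynomials of bounded degree\<close>

text \<open>Unlike \<open>tpoly\<close>, this keeps track of a bound \<open>m\<close> for the degree, which decides how many rotates are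
  needed for a constant sum.\<close>

inductive tpd :: "nat \<Rightarrow> (real \<Rightarrow> complex) \<Rightarrow> bool" for m where
  mono: "\<bar>k\<bar> \<le> int m \<Longrightarrow> tpd m (\<lambda>x. c * cis (of_int k * x))"
| add: "tpd m f \<Longrightarrow> tpd m g \<Longrightarrow> tpd m (\<lambda>x. f x + g x)"

lemma tpd_mult: assumes "tpd m f" "tpd l g" shows "tpd (m + l) (\<lambda>x. f x * g x)"
  using assms(1)
proof induction
  case (mono k c)
  from assms(2) show ?case
  proof induction
    case (mono j d)
    have "(\<lambda>x. c * cis (of_int k * x) * (d * cis (of_int j * x))) = (\<lambda>x. (c * d) * cis (of_int (k + j) * x))"
      by (auto simp: distrib_right cis_mult[symmetric])
    then show ?case using tpd.mono[of "k + j" "m + l" "c * d"] mono \<open>\<bar>k\<bar> \<le> int m\<close> by simp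
  next
    case (add f g) then show ?case using tpd.add by (simp add: distrib_left)
  qed
next
  case (add f g) then show ?case using tpd.add by (simp add: distrib_right)
qed

lemma tpd_cmult: "tpd m f \<Longrightarrow> tpd m (\<lambda>x. a * f x)"
proof (induction rule: tpd.induct)
  case (mono k c) then show ?case using tpd.mono[of k m "a * c"] by (simp add: mult.assoc)
next
  case (add f g) then show ?case using tpd.add by (simp add: distrib_left)
qed

lemma tpd_shift: "tpd m f \<Longrightarrow> tpd m (\<lambda>x. f (x + y))"
proof (induction rule: tpd.induct)
  case (mono k c)
  have "(\<lambda>x. c * cis (of_int k * (x + y))) = (\<lambda>x. (c * cis (of_int k * y)) * cis (of_int k * x))"
    by (auto simp: distrib_left cis_mult[symmetric])
  then show ?case using tpd.mono[OF mono, of "c * cis (of_int k * y)"] by simp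
qed (rule tpd.add)

lemma tpoly_tpd: "tpoly f \<Longrightarrow> \<exists>m. tpd m f"
proof (induction rule: tpoly.induct)
  case (mono c k) show ?case using tpd.mono[of k "nat \<bar>k\<bar>" c] by auto
next
  case (add f g)
  have mono: "tpd m h \<Longrightarrow> tpd (m + l) h" for m l h
  proof (induction rule: tpd.induct)
    case (mono k c) then show ?case by (intro tpd.mono) simp
  qed (rule tpd.add)
  from add obtain m l where "tpd m f" "tpd l g" by blast
  then have "tpd (m + l) f" "tpd (l + m) g" by (auto intro: mono)
  then show ?case using tpd.add by (metis add.commute)
qed

lemma tpd_cos: "k \<le> m \<Longrightarrow> tpd m (\<lambda>x. of_real (cos (real k * x)))"
  and tpd_sin: "k \<le> m \<Longrightarrow> tpd m (\<lambda>x. of_real (sin (real k * x)))"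
proof -
  assume k: "k \<le> m"
  have "(\<lambda>x. complex_of_real (cos (real k * x))) = (\<lambda>x. (1/2) * cis (of_int (int k) * x) + (1/2) * cis (of_int (- int k) * x))"
    by (auto simp: fun_eq_iff complex_eq_iff)
  then show "tpd m (\<lambda>x. of_real (cos (real k * x)))"
    using tpd.add[OF tpd.mono[of "int k" m "1/2"] tpd.mono[of "- int k" m "1/2"]] k by simp
  have "(\<lambda>x. complex_of_real (sin (real k * x))) = (\<lambda>x. (-\<i>/2) * cis (of_int (int k) * x) + (\<i>/2) * cis (of_int (- int k) * x))"
    by (auto simp: fun_eq_iff complex_eq_iff)
  then show "tpd m (\<lambda>x. of_real (sin (real k * x)))"
    using tpd.add[OF tpd.mono[of "int k" m "-\<i>/2"] tpd.mono[of "- int k" m "\<i>/2"]] k by simp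
qed

text \<open>Summing over \<open>N\<close> equidistant rotates annihilates every frequency that is not a multiple of \<open>N\<close>.\<close>

lemma rotation_sum_const:
  assumes "tpd m f" "m < N"
  shows "\<exists>C. \<forall>x. (\<Sum>j<N. f (x + 2 * pi * real j / real N)) = C"
  using assms(1)
proof induction
  case (mono k c)
  show ?case
  proof (cases "k = 0")
    case False
    let ?z = "cis (2 * pi * of_int k / real N)"
    have N: "N > 0" using assms(2) by simp
    have "cis (of_int k * (x + 2 * pi * real j / real N)) = cis (of_int k * x) * ?z ^ j" for x j
    proof -
      have "?z ^ j = cis (real j * (2 * pi * of_int k / real N))" by (rule Complex.DeMoivre)
      moreover have "of_int k * (x + 2 * pi * real j / real N) = of_int k * x + real j * (2 * pi * of_int k / real N)"
        using N by (simp add: field_simps)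
      ultimately show ?thesis by (simp only: cis_mult)
    qed
    then have 1: "(\<Sum>j<N. c * cis (of_int k * (x + 2 * pi * real j / real N))) = c * cis (of_int k * x) * (\<Sum>j<N. ?z ^ j)" for x
      by (simp add: sum_distrib_left mult.assoc)
    have "?z ^ N = 1" using N cis_multiple_2pi[of "of_int k"] by (simp add: Complex.DeMoivre)
    moreover have "?z \<noteq> 1"
    proof
      assume "?z = 1"
      then have "cis 0 = ?z" by simp
      from cis_eq_shift[OF this] obtain n :: int where "2 * pi * of_int k / real N = 0 + 2 * pi * of_int n" by blast
      then have "2 * pi * of_int k = 2 * pi * (of_int n * real N)" using N by (simp add: field_simps)
      then have "real_of_int k = real_of_int n * real N" by simp
      then have "real_of_int k = real_of_int (n * int N)" by simp
      then have k: "k = n * int N" by (simp only: of_int_eq_iff)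
      then have "n \<noteq> 0" using False by auto
      then have "\<bar>k\<bar> \<ge> int N" unfolding k abs_mult using mult_right_mono[of 1 "\<bar>n\<bar>" "int N"] by simp
      then show False using mono assms(2) by simp
    qed
    ultimately have "(\<Sum>j<N. ?z ^ j) = 0" by (simp add: geometric_sum)
    then show ?thesis unfolding 1 by auto
  qed auto
next
  case (add f g)
  then obtain C D where "\<And>x. (\<Sum>j<N. f (x + 2 * pi * real j / real N)) = C" "\<And>x. (\<Sum>j<N. g (x + 2 * pi * real j / real N)) = D" by blast
  then show ?case by (auto simp: sum.distrib)
qed

definition rtp :: "nat \<Rightarrow> (real \<Rightarrow> real) set" where
  "rtp m = {f. tpd m (\<lambda>x. of_real (f x))}"

lemma tpd_cont: "tpd m f \<Longrightarrow> continuous_on S f"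
  by (induction rule: tpd.induct) (auto intro!: continuous_intros)

lemma tpd_periodic: "tpd m f \<Longrightarrow> f (x + 2 * pi) = f x"
proof (induction rule: tpd.induct)
  case (mono k c)
  have "cis (of_int k * (x + 2*pi)) = cis (of_int k * x)"
    using cis_multiple_2pi[of "of_int k"] by (simp add: distrib_left cis_mult[symmetric] mult_ac)
  then show ?case by simp
qed simp

lemma rtp_per: assumes "f \<in> rtp m" shows "f \<in> per"
proof -
  have t: "tpd m (\<lambda>x. of_real (f x))" using assms by (simp add: rtp_def)
  have "continuous_on UNIV (\<lambda>x. Re (of_real (f x)))" by (intro continuous_on_Re tpd_cont[OF t])
  moreover have "f (x + 2*pi) = f x" for x using tpd_periodic[OF t, of x] by simp
  ultimately show ?thesis by (simp add: per_def)
qed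

lemma rtp_add: "f \<in> rtp m \<Longrightarrow> g \<in> rtp m \<Longrightarrow> (\<lambda>x. f x + g x) \<in> rtp m"
  using tpd.add by (simp add: rtp_def)

lemma rtp_scale: "f \<in> rtp m \<Longrightarrow> (\<lambda>x. a * f x) \<in> rtp m"
  using tpd_cmult by (simp add: rtp_def)

lemma rtp_shift: "f \<in> rtp m \<Longrightarrow> (\<lambda>x. f (x + y)) \<in> rtp m"
  using tpd_shift by (simp add: rtp_def)

lemma rtp_lmults:
  assumes "\<And>k. k \<le> n \<Longrightarrow> (\<lambda>x. cos (real k * x)) \<in> lmults" "\<And>k. k \<le> n \<Longrightarrow> (\<lambda>x. sin (real k * x)) \<in> lmults"
    and "f \<in> rtp n"
  shows "f \<in> lmults"
proof -
  have "(\<lambda>x. Re (g x)) \<in> lmults" if "tpd n g" for g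
    using that
  proof induction
    case (mono k c)
    define l where "l = nat \<bar>k\<bar>"
    have l: "l \<le> n" using mono by (simp add: l_def)
    have eq: "(\<lambda>x. Re (c * cis (of_int k * x))) = (\<lambda>x. Re c * cos (real l * x) + (- Im c * sgn (of_int k)) * sin (real l * x))"
      by (rule ext, cases "k \<ge> 0"; cases "k = 0") (auto simp: l_def)
    show ?case unfolding eq by (intro lmults_add lmults_scale assms l)
  next
    case (add f g) then show ?case using lmults_add by simp
  qed
  from this[of "\<lambda>x. of_real (f x)"] assms(3) show ?thesis by (simp add: rtp_def)
qed

text \<open>Trigonometric polynomials of degree at most \<open>n\<close> without constant term, in the form in which they
  serve as derivatives of exponents.\<close>

definition derivs :: "nat \<Rightarrow> (real \<Rightarrow> real) set" where
  "derivs n = {b. b \<in> rtp n \<and> (\<exists>\<phi>\<in>rtp n. \<forall>x. (\<phi> has_real_derivative b x) (at x))}"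

lemma derivs_add: assumes "b \<in> derivs n" "c \<in> derivs n" shows "(\<lambda>x. b x + c x) \<in> derivs n"
proof -
  obtain \<phi> \<psi> where "\<phi> \<in> rtp n" "\<psi> \<in> rtp n" "\<And>x. (\<phi> has_real_derivative b x) (at x)" "\<And>x. (\<psi> has_real_derivative c x) (at x)"
    using assms unfolding derivs_def by blast
  then show ?thesis using assms unfolding derivs_def
    by (auto intro!: rtp_add bexI[of _ "\<lambda>x. \<phi> x + \<psi> x"] DERIV_add)
qed

lemma derivs_scale: assumes "b \<in> derivs n" shows "(\<lambda>x. a * b x) \<in> derivs n"
proof -
  obtain \<phi> where "\<phi> \<in> rtp n" "\<And>x. (\<phi> has_real_derivative b x) (at x)" using assms unfolding derivs_def by blast
  then show ?thesis using assms unfolding derivs_def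
    by (auto intro!: rtp_scale bexI[of _ "\<lambda>x. a * \<phi> x"] DERIV_cmult)
qed

lemma derivs_shift: assumes "b \<in> derivs n" shows "(\<lambda>x. b (x + y)) \<in> derivs n"
proof -
  obtain \<phi> where "\<phi> \<in> rtp n" "\<And>x. (\<phi> has_real_derivative b x) (at x)" using assms unfolding derivs_def by blast
  then show ?thesis using assms unfolding derivs_def
    by (auto intro!: rtp_shift bexI[of _ "\<lambda>x. \<phi> (x + y)"] DERIV_shift[THEN iffD1])
qed

lemma derivs_cos: assumes "1 \<le> k" "k \<le> n" shows "(\<lambda>x. cos (real k * x)) \<in> derivs n"
proof -
  have "((\<lambda>x. (1 / real k) * sin (real k * x)) has_real_derivative cos (real k * x)) (at x)" for x
    using assms by (auto intro!: derivative_eq_intros)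
  moreover have "(\<lambda>x. (1 / real k) * sin (real k * x)) \<in> rtp n" using tpd_sin assms by (intro rtp_scale) (simp add: rtp_def)
  ultimately show ?thesis using tpd_cos[of k n] assms unfolding derivs_def rtp_def by blast
qed

lemma derivs_sin: assumes "1 \<le> k" "k \<le> n" shows "(\<lambda>x. sin (real k * x)) \<in> derivs n"
proof -
  have "((\<lambda>x. (- 1 / real k) * cos (real k * x)) has_real_derivative sin (real k * x)) (at x)" for x
    using assms by (auto intro!: derivative_eq_intros)
  moreover have "(\<lambda>x. (- 1 / real k) * cos (real k * x)) \<in> rtp n" using tpd_cos assms by (intro rtp_scale) (simp add: rtp_def)
  ultimately show ?thesis using tpd_sin[of k n] assms unfolding derivs_def rtp_def by blast
qed

text \<open>Fourth powers are at first available with a negative sign only.  But the rotates of \<open>b\<^sup>4\<close> add up to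
  a constant, so \<open>b\<^sup>4\<close> is a constant minus fourth powers, and the sign restriction disappears.\<close>

lemma quartic_lmults:
  assumes L: "rtp n \<subseteq> lmults" and b: "b \<in> derivs n"
  shows "(\<lambda>x. b x ^ 4) \<in> lmults"
proof -
  have neg: "(\<lambda>x. - (c x ^ 4)) \<in> mults" if "c \<in> derivs n" for c
    using that L rtp_per quartic_mults unfolding derivs_def by blast
  have zero: "(\<lambda>x. 0) \<in> mults" using lmults_mults[OF const_lmults[of 0], of 0] by simp
  have root: "(root 4 r) ^ 4 = r" if "r \<ge> 0" for r using that by (intro real_root_pow_pos2) auto
  have negr: "(\<lambda>x. - r * c x ^ 4) \<in> mults" if "c \<in> derivs n" "r \<ge> 0" for c r
    using neg[OF derivs_scale[OF that(1), of "root 4 r"]] root[OF that(2)] by (simp add: power_mult_distrib)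
  have posr: "(\<lambda>x. r * b x ^ 4) \<in> mults" if r: "r \<ge> 0" for r
  proof -
    \<comment> \<open>more rotates than the degree of the fourth power\<close>
    define N where "N = Suc (n + n + (n + n))"
    have t: "tpd n (\<lambda>x. of_real (b x))" using b by (simp add: derivs_def rtp_def)
    have "tpd (n + n + (n + n)) (\<lambda>x. (of_real (b x) * of_real (b x)) * (of_real (b x) * of_real (b x)))"
      by (intro tpd_mult t)
    moreover have "(\<lambda>x. (of_real (b x) * of_real (b x)) * (of_real (b x) * of_real (b x))) = (\<lambda>x. complex_of_real (b x ^ 4))"
      by (simp add: power4_eq_xxxx mult.assoc)
    ultimately have "tpd (n + n + (n + n)) (\<lambda>x. complex_of_real (b x ^ 4))" by (simp only:)
    moreover have "n + n + (n + n) < N" by (simp add: N_def)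
    ultimately obtain C where C: "\<And>x. (\<Sum>j<N. complex_of_real (b (x + 2 * pi * real j / real N) ^ 4)) = C"
      using rotation_sum_const by blast
    then have C: "(\<Sum>j<N. b (x + 2 * pi * real j / real N) ^ 4) = Re C" for x
      by (metis Re_complex_of_real of_real_sum)
    have sp: "(\<Sum>j<N. b (x + 2 * pi * real j / real N) ^ 4) = b x ^ 4 + (\<Sum>j\<in>{1..<N}. b (x + 2 * pi * real j / real N) ^ 4)" for x
      unfolding lessThan_atLeast0 by (subst sum.atLeast_Suc_lessThan) (auto simp: N_def)
    have e: "r * b x ^ 4 = r * Re C + (\<Sum>j\<in>{1..<N}. - r * b (x + 2 * pi * real j / real N) ^ 4)" for x
    proof -
      define Y where "Y = (\<Sum>j\<in>{1..<N}. b (x + 2 * pi * real j / real N) ^ 4)"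
      have "b x ^ 4 + Y = Re C" using C[of x] sp[of x] by (simp only: Y_def)
      then have "r * b x ^ 4 = r * Re C + - r * Y" by (simp only: flip: \<open>b x ^ 4 + Y = Re C\<close>) (simp add: algebra_simps)
      then show ?thesis unfolding Y_def sum_distrib_left .
    qed
    have "(\<lambda>x. r * Re C + (\<Sum>j\<in>{1..<N}. - r * b (x + 2 * pi * real j / real N) ^ 4)) \<in> mults"
    proof (intro mults_add mults_sum zero)
      show "(\<lambda>x. r * Re C) \<in> mults" using lmults_mults[OF const_lmults, of r "Re C"] .
      show "(\<lambda>x. - r * b (x + 2 * pi * real j / real N) ^ 4) \<in> mults" for j
        by (rule negr[OF derivs_shift[OF b] r])
    qed simp
    then show ?thesis unfolding e[symmetric] .
  qed
  have "(\<lambda>x. a * b x ^ 4) \<in> mults" for a using posr[of a] negr[OF b, of "-a"] by (cases "a \<ge> 0") auto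
  moreover have "(\<lambda>x. b x ^ 4) \<in> per" using b rtp_per by (auto simp: derivs_def intro!: per_power)
  ultimately show ?thesis by (simp add: lmults_def)
qed

text \<open>The polarization \<open>48 f\<^sup>3 g = 8 ((f+g)\<^sup>4 - (f-g)\<^sup>4) - ((f+2g)\<^sup>4 - (f-2g)\<^sup>4)\<close>.\<close>

lemma cubic_lmults:
  assumes L: "rtp n \<subseteq> lmults" and f: "f \<in> derivs n" and g: "g \<in> derivs n"
  shows "(\<lambda>x. f x ^ 3 * g x) \<in> lmults"
proof -
  have q: "(\<lambda>x. (f x + a * g x) ^ 4) \<in> lmults" for a
    by (intro quartic_lmults[OF L] derivs_add derivs_scale f g)
  have "(\<lambda>x. (8 / 48) * ((f x + 1 * g x) ^ 4 - (f x + (-1) * g x) ^ 4) - (1 / 48) * ((f x + 2 * g x) ^ 4 - (f x + (-2) * g x) ^ 4)) \<in> lmults"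
    by (intro lmults_diff lmults_scale q)
  moreover have "(8 / 48) * ((x + 1 * y) ^ 4 - (x + (-1) * y) ^ 4) - (1 / 48) * ((x + 2 * y) ^ 4 - (x + (-2) * y) ^ 4) = x ^ 3 * y" for x y :: real
    by (simp add: power4_eq_xxxx power3_eq_cube field_simps)
  ultimately show ?thesis by simp
qed

text \<open>With \<open>cos\<^sup>3 x = (3 cos x + cos 3x)/4\<close> and \<open>sin\<^sup>3 x = (3 sin x - sin 3x)/4\<close>, the combination
  \<open>cos\<^sup>3 x cos n x - sin\<^sup>3 x sin n x\<close> equals \<open>(3 cos (n+1)x + cos (n-3)x)/4\<close>, and similarly for the sine.
  So the frequency \<open>n + 1\<close> is obtained from cubic products of degree at most \<open>n\<close> and from the
  frequency \<open>|n - 3|\<close>, which is lower unless \<open>n = 1\<close>.\<close>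

lemma cos_sin_lmults: "(\<lambda>x. cos (real n * x)) \<in> lmults \<and> (\<lambda>x. sin (real n * x)) \<in> lmults"
proof (induction n rule: less_induct)
  case (less m)
  consider "m = 0" | "m = 1" | "m \<ge> 2" by linarith
  then show ?case
  proof cases
    case 1 then show ?thesis using const_lmults[of 0] const_lmults[of 1] by simp
  next
    case 2 then show ?thesis using cos_lmults sin_lmults by simp
  next
    case 3
    define n where "n = m - 1"
    have n: "1 \<le> n" "m = Suc n" using 3 by (auto simp: n_def)
    have L: "rtp n \<subseteq> lmults" using rtp_lmults[of n] less n by force
    note c1 = derivs_cos[of 1 n, simplified] and s1 = derivs_sin[of 1 n, simplified]
    note cn = derivs_cos[OF n(1) order_refl] and sn = derivs_sin[OF n(1) order_refl]
    have A: "(\<lambda>x. cos x ^ 3 * cos (real n * x) - sin x ^ 3 * sin (real n * x)) \<in> lmults"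
      by (intro lmults_diff cubic_lmults[OF L] c1 s1 cn sn) (use n in auto)
    have B: "(\<lambda>x. cos x ^ 3 * sin (real n * x) + sin x ^ 3 * cos (real n * x)) \<in> lmults"
      by (intro lmults_add cubic_lmults[OF L] c1 s1 cn sn) (use n in auto)
    have cos3: "cos (3 * x) = 4 * cos x ^ 3 - 3 * cos x" and sin3: "sin (3 * x) = 3 * sin x - 4 * sin x ^ 3" for x :: real
    proof -
      have "cos (3 * x) = cos (2 * x + x)" "sin (3 * x) = sin (2 * x + x)" by (simp_all add: algebra_simps)
      then show "cos (3 * x) = 4 * cos x ^ 3 - 3 * cos x" "sin (3 * x) = 3 * sin x - 4 * sin x ^ 3"
        unfolding cos_add sin_add cos_double sin_double using sin_cos_squared_add[of x] by algebra+
    qed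
    have cm: "cos (real m * x) = (4/3) * (cos x ^ 3 * cos (real n * x) - sin x ^ 3 * sin (real n * x)) + (- (1/3)) * cos ((real n - 3) * x)"
     and sm: "sin (real m * x) = (4/3) * (cos x ^ 3 * sin (real n * x) + sin x ^ 3 * cos (real n * x)) + (- (1/3)) * sin ((real n - 3) * x)" for x
    proof -
      have "real m * x = real n * x + x" "(real n - 3) * x = real n * x - 3 * x" using n by (simp_all add: algebra_simps)
      then show "cos (real m * x) = (4/3) * (cos x ^ 3 * cos (real n * x) - sin x ^ 3 * sin (real n * x)) + (- (1/3)) * cos ((real n - 3) * x)"
         "sin (real m * x) = (4/3) * (cos x ^ 3 * sin (real n * x) + sin x ^ 3 * cos (real n * x)) + (- (1/3)) * sin ((real n - 3) * x)"
        by (simp_all only: cos_add sin_add cos_diff sin_diff cos3 sin3) (simp_all add: field_simps)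
    qed
    show ?thesis
    \<comment> \<open>for \<open>n = 1\<close> the frequencies \<open>n + 1\<close> and \<open>|n - 3|\<close> coincide and the identity is solved for them\<close>
    proof (cases "n = 1")
      case True
      have solve: "\<lbrakk>c = (4/3) * a + (- (1/3)) * d; d = c\<rbrakk> \<Longrightarrow> c = a"
        and solve': "\<lbrakk>c = (4/3) * a + (- (1/3)) * d; d = - c\<rbrakk> \<Longrightarrow> c = 2 * a" for a c d :: real
        by linarith+
      have "cos (real m * x) = cos x ^ 3 * cos (real n * x) - sin x ^ 3 * sin (real n * x)" for x
      proof -
        have "cos ((real n - 3) * x) = cos (real m * x)" using True n cos_minus[of "2 * x"] by simp
        then show ?thesis by (rule solve[OF cm])
      qed
      moreover have "sin (real m * x) = 2 * (cos x ^ 3 * sin (real n * x) + sin x ^ 3 * cos (real n * x))" for x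
      proof -
        have "sin ((real n - 3) * x) = - sin (real m * x)" using True n sin_minus[of "2 * x"] by simp
        then show ?thesis by (rule solve'[OF sm])
      qed
      ultimately show ?thesis using A lmults_scale[OF B, of 2] by simp
    next
      case False
      define l where "l = nat \<bar>int n - 3\<bar>"
      have l: "l < m" using False n by (auto simp: l_def)
      have "cos ((real n - 3) * x) = cos (real l * x)" "sin ((real n - 3) * x) = sgn (real n - 3) * sin (real l * x)" for x
      proof -
        have "real l = \<bar>real n - 3\<bar>" by (simp add: l_def)
        then show "cos ((real n - 3) * x) = cos (real l * x)" "sin ((real n - 3) * x) = sgn (real n - 3) * sin (real l * x)"
          using cos_minus[of "(real n - 3) * x"] sin_minus[of "(real n - 3) * x"]
          by (cases "real n - 3 > 0"; cases "real n - 3 = 0"; simp add: abs_if sgn_if left_diff_distrib)+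
      qed
      then have *: "(\<lambda>x. cos ((real n - 3) * x)) \<in> lmults" "(\<lambda>x. sin ((real n - 3) * x)) \<in> lmults"
        using less[OF l] lmults_scale by simp_all
      show ?thesis unfolding cm sm by (intro conjI lmults_add lmults_scale A B *)
    qed
  qed
qed

lemma per_lmults: assumes "u \<in> per" shows "u \<in> lmults"
proof (rule lmults_closed[OF assms])
  fix e :: real assume "e > 0"
  then obtain g where g: "tpoly (\<lambda>x. of_real (g x))" "\<And>x. \<bar>u x - g x\<bar> < e" using tpoly_dense[OF assms] by blast
  from tpoly_tpd[OF g(1)] obtain m where "g \<in> rtp m" by (auto simp: rtp_def)
  then have "g \<in> lmults" by (rule rtp_lmults[rotated 2]) (use cos_sin_lmults in auto)
  then show "\<exists>g\<in>lmults. \<forall>x. \<bar>u x - g x\<bar> < e" using g by blast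
qed

text \<open>The exponents \<open>ln ((|v| + 1/n) / (|u| + 1/n))\<close> are continuous even where \<open>u\<close> and \<open>v\<close> vanish, and
  \<open>exp \<phi>\<^sub>n u\<close> stays bounded and tends to \<open>sgn u |v| = v\<close> at every point.  It need not
  be uniform, which is why the target is reached in \<open>L\<^sup>2\<close>.\<close>

lemma same_sign_small:
  assumes u: "u \<in> per" and v: "v \<in> per" and sg: "\<And>x. sgn (u x) = sgn (v x)"
  shows "small (fourier_coeff u) (fourier_coeff v)"
  unfolding small_def
proof (intro allI impI steer_per_close v)
  fix T \<epsilon> :: real assume T: "T > 0" and \<epsilon>: "\<epsilon> > 0"
  define \<phi> where "\<phi> n x = ln ((\<bar>v x\<bar> + 1 / real (Suc n)) / (\<bar>u x\<bar> + 1 / real (Suc n)))" for n x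
  have pos: "\<bar>w\<bar> + 1 / real (Suc n) > 0" for w n by (simp add: add_nonneg_pos)
  have \<phi>: "\<phi> n \<in> per" for n
    unfolding per_def \<phi>_def
  proof (intro CollectI conjI allI continuous_intros per_cont u v)
    show "\<forall>x\<in>UNIV. \<bar>u x\<bar> + 1 / real (Suc n) \<noteq> 0" using pos[of "u x" n for x] by (metis less_irrefl)
    show "\<forall>x\<in>UNIV. (\<bar>v x\<bar> + 1 / real (Suc n)) / (\<bar>u x\<bar> + 1 / real (Suc n)) \<noteq> 0" using pos by (metis divide_pos_pos less_irrefl)
  qed (use per_add[OF u] per_add[OF v] in auto)
  define G where "G n x = exp (\<phi> n x) * u x - v x" for n x
  have ex: "exp (\<phi> n x) * u x = (\<bar>v x\<bar> + 1 / real (Suc n)) * (u x / (\<bar>u x\<bar> + 1 / real (Suc n)))" for n x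
    unfolding \<phi>_def using pos[of "u x" n] pos[of "v x" n] by (subst exp_ln) (auto simp del: of_nat_Suc)
  obtain B where B: "B > 0" "\<And>x. \<bar>v x\<bar> \<le> B" using per_bounded[OF v] by blast
  have Gper: "G n \<in> per" for n unfolding G_def by (intro per_diff per_mult per_exp \<phi> u v)
  have Gb: "\<bar>G n x\<bar> \<le> 2 * B + 1" for n x
  proof -
    have "\<bar>u x / (\<bar>u x\<bar> + 1 / real (Suc n))\<bar> \<le> 1" using pos[of "u x" n] by (simp add: abs_divide del: of_nat_Suc)
    moreover have "\<bar>\<bar>v x\<bar> + 1 / real (Suc n)\<bar> \<le> B + 1" using B(2)[of x] by (simp add: add_mono)
    ultimately have "\<bar>exp (\<phi> n x) * u x\<bar> \<le> (B + 1) * 1" unfolding ex abs_mult using B by (intro mult_mono) auto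
    then have "\<bar>exp (\<phi> n x) * u x - v x\<bar> \<le> (B + 1) * 1 + B"
      by (intro order_trans[OF abs_triangle_ineq4 add_mono] B)
    then show ?thesis unfolding G_def by simp
  qed
  have Gl: "(\<lambda>n. G n x) \<longlonglongrightarrow> 0" for x
  proof (cases "u x = 0")
    case True
    then have "v x = 0" using sg[of x] by (simp add: sgn_0_0)
    then show ?thesis using True by (simp add: G_def)
  next
    case False
    have z: "(\<lambda>n. 1 / real (Suc n)) \<longlonglongrightarrow> 0" by real_asymp
    have "(\<lambda>n. (\<bar>v x\<bar> + 1 / real (Suc n)) * (u x / (\<bar>u x\<bar> + 1 / real (Suc n))) - v x) \<longlonglongrightarrow> (\<bar>v x\<bar> + 0) * (u x / (\<bar>u x\<bar> + 0)) - v x"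
      by (intro tendsto_diff tendsto_mult tendsto_add tendsto_divide tendsto_const z) (use False in simp)
    moreover have "\<bar>v x\<bar> * (u x / \<bar>u x\<bar>) = v x"
    proof -
      have "u x / \<bar>u x\<bar> = sgn (u x)" by (metis abs_mult_sgn False mult.commute nonzero_mult_div_cancel_right abs_0_eq)
      then show ?thesis using sg[of x] by (simp add: abs_mult_sgn)
    qed
    ultimately show ?thesis unfolding G_def ex by simp
  qed
  obtain N where N: "\<And>n. n \<ge> N \<Longrightarrow> hs 0 (\<lambda>k. cmod (fourier_coeff (G n) k)) \<epsilon>"
    using L2_dominated_null[OF Gper Gb Gl \<epsilon>] by blast
  have "(\<lambda>x. 1 * \<phi> N x) \<in> mults" by (rule lmults_mults[OF per_lmults[OF \<phi>]])
  then have "steer T (fourier_coeff u) (fourier_coeff (\<lambda>x. exp (\<phi> N x) * u x))" using T u by (simp add: mults_def small_def)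
  then show "\<exists>h\<in>per. steer T (fourier_coeff u) (fourier_coeff h) \<and> hs 0 (\<lambda>k. cmod (fourier_coeff (\<lambda>x. h x - v x) k)) \<epsilon>"
    using N[OF order_refl] unfolding G_def by (intro bexI[of _ "\<lambda>x. exp (\<phi> N x) * u x"]) (auto intro!: per_mult per_exp \<phi> u)
qed

section \<open>The nonlinear equation with a time-dependent factor\<close>

subsection \<open>Piecewise continuous functions of time\<close>

lemma continuous_on_isCont: "continuous_on {0..\<tau>} f \<Longrightarrow> t \<in> {0<..<\<tau>} \<Longrightarrow> isCont f t" for \<tau> t :: real
  by (rule continuous_on_interior) auto

lemma pcont_integrable:
  fixes g :: "real \<Rightarrow> 'a::euclidean_space"
  assumes "pcont \<tau> g" shows "set_integrable lborel {0..\<tau>} g"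
proof -
  obtain B S where B: "\<And>t. t \<in> {0..\<tau>} \<Longrightarrow> norm (g t) \<le> B" and S: "finite S" "\<And>t. t \<in> {0<..<\<tau>} - S \<Longrightarrow> isCont g t"
    using assms unfolding pcont_def by metis
  let ?U = "{0<..<\<tau>} - S"
  have "continuous_on ?U g" by (intro continuous_at_imp_continuous_on ballI S)
  moreover have Um: "?U \<in> sets borel" by (intro sets.Diff borel_open borel_closed finite_imp_closed S) auto
  ultimately have m: "(\<lambda>x. indicator ?U x *\<^sub>R g x) \<in> borel_measurable borel"
    by (intro borel_measurable_continuous_on_indicator)
  have i: "integrable lborel (\<lambda>x. indicator ?U x *\<^sub>R g x)"
  proof (rule integrableI_bounded_set[where A="{0..\<tau>}" and B=B])
    show "emeasure lborel {0..\<tau>} < \<infinity>" by (simp add: emeasure_lborel_Icc_eq)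
    show "AE x in lborel. x \<in> {0..\<tau>} \<longrightarrow> norm (indicator ?U x *\<^sub>R g x) \<le> B"
    proof (rule AE_I2, rule impI)
      fix x assume "x \<in> {0..\<tau>}"
      then show "norm (indicator ?U x *\<^sub>R g x) \<le> B" using B[of x] order_trans[OF norm_ge_zero B[of x]] by (auto simp: indicator_def)
    qed
  qed (use m in \<open>auto simp: indicator_def\<close>)
  have "integrable lborel (\<lambda>x. indicator {0..\<tau>} x *\<^sub>R g x) \<longleftrightarrow> integrable lborel (\<lambda>x. indicator ?U x *\<^sub>R g x)"
    by (rule integrable_discrete_difference[where X="insert 0 (insert \<tau> S)"])
       (use S in \<open>auto simp: indicator_def countable_finite\<close>)
  then show ?thesis unfolding set_integrable_def using i by simp
qed

lemma pcont_cont: "continuous_on {0..\<tau>} f \<Longrightarrow> pcont \<tau> f"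
  unfolding pcont_def
proof (intro conjI exI[of _ "{}"])
  assume c: "continuous_on {0..\<tau>} f"
  have "bounded (f ` {0..\<tau>})" by (intro compact_imp_bounded compact_continuous_image c compact_Icc)
  then show "\<exists>B. \<forall>t\<in>{0..\<tau>}. norm (f t) \<le> B" unfolding bounded_iff by blast
qed (auto intro: continuous_on_isCont)

lemma duhamel_exists:
  fixes G :: "real \<Rightarrow> complex"
  assumes G: "set_integrable lborel {0..\<tau>} G" "\<And>t. t \<in> {0<..<\<tau>} - S \<Longrightarrow> isCont G t"
  shows "\<exists>y. continuous_on {0..\<tau>} y \<and> y 0 = y0 \<and> (\<forall>t\<in>{0<..<\<tau>} - S. (y has_vector_derivative (- of_real \<alpha> * y t + G t)) (at t))"
proof -
  let ?E = "\<lambda>r. complex_of_real (exp (\<alpha> * r))"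
  have Ec: "continuous_on A ?E" for A by (intro continuous_intros)
  have "set_integrable lborel {0..\<tau>} (\<lambda>r. ?E r * G r)"
  proof -
    obtain B where B: "\<And>r. r \<in> {0..\<tau>} \<Longrightarrow> norm (?E r) \<le> B"
      using compact_imp_bounded[OF compact_continuous_image[OF Ec compact_Icc, of 0 \<tau>]] unfolding bounded_iff by blast
    have "integrable lborel (\<lambda>x. B *\<^sub>R norm (indicator {0..\<tau>} x *\<^sub>R G x))"
      using G(1) unfolding set_integrable_def by (intro integrable_scaleR_right integrable_norm) auto
    then show ?thesis unfolding set_integrable_def
    proof (rule Bochner_Integration.integrable_bound)
      have "(\<lambda>x. ?E x * (indicator {0..\<tau>} x *\<^sub>R G x)) \<in> borel_measurable lborel"
        using G(1) borel_measurable_continuous_onI[OF Ec] unfolding set_integrable_def by (intro borel_measurable_times) auto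
      then show "(\<lambda>x. indicat_real {0..\<tau>} x *\<^sub>R (?E x * G x)) \<in> borel_measurable lborel" by simp
      show "AE x in lborel. norm (indicat_real {0..\<tau>} x *\<^sub>R (?E x * G x)) \<le> norm (B *\<^sub>R norm (indicator {0..\<tau>} x *\<^sub>R G x))"
      proof (rule AE_I2)
        fix x show "norm (indicat_real {0..\<tau>} x *\<^sub>R (?E x * G x)) \<le> norm (B *\<^sub>R norm (indicator {0..\<tau>} x *\<^sub>R G x))"
          using B[of x] order_trans[OF norm_ge_zero B[of x]] by (auto simp: indicator_def norm_mult intro!: mult_right_mono)
      qed
    qed
  qed
  then have hk: "(\<lambda>r. ?E r * G r) integrable_on {0..\<tau>}" by (rule set_borel_integral_eq_integral(1))
  define I where "I t = integral {0..t} (\<lambda>r. ?E r * G r)" for t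
  have Ic: "continuous_on {0..\<tau>} I" unfolding I_def by (rule indefinite_integral_continuous_1[OF hk])
  define y where "y t = of_real (exp (- \<alpha> * t)) * (y0 + I t)" for t
  show ?thesis
  proof (intro exI[of _ y] conjI ballI)
    show "continuous_on {0..\<tau>} y" unfolding y_def by (intro continuous_intros Ic)
    show "y 0 = y0" by (simp add: y_def I_def)
    fix t assume t: "t \<in> {0<..<\<tau>} - S"
    have "isCont (\<lambda>r. ?E r * G r) t" by (intro continuous_intros G t)
    then have "(I has_vector_derivative ?E t * G t) (at t within {0..\<tau>})"
      unfolding I_def using integral_has_vector_derivative_continuous_at[OF hk, of t "{}"] t by (auto intro: continuous_at_imp_continuous_at_within)
    then have Id: "(I has_vector_derivative ?E t * G t) (at t)"
      using t at_within_interior[of t "{0..\<tau>}"] by auto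
    have "((\<lambda>t. exp (- \<alpha> * t)) has_real_derivative - \<alpha> * exp (- \<alpha> * t)) (at t)" by (auto intro!: derivative_eq_intros)
    then have "((\<lambda>t. complex_of_real (exp (- \<alpha> * t))) has_vector_derivative of_real (- \<alpha> * exp (- \<alpha> * t))) (at t)"
      by (intro has_vector_derivative_of_real) (simp add: has_real_derivative_iff_has_vector_derivative)
    from has_vector_derivative_mult[OF this has_vector_derivative_add[OF has_vector_derivative_const[of y0] Id]]
    have "(y has_vector_derivative (of_real (exp (- \<alpha> * t)) * (0 + ?E t * G t) + of_real (- \<alpha> * exp (- \<alpha> * t)) * (y0 + I t))) (at t)"
      unfolding y_def .
    moreover have "complex_of_real (exp (- \<alpha> * t)) * ?E t = 1" by (simp flip: of_real_mult exp_add)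
    then have "of_real (exp (- \<alpha> * t)) * (0 + ?E t * G t) = G t" by (metis add_0 mult.assoc mult_1)
    moreover have "of_real (- \<alpha> * exp (- \<alpha> * t)) * (y0 + I t) = - of_real \<alpha> * y t" by (simp add: y_def)
    ultimately show "(y has_vector_derivative (- of_real \<alpha> * y t + G t)) (at t)"
      by (metis add.commute)
  qed
qed

subsection \<open>Convolution powers\<close>

lemma continuous_on_conv:
  fixes a b :: "real \<Rightarrow> int \<Rightarrow> complex"
  assumes "\<And>k. continuous_on T (\<lambda>t. a t k)" "\<And>k. continuous_on T (\<lambda>t. b t k)"
    and "\<And>t k. t \<in> T \<Longrightarrow> norm (a t k) \<le> A k" "\<And>t k. t \<in> T \<Longrightarrow> norm (b t k) \<le> B k" and "l1 A" "l1 B"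
  shows "continuous_on T (\<lambda>t. conv (a t) (b t) k)"
  unfolding conv_def
proof (rule uniform_limit_theorem[OF _ Weierstrass_m_test_general])
  show "(\<lambda>j. norm (A j * B (k - j))) summable_on UNIV" by (rule conv_summable[OF assms(5,6)])
  show "norm (a t j * b t (k - j)) \<le> norm (A j * B (k - j))" if "t \<in> T" for j t
  proof -
    have "norm (a t j * b t (k - j)) \<le> A j * B (k - j)"
      unfolding norm_mult using assms(3)[OF that, of j] by (intro mult_mono assms that order_trans[OF norm_ge_zero assms(3)[OF that, of j]]) auto
    then show ?thesis by simp
  qed
  show "\<forall>\<^sub>F F in finite_subsets_at_top UNIV. continuous_on T (\<lambda>t. \<Sum>j\<in>F. a t j * b t (k - j))"
    by (intro always_eventually allI continuous_intros assms)
qed auto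

lemma cpow_norm_le:
  fixes c :: "int \<Rightarrow> complex"
  assumes "l1 C" "\<And>k. norm (c k) \<le> C k" shows "norm (cpow n c k) \<le> cpow n C k"
proof (induction n arbitrary: k)
  case (Suc n)
  show ?case using norm_conv_le[OF assms(1) l1_cpow(1)[OF assms(1)] assms(2) Suc] by simp
qed auto

lemma cpow_nonneg: "(\<And>k. C k \<ge> 0) \<Longrightarrow> cpow n C k \<ge> (0::real)"
  by (induction n arbitrary: k) (auto intro: conv_nonneg)

lemma continuous_on_cpow:
  fixes c :: "real \<Rightarrow> int \<Rightarrow> complex"
  assumes "\<And>k. continuous_on T (\<lambda>t. c t k)" "\<And>t k. t \<in> T \<Longrightarrow> norm (c t k) \<le> C k" "l1 C"
  shows "continuous_on T (\<lambda>t. cpow n (c t) k)"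
proof (induction n arbitrary: k)
  case (Suc n)
  show ?case unfolding cpow.simps
    by (rule continuous_on_conv[OF assms(1) Suc assms(2) _ assms(3) l1_cpow(1)[OF assms(3), of n]])
       (auto intro: cpow_norm_le assms)
qed auto

lemma infsum_minus:
  fixes f g :: "'b \<Rightarrow> complex"
  assumes "f summable_on A" "g summable_on A"
  shows "(\<Sum>\<^sub>\<infinity>x\<in>A. f x - g x) = infsum f A - infsum g A"
  using infsum_add[OF assms(1) summable_on_uminus[THEN iffD2, OF assms(2)]] by (simp add: infsum_uminus)

lemma conv_diff:
  fixes a b c d :: "int \<Rightarrow> complex"
  assumes "l1 a" "l1 b" "l1 c" "l1 d"
  shows "conv a b k - conv c d k = conv (\<lambda>k. a k - c k) b k + conv c (\<lambda>k. b k - d k) k"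
proof -
  have s: "(\<lambda>j. x j * y (k - j)) summable_on UNIV" if "l1 x" "l1 y" for x y :: "int \<Rightarrow> complex"
    by (rule abs_summable_summable, rule conv_summable[OF that])
  have "conv (\<lambda>k. a k - c k) b k = conv a b k - conv c b k"
    unfolding conv_def left_diff_distrib by (intro infsum_minus s assms)
  moreover have "conv c (\<lambda>k. b k - d k) k = conv c b k - conv c d k"
    unfolding conv_def right_diff_distrib by (intro infsum_minus s assms)
  ultimately show ?thesis by simp
qed

lemma hs_unit: "hs s (\<lambda>k. if k = 0 then 1 else 0) 1"
  unfolding hs_def
proof (intro allI impI)
  fix F :: "int set" assume F: "finite F"
  have w0: "wt s 0 = 1" by (simp add: wt_def)
  have "(\<Sum>k\<in>F. (wt s k * (if k = 0 then 1 else 0))\<^sup>2) = (\<Sum>k\<in>F. if k = 0 then 1 else 0)"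
    by (intro sum.cong) (auto simp: w0)
  also have "\<dots> \<le> 1" using F by (simp add: sum.delta)
  finally show "L2_set (\<lambda>k. wt s k * (if k = 0 then 1 else 0)) F \<le> 1" by (simp add: L2_set_def)
qed

lemma hs_cpow:
  assumes K: "\<And>C D B B'. hs s C B \<Longrightarrow> hs s D B' \<Longrightarrow> (\<And>k. C k \<ge> 0) \<Longrightarrow> (\<And>k. D k \<ge> 0) \<Longrightarrow> hs s (conv C D) (K * B * B')"
    and C: "hs s C R" "\<And>k. C k \<ge> 0"
  shows "hs s (cpow n C) ((K * R) ^ n)"
proof (induction n)
  case 0 show ?case using hs_unit by simp
next
  case (Suc n)
  show ?case using K[OF C(1) Suc C(2) cpow_nonneg[OF C(2)]] by simp
qed

lemma cpow_lipschitz: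
  assumes s: "s > 1/2" and R: "R \<ge> 0"
  shows "\<exists>\<Lambda>\<ge>0. \<forall>C D B. hs s C R \<longrightarrow> hs s D B \<longrightarrow> (\<forall>k. C k \<ge> 0) \<longrightarrow> (\<forall>k. D k \<ge> 0) \<longrightarrow>
     (\<exists>E. (\<forall>k. E k \<ge> 0) \<and> hs s E (\<Lambda> * B) \<and> (\<forall>c d. (\<forall>k. cmod (c k) \<le> C k) \<longrightarrow> (\<forall>k. cmod (d k) \<le> C k) \<longrightarrow>
        (\<forall>k. cmod (c k - d k) \<le> D k) \<longrightarrow> (\<forall>k. cmod (cpow n c k - cpow n d k) \<le> E k)))"
proof (induction n)
  case 0
  show ?case by (rule exI[of _ 0]) (auto intro!: exI[of _ "\<lambda>_. 0"])
next
  case (Suc n)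
  obtain K where K: "K > 0" "\<And>C D B B'. hs s C B \<Longrightarrow> hs s D B' \<Longrightarrow> (\<And>k. C k \<ge> 0) \<Longrightarrow> (\<And>k. D k \<ge> 0) \<Longrightarrow> hs s (conv C D) (K * B * B')"
    using hs_conv[OF s] by blast
  obtain K1 where K1: "K1 > 0" "\<And>C B. hs s C B \<Longrightarrow> l1 C \<and> l1n C \<le> K1 * B" using hs_l1[OF s] by blast
  from Suc obtain \<Lambda> where \<Lambda>: "\<Lambda> \<ge> 0" "\<And>C D B. hs s C R \<Longrightarrow> hs s D B \<Longrightarrow> (\<forall>k. C k \<ge> 0) \<Longrightarrow> (\<forall>k. D k \<ge> 0) \<Longrightarrow>
     (\<exists>E. (\<forall>k. E k \<ge> 0) \<and> hs s E (\<Lambda> * B) \<and> (\<forall>c d. (\<forall>k. cmod (c k) \<le> C k) \<longrightarrow> (\<forall>k. cmod (d k) \<le> C k) \<longrightarrow>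
        (\<forall>k. cmod (c k - d k) \<le> D k) \<longrightarrow> (\<forall>k. cmod (cpow n c k - cpow n d k) \<le> E k)))" by blast
  let ?\<Lambda> = "K * (K * R) ^ n + K * R * \<Lambda>"
  show ?case
  proof (rule exI[of _ ?\<Lambda>], intro conjI allI impI)
    show "?\<Lambda> \<ge> 0" using K R \<Lambda> by simp
    fix C D B assume C: "hs s C R" and D: "hs s D B" and C0: "\<forall>k. C k \<ge> 0" and D0: "\<forall>k. D k \<ge> 0"
    obtain E where E: "\<And>k. E k \<ge> 0" "hs s E (\<Lambda> * B)" "\<And>c d. (\<forall>k. cmod (c k) \<le> C k) \<Longrightarrow> (\<forall>k. cmod (d k) \<le> C k) \<Longrightarrow>
        (\<forall>k. cmod (c k - d k) \<le> D k) \<Longrightarrow> (\<forall>k. cmod (cpow n c k - cpow n d k) \<le> E k)"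
      using \<Lambda>(2)[OF C D C0 D0] by blast
    have C0': "C k \<ge> 0" for k by (rule C0[rule_format])
    have D0': "D k \<ge> 0" for k by (rule D0[rule_format])
    have P: "hs s (cpow n C) ((K * R) ^ n)" by (rule hs_cpow[OF K(2) C C0'])
    have P0: "cpow n C k \<ge> 0" for k by (rule cpow_nonneg[OF C0'])
    let ?E = "\<lambda>k. conv D (cpow n C) k + conv C E k"
    have lC: "l1 C" "l1 D" "l1 E" "l1 (cpow n C)" using K1(2)[OF C] K1(2)[OF D] K1(2)[OF E(2)] K1(2)[OF P] by auto
    show "\<exists>E. (\<forall>k. E k \<ge> 0) \<and> hs s E (?\<Lambda> * B) \<and> (\<forall>c d. (\<forall>k. cmod (c k) \<le> C k) \<longrightarrow> (\<forall>k. cmod (d k) \<le> C k) \<longrightarrow>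
        (\<forall>k. cmod (c k - d k) \<le> D k) \<longrightarrow> (\<forall>k. cmod (cpow (Suc n) c k - cpow (Suc n) d k) \<le> E k))"
    proof (rule exI[of _ ?E], intro conjI allI impI)
      show "?E k \<ge> 0" for k by (intro add_nonneg_nonneg conv_nonneg C0' D0' P0 E)
      have "hs s ?E (K * B * (K * R) ^ n + K * R * (\<Lambda> * B))" by (intro hs_add K(2) D P C E D0' P0 C0')
      then show "hs s ?E (?\<Lambda> * B)" by (simp add: algebra_simps)
      fix c d k assume c: "\<forall>k. cmod (c k) \<le> C k" and d: "\<forall>k. cmod (d k) \<le> C k" and cd: "\<forall>k. cmod (c k - d k) \<le> D k"
      have l: "l1 c" "l1 d" using l1_mono(1)[OF lC(1)] c d by blast+
      have "cpow (Suc n) c k - cpow (Suc n) d k = conv (\<lambda>k. c k - d k) (cpow n c) k + conv d (\<lambda>k. cpow n c k - cpow n d k) k"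
        unfolding cpow.simps by (intro conv_diff l l1_cpow)
      also have "cmod \<dots> \<le> ?E k"
      proof (rule norm_triangle_mono)
        show "cmod (conv (\<lambda>k. c k - d k) (cpow n c) k) \<le> conv D (cpow n C) k"
          by (rule norm_conv_le[OF lC(2,4)]) (use cd c cpow_norm_le[OF lC(1)] in auto)
        show "cmod (conv d (\<lambda>k. cpow n c k - cpow n d k) k) \<le> conv C E k"
          by (rule norm_conv_le[OF lC(1,3)]) (use d E(3)[OF c d cd] in auto)
      qed
      finally show "cmod (cpow (Suc n) c k - cpow (Suc n) d k) \<le> ?E k" .
    qed
  qed
qed

subsection \<open>Picard iteration\<close>

text \<open>The supremum over time is taken inside the weighted norm, mode by mode, with the weight
  \<open>exp (L t)\<close> that makes the potential a contraction.\<close>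

definition tnorm :: "real \<Rightarrow> real \<Rightarrow> real \<Rightarrow> (real \<Rightarrow> int \<Rightarrow> complex) \<Rightarrow> real \<Rightarrow> bool" where
  "tnorm s L \<tau> c B \<longleftrightarrow> (\<exists>C. (\<forall>k. C k \<ge> 0) \<and> hs s C B \<and> (\<forall>t\<in>{0..\<tau>}. \<forall>k. cmod (c t k) \<le> exp (L * t) * C k))"

text \<open>\<open>c'\<close> solves the linear problem with the potential and the nonlinear term evaluated at \<open>c\<close>: a Picard
  step.  The factor \<open>\<mu>\<close> in front of the nonlinearity is \<open>\<eta>\<^sup>m\<^sup>-\<^sup>1\<close>; with \<open>\<mu> = 0\<close> a fixed point is a
  solution of the linear equation.\<close>

definition nlstep :: "real \<Rightarrow> (real \<Rightarrow> real^3) \<Rightarrow> (real \<Rightarrow> real) \<Rightarrow> (int \<Rightarrow> complex) \<Rightarrow> nat \<Rightarrow> real set \<Rightarrow> (int \<Rightarrow> complex)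
    \<Rightarrow> (real \<Rightarrow> int \<Rightarrow> complex) \<Rightarrow> (real \<Rightarrow> int \<Rightarrow> complex) \<Rightarrow> bool" where
  "nlstep \<tau> q \<mu> \<nu> m S c0 c c' \<longleftrightarrow> (\<forall>k. continuous_on {0..\<tau>} (\<lambda>t. c' t k)) \<and> c' 0 = c0 \<and>
     (\<forall>t\<in>{0<..<\<tau>} - S. \<forall>k. ((\<lambda>t. c' t k) has_vector_derivative
        (- of_real (dsp k) * c' t k + (pot (q t) (c t) k - of_real (\<mu> t) * (\<nu> k * cpow m (c t) k)))) (at t))"

lemma tnorm_add: "tnorm s L \<tau> c B \<Longrightarrow> tnorm s L \<tau> d B' \<Longrightarrow> tnorm s L \<tau> (\<lambda>t k. c t k + d t k) (B + B')"
  unfolding tnorm_def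
proof (elim exE conjE)
  fix C D assume *: "\<forall>k. C k \<ge> 0" "hs s C B" "\<forall>t\<in>{0..\<tau>}. \<forall>k. cmod (c t k) \<le> exp (L * t) * C k"
    "\<forall>k. D k \<ge> 0" "hs s D B'" "\<forall>t\<in>{0..\<tau>}. \<forall>k. cmod (d t k) \<le> exp (L * t) * D k"
  show "\<exists>C. (\<forall>k. C k \<ge> 0) \<and> hs s C (B + B') \<and> (\<forall>t\<in>{0..\<tau>}. \<forall>k. cmod (c t k + d t k) \<le> exp (L * t) * C k)"
    by (rule exI[of _ "\<lambda>k. C k + D k"]) (use * in \<open>auto intro!: hs_add norm_triangle_mono simp: distrib_left\<close>)
qed

lemma tnorm_le: "tnorm s L \<tau> c B \<Longrightarrow> B \<le> B' \<Longrightarrow> tnorm s L \<tau> c B'"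
  unfolding tnorm_def by (metis hs_mono abs_of_nonneg order_refl)

lemma nlstep_exists:
  assumes s: "s > 1/2" and q: "pcont \<tau> q" "finite S" "\<And>t. t \<in> {0<..<\<tau>} - S \<Longrightarrow> isCont q t" and \<mu>: "continuous_on {0..\<tau>} \<mu>"
    and c: "\<And>k. continuous_on {0..\<tau>} (\<lambda>t. c t k)" "tnorm s L \<tau> c B" and L: "L \<ge> 0"
  shows "\<exists>c'. nlstep \<tau> q \<mu> \<nu> m S c0 c c'"
proof -
  obtain C where C: "\<And>k. C k \<ge> 0" "hs s C B" "\<And>t k. t \<in> {0..\<tau>} \<Longrightarrow> cmod (c t k) \<le> exp (L * t) * C k" using c(2) unfolding tnorm_def by blast
  obtain K1 where K1: "K1 > 0" "\<And>C B. hs s C B \<Longrightarrow> l1 C \<and> l1n C \<le> K1 * B" using hs_l1[OF s] by blast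
  have l: "l1 (\<lambda>k. exp (L * \<tau>) * C k)" using K1(2)[OF C(2)] by (intro l1_cmult) auto
  have b: "cmod (c t k) \<le> exp (L * \<tau>) * C k" if "t \<in> {0..\<tau>}" for t k
  proof -
    have "exp (L * t) * C k \<le> exp (L * \<tau>) * C k" using that L C(1) by (intro mult_right_mono) (auto intro: mult_left_mono)
    then show ?thesis using C(3)[OF that, of k] by linarith
  qed
  define G where "G k t = pot (q t) (c t) k - of_real (\<mu> t) * (\<nu> k * cpow m (c t) k)" for k t
  have cp: "continuous_on {0..\<tau>} (\<lambda>t. cpow m (c t) k)" for k by (rule continuous_on_cpow[OF c(1) b l])
  have cont2: "continuous_on {0..\<tau>} (\<lambda>t. of_real (\<mu> t) * (\<nu> k * cpow m (c t) k))" for k by (intro continuous_intros \<mu> cp)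
  have Gc: "isCont (G k) t" if t: "t \<in> {0<..<\<tau>} - S" for k t
  proof -
    have ci: "isCont (\<lambda>t. c t k) t" for k using continuous_on_isCont[OF c(1)] t by blast
    have qi: "isCont (\<lambda>t. q t $ i) t" for i using q(3)[OF t] by (intro continuous_intros)
    have cc: "isCont (\<lambda>t. of_real (\<mu> t) * (\<nu> k * cpow m (c t) k)) t" using continuous_on_isCont[OF cont2] t by blast
    show ?thesis unfolding G_def pot_def
      by (rule continuous_diff[OF _ cc], intro continuous_diff continuous_add continuous_mult continuous_divide continuous_of_real continuous_const ci qi) auto
  qed
  have "pcont \<tau> (G k)" for k
    unfolding pcont_def
  proof (intro conjI exI[of _ S] q(2) ballI Gc)
    obtain Bq where Bq: "\<And>t. t \<in> {0..\<tau>} \<Longrightarrow> norm (q t) \<le> Bq" using q(1) unfolding pcont_def by blast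
    obtain B2 where B2: "\<And>t. t \<in> {0..\<tau>} \<Longrightarrow> norm (of_real (\<mu> t) * (\<nu> k * cpow m (c t) k)) \<le> B2"
      using pcont_cont[OF cont2] unfolding pcont_def by blast
    let ?C = "\<lambda>k. exp (L * \<tau>) * C k"
    show "\<exists>B. \<forall>t\<in>{0..\<tau>}. norm (G k t) \<le> B"
    proof (intro exI ballI)
      fix t assume t: "t \<in> {0..\<tau>}"
      have "norm (pot (q t) (c t) k) \<le> Bq * (?C k + (?C (k - 1) + ?C (k + 1)))"
        by (rule norm_pot_le) (use component_le_norm_cart[of "q t"] Bq[OF t] b[OF t] order_trans in blast)+
      then show "norm (G k t) \<le> Bq * (?C k + (?C (k - 1) + ?C (k + 1))) + B2"
        unfolding G_def by (intro order_trans[OF norm_triangle_ineq4 add_mono[OF _ B2[OF t]]])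
    qed
  qed
  then have "\<forall>k. \<exists>y. continuous_on {0..\<tau>} y \<and> y 0 = c0 k \<and> (\<forall>t\<in>{0<..<\<tau>} - S. (y has_vector_derivative (- of_real (dsp k) * y t + G k t)) (at t))"
    using duhamel_exists[OF pcont_integrable Gc] by blast
  then obtain Y where Y: "\<And>k. continuous_on {0..\<tau>} (Y k)" "\<And>k. Y k 0 = c0 k"
     "\<And>k t. t \<in> {0<..<\<tau>} - S \<Longrightarrow> (Y k has_vector_derivative (- of_real (dsp k) * Y k t + G k t)) (at t)"
    by metis
  then have "nlstep \<tau> q \<mu> \<nu> m S c0 c (\<lambda>t k. Y k t)" unfolding nlstep_def G_def by auto
  then show ?thesis by blast
qed

text \<open>\<open>\<kappa>\<close> bounds the strength of the nonlinearity after integration against the parabolic kernel, with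
  the two lost derivatives included as \<open>k\<^sup>2\<close>.\<close>

definition kbound :: "real \<Rightarrow> (real \<Rightarrow> real) \<Rightarrow> real \<Rightarrow> bool" where
  "kbound \<tau> \<mu> \<kappa> \<longleftrightarrow> (\<forall>t\<in>{0..\<tau>}. \<forall>k. \<exists>I\<le>\<kappa>. ((\<lambda>r. exp (- (dsp k * (t - r))) * ((real_of_int k)\<^sup>2 * \<mu> r)) has_integral I) {0..t})"

text \<open>A quarter of the contraction factor is spent on the potential, through the choice of \<open>L\<close>, and a
  quarter on the nonlinearity, through the smallness of \<open>\<kappa>\<^sub>0\<close>.  The length of the interval is
  arbitrary.\<close>

lemma nlstep_contract:
  assumes s: "s > 1/2" and R: "R \<ge> 0" and P: "P \<ge> 0"
    and L: "L = 4 * P * nbc s + 1"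
  shows "\<exists>\<kappa>0>0. \<forall>q \<mu> \<nu> S c0 c d c' d' B. finite S \<longrightarrow> (\<forall>t i. \<bar>(q t :: real^3) $ i\<bar> \<le> P) \<longrightarrow> (\<forall>t. \<mu> t \<ge> 0) \<longrightarrow> kbound \<tau> \<mu> \<kappa>0 \<longrightarrow>
     (\<forall>k. cmod (\<nu> k) \<le> (real_of_int k)\<^sup>2) \<longrightarrow> tnorm s L \<tau> c R \<longrightarrow> tnorm s L \<tau> d R \<longrightarrow> tnorm s L \<tau> (\<lambda>t k. c t k - d t k) B \<longrightarrow>
     nlstep \<tau> q \<mu> \<nu> m S c0 c c' \<longrightarrow> nlstep \<tau> q \<mu> \<nu> m S c0 d d' \<longrightarrow> tnorm s L \<tau> (\<lambda>t k. c' t k - d' t k) (B / 2)"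
proof -
  have L0: "L > 0" using P nbc_pos[of s] by (simp add: L add_nonneg_pos less_imp_le)
  define M where "M = exp (L * \<tau>)"
  have M0: "M > 0" by (simp add: M_def)
  obtain \<Lambda> where \<Lambda>: "\<Lambda> \<ge> 0" "\<And>C D B. hs s C (M * (2 * R)) \<Longrightarrow> hs s D B \<Longrightarrow> (\<forall>k. C k \<ge> 0) \<Longrightarrow> (\<forall>k. D k \<ge> 0) \<Longrightarrow>
     (\<exists>E. (\<forall>k. E k \<ge> 0) \<and> hs s E (\<Lambda> * B) \<and> (\<forall>c d. (\<forall>k. cmod (c k) \<le> C k) \<longrightarrow> (\<forall>k. cmod (d k) \<le> C k) \<longrightarrow>
        (\<forall>k. cmod (c k - d k) \<le> D k) \<longrightarrow> (\<forall>k. cmod (cpow m c k - cpow m d k) \<le> E k)))"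
    using cpow_lipschitz[OF s, of "M * (2 * R)" m] R M0 by auto
  define \<kappa>0 where "\<kappa>0 = 1 / (4 * \<Lambda> * M + 1)"
  have N0: "4 * \<Lambda> * M + 1 > 0" using \<Lambda>(1) M0 by (simp add: add_nonneg_pos)
  have \<kappa>0: "\<kappa>0 > 0" "\<kappa>0 * (\<Lambda> * M) \<le> 1 / 4"
    using N0 by (simp_all add: \<kappa>0_def divide_le_eq)
  show ?thesis
  proof (rule exI[of _ \<kappa>0], intro conjI allI impI)
    show "\<kappa>0 > 0" by (rule \<kappa>0)
    fix q \<mu> \<nu> S c0 c d c' d' B
    assume S: "finite S" and q: "\<forall>t i. \<bar>(q t :: real^3) $ i\<bar> \<le> P" and \<mu>: "\<forall>t. \<mu> t \<ge> 0" and kb: "kbound \<tau> \<mu> \<kappa>0"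
      and \<nu>: "\<forall>k. cmod (\<nu> k) \<le> (real_of_int k)\<^sup>2" and c: "tnorm s L \<tau> c R" and d: "tnorm s L \<tau> d R"
      and cd: "tnorm s L \<tau> (\<lambda>t k. c t k - d t k) B"
      and c': "nlstep \<tau> q \<mu> \<nu> m S c0 c c'" and d': "nlstep \<tau> q \<mu> \<nu> m S c0 d d'"
    obtain C1 where C1: "\<And>k. C1 k \<ge> 0" "hs s C1 R" "\<And>t k. t \<in> {0..\<tau>} \<Longrightarrow> cmod (c t k) \<le> exp (L * t) * C1 k" using c unfolding tnorm_def by blast
    obtain C2 where C2: "\<And>k. C2 k \<ge> 0" "hs s C2 R" "\<And>t k. t \<in> {0..\<tau>} \<Longrightarrow> cmod (d t k) \<le> exp (L * t) * C2 k" using d unfolding tnorm_def by blast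
    obtain D where D: "\<And>k. D k \<ge> 0" "hs s D B" "\<And>t k. t \<in> {0..\<tau>} \<Longrightarrow> cmod (c t k - d t k) \<le> exp (L * t) * D k" using cd unfolding tnorm_def by blast
    let ?C = "\<lambda>k. M * (C1 k + C2 k)"
    have eM: "exp (L * t) \<le> M" if "t \<in> {0..\<tau>}" for t using that L0 by (simp add: M_def)
    have "hs s ?C (M * (R + R))" using M0 by (intro hs_cmult hs_add C1 C2) auto
    then have hC: "hs s ?C (M * (2 * R))" by (simp add: algebra_simps)
    have hD: "hs s (\<lambda>k. M * D k) (M * B)" using M0 by (intro hs_cmult D) auto
    have "\<forall>k. ?C k \<ge> 0" "\<forall>k. M * D k \<ge> 0" using M0 C1 C2 D by auto
    from \<Lambda>(2)[OF hC hD this] obtain E where E: "\<And>k. E k \<ge> 0" "hs s E (\<Lambda> * (M * B))"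
      "\<And>c d k. (\<forall>k. cmod (c k) \<le> ?C k) \<Longrightarrow> (\<forall>k. cmod (d k) \<le> ?C k) \<Longrightarrow>
        (\<forall>k. cmod (c k - d k) \<le> M * D k) \<Longrightarrow> cmod (cpow m c k - cpow m d k) \<le> E k" by blast
    have Ecd: "cmod (cpow m (c t) k - cpow m (d t) k) \<le> E k" if t: "t \<in> {0..\<tau>}" for t k
    proof (rule E(3))
      show "\<forall>k. cmod (c t k) \<le> ?C k"
      proof
        fix k have "exp (L * t) * C1 k \<le> M * (C1 k + C2 k)" using eM[OF t] C1 C2 M0 by (intro mult_mono) auto
        then show "cmod (c t k) \<le> ?C k" using C1(3)[OF t, of k] by linarith
      qed
      show "\<forall>k. cmod (d t k) \<le> ?C k"
      proof
        fix k have "exp (L * t) * C2 k \<le> M * (C1 k + C2 k)" using eM[OF t] C1 C2 M0 by (intro mult_mono) auto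
        then show "cmod (d t k) \<le> ?C k" using C2(3)[OF t, of k] by linarith
      qed
      show "\<forall>k. cmod (c t k - d t k) \<le> M * D k"
      proof
        fix k have "exp (L * t) * D k \<le> M * D k" using eM[OF t] D by (intro mult_right_mono) auto
        then show "cmod (c t k - d t k) \<le> M * D k" using D(3)[OF t, of k] by linarith
      qed
    qed
    let ?D' = "\<lambda>k. (P / L) * nbs D k + \<kappa>0 * E k"
    show "tnorm s L \<tau> (\<lambda>t k. c' t k - d' t k) (B / 2)"
      unfolding tnorm_def
    proof (rule exI[of _ ?D'], intro conjI allI ballI)
      show D'0: "?D' k \<ge> 0" for k using P L0 \<kappa>0(1) E(1)[of k] nbs_nonneg[of D, OF D(1)] by simp
      have "hs s ?D' ((P / L) * (nbc s * B) + \<kappa>0 * (\<Lambda> * (M * B)))"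
        using P L0 \<kappa>0 s by (intro hs_add hs_cmult hs_nbs D E) auto
      moreover have "(P / L) * (nbc s * B) + \<kappa>0 * (\<Lambda> * (M * B)) \<le> B / 2"
      proof -
        have B0: "B \<ge> 0" using hs_nonneg[OF D(2)] .
        have "P / L * nbc s \<le> 1 / 4" using L0 by (simp add: L field_simps)
        then have "(P / L * nbc s) * B \<le> 1 / 4 * B" by (rule mult_right_mono[OF _ B0])
        moreover have "(\<kappa>0 * (\<Lambda> * M)) * B \<le> 1 / 4 * B" by (rule mult_right_mono[OF \<kappa>0(2) B0])
        moreover have "(P / L) * (nbc s * B) = (P / L * nbc s) * B" "\<kappa>0 * (\<Lambda> * (M * B)) = (\<kappa>0 * (\<Lambda> * M)) * B"
          by (simp_all only: mult.assoc)
        ultimately show ?thesis by linarith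
      qed
      ultimately show "hs s ?D' (B / 2)" using hs_mono[of s ?D' _ ?D'] D'0 by auto
      fix t k assume t: "t \<in> {0..\<tau>}"
      obtain I where I: "I \<le> \<kappa>0" "((\<lambda>r. exp (- (dsp k * (t - r))) * ((real_of_int k)\<^sup>2 * \<mu> r)) has_integral I) {0..t}"
        using kb t unfolding kbound_def by blast
      let ?g = "\<lambda>r. (pot (q r) (c r) k - pot (q r) (d r) k) - of_real (\<mu> r) * (\<nu> k * (cpow m (c r) k - cpow m (d r) k))"
      have ode: "((\<lambda>t. c' t k - d' t k) has_vector_derivative (- of_real (dsp k) * (c' t k - d' t k) + ?g t)) (at t)" if "t \<in> {0<..<\<tau>} - S" for t
      proof -
        have "((\<lambda>t. c' t k - d' t k) has_vector_derivative (- of_real (dsp k) * c' t k + (pot (q t) (c t) k - of_real (\<mu> t) * (\<nu> k * cpow m (c t) k)))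
           - (- of_real (dsp k) * d' t k + (pot (q t) (d t) k - of_real (\<mu> t) * (\<nu> k * cpow m (d t) k)))) (at t)"
          using c' d' that unfolding nlstep_def by (intro has_vector_derivative_diff) auto
        then show ?thesis by (elim has_vector_derivative_eq_rhs) (simp add: algebra_simps)
      qed
      have cont: "continuous_on {0..\<tau>} (\<lambda>t. c' t k - d' t k)" using c' d' unfolding nlstep_def by (intro continuous_intros) auto
      let ?b = "\<lambda>r. (exp (- (dsp k * (t - r))) * ((real_of_int k)\<^sup>2 * \<mu> r)) * E k + (P * nbs D k) * exp (L * r)"
      have "cmod ((c' t k - d' t k) - of_real (exp (- (dsp k * t))) * (c' 0 k - d' 0 k)) \<le> I * E k + (P * nbs D k) * ((exp (L * t) - 1) / L)"
      proof (rule duhamel_bound[OF cont S ode t])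
        show "(?b has_integral (I * E k + (P * nbs D k) * ((exp (L * t) - 1) / L))) {0..t}"
          by (intro has_integral_add has_integral_mult_left I exp_has_integral L0) (use t in auto)
        fix r assume r: "r \<in> {0<..<t} - S"
        then have r': "r \<in> {0..\<tau>}" using t by auto
        have nbs_eq: "P * nbs D k * exp (L * r) = 1 * (P * (exp (L * r) * D k + (exp (L * r) * D (k - 1) + exp (L * r) * D (k + 1))))"
          by (simp add: nbs_def algebra_simps)
        have "pot (q r) (c r) k - pot (q r) (d r) k = pot (q r) (\<lambda>k. c r k - d r k) k" by (rule pot_diff[symmetric])
        also have "cmod \<dots> \<le> P * (exp (L * r) * D k + (exp (L * r) * D (k - 1) + exp (L * r) * D (k + 1)))"
          by (rule norm_pot_le) (use q D(3)[OF r'] in auto)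
        finally have p: "cmod (pot (q r) (c r) k - pot (q r) (d r) k) \<le> P * (exp (L * r) * D k + (exp (L * r) * D (k - 1) + exp (L * r) * D (k + 1)))" .
        have e1: "exp (- (dsp k * (t - r))) \<le> 1" using r by simp
        have 1: "exp (- (dsp k * (t - r))) * cmod (pot (q r) (c r) k - pot (q r) (d r) k) \<le> P * nbs D k * exp (L * r)"
          unfolding nbs_eq by (intro mult_mono e1 p) auto
        have "cmod (of_real (\<mu> r) * (\<nu> k * (cpow m (c r) k - cpow m (d r) k))) \<le> \<mu> r * ((real_of_int k)\<^sup>2 * E k)"
          unfolding norm_mult norm_of_real using \<mu> \<nu> Ecd[OF r'] E(1)[of k] by (intro mult_mono) auto
        then have 2: "exp (- (dsp k * (t - r))) * cmod (of_real (\<mu> r) * (\<nu> k * (cpow m (c r) k - cpow m (d r) k)))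
            \<le> exp (- (dsp k * (t - r))) * (\<mu> r * ((real_of_int k)\<^sup>2 * E k))" by (intro mult_left_mono) auto
        have "exp (- (dsp k * (t - r))) * cmod (?g r) \<le> exp (- (dsp k * (t - r))) * cmod (pot (q r) (c r) k - pot (q r) (d r) k)
            + exp (- (dsp k * (t - r))) * cmod (of_real (\<mu> r) * (\<nu> k * (cpow m (c r) k - cpow m (d r) k)))"
          unfolding distrib_left[symmetric] by (intro mult_left_mono norm_triangle_ineq4) auto
        also have "\<dots> \<le> P * nbs D k * exp (L * r) + exp (- (dsp k * (t - r))) * (\<mu> r * ((real_of_int k)\<^sup>2 * E k))" using 1 2 by (rule add_mono)
        also have "\<dots> = ?b r" by simp
        finally show "exp (- (dsp k * (t - r))) * cmod (?g r) \<le> ?b r" .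
      qed
      moreover have "c' 0 k - d' 0 k = 0" using c' d' by (simp add: nlstep_def)
      ultimately have "cmod (c' t k - d' t k) \<le> I * E k + (P * nbs D k) * ((exp (L * t) - 1) / L)" by simp
      also have "\<dots> \<le> \<kappa>0 * E k + (P * nbs D k) * (exp (L * t) / L)"
        using I(1) E(1)[of k] P L0 nbs_nonneg[of D, OF D(1)] by (intro add_mono mult_right_mono mult_left_mono divide_right_mono) auto
      also have "\<dots> \<le> exp (L * t) * (\<kappa>0 * E k) + (P * nbs D k) * (exp (L * t) / L)"
      proof -
        have "1 * (\<kappa>0 * E k) \<le> exp (L * t) * (\<kappa>0 * E k)" using t L0 \<kappa>0(1) E(1)[of k] by (intro mult_right_mono) auto
        then show ?thesis by simp
      qed
      also have "\<dots> = exp (L * t) * ?D' k" by (simp add: algebra_simps)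
      finally show "cmod (c' t k - d' t k) \<le> exp (L * t) * ?D' k" .
    qed
  qed
qed

definition herm :: "(int \<Rightarrow> complex) \<Rightarrow> bool" where
  "herm c \<longleftrightarrow> (\<forall>k. c (- k) = cnj (c k))"

lemma bij_betw_uminus_int: "bij_betw uminus UNIV (UNIV :: int set)"
  by (rule bij_betwI[where g=uminus]) auto

lemma herm_conv: assumes "herm a" "herm b" shows "herm (conv a b)"
  unfolding herm_def
proof
  fix k
  have "conv a b (- k) = (\<Sum>\<^sub>\<infinity>j. a (- j) * b (- k - (- j)))"
    unfolding conv_def using infsum_reindex_bij_betw[OF bij_betw_uminus_int, of "\<lambda>j. a j * b (- k - j)"] by simp
  also have "\<dots> = (\<Sum>\<^sub>\<infinity>j. cnj (a j * b (k - j)))"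
  proof (intro infsum_cong)
    fix j
    have "b (- k - (- j)) = cnj (b (k - j))" using assms(2)[unfolded herm_def, rule_format, of "k - j"] by (simp add: algebra_simps)
    then show "a (- j) * b (- k - (- j)) = cnj (a j * b (k - j))" using assms(1) by (simp add: herm_def)
  qed
  also have "\<dots> = cnj (conv a b k)" unfolding conv_def by (rule infsum_cnj)
  finally show "conv a b (- k) = cnj (conv a b k)" .
qed

lemma herm_cpow: "herm c \<Longrightarrow> herm (cpow n c)"
  by (induction n) (auto intro: herm_conv simp: herm_def[of "\<lambda>k. if k = 0 then 1 else 0"])

lemma herm_pot: assumes "herm c" shows "herm (pot p c)"
proof -
  have "c (- k - 1) = cnj (c (k + 1))" "c (- k + 1) = cnj (c (k - 1))" for k
  proof -
    have "- k - 1 = - (k + 1)" "- k + 1 = - (k - 1)" by simp_all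
    then show "c (- k - 1) = cnj (c (k + 1))" "c (- k + 1) = cnj (c (k - 1))"
      using assms unfolding herm_def by metis+
  qed
  then show ?thesis using assms by (simp add: herm_def pot_def field_simps)
qed

text \<open>Real-valued functions have Hermitian coefficients, and the equation preserves the symmetry.\<close>

lemma nlstep_herm:
  assumes c: "\<And>t. t \<in> {0..\<tau>} \<Longrightarrow> herm (c t)" and st: "nlstep \<tau> q \<mu> \<nu> m S c0 c c'" and S: "finite S"
    and \<nu>: "herm \<nu>" and c0: "herm c0" and t: "t \<in> {0..\<tau>}"
  shows "herm (c' t)"
  unfolding herm_def
proof
  fix k
  have cont: "continuous_on {0..\<tau>} (\<lambda>t. c' t (- k) - cnj (c' t k))"
    using st unfolding nlstep_def by (intro continuous_intros) auto
  have ode: "((\<lambda>t. c' t (- k) - cnj (c' t k)) has_vector_derivative (- of_real (dsp k) * (c' t (- k) - cnj (c' t k)) + 0)) (at t)"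
    if t: "t \<in> {0<..<\<tau>} - S" for t
  proof -
    let ?F = "\<lambda>k. - of_real (dsp k) * c' t k + (pot (q t) (c t) k - of_real (\<mu> t) * (\<nu> k * cpow m (c t) k))"
    have d: "((\<lambda>t. c' t k) has_vector_derivative ?F k) (at t)" for k using st t unfolding nlstep_def by blast
    have "((\<lambda>t. c' t (- k) - cnj (c' t k)) has_vector_derivative (?F (- k) - cnj (?F k))) (at t)"
      by (intro has_vector_derivative_diff d has_vector_derivative_cnj)
    moreover have "herm (pot (q t) (c t))" "herm (cpow m (c t))" using c t by (auto intro!: herm_pot herm_cpow)
    then have "?F (- k) - cnj (?F k) = - of_real (dsp k) * (c' t (- k) - cnj (c' t k)) + 0"
      using \<nu> by (simp add: herm_def algebra_simps)
    ultimately show ?thesis by simp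
  qed
  have "cmod ((c' t (- k) - cnj (c' t k)) - of_real (exp (- (dsp k * t))) * (c' 0 (- k) - cnj (c' 0 k))) \<le> 0"
    by (rule duhamel_bound[OF cont S ode t, of "\<lambda>_. 0"]) auto
  moreover have "c' 0 (- k) - cnj (c' 0 k) = 0" using st c0 by (simp add: nlstep_def herm_def)
  ultimately show "c' t (- k) = cnj (c' t k)" by simp
qed

lemma conv_zero_left: "conv (\<lambda>_. 0) b k = 0"
  by (simp add: conv_def)

text \<open>Picard iteration from zero.  The first iterate is the free evolution, of size \<open>R0\<close>, and the
  increments are halved each time, so all iterates stay in the ball of radius \<open>2 R0\<close>.  The threshold
  \<open>\<kappa>\<^sub>0\<close> depends on \<open>\<tau>\<close> and on the sizes of the data and of the control; \<open>\<mu>\<close> is chosen afterwards.\<close>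

lemma nl_solution_exists:
  assumes s: "s > 1/2" and R0: "R0 \<ge> 0" and P: "P \<ge> 0" and L: "L = 4 * P * nbc s + 1" and m: "m \<ge> 1" and \<tau>: "\<tau> \<ge> 0"
  shows "\<exists>\<kappa>0>0. \<forall>q \<mu> \<nu> S c0. finite S \<longrightarrow> pcont \<tau> q \<longrightarrow> (\<forall>t\<in>{0<..<\<tau>} - S. isCont q t) \<longrightarrow> (\<forall>t i. \<bar>(q t :: real^3) $ i\<bar> \<le> P) \<longrightarrow>
     continuous_on {0..\<tau>} \<mu> \<longrightarrow> (\<forall>t. \<mu> t \<ge> 0) \<longrightarrow> kbound \<tau> \<mu> \<kappa>0 \<longrightarrow>
     (\<forall>k. cmod (\<nu> k) \<le> (real_of_int k)\<^sup>2) \<longrightarrow> herm \<nu> \<longrightarrow> herm c0 \<longrightarrow> hs s (\<lambda>k. cmod (c0 k)) R0 \<longrightarrow>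
     (\<exists>c. nlstep \<tau> q \<mu> \<nu> m S c0 c c \<and> tnorm s L \<tau> c (2 * R0) \<and> (\<forall>t\<in>{0..\<tau>}. herm (c t)))"
proof -
  have L0: "L > 0" using P nbc_pos[of s] by (simp add: L add_nonneg_pos less_imp_le)
  obtain \<kappa>0 where \<kappa>0: "\<kappa>0 > 0" and contr: "\<And>q \<mu> \<nu> S c0 c d c' d' B. finite S \<Longrightarrow> (\<forall>t i. \<bar>(q t :: real^3) $ i\<bar> \<le> P) \<Longrightarrow> (\<forall>t. \<mu> t \<ge> 0) \<Longrightarrow> kbound \<tau> \<mu> \<kappa>0 \<Longrightarrow>
     (\<forall>k. cmod (\<nu> k) \<le> (real_of_int k)\<^sup>2) \<Longrightarrow> tnorm s L \<tau> c (2 * R0) \<Longrightarrow> tnorm s L \<tau> d (2 * R0) \<Longrightarrow> tnorm s L \<tau> (\<lambda>t k. c t k - d t k) B \<Longrightarrow>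
     nlstep \<tau> q \<mu> \<nu> m S c0 c c' \<Longrightarrow> nlstep \<tau> q \<mu> \<nu> m S c0 d d' \<Longrightarrow> tnorm s L \<tau> (\<lambda>t k. c' t k - d' t k) (B / 2)"
  proof -
    have "2 * R0 \<ge> 0" using R0 by simp
    from nlstep_contract[OF s this P L, of \<tau> m] that show thesis by blast
  qed
  show ?thesis
  proof (rule exI[of _ \<kappa>0], intro conjI allI impI \<kappa>0)
    fix q \<mu> \<nu> S c0
    assume S: "finite S" and q: "pcont \<tau> q" and qc: "\<forall>t\<in>{0<..<\<tau>} - S. isCont q t" and qP: "\<forall>t i. \<bar>(q t :: real^3) $ i\<bar> \<le> P"
      and \<mu>: "continuous_on {0..\<tau>} \<mu>" and \<mu>0: "\<forall>t. \<mu> t \<ge> 0" and kb: "kbound \<tau> \<mu> \<kappa>0"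
      and \<nu>: "\<forall>k. cmod (\<nu> k) \<le> (real_of_int k)\<^sup>2" and \<nu>h: "herm \<nu>" and c0h: "herm c0" and c0: "hs s (\<lambda>k. cmod (c0 k)) R0"
    let ?step = "nlstep \<tau> q \<mu> \<nu> m S c0"
    let ?tn = "tnorm s L \<tau>"
    have ex: "\<exists>c'. ?step c c'" if "\<And>k. continuous_on {0..\<tau>} (\<lambda>t. c t k)" "?tn c B" for c B
      by (rule nlstep_exists[OF s q S _ \<mu> that]) (use qc L0 in auto)
    note con = contr[OF S qP \<mu>0 kb \<nu>]
    define X where "X = rec_nat (\<lambda>_ _. 0) (\<lambda>_ c. SOME c'. ?step c c')"
    have X0: "X 0 = (\<lambda>_ _. 0)" and XS: "\<And>n. X (Suc n) = (SOME c'. ?step (X n) c')" by (auto simp: X_def)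
    have base: "?tn c (R0 / 2 ^ 0)" if "?step (\<lambda>_ _. 0) c" for c
      unfolding tnorm_def
    proof (rule exI[of _ "\<lambda>k. cmod (c0 k)"], intro conjI allI ballI)
      show "hs s (\<lambda>k. cmod (c0 k)) (R0 / 2 ^ 0)" using c0 by simp
      fix t k assume t: "t \<in> {0..\<tau>}"
      have z: "cpow m (\<lambda>_. 0 :: complex) k = 0" for k using m by (cases m) (auto simp: conv_zero_left)
      have "cmod (c t k - of_real (exp (- (dsp k * t))) * c 0 k) \<le> 0"
        by (rule duhamel_bound[where \<tau>=\<tau> and S=S and g="\<lambda>_. 0" and b="\<lambda>_. 0", OF _ S _ t])
           (use that z in \<open>auto simp: nlstep_def pot_def\<close>)
      then have "cmod (c t k) = exp (- (dsp k * t)) * cmod (c0 k)" using that by (simp add: nlstep_def norm_mult)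
      also have "\<dots> \<le> exp (L * t) * cmod (c0 k)"
      proof (intro mult_right_mono)
        have "exp (- (dsp k * t)) \<le> 1" "1 \<le> exp (L * t)" using t L0 by auto
        then show "exp (- (dsp k * t)) \<le> exp (L * t)" by linarith
      qed auto
      finally show "cmod (c t k) \<le> exp (L * t) * cmod (c0 k)" .
    qed auto
    have main: "(\<forall>k. continuous_on {0..\<tau>} (\<lambda>t. X n t k)) \<and> ?tn (X n) (R0 * (2 - 2 / 2 ^ n)) \<and> ?step (X n) (X (Suc n)) \<and>
       ?tn (\<lambda>t k. X (Suc n) t k - X n t k) (R0 / 2 ^ n) \<and> (\<forall>t\<in>{0..\<tau>}. herm (X n t))" for n
    proof (induction n)
      case 0
      have 1: "?tn (X 0) (R0 * (2 - 2 / 2 ^ 0))" unfolding X0 tnorm_def by (rule exI[of _ "\<lambda>_. 0"]) simp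
      have 2: "continuous_on {0..\<tau>} (\<lambda>t. X 0 t k)" for k by (simp add: X0)
      have 3: "?step (X 0) (X (Suc 0))" unfolding XS using ex[OF 2 1] by (rule someI_ex)
      have 4: "?tn (\<lambda>t k. X (Suc 0) t k - X 0 t k) (R0 / 2 ^ 0)" using base[OF 3[unfolded X0]] by (simp add: X0)
      show ?case using 1 2 3 4 by (simp add: X0 herm_def)
    next
      case (Suc n)
      have 2: "continuous_on {0..\<tau>} (\<lambda>t. X (Suc n) t k)" for k using Suc unfolding nlstep_def by blast
      have "?tn (\<lambda>t k. X n t k + (X (Suc n) t k - X n t k)) (R0 * (2 - 2 / 2 ^ n) + R0 / 2 ^ n)" using Suc by (intro tnorm_add) auto
      moreover have "R0 * (2 - 2 / 2 ^ n) + R0 / 2 ^ n = R0 * (2 - 2 / 2 ^ Suc n)" by (simp add: field_simps)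
      ultimately have 1: "?tn (X (Suc n)) (R0 * (2 - 2 / 2 ^ Suc n))" by simp
      have 3: "?step (X (Suc n)) (X (Suc (Suc n)))" unfolding XS[of "Suc n"] using ex[OF 2 1] by (rule someI_ex)
      have le: "R0 * (2 - 2 / 2 ^ n) \<le> 2 * R0" for n using R0 by (simp add: right_diff_distrib)
      have "?tn (\<lambda>t k. X (Suc (Suc n)) t k - X (Suc n) t k) ((R0 / 2 ^ n) / 2)"
        by (rule con[OF tnorm_le[OF 1 le] tnorm_le[OF _ le] _ 3]) (use Suc in auto)
      then have 4: "?tn (\<lambda>t k. X (Suc (Suc n)) t k - X (Suc n) t k) (R0 / 2 ^ Suc n)" by (simp add: mult.commute)
      have "\<forall>t\<in>{0..\<tau>}. herm (X (Suc n) t)" using nlstep_herm[OF _ _ S \<nu>h c0h] Suc by blast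
      then show ?case using 1 2 3 4 by blast
    qed
    have le: "R0 * (2 - 2 / 2 ^ n) \<le> 2 * R0" for n using R0 by (simp add: right_diff_distrib)
    have Xt: "?tn (X n) (2 * R0)" for n using tnorm_le[OF _ le] main by blast
    have Xc: "continuous_on {0..\<tau>} (\<lambda>t. X n t k)" for n k using main by blast
    have "\<forall>n. \<exists>D. (\<forall>k. D k \<ge> 0) \<and> hs s D (R0 / 2 ^ n) \<and> (\<forall>t\<in>{0..\<tau>}. \<forall>k. cmod (X (Suc n) t k - X n t k) \<le> exp (L * t) * D k)"
      using main unfolding tnorm_def by blast
    then obtain D where D: "\<And>n k. D n k \<ge> 0" "\<And>n. hs s (D n) (R0 / 2 ^ n)"
       "\<And>n t k. t \<in> {0..\<tau>} \<Longrightarrow> cmod (X (Suc n) t k - X n t k) \<le> exp (L * t) * D n k" by metis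
    have geo: "(\<lambda>i. R0 / 2 ^ (i + n)) sums (2 * R0 / 2 ^ n)" for n
    proof -
      have "(\<lambda>i. (1/2::real) ^ i) sums (1 / (1 - 1/2))" by (rule geometric_sums) simp
      from sums_mult[OF this, of "R0 / 2 ^ n"] show ?thesis by (simp add: power_add power_one_over mult_ac)
    qed
    have s0: "s \<ge> 0" using s by simp
    have Dn: "summable (\<lambda>i. D (i + n) k)" "hs s (\<lambda>k. \<Sum>i. D (i + n) k) (2 * R0 / 2 ^ n)" for n k
      using hs_suminf[of s "\<lambda>i. D (i + n)" "\<lambda>i. R0 / 2 ^ (i + n)"] D s0 geo[of n] by (auto simp: sums_iff)
    define c where "c t k = (\<Sum>i. X (Suc i) t k - X i t k)" for t k
    have tel: "(\<lambda>i. X (Suc (i + n)) t k - X (i + n) t k) sums (c t k - X n t k)" if t: "t \<in> {0..\<tau>}" for t k n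
    proof -
      have "summable (\<lambda>i. X (Suc i) t k - X i t k)"
        by (rule summable_comparison_test'[where g="\<lambda>i. exp (L * t) * D i k" and N=0]) (use Dn(1)[of 0] D(3)[OF t] in \<open>auto intro: summable_mult\<close>)
      then have "(\<lambda>i. X (Suc i) t k - X i t k) sums c t k" unfolding c_def by (rule summable_sums)
      moreover have "(\<Sum>i<n. X (Suc i) t k - X i t k) = X n t k" by (subst sum_lessThan_telescope) (simp add: X0)
      ultimately show ?thesis using sums_split_initial_segment[of "\<lambda>i. X (Suc i) t k - X i t k" "c t k" n] by simp
    qed
    have cX: "?tn (\<lambda>t k. c t k - X n t k) (2 * R0 / 2 ^ n)" for n
      unfolding tnorm_def
    proof (rule exI[of _ "\<lambda>k. \<Sum>i. D (i + n) k"], intro conjI allI ballI Dn(2))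
      show "0 \<le> (\<Sum>i. D (i + n) k)" for k by (intro suminf_nonneg Dn D)
      fix t k assume t: "t \<in> {0..\<tau>}"
      have sm: "summable (\<lambda>i. exp (L * t) * D (i + n) k)" by (intro summable_mult Dn)
      have "cmod (\<Sum>i. X (Suc (i + n)) t k - X (i + n) t k) \<le> (\<Sum>i. exp (L * t) * D (i + n) k)"
        by (rule norm_suminf_le[OF _ sm]) (rule D(3)[OF t])
      then show "cmod (c t k - X n t k) \<le> exp (L * t) * (\<Sum>i. D (i + n) k)"
        using sums_unique[OF tel[OF t, of n k]] suminf_mult[OF Dn(1)] by simp
    qed
    have small: "\<exists>e. e \<longlonglongrightarrow> 0 \<and> (\<forall>n. \<forall>t\<in>{0..\<tau>}. cmod (a t k - b n t k) \<le> e n)"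
      if ab: "\<And>n. ?tn (\<lambda>t k. a t k - b n t k) (B / 2 ^ n)" for a b k B
    proof (intro exI conjI allI ballI)
      have "(\<lambda>n. exp (L * \<tau>) * (B * (1 / 2) ^ n)) \<longlonglongrightarrow> exp (L * \<tau>) * (B * 0)"
        by (intro tendsto_mult tendsto_const LIMSEQ_realpow_zero) simp_all
      then show "(\<lambda>n. exp (L * \<tau>) * (B / 2 ^ n)) \<longlonglongrightarrow> 0" by (simp add: power_one_over)
      fix n t assume t: "t \<in> {0..\<tau>}"
      obtain C where C: "\<And>k. C k \<ge> 0" "hs s C (B / 2 ^ n)" "\<And>t k. t \<in> {0..\<tau>} \<Longrightarrow> cmod (a t k - b n t k) \<le> exp (L * t) * C k"
        using ab[of n] unfolding tnorm_def by blast
      have "exp (L * t) * C k \<le> exp (L * \<tau>) * (B / 2 ^ n)"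
        using hs_point[OF C(2) s0, of k] C(1)[of k] t L0 by (intro mult_mono) auto
      then show "cmod (a t k - b n t k) \<le> exp (L * \<tau>) * (B / 2 ^ n)" using C(3)[OF t, of k] by linarith
    qed
    have cc: "continuous_on {0..\<tau>} (\<lambda>t. c t k)" for k
    proof -
      obtain e where e: "e \<longlonglongrightarrow> 0" "\<And>n t. t \<in> {0..\<tau>} \<Longrightarrow> cmod (c t k - X n t k) \<le> e n" using small[OF cX] by blast
      have "uniform_limit {0..\<tau>} (\<lambda>n t. X n t k) (\<lambda>t. c t k) sequentially"
      proof (rule uniform_limitI)
        fix \<epsilon> :: real assume "\<epsilon> > 0"
        then have "\<forall>\<^sub>F n in sequentially. e n < \<epsilon>" using order_tendstoD(2)[OF e(1)] by blast
        then show "\<forall>\<^sub>F n in sequentially. \<forall>t\<in>{0..\<tau>}. dist (X n t k) (c t k) < \<epsilon>"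
        proof eventually_elim
          case (elim n)
          then show ?case using e(2) by (metis dist_norm norm_minus_commute le_less_trans)
        qed
      qed
      then show ?thesis by (rule uniform_limit_theorem[rotated]) (auto intro!: always_eventually Xc)
    qed
    have ct: "?tn c (2 * R0)" using cX[of 0] by (simp add: X0)
    obtain c' where c': "?step c c'" using ex[OF cc ct] by blast
    have c'X: "?tn (\<lambda>t k. c' t k - X (Suc n) t k) (R0 / 2 ^ n)" for n
    proof -
      have "?tn (\<lambda>t k. c' t k - X (Suc n) t k) ((2 * R0 / 2 ^ n) / 2)"
        by (rule con[OF ct Xt cX c']) (use main in blast)
      then show ?thesis by simp
    qed
    have eq: "c' t k = c t k" if t: "t \<in> {0..\<tau>}" for t k
    proof -
      obtain e where e: "e \<longlonglongrightarrow> 0" "\<And>n t. t \<in> {0..\<tau>} \<Longrightarrow> cmod (c t k - X n t k) \<le> e n" using small[OF cX] by blast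
      obtain e' where e': "e' \<longlonglongrightarrow> 0" "\<And>n t. t \<in> {0..\<tau>} \<Longrightarrow> cmod (c' t k - X (Suc n) t k) \<le> e' n" using small[OF c'X] by blast
      have "(\<lambda>n. X n t k) \<longlonglongrightarrow> c t k"
        by (rule LIM_zero_cancel, rule Lim_null_comparison[OF _ e(1)]) (use e(2)[OF t] in \<open>auto simp: norm_minus_commute\<close>)
      then have "(\<lambda>n. X (Suc n) t k) \<longlonglongrightarrow> c t k" by (rule LIMSEQ_Suc)
      moreover have "(\<lambda>n. X (Suc n) t k) \<longlonglongrightarrow> c' t k"
        by (rule LIM_zero_cancel, rule Lim_null_comparison[OF _ e'(1)]) (use e'(2)[OF t] in \<open>auto simp: norm_minus_commute\<close>)
      ultimately show ?thesis using LIMSEQ_unique by blast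
    qed
    have ceq: "c t = c' t" if "t \<in> {0..\<tau>}" for t using eq[OF that] by auto
    have hX: "herm (c t)" if t: "t \<in> {0..\<tau>}" for t
      unfolding herm_def
    proof
      fix k
      have lim: "(\<lambda>n. X n t k) \<longlonglongrightarrow> c t k" for k
      proof -
        obtain e where e: "e \<longlonglongrightarrow> 0" "\<And>n t. t \<in> {0..\<tau>} \<Longrightarrow> cmod (c t k - X n t k) \<le> e n" using small[OF cX] by blast
        show ?thesis by (rule LIM_zero_cancel, rule Lim_null_comparison[OF _ e(1)]) (use e(2)[OF t] in \<open>auto simp: norm_minus_commute\<close>)
      qed
      have "X n t (- k) = cnj (X n t k)" for n using main t unfolding herm_def by blast
      then show "c t (- k) = cnj (c t k)" using LIMSEQ_unique[OF lim[of "-k"]] tendsto_cnj[OF lim[of k]] by simp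
    qed
    show "\<exists>c. ?step c c \<and> ?tn c (2 * R0) \<and> (\<forall>t\<in>{0..\<tau>}. herm (c t))"
    proof (intro exI[of _ c'] conjI ballI)
      show "?step c' c'" using c' ceq unfolding nlstep_def by auto
      show "?tn c' (2 * R0)" using ct ceq unfolding tnorm_def by metis
      show "herm (c' t)" if "t \<in> {0..\<tau>}" for t using hX ceq that by metis
    qed
  qed
qed

text \<open>The difference solves the linear equation with zero initial value and the nonlinear term as its
  source.\<close>

lemma nl_close:
  assumes s: "s > 1/2" and R: "R \<ge> 0" and P: "P \<ge> 0" and L: "L \<ge> 0" and \<tau>: "\<tau> \<ge> 0"
  shows "\<exists>M\<ge>0. \<forall>q \<mu> \<nu> S c0 c d \<kappa>. finite S \<longrightarrow> (\<forall>t i. \<bar>(q t :: real^3) $ i\<bar> \<le> P) \<longrightarrow> (\<forall>t. \<mu> t \<ge> 0) \<longrightarrow> kbound \<tau> \<mu> \<kappa> \<longrightarrow> \<kappa> \<ge> 0 \<longrightarrow>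
     (\<forall>k. cmod (\<nu> k) \<le> (real_of_int k)\<^sup>2) \<longrightarrow> nlstep \<tau> q \<mu> \<nu> m S c0 c c \<longrightarrow> tnorm s L \<tau> c R \<longrightarrow>
     nlstep \<tau> q (\<lambda>_. 0) \<nu> m S c0 d d \<longrightarrow> tnorm s L \<tau> d R \<longrightarrow> hs s (\<lambda>k. cmod (c \<tau> k - d \<tau> k)) (M * \<kappa>)"
proof -
  obtain K where K: "K > 0" "\<And>C D B B'. hs s C B \<Longrightarrow> hs s D B' \<Longrightarrow> (\<And>k. C k \<ge> 0) \<Longrightarrow> (\<And>k. D k \<ge> 0) \<Longrightarrow> hs s (conv C D) (K * B * B')"
    using hs_conv[OF s] by blast
  obtain K1 where K1: "K1 > 0" "\<And>C B. hs s C B \<Longrightarrow> l1 C \<and> l1n C \<le> K1 * B" using hs_l1[OF s] by blast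
  define Z where "Z = (K * (exp (L * \<tau>) * R)) ^ m"
  have Z: "Z \<ge> 0" using K R by (simp add: Z_def)
  define M where "M = exp (growth s P * \<tau>) * (2 * Z)"
  have M: "M \<ge> 0" using Z by (simp add: M_def)
  show ?thesis
  proof (rule exI[of _ M], intro conjI allI impI M)
    fix q \<mu> \<nu> S c0 c d \<kappa>
    assume S: "finite S" and q: "\<forall>t i. \<bar>(q t :: real^3) $ i\<bar> \<le> P" and \<mu>: "\<forall>t. \<mu> t \<ge> 0" and kb: "kbound \<tau> \<mu> \<kappa>" and \<kappa>: "\<kappa> \<ge> 0"
      and \<nu>: "\<forall>k. cmod (\<nu> k) \<le> (real_of_int k)\<^sup>2" and c: "nlstep \<tau> q \<mu> \<nu> m S c0 c c" "tnorm s L \<tau> c R"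
      and d: "nlstep \<tau> q (\<lambda>_. 0) \<nu> m S c0 d d" "tnorm s L \<tau> d R"
    obtain C1 where C1: "\<And>k. C1 k \<ge> 0" "hs s C1 R" "\<And>t k. t \<in> {0..\<tau>} \<Longrightarrow> cmod (c t k) \<le> exp (L * t) * C1 k" using c unfolding tnorm_def by blast
    obtain C2 where C2: "\<And>k. C2 k \<ge> 0" "hs s C2 R" "\<And>t k. t \<in> {0..\<tau>} \<Longrightarrow> cmod (d t k) \<le> exp (L * t) * C2 k" using d unfolding tnorm_def by blast
    have up: "exp (L * t) * x \<le> exp (L * \<tau>) * x" if "t \<in> {0..\<tau>}" "x \<ge> 0" for t x
      using that L by (intro mult_right_mono) (auto intro: mult_left_mono)
    let ?C = "\<lambda>k. exp (L * \<tau>) * C1 k"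
    have hC: "hs s ?C (exp (L * \<tau>) * R)" by (intro hs_cmult C1) auto
    have cb: "cmod (c t k) \<le> ?C k" if "t \<in> {0..\<tau>}" for t k using C1(3)[OF that, of k] up[OF that C1(1)[of k]] by linarith
    have db: "cmod (d t k) \<le> exp (L * \<tau>) * C2 k" if "t \<in> {0..\<tau>}" for t k using C2(3)[OF that, of k] up[OF that C2(1)[of k]] by linarith
    define E where "E = cpow m ?C"
    have E0: "E k \<ge> 0" for k unfolding E_def by (rule cpow_nonneg) (simp add: C1)
    have hE: "hs s E Z" unfolding E_def Z_def by (rule hs_cpow[OF K(2) hC]) (auto simp: C1)
    have lC: "l1 ?C" using K1(2)[OF hC] by blast
    have cE: "cmod (cpow m (c t) k) \<le> E k" if "t \<in> {0..\<tau>}" for t k unfolding E_def by (rule cpow_norm_le[OF lC cb[OF that]])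
    have "hs s (\<lambda>k. cmod (c \<tau> k - d \<tau> k)) (exp (growth s P * \<tau>) * (2 * (0 + \<kappa> * Z)))"
    proof (rule linear_apriori[where e="\<lambda>t k. c t k - d t k" and \<alpha>=dsp and S=S and q=q and ?C0.0="\<lambda>k. ?C k + exp (L * \<tau>) * C2 k" and P=P
          and g="\<lambda>t k. - (of_real (\<mu> t) * (\<nu> k * cpow m (c t) k))" and h="\<lambda>k t. ((real_of_int k)\<^sup>2 * \<mu> t) * E k" and H="\<lambda>k. \<kappa> * E k"])
      show "continuous_on {0..\<tau>} (\<lambda>t. c t k - d t k)" for k using c(1) d(1) unfolding nlstep_def by (intro continuous_intros) auto
      show "((\<lambda>t. c t k - d t k) has_vector_derivative (- of_real (dsp k) * (c t k - d t k) + (pot (q t) (\<lambda>k. c t k - d t k) k + - (of_real (\<mu> t) * (\<nu> k * cpow m (c t) k))))) (at t)"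
        if "t \<in> {0<..<\<tau>} - S" for t k
      proof -
        have "((\<lambda>t. c t k - d t k) has_vector_derivative (- of_real (dsp k) * c t k + (pot (q t) (c t) k - of_real (\<mu> t) * (\<nu> k * cpow m (c t) k)))
           - (- of_real (dsp k) * d t k + (pot (q t) (d t) k - of_real 0 * (\<nu> k * cpow m (d t) k)))) (at t)"
          using c d that unfolding nlstep_def by (intro has_vector_derivative_diff) auto
        then show ?thesis by (elim has_vector_derivative_eq_rhs) (simp add: pot_diff algebra_simps)
      qed
      show "cmod (c t k - d t k) \<le> ?C k + exp (L * \<tau>) * C2 k" if "t \<in> {0..\<tau>}" for t k
        by (intro order_trans[OF norm_triangle_ineq4] add_mono cb db that)
      show "hs s (\<lambda>k. ?C k + exp (L * \<tau>) * C2 k) (exp (L * \<tau>) * R + exp (L * \<tau>) * R)" by (intro hs_add hC hs_cmult C2) auto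
      show "cmod (- (of_real (\<mu> t) * (\<nu> k * cpow m (c t) k))) \<le> ((real_of_int k)\<^sup>2 * \<mu> t) * E k" if "t \<in> {0<..<\<tau>} - S" for t k
      proof -
        have "\<mu> t * (cmod (\<nu> k) * cmod (cpow m (c t) k)) \<le> \<mu> t * ((real_of_int k)\<^sup>2 * E k)"
          using \<mu> \<nu> cE[of t k] E0[of k] that by (intro mult_left_mono mult_mono) auto
        then show ?thesis using \<mu> by (simp add: norm_mult mult_ac)
      qed
      show "\<exists>I\<le>\<kappa> * E k. ((\<lambda>r. exp (- (dsp k * (t - r))) * (((real_of_int k)\<^sup>2 * \<mu> r) * E k)) has_integral I) {0..t}" if t: "t \<in> {0..\<tau>}" for t k
      proof -
        obtain I where I: "I \<le> \<kappa>" "((\<lambda>r. exp (- (dsp k * (t - r))) * ((real_of_int k)\<^sup>2 * \<mu> r)) has_integral I) {0..t}"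
          using kb t unfolding kbound_def by blast
        from has_integral_mult_left[OF I(2), of "E k"] show ?thesis
          using mult_right_mono[OF I(1) E0[of k]] by (intro exI[of _ "I * E k"]) (simp add: mult.assoc)
      qed
      show "hs s (\<lambda>k. cmod (c 0 k - d 0 k)) 0" using c(1) d(1) by (simp add: nlstep_def)
      show "hs s (\<lambda>k. \<kappa> * E k) (\<kappa> * Z)" by (intro hs_cmult hE \<kappa>)
    qed (use s P S q \<tau> in auto)
    then show "hs s (\<lambda>k. cmod (c \<tau> k - d \<tau> k)) (M * \<kappa>)" by (simp add: M_def mult_ac)
  qed
qed

subsection \<open>Turning off the nonlinearity\<close>

text \<open>With \<open>x = k\<^sup>2 exp (- dsp k (t - r))\<close> one has \<open>x \<mu> \<le> (z x\<^sup>2 + \<mu>\<^sup>2 / z) / 2\<close> for every \<open>z > 0\<close>.  The integral of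
  \<open>x\<^sup>2\<close> is bounded uniformly in \<open>k\<close>, because \<open>k\<^sup>4 \<le> 2 dsp k\<close> for \<open>|k| \<ge> 2\<close>, and the integral of \<open>\<mu>\<^sup>2\<close> is
  \<open>O(1/M)\<close>.  The choice \<open>z = M\<^sup>-\<^sup>1\<^sup>/\<^sup>2\<close> balances the two.\<close>

lemma kbound_small:
  assumes M: "M > 0" and \<mu>c: "continuous_on {0..\<tau>} \<mu>" and \<mu>: "\<And>r. 0 \<le> \<mu> r" "\<And>r. \<mu> r \<le> exp (- (M * r)) + exp (- (M * (\<tau> - r)))"
  shows "kbound \<tau> \<mu> (((\<tau> + 1) / 2 + 1) / sqrt M)"
  unfolding kbound_def
proof (intro ballI allI exI conjI)
  fix t k assume t: "t \<in> {0..\<tau>}"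
  let ?f = "\<lambda>r. exp (- (dsp k * (t - r))) * ((real_of_int k)\<^sup>2 * \<mu> r)"
  have fi: "?f integrable_on {0..t}"
    using t by (intro integrable_continuous_real continuous_intros continuous_on_subset[OF \<mu>c]) auto
  then show "(?f has_integral integral {0..t} ?f) {0..t}" by (rule integrable_integral)
  define z where "z = 1 / sqrt M"
  have z: "z > 0" "1 / z = sqrt M" "1 / z * (1 / M) = z"
    using M by (simp_all add: z_def real_div_sqrt divide_simps)
  let ?d = "2 * dsp k"
  let ?b = "\<lambda>r. z / 2 * (1 + ?d * exp (- (?d * (t - r)))) + 1 / z * (exp (- (2 * M * r)) + exp (- (2 * M * (\<tau> - r))))"
  let ?B = "\<lambda>r. z / 2 * (r + exp (- (?d * (t - r)))) + 1 / z * (- exp (- (2 * M * r)) / (2 * M) + exp (- (2 * M * (\<tau> - r))) / (2 * M))"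
  have b: "(?b has_integral (?B t - ?B 0)) {0..t}"
  proof (rule fundamental_theorem_of_calculus)
    fix r assume "r \<in> {0..t}"
    have "(?B has_real_derivative ?b r) (at r within {0..t})"
      by (rule derivative_eq_intros refl | (use M in simp))+
    then show "(?B has_vector_derivative ?b r) (at r within {0..t})"
      by (simp add: has_real_derivative_iff_has_vector_derivative)
  qed (use t in auto)
  have "integral {0..t} ?f \<le> integral {0..t} ?b"
  proof (rule integral_le[OF fi])
    show "?b integrable_on {0..t}" using b by blast
    fix r assume r: "r \<in> {0..t}"
    define x where "x = (real_of_int k)\<^sup>2 * exp (- (dsp k * (t - r)))"
    have "(x * z - \<mu> r)\<^sup>2 \<ge> 0" by simp
    then have "2 * (x * \<mu> r) * z \<le> (x * z)\<^sup>2 + (\<mu> r)\<^sup>2" by (simp add: power2_diff algebra_simps)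
    then have "2 * (x * \<mu> r) \<le> ((x * z)\<^sup>2 + (\<mu> r)\<^sup>2) / z" using z(1) by (simp add: pos_le_divide_eq)
    also have "\<dots> = z * x\<^sup>2 + 1 / z * (\<mu> r)\<^sup>2" using z(1) by (simp add: power2_eq_square field_simps)
    finally have am: "x * \<mu> r \<le> z / 2 * x\<^sup>2 + 1 / z * ((\<mu> r)\<^sup>2 / 2)" by simp
    have x2: "x\<^sup>2 \<le> 1 + ?d * exp (- (?d * (t - r)))"
    proof -
      have xe: "x\<^sup>2 = real_of_int k ^ 4 * exp (- (?d * (t - r)))"
      proof -
        have "x\<^sup>2 = ((real_of_int k)\<^sup>2)\<^sup>2 * (exp (- (dsp k * (t - r))))\<^sup>2" unfolding x_def by (rule power_mult_distrib)
        also have "((real_of_int k)\<^sup>2)\<^sup>2 = real_of_int k ^ 4" by (simp flip: power_mult)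
        also have "(exp (- (dsp k * (t - r))))\<^sup>2 = exp (- (?d * (t - r)))" by (simp add: exp_double[symmetric] mult.assoc)
        finally show ?thesis .
      qed
      have e1: "exp (- (?d * (t - r))) \<le> 1" using r by simp
      consider "\<bar>k\<bar> \<le> 1" | "\<bar>k\<bar> \<ge> 2" by linarith
      then show ?thesis
      proof cases
        case 1
        then have "real_of_int k ^ 4 \<le> 1" by (cases "k = 0"; cases "k = 1"; cases "k = -1") auto
        then have "real_of_int k ^ 4 * exp (- (?d * (t - r))) \<le> 1 * 1" using e1 by (intro mult_mono) auto
        moreover have "0 \<le> ?d * exp (- (?d * (t - r)))" by simp
        ultimately show ?thesis unfolding xe by linarith
      next
        case 2
        then have "2 * 2 \<le> \<bar>k\<bar> * \<bar>k\<bar>" by (intro mult_mono) auto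
        then have "4 \<le> k\<^sup>2" by (simp add: power2_eq_square)
        then have "4 \<le> (real_of_int k)\<^sup>2" by (metis of_int_le_iff of_int_numeral of_int_power)
        then have "2 * (real_of_int k)\<^sup>2 \<le> (real_of_int k)\<^sup>2 * (real_of_int k)\<^sup>2" by (intro mult_right_mono) auto
        then have "real_of_int k ^ 4 \<le> ?d" unfolding dsp_def by (simp add: power4_eq_xxxx power2_eq_square mult.assoc)
        then have "real_of_int k ^ 4 * exp (- (?d * (t - r))) \<le> ?d * exp (- (?d * (t - r)))" by (intro mult_right_mono) auto
        then show ?thesis unfolding xe by linarith
      qed
    qed
    have m2: "(\<mu> r)\<^sup>2 / 2 \<le> exp (- (2 * M * r)) + exp (- (2 * M * (\<tau> - r)))"
    proof -
      let ?u = "exp (- (M * r))" and ?v = "exp (- (M * (\<tau> - r)))"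
      have "(\<mu> r)\<^sup>2 \<le> (?u + ?v)\<^sup>2" by (intro power_mono \<mu>)
      also have "\<dots> \<le> 2 * (?u\<^sup>2 + ?v\<^sup>2)" using sum_squares_bound[of ?u ?v] by (simp add: power2_sum)
      finally show ?thesis by (simp add: exp_double[symmetric] mult_ac)
    qed
    have "?f r = x * \<mu> r" by (simp add: x_def)
    also have "\<dots> \<le> ?b r"
      by (rule order_trans[OF am], intro add_mono mult_left_mono x2 m2) (use z(1) in \<open>auto simp: less_imp_le\<close>)
    finally show "?f r \<le> ?b r" .
  qed
  also have "\<dots> = ?B t - ?B 0" using b by (rule integral_unique)
  also have "\<dots> \<le> z / 2 * (\<tau> + 1) + 1 / z * (1 / M)"
  proof -
    have 1: "z / 2 * (t + exp (- (?d * (t - t)))) - z / 2 * (0 + exp (- (?d * (t - 0)))) \<le> z / 2 * (\<tau> + 1)"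
    proof -
      have "(t + exp (- (?d * (t - t)))) - (0 + exp (- (?d * (t - 0)))) \<le> \<tau> + 1"
      proof -
        have "0 < exp (- (?d * (t - 0)))" "exp (- (?d * (t - t))) = 1" "t \<le> \<tau>" using t by simp_all
        then show ?thesis by linarith
      qed
      from mult_left_mono[OF this, of "z / 2"] show ?thesis using z(1) by (simp only: right_diff_distrib)
    qed
    have e: "exp (- (2 * M * (\<tau> - t))) \<le> 1" "exp (- (2 * M * 0)) = 1" "exp (- (2 * M * t)) > 0" "exp (- (2 * M * (\<tau> - 0))) > 0" using t M by auto
    have "(- exp (- (2 * M * t)) / (2 * M) + exp (- (2 * M * (\<tau> - t))) / (2 * M)) - (- exp (- (2 * M * 0)) / (2 * M) + exp (- (2 * M * (\<tau> - 0))) / (2 * M))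
       = (1 + exp (- (2 * M * (\<tau> - t))) - exp (- (2 * M * t)) - exp (- (2 * M * (\<tau> - 0)))) / (2 * M)"
      using M by (simp add: field_simps)
    also have "\<dots> \<le> 2 / (2 * M)" using M e by (intro divide_right_mono) linarith+
    finally have "1 / z * ((- exp (- (2 * M * t)) / (2 * M) + exp (- (2 * M * (\<tau> - t))) / (2 * M)) - (- exp (- (2 * M * 0)) / (2 * M) + exp (- (2 * M * (\<tau> - 0))) / (2 * M))) \<le> 1 / z * (1 / M)"
      using z(1) by (intro mult_left_mono) auto
    with 1 show ?thesis unfolding right_diff_distrib by linarith
  qed
  also have "\<dots> = ((\<tau> + 1) / 2 + 1) * z" unfolding z(3) by (simp add: algebra_simps)
  also have "\<dots> = ((\<tau> + 1) / 2 + 1) / sqrt M" by (simp add: z_def)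
  finally show "integral {0..t} ?f \<le> ((\<tau> + 1) / 2 + 1) / sqrt M" .
qed

section \<open>Mild solutions in Fourier variables\<close>

subsection \<open>Exchange of the Fourier series and the time integral\<close>

lemma infsum_int_decode:
  fixes f :: "int \<Rightarrow> complex"
  assumes "l1 f" shows "(\<lambda>n. f (int_decode n)) sums (\<Sum>\<^sub>\<infinity>k. f k)" "summable (\<lambda>n. norm (f (int_decode n)))"
proof -
  have "(f has_sum (\<Sum>\<^sub>\<infinity>k. f k)) UNIV" using abs_summable_summable[OF assms] by (rule has_sum_infsum)
  then have "((\<lambda>n. f (int_decode n)) has_sum (\<Sum>\<^sub>\<infinity>k. f k)) UNIV"
    using has_sum_reindex_bij_betw[OF bij_int_decode, of f] by simp
  then show "(\<lambda>n. f (int_decode n)) sums (\<Sum>\<^sub>\<infinity>k. f k)" by (rule has_sum_imp_sums)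
  have "(\<lambda>n. norm (f (int_decode n))) summable_on UNIV"
    using summable_on_reindex_bij_betw[OF bij_int_decode, of "\<lambda>k. norm (f k)"] assms by simp
  then show "summable (\<lambda>n. norm (f (int_decode n)))" by (rule summable_on_imp_summable)
qed

text \<open>The partial sums are dominated off the end points only: the majorant needed later is singular at
  \<open>r = t\<close>.\<close>

lemma infsum_integral_exchange:
  fixes f :: "int \<Rightarrow> real \<Rightarrow> complex"
  assumes f: "\<And>k. set_integrable lborel {0..t} (f k)" and h: "set_integrable lborel {0..t} h"
    and b: "\<And>r F. r \<in> {0<..<t} \<Longrightarrow> finite F \<Longrightarrow> (\<Sum>k\<in>F. norm (f k r)) \<le> h r"
  shows "l1 (\<lambda>k. LINT r:{0..t}|lborel. f k r)"
    and "set_integrable lborel {0..t} (\<lambda>r. \<Sum>\<^sub>\<infinity>k. f k r)"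
    and "(LINT r:{0..t}|lborel. (\<Sum>\<^sub>\<infinity>k. f k r)) = (\<Sum>\<^sub>\<infinity>k. (LINT r:{0..t}|lborel. f k r))"
proof -
  let ?ind = "\<lambda>g r. indicat_real {0..t} r *\<^sub>R g r"
  have fi: "integrable lborel (?ind (f k))" for k using f by (simp add: set_integrable_def)
  have hi: "integrable lborel (?ind h)" using h by (simp add: set_integrable_def)
  have AE0: "AE r in lborel. r \<notin> {0,t}"
    using AE_lborel_singleton[of 0] AE_lborel_singleton[of t] by eventually_elim auto
  have "(\<Sum>k\<in>F. norm (LINT r:{0..t}|lborel. f k r)) \<le> (LINT r|lborel. ?ind h r)" if F: "finite F" for F
  proof -
    have "(\<Sum>k\<in>F. norm (LINT r:{0..t}|lborel. f k r)) \<le> (\<Sum>k\<in>F. (LINT r|lborel. norm (?ind (f k) r)))"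
      unfolding set_lebesgue_integral_def by (intro sum_mono integral_norm_bound)
    also have "\<dots> = (LINT r|lborel. (\<Sum>k\<in>F. norm (?ind (f k) r)))"
      by (rule Bochner_Integration.integral_sum[symmetric]) (intro integrable_norm fi)
    also have "\<dots> \<le> (LINT r|lborel. ?ind h r)"
    proof (rule integral_mono_AE)
      show "integrable lborel (\<lambda>r. \<Sum>k\<in>F. norm (?ind (f k) r))" by (intro Bochner_Integration.integrable_sum integrable_norm fi)
      show "AE r in lborel. (\<Sum>k\<in>F. norm (?ind (f k) r)) \<le> ?ind h r"
        using AE0 by eventually_elim (use b F in \<open>auto simp: indicator_def\<close>)
    qed (rule hi)
    finally show ?thesis .
  qed note bF = this
  show l: "l1 (\<lambda>k. LINT r:{0..t}|lborel. f k r)" by (rule l1I(1)[OF bF])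
  let ?g = "\<lambda>n. ?ind (f (int_decode n))"
  have gi: "integrable lborel (?g n)" for n by (rule fi)
  have l1r: "l1 (\<lambda>k. ?ind (f k) r)" if "r \<notin> {0,t}" for r
  proof (rule l1I(1))
    fix F :: "int set" assume "finite F"
    then show "(\<Sum>k\<in>F. norm (?ind (f k) r)) \<le> ?ind h r"
      using b[of r F] that by (auto simp: indicator_def)
  qed
  have sn: "AE r in lborel. summable (\<lambda>n. norm (?g n r))"
    using AE0 by eventually_elim (rule infsum_int_decode(2)[OF l1r])
  have si: "summable (\<lambda>n. LINT r|lborel. norm (?g n r))"
  proof (rule summableI_nonneg_bounded)
    fix n
    have "(\<Sum>i<n. (LINT r|lborel. norm (?g i r))) = (LINT r|lborel. (\<Sum>i<n. norm (?g i r)))"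
      by (rule Bochner_Integration.integral_sum[symmetric]) (intro integrable_norm gi)
    also have "\<dots> \<le> (LINT r|lborel. ?ind h r)"
    proof (rule integral_mono_AE)
      show "integrable lborel (\<lambda>r. \<Sum>i<n. norm (?g i r))" by (intro Bochner_Integration.integrable_sum integrable_norm gi)
      show "AE r in lborel. (\<Sum>i<n. norm (?g i r)) \<le> ?ind h r"
        using AE0
      proof eventually_elim
        case (elim r)
        have "(\<Sum>i<n. norm (?g i r)) = (\<Sum>k\<in>int_decode ` {..<n}. norm (?ind (f k) r))"
          by (subst sum.reindex) (auto intro: inj_on_subset[OF bij_is_inj[OF bij_int_decode]])
        then show ?case using b[of r "int_decode ` {..<n}"] elim by (auto simp: indicator_def)
      qed
    qed (rule hi)
    finally show "(\<Sum>i<n. (LINT r|lborel. norm (?g i r))) \<le> (LINT r|lborel. ?ind h r)" .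
  qed (auto intro: integral_nonneg_AE)
  have eqS: "(\<Sum>n. ?g n r) = ?ind (\<lambda>r. \<Sum>\<^sub>\<infinity>k. f k r) r" if "r \<notin> {0,t}" for r
  proof -
    have "(\<Sum>n. ?g n r) = (\<Sum>\<^sub>\<infinity>k. ?ind (f k) r)" using infsum_int_decode(1)[OF l1r[OF that]] by (simp add: sums_iff)
    then show ?thesis by (simp add: infsum_scaleR_right)
  qed
  have i1: "integrable lborel (\<lambda>r. \<Sum>n. ?g n r)" by (rule integrable_suminf[OF gi sn si])
  have eqi: "integrable lborel (\<lambda>r. \<Sum>n. ?g n r) = integrable lborel (?ind (\<lambda>r. \<Sum>\<^sub>\<infinity>k. f k r))"
    by (rule integrable_discrete_difference[where X="{0,t}"]) (use eqS in auto)
  show "set_integrable lborel {0..t} (\<lambda>r. \<Sum>\<^sub>\<infinity>k. f k r)" using i1 eqi by (simp add: set_integrable_def)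
  have "(LINT r:{0..t}|lborel. (\<Sum>\<^sub>\<infinity>k. f k r)) = (LINT r|lborel. (\<Sum>n. ?g n r))"
    unfolding set_lebesgue_integral_def by (rule integral_discrete_difference[where X="{0,t}"]) (use eqS in auto)
  also have "\<dots> = (\<Sum>n. (LINT r|lborel. ?g n r))" by (rule integral_suminf[OF gi sn si])
  also have "\<dots> = (\<Sum>\<^sub>\<infinity>k. (LINT r:{0..t}|lborel. f k r))"
    using infsum_int_decode(1)[OF l] by (simp add: sums_iff set_lebesgue_integral_def)
  finally show "(LINT r:{0..t}|lborel. (\<Sum>\<^sub>\<infinity>k. f k r)) = (\<Sum>\<^sub>\<infinity>k. (LINT r:{0..t}|lborel. f k r))" .
qed

lemma inverse_sqrt_integral:
  assumes at: "a \<le> t"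
  shows "set_integrable lborel {a..t} (\<lambda>r. 1 + 1 / sqrt (t - r))"
    "(LINT r:{a..t}|lborel. 1 + 1 / sqrt (t - r)) = (t - a) + 2 * sqrt (t - a)"
proof -
  let ?h = "\<lambda>r. 1 + 1 / sqrt (t - r)"
  let ?H = "\<lambda>r. r - 2 * sqrt (t - r)"
  have hk: "(?h has_integral (?H t - ?H a)) {a..t}"
  proof (rule fundamental_theorem_of_calculus_interior[OF at])
    show "continuous_on {a..t} ?H" by (intro continuous_intros)
    fix r assume r: "r \<in> {a<..<t}"
    have "(?H has_real_derivative 1 - 2 * ((- 1) * (inverse (sqrt (t - r)) / 2))) (at r)"
      using r by (auto intro!: derivative_eq_intros)
    then show "(?H has_vector_derivative ?h r) (at r)"
      by (simp add: has_real_derivative_iff_has_vector_derivative inverse_eq_divide)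
  qed
  have "?h absolutely_integrable_on {a..t}"
    by (rule nonnegative_absolutely_integrable_1) (use hk in auto)
  then have "integrable (completion lborel) (\<lambda>r. indicat_real {a..t} r *\<^sub>R ?h r)" by (simp add: set_integrable_def)
  moreover have "(\<lambda>r. indicat_real {a..t} r *\<^sub>R ?h r) \<in> borel_measurable lborel" by measurable
  ultimately show si: "set_integrable lborel {a..t} ?h" by (simp add: integrable_completion set_integrable_def)
  show "(LINT r:{a..t}|lborel. ?h r) = (t - a) + 2 * sqrt (t - a)"
    using set_borel_integral_eq_integral(2)[OF si] integral_unique[OF hk] by simp
qed

text \<open>Two derivatives cost \<open>\<sigma>\<^sup>-\<^sup>1\<^sup>/\<^sup>2\<close>, which is integrable; this makes the Duhamel integral converge.\<close>

lemma parabolic_gain: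
  assumes "\<sigma> > 0" shows "(1 + (real_of_int k)\<^sup>2) * exp (- \<sigma> * real_of_int k ^ 4) \<le> 1 + 1 / sqrt \<sigma>"
proof -
  define x where "x = (real_of_int k)\<^sup>2 * sqrt \<sigma>"
  have x: "x \<ge> 0" using assms by (simp add: x_def)
  have "x\<^sup>2 = \<sigma> * real_of_int k ^ 4"
    using assms by (simp add: x_def power_mult_distrib)
  then have e: "exp (- \<sigma> * real_of_int k ^ 4) = exp (- x\<^sup>2)" by simp
  have "x \<le> 1 + x\<^sup>2"
  proof -
    have "(x - 1/2)\<^sup>2 \<ge> 0" by simp
    then have "x \<le> x\<^sup>2 + (1/2)\<^sup>2" by (simp add: power2_diff)
    moreover have "(1/2)\<^sup>2 \<le> (1::real)" by (simp add: power2_eq_square)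
    ultimately show ?thesis by linarith
  qed
  also have "\<dots> \<le> exp (x\<^sup>2)" by (rule exp_ge_add_one_self)
  finally have "x * exp (- x\<^sup>2) \<le> 1" by (simp add: exp_minus field_simps)
  then have "(real_of_int k)\<^sup>2 * exp (- x\<^sup>2) \<le> 1 / sqrt \<sigma>" using assms by (simp add: x_def field_simps)
  moreover have "exp (- x\<^sup>2) \<le> 1" by simp
  moreover have "(1 + (real_of_int k)\<^sup>2) * exp (- x\<^sup>2) = exp (- x\<^sup>2) + (real_of_int k)\<^sup>2 * exp (- x\<^sup>2)" by (simp add: distrib_right)
  ultimately show ?thesis unfolding e by linarith
qed

subsection \<open>The Wiener algebra\<close>

lemma l1_cpow_lipschitz:
  fixes a b :: "int \<Rightarrow> complex"
  assumes a: "l1 a" "l1n a \<le> R" and b: "l1 b" "l1n b \<le> R" and R: "R \<ge> 1"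
  shows "l1 (\<lambda>k. cpow n a k - cpow n b k)" "l1n (\<lambda>k. cpow n a k - cpow n b k) \<le> n * R ^ n * l1n (\<lambda>k. a k - b k)"
proof -
  have d: "l1 (\<lambda>k. cpow n a k - cpow n b k)" for n by (intro l1_diff l1_cpow a b)
  then show "l1 (\<lambda>k. cpow n a k - cpow n b k)" .
  have ab: "l1 (\<lambda>k. a k - b k)" by (intro l1_diff a b)
  show "l1n (\<lambda>k. cpow n a k - cpow n b k) \<le> n * R ^ n * l1n (\<lambda>k. a k - b k)"
  proof (induction n)
    case 0 show ?case by (simp add: l1n_def)
  next
    case (Suc n)
    have "(\<lambda>k. cpow (Suc n) a k - cpow (Suc n) b k) = (\<lambda>k. conv (\<lambda>k. a k - b k) (cpow n a) k + conv b (\<lambda>k. cpow n a k - cpow n b k) k)"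
      unfolding cpow.simps by (intro ext conv_diff a b l1_cpow)
    then have "l1n (\<lambda>k. cpow (Suc n) a k - cpow (Suc n) b k) \<le> l1n (conv (\<lambda>k. a k - b k) (cpow n a)) + l1n (conv b (\<lambda>k. cpow n a k - cpow n b k))"
      using l1_add(2)[OF l1_conv(1)[OF ab l1_cpow(1)[OF a(1), of n]] l1_conv(1)[OF b(1) d[of n]]] by (simp only:)
    also have "\<dots> \<le> l1n (\<lambda>k. a k - b k) * l1n (cpow n a) + l1n b * l1n (\<lambda>k. cpow n a k - cpow n b k)"
      by (intro add_mono l1_conv ab l1_cpow a b d)
    also have "\<dots> \<le> l1n (\<lambda>k. a k - b k) * R ^ n + R * (n * R ^ n * l1n (\<lambda>k. a k - b k))"
    proof (intro add_mono mult_left_mono mult_mono b Suc)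
      show "l1n (cpow n a) \<le> R ^ n" using l1_cpow(2)[OF a(1), of n] power_mono[OF a(2), of n] by simp
    qed (use R in auto)
    also have "\<dots> \<le> l1n (\<lambda>k. a k - b k) * R ^ Suc n + R * (n * R ^ n * l1n (\<lambda>k. a k - b k))"
      using R by (intro add_mono mult_left_mono power_increasing) auto
    also have "\<dots> = Suc n * R ^ Suc n * l1n (\<lambda>k. a k - b k)" by (simp add: algebra_simps)
    finally show ?case .
  qed
qed

text \<open>Continuity in the space of absolutely summable sequences.  \<open>H\<^sup>s\<close> embeds into it for \<open>s > 1/2\<close>, and
  it is large enough for uniqueness.\<close>

definition wcont :: "real \<Rightarrow> (real \<Rightarrow> int \<Rightarrow> complex) \<Rightarrow> bool" where
  "wcont \<tau> c \<longleftrightarrow> (\<forall>t\<in>{0..\<tau>}. l1 (c t) \<and> ((\<lambda>r. l1n (\<lambda>k. c r k - c t k)) \<longlongrightarrow> 0) (at t within {0..\<tau>}))"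

lemma wcont_bounded: assumes c: "wcont \<tau> c" obtains R where "R \<ge> 1" "\<And>t. t \<in> {0..\<tau>} \<Longrightarrow> l1n (c t) \<le> R"
proof -
  have "continuous_on {0..\<tau>} (\<lambda>t. l1n (c t))"
    unfolding continuous_on_def
  proof
    fix t assume t: "t \<in> {0..\<tau>}"
    have "((\<lambda>r. l1n (c r) - l1n (c t)) \<longlongrightarrow> 0) (at t within {0..\<tau>})"
    proof (rule Lim_null_comparison)
      show "((\<lambda>r. l1n (\<lambda>k. c r k - c t k)) \<longlongrightarrow> 0) (at t within {0..\<tau>})" using c t by (simp add: wcont_def)
      have "norm (l1n (c r) - l1n (c t)) \<le> l1n (\<lambda>k. c r k - c t k)" if r: "r \<in> {0..\<tau>}" for r
      proof -
        have l: "l1 (c r)" "l1 (c t)" using c t r by (auto simp: wcont_def)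
        have "l1n (c r) \<le> l1n (\<lambda>k. c r k - c t k) + l1n (c t)" using l1_add(2)[OF l1_diff(1)[OF l] l(2)] by simp
        moreover have "l1n (c t) \<le> l1n (\<lambda>k. c t k - c r k) + l1n (c r)" using l1_add(2)[OF l1_diff(1)[OF l(2,1)] l(1)] by simp
        moreover have "l1n (\<lambda>k. c t k - c r k) = l1n (\<lambda>k. c r k - c t k)" by (simp add: l1n_def norm_minus_commute)
        ultimately show ?thesis by auto
      qed
      then show "\<forall>\<^sub>F r in at t within {0..\<tau>}. norm (l1n (c r) - l1n (c t)) \<le> l1n (\<lambda>k. c r k - c t k)"
        by (auto simp: eventually_at intro!: exI[of _ 1])
    qed
    then show "((\<lambda>t. l1n (c t)) \<longlongrightarrow> l1n (c t)) (at t within {0..\<tau>})" by (rule LIM_zero_cancel)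
  qed
  then have "bounded ((\<lambda>t. l1n (c t)) ` {0..\<tau>})" by (intro compact_imp_bounded compact_continuous_image compact_Icc)
  then obtain B where "\<forall>t\<in>{0..\<tau>}. norm (l1n (c t)) \<le> B" unfolding bounded_iff by blast
  then show thesis using that[of "max 1 B"] by force
qed

lemma wcont_mode: assumes "wcont \<tau> c" shows "continuous_on {0..\<tau>} (\<lambda>t. c t k)"
  unfolding continuous_on_def
proof
  fix t assume t: "t \<in> {0..\<tau>}"
  have "((\<lambda>r. c r k - c t k) \<longlongrightarrow> 0) (at t within {0..\<tau>})"
  proof (rule Lim_null_comparison)
    show "((\<lambda>r. l1n (\<lambda>k. c r k - c t k)) \<longlongrightarrow> 0) (at t within {0..\<tau>})" using assms t by (simp add: wcont_def)
    show "\<forall>\<^sub>F r in at t within {0..\<tau>}. norm (c r k - c t k) \<le> l1n (\<lambda>k. c r k - c t k)"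
      using assms t l1_point[OF l1_diff(1), of "c r" "c t" k for r] by (auto simp: eventually_at wcont_def intro!: exI[of _ 1])
  qed
  then show "((\<lambda>t. c t k) \<longlongrightarrow> c t k) (at t within {0..\<tau>})" by (rule LIM_zero_cancel)
qed

lemma wcont_cpow: assumes c: "wcont \<tau> c" shows "wcont \<tau> (\<lambda>t. cpow n (c t))"
proof -
  obtain R where R: "R \<ge> 1" "\<And>t. t \<in> {0..\<tau>} \<Longrightarrow> l1n (c t) \<le> R" using wcont_bounded[OF c] by blast
  have l: "l1 (c t)" if "t \<in> {0..\<tau>}" for t using c that by (simp add: wcont_def)
  show ?thesis unfolding wcont_def
  proof (intro ballI conjI)
    fix t assume t: "t \<in> {0..\<tau>}"
    show "l1 (cpow n (c t))" by (rule l1_cpow(1)[OF l[OF t]])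
    show "((\<lambda>r. l1n (\<lambda>k. cpow n (c r) k - cpow n (c t) k)) \<longlongrightarrow> 0) (at t within {0..\<tau>})"
    proof (rule Lim_null_comparison)
      show "\<forall>\<^sub>F r in at t within {0..\<tau>}. norm (l1n (\<lambda>k. cpow n (c r) k - cpow n (c t) k)) \<le> n * R ^ n * l1n (\<lambda>k. c r k - c t k)"
        using l1_cpow_lipschitz(2)[OF l R(2) l[OF t] R(2)[OF t] R(1)] by (auto simp: eventually_at intro!: exI[of _ 1])
      have "((\<lambda>r. n * R ^ n * l1n (\<lambda>k. c r k - c t k)) \<longlongrightarrow> n * R ^ n * 0) (at t within {0..\<tau>})"
        using c t by (intro tendsto_intros) (simp add: wcont_def)
      then show "((\<lambda>r. n * R ^ n * l1n (\<lambda>k. c r k - c t k)) \<longlongrightarrow> 0) (at t within {0..\<tau>})" by simp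
    qed
  qed
qed

lemma sobolev_diff: assumes "u \<in> sobolev_space s" "v \<in> sobolev_space s" shows "(\<lambda>x. u x - v x) \<in> sobolev_space s"
proof -
  obtain B B' where B: "hs s (\<lambda>k. cmod (fourier_coeff u k)) B" "hs s (\<lambda>k. cmod (fourier_coeff v k)) B'" and p: "u \<in> per" "v \<in> per"
    using assms by (auto simp: sobolev_iff)
  have "hs s (\<lambda>k. cmod (fourier_coeff (\<lambda>x. u x - v x) k)) (B + B')"
    by (rule hs_mono[OF hs_add[OF B]]) (auto simp: fourier_coeff_diff[OF p] norm_triangle_ineq4)
  then show ?thesis using p by (auto simp: sobolev_iff per_diff)
qed

lemma sobolev_l1: "s > 1/2 \<Longrightarrow> u \<in> sobolev_space s \<Longrightarrow> l1 (fourier_coeff u)"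
  using hs_l1 by (metis hs_sobolev_norm l1_norm(1))

lemma continuous_into_sobolev_wcont:
  assumes s: "s > 1/2" and u: "continuous_into_sobolev s \<tau> u" shows "wcont \<tau> (\<lambda>t. fourier_coeff (u t))"
proof -
  obtain K1 where K1: "K1 > 0" "\<And>C B. hs s C B \<Longrightarrow> l1 C \<and> l1n C \<le> K1 * B" using hs_l1[OF s] by blast
  have us: "u t \<in> sobolev_space s" if "t \<in> {0..\<tau>}" for t using u that by (simp add: continuous_into_sobolev_def)
  show ?thesis unfolding wcont_def
  proof (intro ballI conjI)
    fix t assume t: "t \<in> {0..\<tau>}"
    show "l1 (fourier_coeff (u t))" by (rule sobolev_l1[OF s us[OF t]])
    show "((\<lambda>r. l1n (\<lambda>k. fourier_coeff (u r) k - fourier_coeff (u t) k)) \<longlongrightarrow> 0) (at t within {0..\<tau>})"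
    proof (rule Lim_null_comparison)
      have "((\<lambda>r. K1 * sobolev_norm s (\<lambda>x. u r x - u t x)) \<longlongrightarrow> K1 * 0) (at t within {0..\<tau>})"
        using u t by (intro tendsto_intros) (simp add: continuous_into_sobolev_def)
      then show "((\<lambda>r. K1 * sobolev_norm s (\<lambda>x. u r x - u t x)) \<longlongrightarrow> 0) (at t within {0..\<tau>})" by simp
      have "norm (l1n (\<lambda>k. fourier_coeff (u r) k - fourier_coeff (u t) k)) \<le> K1 * sobolev_norm s (\<lambda>x. u r x - u t x)" if r: "r \<in> {0..\<tau>}" for r
      proof -
        have p: "u r \<in> per" "u t \<in> per" using us t r by (auto simp: sobolev_iff)
        have "l1n (\<lambda>k. cmod (fourier_coeff (\<lambda>x. u r x - u t x) k)) \<le> K1 * sobolev_norm s (\<lambda>x. u r x - u t x)"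
          using K1(2)[OF hs_sobolev_norm[OF sobolev_diff[OF us[OF r] us[OF t]]]] by blast
        then show ?thesis by (simp add: l1n_def fourier_coeff_diff[OF p] infsum_nonneg)
      qed
      then show "\<forall>\<^sub>F r in at t within {0..\<tau>}. norm (l1n (\<lambda>k. fourier_coeff (u r) k - fourier_coeff (u t) k)) \<le> K1 * sobolev_norm s (\<lambda>x. u r x - u t x)"
        by (auto simp: eventually_at intro!: exI[of _ 1])
    qed
  qed
qed

subsection \<open>The Duhamel formula mode by mode\<close>

text \<open>The coefficients of \<open>source\<close> when the nonlinearity is \<open>\<nu>\<close> times an \<open>m\<close>-th power.\<close>

definition source_coeff :: "(int \<Rightarrow> complex) \<Rightarrow> nat \<Rightarrow> real^3 \<Rightarrow> (int \<Rightarrow> complex) \<Rightarrow> int \<Rightarrow> complex" where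
  "source_coeff \<nu> m p c k = of_real ((real_of_int k)\<^sup>2) * c k - \<nu> k * cpow m c k + pot p c k"

lemma source_eq_source_coeff:
  assumes N: "\<And>k. N (u r) k = \<nu> k * fourier_coeff (\<lambda>x. u r x ^ m) k" and u: "u r \<in> per" "l1 (fourier_coeff (u r))"
  shows "source N p u r k = source_coeff \<nu> m (p r) (fourier_coeff (u r)) k"
  unfolding source_def source_coeff_def fourier_coeff_control[OF u(1)] N fourier_coeff_power[OF u]
proof -
  have "- dx (dx (fourier_coeff (u r))) k = - (\<i> * \<i>) * (of_int k * of_int k * fourier_coeff (u r) k)"
    by (simp only: dx_def mult_ac minus_mult_left)
  then show "- dx (dx (fourier_coeff (u r))) k - \<nu> k * cpow m (fourier_coeff (u r)) k + pot (p r) (fourier_coeff (u r)) k =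
     of_real ((real_of_int k)\<^sup>2) * fourier_coeff (u r) k - \<nu> k * cpow m (fourier_coeff (u r)) k + pot (p r) (fourier_coeff (u r)) k"
    by (simp add: power2_eq_square)
qed

lemma sum_nbs_le:
  fixes a :: "int \<Rightarrow> complex"
  assumes a: "l1 a" and F: "finite F" shows "(\<Sum>k\<in>F. nbs (\<lambda>k. cmod (a k)) k) \<le> 3 * l1n a"
proof -
  have "(\<Sum>k\<in>F. cmod (a (k + j))) \<le> l1n a" for j
    using l1_sum_le[OF l1_shift(1)[OF a, of j] F] by (simp add: l1_shift(2))
  from this[of "-1"] this[of 1] l1_sum_le[OF a F] show ?thesis by (simp add: nbs_def sum.distrib)
qed

text \<open>The smoothing of two derivatives by the semigroup, summed over the modes.\<close>

lemma gain_sum: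
  assumes a: "l1 a" and b: "l1 b" and \<nu>: "\<And>k. cmod (\<nu> k) \<le> (real_of_int k)\<^sup>2" and p: "\<And>i. \<bar>(p::real^3) $ i\<bar> \<le> P" and \<sigma>: "\<sigma> > 0" and F: "finite F"
  shows "(\<Sum>k\<in>F. exp (- \<sigma> * real_of_int k ^ 4) * cmod (of_real ((real_of_int k)\<^sup>2) * a k - \<nu> k * b k + pot p a k))
     \<le> (1 + 1 / sqrt \<sigma>) * ((1 + 3 * P) * l1n a + l1n b)"
proof -
  have P: "P \<ge> 0" using order_trans[OF abs_ge_zero p] .
  let ?g = "\<lambda>k. cmod (a k) + cmod (b k) + P * nbs (\<lambda>k. cmod (a k)) k"
  have nb: "nbs (\<lambda>k. cmod (a k)) k \<ge> 0" for k by (rule nbs_nonneg) simp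
  have g0: "?g k \<ge> 0" for k using P nb[of k] by simp
  have pt: "exp (- \<sigma> * real_of_int k ^ 4) * cmod (of_real ((real_of_int k)\<^sup>2) * a k - \<nu> k * b k + pot p a k) \<le> (1 + 1 / sqrt \<sigma>) * ?g k" for k
  proof -
    let ?K = "1 + (real_of_int k)\<^sup>2"
    have "cmod (pot p a k) \<le> P * nbs (\<lambda>k. cmod (a k)) k"
      unfolding nbs_def by (rule norm_pot_le) (use p in auto)
    also have "\<dots> \<le> ?K * (P * nbs (\<lambda>k. cmod (a k)) k)" using P nb[of k] by (simp add: distrib_right)
    finally have 1: "cmod (pot p a k) \<le> ?K * (P * nbs (\<lambda>k. cmod (a k)) k)" .
    have 2: "cmod (of_real ((real_of_int k)\<^sup>2) * a k) \<le> ?K * cmod (a k)" by (simp add: norm_mult norm_power distrib_right)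
    have "cmod (\<nu> k * b k) \<le> (real_of_int k)\<^sup>2 * cmod (b k)" unfolding norm_mult by (intro mult_right_mono \<nu>) auto
    then have 3: "cmod (\<nu> k * b k) \<le> ?K * cmod (b k)" by (simp add: distrib_right add_increasing)
    have "cmod (of_real ((real_of_int k)\<^sup>2) * a k - \<nu> k * b k + pot p a k) \<le> (?K * cmod (a k) + ?K * cmod (b k)) + ?K * (P * nbs (\<lambda>k. cmod (a k)) k)"
      by (rule order_trans[OF norm_triangle_ineq add_mono[OF order_trans[OF norm_triangle_ineq4 add_mono[OF 2 3]] 1]])
    also have "\<dots> = ?K * ?g k" by (simp add: algebra_simps)
    finally have "exp (- \<sigma> * real_of_int k ^ 4) * cmod (of_real ((real_of_int k)\<^sup>2) * a k - \<nu> k * b k + pot p a k) \<le> exp (- \<sigma> * real_of_int k ^ 4) * (?K * ?g k)"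
      by (intro mult_left_mono) auto
    also have "\<dots> = (?K * exp (- \<sigma> * real_of_int k ^ 4)) * ?g k" by (simp only: mult_ac)
    also have "\<dots> \<le> (1 + 1 / sqrt \<sigma>) * ?g k" by (rule mult_right_mono[OF parabolic_gain[OF \<sigma>] g0])
    finally show ?thesis .
  qed
  have "(\<Sum>k\<in>F. ?g k) = (\<Sum>k\<in>F. cmod (a k)) + (\<Sum>k\<in>F. cmod (b k)) + P * (\<Sum>k\<in>F. nbs (\<lambda>k. cmod (a k)) k)"
    by (simp add: sum.distrib sum_distrib_left)
  also have "\<dots> \<le> l1n a + l1n b + P * (3 * l1n a)"
    by (intro add_mono mult_left_mono sum_nbs_le l1_sum_le a b F P)
  also have "\<dots> = (1 + 3 * P) * l1n a + l1n b" by (simp add: algebra_simps)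
  finally have "(1 + 1 / sqrt \<sigma>) * (\<Sum>k\<in>F. ?g k) \<le> (1 + 1 / sqrt \<sigma>) * ((1 + 3 * P) * l1n a + l1n b)"
    using \<sigma> by (intro mult_left_mono) auto
  moreover have "(\<Sum>k\<in>F. exp (- \<sigma> * real_of_int k ^ 4) * cmod (of_real ((real_of_int k)\<^sup>2) * a k - \<nu> k * b k + pot p a k)) \<le> (1 + 1 / sqrt \<sigma>) * (\<Sum>k\<in>F. ?g k)"
    unfolding sum_distrib_left by (intro sum_mono pt)
  ultimately show ?thesis by linarith
qed

lemma source_coeff_integrable:
  assumes c: "wcont \<tau> c" and S: "finite S" "\<And>t. t \<in> {0<..<\<tau>} - S \<Longrightarrow> isCont p t" and p: "\<And>t i. \<bar>(p t::real^3) $ i\<bar> \<le> P"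
    and t: "t \<in> {0..\<tau>}" and f: "continuous_on UNIV f"
  shows "set_integrable lborel {0..t} (\<lambda>r. f r * source_coeff \<nu> m (p r) (c r) k)"
proof (rule pcont_integrable)
  have P: "P \<ge> 0" using order_trans[OF abs_ge_zero p] .
  have cc: "continuous_on {0..t} (\<lambda>r. c r k)" for k using t by (intro continuous_on_subset[OF wcont_mode[OF c]]) auto
  have cp: "continuous_on {0..t} (\<lambda>r. cpow m (c r) k)" using t by (intro continuous_on_subset[OF wcont_mode[OF wcont_cpow[OF c]]]) auto
  have c1: "continuous_on {0..t} (\<lambda>r. f r * (of_real ((real_of_int k)\<^sup>2) * c r k - \<nu> k * cpow m (c r) k))"
    by (intro continuous_intros cc cp continuous_on_subset[OF f]) auto
  have fc: "continuous_on {0..t} f" by (rule continuous_on_subset[OF f]) auto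
  have eq: "f r * source_coeff \<nu> m (p r) (c r) k = f r * (of_real ((real_of_int k)\<^sup>2) * c r k - \<nu> k * cpow m (c r) k) + f r * pot (p r) (c r) k" for r
    by (simp add: source_coeff_def algebra_simps)
  obtain B1 where B1: "\<And>r. r \<in> {0..t} \<Longrightarrow> norm (f r * (of_real ((real_of_int k)\<^sup>2) * c r k - \<nu> k * cpow m (c r) k)) \<le> B1"
    using pcont_cont[OF c1] unfolding pcont_def by blast
  obtain B2 where B2: "\<And>r. r \<in> {0..t} \<Longrightarrow> norm (f r) \<le> B2" using pcont_cont[OF fc] unfolding pcont_def by blast
  obtain R where R: "R \<ge> 1" "\<And>t. t \<in> {0..\<tau>} \<Longrightarrow> l1n (c t) \<le> R" using wcont_bounded[OF c] by blast
  show "pcont t (\<lambda>r. f r * source_coeff \<nu> m (p r) (c r) k)"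
    unfolding pcont_def
  proof (intro conjI exI ballI)
    fix r assume r: "r \<in> {0..t}"
    then have rt: "r \<in> {0..\<tau>}" using t by auto
    have "cmod (c r k) \<le> R" for k using l1_point[of "c r" k] c rt R(2)[OF rt] unfolding wcont_def by force
    then have "norm (pot (p r) (c r) k) \<le> P * (R + (R + R))" by (intro norm_pot_le p) auto
    then have "norm (f r * pot (p r) (c r) k) \<le> B2 * (P * (R + (R + R)))"
      unfolding norm_mult by (intro mult_mono B2 r) (use order_trans[OF norm_ge_zero B2[OF r]] in auto)
    then show "norm (f r * source_coeff \<nu> m (p r) (c r) k) \<le> B1 + B2 * (P * (R + (R + R)))"
      unfolding eq by (intro order_trans[OF norm_triangle_ineq add_mono[OF B1[OF r]]])
  next
    show "finite S" by fact
    fix r assume r: "r \<in> {0<..<t} - S"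
    then have r': "r \<in> {0<..<\<tau>} - S" using t by auto
    have ci: "isCont (\<lambda>t. c t k) r" for k using continuous_on_isCont[OF cc] r by blast
    have qi: "isCont (\<lambda>t. p t $ i) r" for i using S(2)[OF r'] by (intro continuous_intros)
    have fi: "isCont f r" using f by (simp add: continuous_on_eq_continuous_at)
    have "isCont (\<lambda>r. pot (p r) (c r) k) r" unfolding pot_def
      by (intro continuous_diff continuous_add continuous_mult continuous_divide continuous_of_real continuous_const ci qi) auto
    then show "isCont (\<lambda>r. f r * source_coeff \<nu> m (p r) (c r) k) r"
      unfolding eq using r by (intro continuous_add continuous_on_isCont[OF c1] continuous_mult fi) auto
  qed
qed

definition duhamel_term :: "(int \<Rightarrow> complex) \<Rightarrow> nat \<Rightarrow> (real \<Rightarrow> real^3) \<Rightarrow> (real \<Rightarrow> int \<Rightarrow> complex) \<Rightarrow> real \<Rightarrow> int \<Rightarrow> complex" where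
  "duhamel_term \<nu> m p c t k = (LINT r:{0..t}|lborel. of_real (exp (- (t - r) * real_of_int k ^ 4)) * source_coeff \<nu> m (p r) (c r) k)"

lemma duhamel_series:
  assumes c: "wcont \<tau> c" and S: "finite S" "\<And>t. t \<in> {0<..<\<tau>} - S \<Longrightarrow> isCont p t" and p: "\<And>t i. \<bar>(p t::real^3) $ i\<bar> \<le> P"
    and \<nu>: "\<And>k. cmod (\<nu> k) \<le> (real_of_int k)\<^sup>2" and t: "t \<in> {0..\<tau>}"
  shows "l1 (duhamel_term \<nu> m p c t)"
    "set_integrable lborel {0..t} (\<lambda>r. semigroup4 (t - r) (source_coeff \<nu> m (p r) (c r)) x)"
    "(LINT r:{0..t}|lborel. semigroup4 (t - r) (source_coeff \<nu> m (p r) (c r)) x) = synth (duhamel_term \<nu> m p c t) x"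
proof -
  have P: "P \<ge> 0" using order_trans[OF abs_ge_zero p] .
  obtain R where R: "R \<ge> 1" "\<And>t. t \<in> {0..\<tau>} \<Longrightarrow> l1n (c t) \<le> R" using wcont_bounded[OF c] by blast
  let ?A = "(1 + 3 * P) * R + R ^ m"
  have h: "set_integrable lborel {0..t} (\<lambda>r. (1 + 1 / sqrt (t - r)) * ?A)"
    using t by (intro set_integrable_mult_left inverse_sqrt_integral(1)) auto
  have sb: "(\<Sum>k\<in>F. exp (- (t - r) * real_of_int k ^ 4) * cmod (source_coeff \<nu> m (p r) (c r) k)) \<le> (1 + 1 / sqrt (t - r)) * ?A"
    if r: "r \<in> {0<..<t}" and F: "finite F" for r F
  proof -
    have rt: "r \<in> {0..\<tau>}" using r t by auto
    have l: "l1 (c r)" using c rt by (simp add: wcont_def)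
    have "(\<Sum>k\<in>F. exp (- (t - r) * real_of_int k ^ 4) * cmod (source_coeff \<nu> m (p r) (c r) k)) \<le> (1 + 1 / sqrt (t - r)) * ((1 + 3 * P) * l1n (c r) + l1n (cpow m (c r)))"
      unfolding source_coeff_def by (rule gain_sum[OF l l1_cpow(1)[OF l] \<nu> p _ F]) (use r in auto)
    also have "\<dots> \<le> (1 + 1 / sqrt (t - r)) * ?A"
    proof (intro mult_left_mono add_mono)
      show "l1n (cpow m (c r)) \<le> R ^ m" using l1_cpow(2)[OF l, of m] power_mono[OF R(2)[OF rt], of m] by simp
    qed (use R(2)[OF rt] P r in auto)
    finally show ?thesis .
  qed
  let ?f = "\<lambda>x k r. of_real (exp (- (t - r) * real_of_int k ^ 4)) * source_coeff \<nu> m (p r) (c r) k * cis (of_int k * x)"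
  have fi: "set_integrable lborel {0..t} (?f x k)" for x k
    by (intro set_integrable_mult_left source_coeff_integrable[OF c S p t] continuous_intros)
  have fb: "(\<Sum>k\<in>F. norm (?f x k r)) \<le> (1 + 1 / sqrt (t - r)) * ?A" if "r \<in> {0<..<t}" "finite F" for r F x
    using sb[OF that] by (simp add: norm_mult)
  have fl: "(LINT r:{0..t}|lborel. ?f x k r) = duhamel_term \<nu> m p c t k * cis (of_int k * x)" for x k
    unfolding duhamel_term_def by (rule set_integral_mult_left)
  note ex = infsum_integral_exchange[OF fi h fb]
  show "l1 (duhamel_term \<nu> m p c t)" using ex(1)[of 0] unfolding fl by simp
  show "set_integrable lborel {0..t} (\<lambda>r. semigroup4 (t - r) (source_coeff \<nu> m (p r) (c r)) x)"
    using ex(2)[of x] unfolding semigroup4_def .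
  show "(LINT r:{0..t}|lborel. semigroup4 (t - r) (source_coeff \<nu> m (p r) (c r)) x) = synth (duhamel_term \<nu> m p c t) x"
    using ex(3)[of x] unfolding fl semigroup4_def synth_def .
qed

lemma heat_l1: fixes c :: "int \<Rightarrow> complex" shows "l1 c \<Longrightarrow> t \<ge> 0 \<Longrightarrow> l1 (\<lambda>k. of_real (exp (- t * real_of_int k ^ 4)) * c k)"
  by (rule l1_mono(1)[of "\<lambda>k. norm (c k)"]) (simp_all add: norm_mult mult_left_le_one_le)

text \<open>Both sides of the mild formulation are absolutely convergent Fourier series in \<open>x\<close>, so they agree
  as functions exactly if their coefficients agree.\<close>

lemma mild_iff_coeff:
  assumes s: "s > 1/2" and N: "\<And>u k. N u k = \<nu> k * fourier_coeff (\<lambda>x. u x ^ m) k" and \<nu>: "\<And>k. cmod (\<nu> k) \<le> (real_of_int k)\<^sup>2"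
    and u0: "u0 \<in> sobolev_space s" and v: "continuous_into_sobolev s \<tau> v"
    and S: "finite S" "\<And>t. t \<in> {0<..<\<tau>} - S \<Longrightarrow> isCont p t" and p: "\<And>t i. \<bar>(p t::real^3) $ i\<bar> \<le> P"
  shows "mild_solution N s u0 \<tau> p v \<longleftrightarrow> (\<forall>t\<in>{0..\<tau>}. \<forall>k. fourier_coeff (v t) k =
     of_real (exp (- t * real_of_int k ^ 4)) * fourier_coeff u0 k + duhamel_term \<nu> m p (\<lambda>t. fourier_coeff (v t)) t k)" (is "_ \<longleftrightarrow> ?R")
proof -
  let ?c = "\<lambda>t. fourier_coeff (v t)"
  have c: "wcont \<tau> ?c" by (rule continuous_into_sobolev_wcont[OF s v])
  have vs: "v t \<in> sobolev_space s" if "t \<in> {0..\<tau>}" for t using v that by (simp add: continuous_into_sobolev_def)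
  have vp: "v t \<in> per" "l1 (?c t)" if "t \<in> {0..\<tau>}" for t using vs[OF that] sobolev_l1[OF s] by (auto simp: sobolev_iff)
  have ds: "l1 (duhamel_term \<nu> m p ?c t)" "set_integrable lborel {0..t} (\<lambda>r. semigroup4 (t - r) (source_coeff \<nu> m (p r) (?c r)) x)"
    "(LINT r:{0..t}|lborel. semigroup4 (t - r) (source_coeff \<nu> m (p r) (?c r)) x) = synth (duhamel_term \<nu> m p ?c t) x" if "t \<in> {0..\<tau>}" for t x
    by (rule duhamel_series[OF c S p \<nu> that], assumption)+
  have source_coeff: "source N p v r = source_coeff \<nu> m (p r) (?c r)" if "r \<in> {0..\<tau>}" for r
    by (rule ext) (rule source_eq_source_coeff[of N v r, OF N vp[OF that]])
  have si: "set_integrable lborel {0..t} (\<lambda>r. semigroup4 (t - r) (source N p v r) x)"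
    and sv: "(LINT r:{0..t}|lborel. semigroup4 (t - r) (source N p v r) x) = synth (duhamel_term \<nu> m p ?c t) x" if t: "t \<in> {0..\<tau>}" for t x
  proof -
    have e: "semigroup4 (t - r) (source N p v r) x = semigroup4 (t - r) (source_coeff \<nu> m (p r) (?c r)) x" if "r \<in> {0..t}" for r
      using source_coeff[of r] that t by auto
    show "set_integrable lborel {0..t} (\<lambda>r. semigroup4 (t - r) (source N p v r) x)"
      using ds(2)[OF t, of x] by (subst set_integrable_cong[OF refl refl e]) auto
    show "(LINT r:{0..t}|lborel. semigroup4 (t - r) (source N p v r) x) = synth (duhamel_term \<nu> m p ?c t) x"
      unfolding ds(3)[OF t, of x, symmetric] by (rule set_lebesgue_integral_cong) (use e in auto)
  qed
  let ?h = "\<lambda>t k. of_real (exp (- t * real_of_int k ^ 4)) * fourier_coeff u0 k"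
  have hl: "l1 (?h t)" if "t \<in> {0..\<tau>}" for t using that by (intro heat_l1 sobolev_l1[OF s u0]) auto
  have sh: "semigroup4 t (fourier_coeff u0) x = synth (?h t) x" for t x by (simp add: semigroup4_def synth_def)
  have add: "synth (?h t) x + synth (duhamel_term \<nu> m p ?c t) x = synth (\<lambda>k. ?h t k + duhamel_term \<nu> m p ?c t k) x" if t: "t \<in> {0..\<tau>}" for t x
    unfolding synth_def distrib_right
    by (rule infsum_add[symmetric]) (rule abs_summable_summable, rule synth_summable, rule hl[OF t] ds(1)[OF t])+
  have rep: "complex_of_real (v t x) = synth (?c t) x" if "t \<in> {0..\<tau>}" for t x by (rule per_eq_synth[OF vp[OF that]])
  show ?thesis
  proof
    assume m: "mild_solution N s u0 \<tau> p v"
    show ?R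
    proof (intro ballI allI)
      fix t k assume t: "t \<in> {0..\<tau>}"
      have "synth (?c t) = synth (\<lambda>k. ?h t k + duhamel_term \<nu> m p ?c t k)"
      proof
        fix x show "synth (?c t) x = synth (\<lambda>k. ?h t k + duhamel_term \<nu> m p ?c t k) x"
          using m t unfolding mild_solution_def by (simp only: rep[OF t, symmetric] add[OF t, symmetric] sv[OF t, symmetric] sh[symmetric])
      qed
      then have "fcc (synth (?c t)) k = fcc (synth (\<lambda>k. ?h t k + duhamel_term \<nu> m p ?c t k)) k" by simp
      then show "?c t k = ?h t k + duhamel_term \<nu> m p ?c t k"
        using fcc_synth[OF vp(2)[OF t]] fcc_synth[OF l1_add(1)[OF hl[OF t] ds(1)[OF t]]] by simp
    qed
  next
    assume R: ?R
    show "mild_solution N s u0 \<tau> p v"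
      unfolding mild_solution_def
    proof (intro conjI ballI allI v)
      fix t x assume t: "t \<in> {0..\<tau>}"
      show "set_integrable lborel {0..t} (\<lambda>r. semigroup4 (t - r) (source N p v r) x)" by (rule si[OF t])
      have "?c t = (\<lambda>k. ?h t k + duhamel_term \<nu> m p ?c t k)" using R t by (intro ext) blast
      then have "synth (?c t) x = synth (\<lambda>k. ?h t k + duhamel_term \<nu> m p ?c t k) x" by (rule arg_cong[where f="\<lambda>c. synth c x"])
      then show "complex_of_real (v t x) = semigroup4 t (fourier_coeff u0) x + (LINT r:{0..t}|lborel. semigroup4 (t - r) (source N p v r) x)"
        unfolding sv[OF t] sh rep[OF t] add[OF t] .
    qed
  qed
qed

subsection \<open>Uniqueness\<close>

text \<open>On a time step of length \<open>hh\<close> the difference of two solutions is at most half of its own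
  bound, because the singular kernel has a small integral; iterating the step kills it there.
  Finitely many steps cover the interval, the length being the same for all of them.\<close>

lemma coeff_equation_unique:
  assumes c: "wcont \<tau> c" and d: "wcont \<tau> d" and S: "finite S" "\<And>t. t \<in> {0<..<\<tau>} - S \<Longrightarrow> isCont p t" and p: "\<And>t i. \<bar>(p t::real^3) $ i\<bar> \<le> P"
    and \<nu>: "\<And>k. cmod (\<nu> k) \<le> (real_of_int k)\<^sup>2"
    and ce: "\<And>t k. t \<in> {0..\<tau>} \<Longrightarrow> c t k = h t k + duhamel_term \<nu> m p c t k"
    and de: "\<And>t k. t \<in> {0..\<tau>} \<Longrightarrow> d t k = h t k + duhamel_term \<nu> m p d t k" and t: "t \<in> {0..\<tau>}"
  shows "c t = d t"
proof -
  have P: "P \<ge> 0" using order_trans[OF abs_ge_zero p] .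
  obtain R1 where R1: "R1 \<ge> 1" "\<And>t. t \<in> {0..\<tau>} \<Longrightarrow> l1n (c t) \<le> R1" using wcont_bounded[OF c] by blast
  obtain R2 where R2: "R2 \<ge> 1" "\<And>t. t \<in> {0..\<tau>} \<Longrightarrow> l1n (d t) \<le> R2" using wcont_bounded[OF d] by blast
  define R where "R = max R1 R2"
  have R: "R \<ge> 1" "\<And>t. t \<in> {0..\<tau>} \<Longrightarrow> l1n (c t) \<le> R" "\<And>t. t \<in> {0..\<tau>} \<Longrightarrow> l1n (d t) \<le> R"
    using R1 R2 by (auto simp: R_def le_max_iff_disj)
  have l: "l1 (c t)" "l1 (d t)" if "t \<in> {0..\<tau>}" for t using c d that by (auto simp: wcont_def)
  define A where "A = (1 + 3 * P) + m * R ^ m"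
  have A: "A > 0" using P R by (simp add: A_def add_pos_nonneg)
  define \<delta> where "\<delta> t k = c t k - d t k" for t k
  have \<delta>l: "l1 (\<delta> t)" if "t \<in> {0..\<tau>}" for t unfolding \<delta>_def by (intro l1_diff l that)
  \<comment> \<open>short enough for the singular kernel to give the factor one half\<close>
  define hh where "hh = min 1 ((1 / (6 * A))\<^sup>2)"
  have hh: "hh > 0" "hh \<le> 1" "sqrt hh \<le> 1 / (6 * A)"
  proof -
    show "hh > 0" "hh \<le> 1" using A by (auto simp: hh_def)
    have "sqrt hh \<le> sqrt ((1 / (6 * A))\<^sup>2)" by (intro real_sqrt_le_mono) (simp add: hh_def)
    then show "sqrt hh \<le> 1 / (6 * A)" using A by simp
  qed
  have hA: "A * (hh + 2 * sqrt hh) \<le> 1 / 2"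
  proof -
    have "hh \<le> sqrt hh" using hh by (intro real_le_rsqrt) (simp add: power2_eq_square mult_left_le)
    then have "A * (hh + 2 * sqrt hh) \<le> A * (3 * (1 / (6 * A)))" using hh A by (intro mult_left_mono) auto
    then show ?thesis using A by simp
  qed
  have step: "l1n (\<delta> t) \<le> B / 2"
    if a: "a \<ge> 0" and z: "\<And>r. r \<in> {0..\<tau>} \<Longrightarrow> r < a \<Longrightarrow> \<delta> r = (\<lambda>_. 0)" and B: "\<And>r. r \<in> {0..\<tau>} \<Longrightarrow> r \<le> a + hh \<Longrightarrow> l1n (\<delta> r) \<le> B"
      and t: "t \<in> {0..\<tau>}" "a \<le> t" "t \<le> a + hh" for a B t
  proof (rule l1I(2))
    have B0: "B \<ge> 0" using order_trans[OF l1n_nonneg B[OF t(1,3)]] .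
    fix F :: "int set" assume F: "finite F"
    let ?E = "\<lambda>r k. complex_of_real (exp (- (t - r) * real_of_int k ^ 4))"
    let ?g = "\<lambda>k r. ?E r k * source_coeff \<nu> m (p r) (c r) k - ?E r k * source_coeff \<nu> m (p r) (d r) k"
    have i1: "set_integrable lborel {0..t} (\<lambda>r. ?E r k * source_coeff \<nu> m (p r) (c r) k)" for k
      by (intro source_coeff_integrable[OF c S p t(1)] continuous_intros)
    have i2: "set_integrable lborel {0..t} (\<lambda>r. ?E r k * source_coeff \<nu> m (p r) (d r) k)" for k
      by (intro source_coeff_integrable[OF d S p t(1)] continuous_intros)
    have gi: "integrable lborel (\<lambda>r. indicat_real {0..t} r *\<^sub>R ?g k r)" for k
      using set_integral_diff(1)[OF i1 i2] by (simp add: set_integrable_def)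
    have \<delta>e: "\<delta> t k = (LINT r:{0..t}|lborel. ?g k r)" for k
      unfolding \<delta>_def ce[OF t(1)] de[OF t(1)] duhamel_term_def using set_integral_diff(2)[OF i1 i2] by simp
    have hi: "set_integrable lborel {a..t} (\<lambda>r. (1 + 1 / sqrt (t - r)) * (A * B))"
      by (intro set_integrable_mult_left inverse_sqrt_integral(1) t)
    have AE0: "AE r in lborel. r \<notin> {a,t}"
      using AE_lborel_singleton[of a] AE_lborel_singleton[of t] by eventually_elim auto
    have "(\<Sum>k\<in>F. cmod (\<delta> t k)) \<le> (\<Sum>k\<in>F. (LINT r|lborel. norm (indicat_real {0..t} r *\<^sub>R ?g k r)))"
      unfolding \<delta>e set_lebesgue_integral_def by (intro sum_mono integral_norm_bound)
    also have "\<dots> = (LINT r|lborel. (\<Sum>k\<in>F. norm (indicat_real {0..t} r *\<^sub>R ?g k r)))"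
      by (rule Bochner_Integration.integral_sum[symmetric]) (intro integrable_norm gi)
    also have "\<dots> \<le> (LINT r|lborel. indicat_real {a..t} r *\<^sub>R ((1 + 1 / sqrt (t - r)) * (A * B)))"
    proof (rule integral_mono_AE)
      show "integrable lborel (\<lambda>r. \<Sum>k\<in>F. norm (indicat_real {0..t} r *\<^sub>R ?g k r))"
        by (intro Bochner_Integration.integrable_sum integrable_norm gi)
      show "integrable lborel (\<lambda>r. indicat_real {a..t} r *\<^sub>R ((1 + 1 / sqrt (t - r)) * (A * B)))" using hi by (simp add: set_integrable_def)
      show "AE r in lborel. (\<Sum>k\<in>F. norm (indicat_real {0..t} r *\<^sub>R ?g k r)) \<le> indicat_real {a..t} r *\<^sub>R ((1 + 1 / sqrt (t - r)) * (A * B))"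
        using AE0
      proof eventually_elim
        case (elim r)
        consider "r \<notin> {0..t}" | "r \<in> {0..t}" "r < a" | "r \<in> {a<..<t}" using elim by force
        then show ?case
        proof cases
          case 1 then show ?thesis using a by (auto simp: indicator_def)
        next
          case 2
          then have "c r = d r" using z[of r] t unfolding \<delta>_def by (auto simp: fun_eq_iff)
          then show ?thesis using 2 by (simp add: indicator_def)
        next
          case 3
          then have rt: "r \<in> {0..\<tau>}" "r \<le> a + hh" "t - r > 0" using t a by auto
          have lr: "l1 (c r)" "l1 (d r)" using l rt by auto
          note lip = l1_cpow_lipschitz[OF lr(1) R(2)[OF rt(1)] lr(2) R(3)[OF rt(1)] R(1), of m]
          have "?g k r = ?E r k * (of_real ((real_of_int k)\<^sup>2) * \<delta> r k - \<nu> k * (cpow m (c r) k - cpow m (d r) k) + pot (p r) (\<delta> r) k)" for k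
            unfolding \<delta>_def pot_diff source_coeff_def by (simp add: algebra_simps)
          then have "(\<Sum>k\<in>F. norm (?g k r)) = (\<Sum>k\<in>F. exp (- (t - r) * real_of_int k ^ 4) * cmod (of_real ((real_of_int k)\<^sup>2) * \<delta> r k - \<nu> k * (cpow m (c r) k - cpow m (d r) k) + pot (p r) (\<delta> r) k))"
            by (intro sum.cong refl) (simp add: norm_mult)
          also have "\<dots> \<le> (1 + 1 / sqrt (t - r)) * ((1 + 3 * P) * l1n (\<delta> r) + l1n (\<lambda>k. cpow m (c r) k - cpow m (d r) k))"
            by (rule gain_sum[OF \<delta>l[OF rt(1)] lip(1) \<nu> p rt(3) F])
          also have "\<dots> \<le> (1 + 1 / sqrt (t - r)) * ((1 + 3 * P) * B + m * R ^ m * B)"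
          proof (intro mult_left_mono add_mono)
            show "l1n (\<delta> r) \<le> B" by (rule B[OF rt(1,2)])
            have "m * R ^ m * l1n (\<delta> r) \<le> m * R ^ m * B" using R B[OF rt(1,2)] by (intro mult_left_mono) auto
            then show "l1n (\<lambda>k. cpow m (c r) k - cpow m (d r) k) \<le> m * R ^ m * B" using lip(2) unfolding \<delta>_def by linarith
          qed (use P rt in auto)
          also have "\<dots> = (1 + 1 / sqrt (t - r)) * (A * B)" by (simp add: A_def algebra_simps)
          finally show ?thesis using 3 a by (simp add: indicator_def)
        qed
      qed
    qed
    also have "\<dots> = (LINT r:{a..t}|lborel. (1 + 1 / sqrt (t - r)) * (A * B))" by (simp only: set_lebesgue_integral_def)
    also have "\<dots> = ((t - a) + 2 * sqrt (t - a)) * (A * B)"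
      unfolding inverse_sqrt_integral(2)[OF t(2), symmetric] by (rule set_integral_mult_left)
    also have "\<dots> \<le> (hh + 2 * sqrt hh) * (A * B)"
      using t A B0 by (intro mult_right_mono add_mono mult_left_mono real_sqrt_le_mono) auto
    also have "\<dots> = (A * (hh + 2 * sqrt hh)) * B" by (simp only: mult_ac)
    also have "\<dots> \<le> 1 / 2 * B" by (rule mult_right_mono[OF hA B0])
    finally show "(\<Sum>k\<in>F. norm (\<delta> t k)) \<le> B / 2" by simp
  qed
  have main: "\<forall>t\<in>{0..\<tau>}. t < real n * hh \<longrightarrow> \<delta> t = (\<lambda>_. 0)" for n
  proof (induction n)
    case (Suc n)
    show ?case
    proof (intro ballI impI)
      fix t assume t: "t \<in> {0..\<tau>}" "t < real (Suc n) * hh"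
      let ?a = "real n * hh"
      have a: "?a \<ge> 0" using hh by simp
      show "\<delta> t = (\<lambda>_. 0)"
      proof (cases "t < ?a")
        case True then show ?thesis using Suc t by blast
      next
        case False
        have b0: "l1n (\<delta> r) \<le> 2 * R" if "r \<in> {0..\<tau>}" for r
          using l1_diff(2)[OF l[OF that]] R(2,3)[OF that] unfolding \<delta>_def by linarith
        have zr: "l1n (\<delta> r) = 0" if "r \<in> {0..\<tau>}" "r < ?a" for r using Suc that by (simp add: l1n_def)
        have it: "\<forall>r\<in>{0..\<tau>}. r \<le> ?a + hh \<longrightarrow> l1n (\<delta> r) \<le> 2 * R / 2 ^ j" for j
        proof (induction j)
          case 0 show ?case using b0 by simp
        next
          case (Suc j)
          show ?case
          proof (intro ballI impI)
            fix r assume r: "r \<in> {0..\<tau>}" "r \<le> ?a + hh"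
            show "l1n (\<delta> r) \<le> 2 * R / 2 ^ Suc j"
            proof (cases "r < ?a")
              case True then show ?thesis using zr[OF r(1)] R(1) by simp
            next
              case False
              have "l1n (\<delta> r) \<le> (2 * R / 2 ^ j) / 2"
                by (rule step[OF a _ _ r(1) _ r(2)]) (use \<open>\<forall>t\<in>{0..\<tau>}. t < ?a \<longrightarrow> \<delta> t = (\<lambda>_. 0)\<close> Suc False in auto)
              then show ?thesis by simp
            qed
          qed
        qed
        have "t \<le> ?a + hh" using t by (simp add: algebra_simps)
        then have "l1n (\<delta> t) \<le> 2 * R * (1 / 2) ^ j" for j using it t by (simp add: power_one_over)
        moreover have "(\<lambda>j. 2 * R * (1 / 2) ^ j) \<longlonglongrightarrow> 2 * R * 0" by (intro tendsto_mult tendsto_const LIMSEQ_realpow_zero) simp_all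
        ultimately have "l1n (\<delta> t) \<le> 2 * R * 0" by (intro LIMSEQ_le_const) auto
        then show ?thesis using l1_point[OF \<delta>l[OF t(1)]] by (intro ext) (metis mult_zero_right norm_le_zero_iff order_trans)
      qed
    qed
  qed simp
  obtain n where "t / hh < real n" using reals_Archimedean2 by blast
  then have "t < real n * hh" using hh by (simp add: field_simps)
  then have "\<delta> t = (\<lambda>_. 0)" using main t by blast
  then show ?thesis by (auto simp: \<delta>_def fun_eq_iff)
qed

section \<open>From linear steering to nonlinear controllability\<close>

subsection \<open>Majorants and continuity in time\<close>

lemma hs_tail:
  assumes D: "hs s D B" and e: "e > 0"
  obtains F where "finite F" "hs s (\<lambda>k. if k \<in> F then 0 else D k) e"
proof -
  let ?g = "\<lambda>k. (wt s k * D k)\<^sup>2"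
  have sm: "?g summable_on UNIV" using D hs_iff[of s D] unfolding power_mult_distrib wt_sq by blast
  let ?S = "infsum ?g UNIV"
  have "(sum ?g \<longlongrightarrow> ?S) (finite_subsets_at_top UNIV)" using has_sum_infsum[OF sm] by (simp add: has_sum_def)
  then have "\<forall>\<^sub>F F in finite_subsets_at_top UNIV. ?S - e\<^sup>2 < sum ?g F" using e by (intro order_tendstoD(1)) auto
  then obtain F where F: "finite F" "?S - e\<^sup>2 < sum ?g F" unfolding eventually_finite_subsets_at_top by blast
  show thesis
  proof (rule that[OF F(1)], unfold hs_def, intro allI impI)
    fix G :: "int set" assume G: "finite G"
    have "L2_set (\<lambda>k. wt s k * (if k \<in> F then 0 else D k)) G = sqrt (\<Sum>k\<in>G. if k \<in> F then 0 else ?g k)"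
      unfolding L2_set_def by (intro arg_cong[where f=sqrt] sum.cong) auto
    also have "(\<Sum>k\<in>G. if k \<in> F then 0 else ?g k) = sum ?g (G - F)"
      using G by (intro sum.mono_neutral_cong_right) auto
    also have "\<dots> = sum ?g ((G - F) \<union> F) - sum ?g F" using G F by (subst sum.union_disjoint) auto
    also have "\<dots> \<le> e\<^sup>2" using finite_sum_le_infsum[OF sm, of "(G - F) \<union> F"] G F by simp
    finally show "L2_set (\<lambda>k. wt s k * (if k \<in> F then 0 else D k)) G \<le> e"
      using e by (simp add: real_le_lsqrt real_sqrt_le_iff)
  qed
qed

text \<open>Dominated convergence for sequences: finitely many modes carry all but \<open>e/2\<close> of the majorant.\<close>

lemma hs_dominated_null:
  fixes f :: "'a \<Rightarrow> int \<Rightarrow> complex"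
  assumes D: "hs s D B" and le: "\<forall>\<^sub>F a in G. \<forall>k. cmod (f a k) \<le> D k" and z: "\<And>k. ((\<lambda>a. f a k) \<longlongrightarrow> 0) G" and e: "e > 0"
  shows "\<forall>\<^sub>F a in G. hs s (\<lambda>k. cmod (f a k)) e"
proof -
  obtain F where F: "finite F" "hs s (\<lambda>k. if k \<in> F then 0 else D k) (e/2)" using hs_tail[OF D, of "e/2"] e by auto
  have "((\<lambda>a. \<Sum>k\<in>F. wt s k * cmod (f a k)) \<longlongrightarrow> (\<Sum>k\<in>F. wt s k * cmod 0)) G" by (intro tendsto_sum tendsto_mult tendsto_const tendsto_norm z)
  then have "\<forall>\<^sub>F a in G. (\<Sum>k\<in>F. wt s k * cmod (f a k)) < e/2" using e by (intro order_tendstoD(2)) auto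
  with le show ?thesis
  proof eventually_elim
    case (elim a)
    have "hs s (\<lambda>k. if k \<in> F then cmod (f a k) else 0) (e/2)" unfolding hs_def
    proof (intro allI impI)
      fix G :: "int set" assume G: "finite G"
      have "L2_set (\<lambda>k. wt s k * (if k \<in> F then cmod (f a k) else 0)) G \<le> (\<Sum>k\<in>G. wt s k * (if k \<in> F then cmod (f a k) else 0))"
        by (intro L2_set_le_sum) auto
      also have "\<dots> = (\<Sum>k\<in>G \<inter> F. wt s k * cmod (f a k))" using G by (intro sum.mono_neutral_cong_right) auto
      also have "\<dots> \<le> (\<Sum>k\<in>F. wt s k * cmod (f a k))" using F by (intro sum_mono2) auto
      finally show "L2_set (\<lambda>k. wt s k * (if k \<in> F then cmod (f a k) else 0)) G \<le> e/2" using elim by linarith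
    qed
    from hs_add[OF this F(2)] show ?case by (rule hs_mono) (use elim in auto)
  qed
qed

lemma continuous_into_sobolev_majorant:
  assumes C: "hs s C B" and u: "\<And>t. t \<in> {0..\<tau>} \<Longrightarrow> u t \<in> per" and le: "\<And>t k. t \<in> {0..\<tau>} \<Longrightarrow> cmod (fourier_coeff (u t) k) \<le> C k"
    and c: "\<And>k. continuous_on {0..\<tau>} (\<lambda>t. fourier_coeff (u t) k)"
  shows "continuous_into_sobolev s \<tau> u"
  unfolding continuous_into_sobolev_def
proof (intro ballI conjI)
  fix t assume t: "t \<in> {0..\<tau>}"
  have us: "u r \<in> sobolev_space s" if "r \<in> {0..\<tau>}" for r
    unfolding sobolev_iff using u[OF that] hs_mono[OF C, of "\<lambda>k. cmod (fourier_coeff (u r) k)" B] le[OF that] by auto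
  show "u t \<in> sobolev_space s" by (rule us[OF t])
  let ?G = "at t within {0..\<tau>}"
  have inG: "\<forall>\<^sub>F r in ?G. r \<in> {0..\<tau>}" by (simp add: eventually_at_filter)
  show "((\<lambda>r. sobolev_norm s (\<lambda>x. u r x - u t x)) \<longlongrightarrow> 0) ?G"
  proof (rule tendstoI)
    fix e :: real assume e: "e > 0"
    have "\<forall>\<^sub>F r in ?G. hs s (\<lambda>k. cmod (fourier_coeff (u r) k - fourier_coeff (u t) k)) (e/2)"
    proof (rule hs_dominated_null[OF hs_cmult[OF C, of 2]])
      show "\<forall>\<^sub>F r in ?G. \<forall>k. cmod (fourier_coeff (u r) k - fourier_coeff (u t) k) \<le> 2 * C k"
        using inG
      proof eventually_elim
        case (elim r)
        show ?case
        proof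
          fix k show "cmod (fourier_coeff (u r) k - fourier_coeff (u t) k) \<le> 2 * C k"
            using norm_triangle_ineq4[of "fourier_coeff (u r) k" "fourier_coeff (u t) k"] le[OF elim, of k] le[OF t, of k] by linarith
        qed
      qed
      show "((\<lambda>r. fourier_coeff (u r) k - fourier_coeff (u t) k) \<longlongrightarrow> 0) ?G" for k
        using c[of k] t unfolding continuous_on_def by (intro LIM_zero) auto
    qed (use e in auto)
    with inG show "\<forall>\<^sub>F r in ?G. dist (sobolev_norm s (\<lambda>x. u r x - u t x)) 0 < e"
    proof eventually_elim
      case (elim r)
      have "sobolev_norm s (\<lambda>x. u r x - u t x) \<le> e/2"
        by (rule sobolev_norm_le) (use elim(2) in \<open>simp add: fourier_coeff_diff[OF u[OF elim(1)] u[OF t]]\<close>)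
      moreover have "sobolev_norm s (\<lambda>x. u r x - u t x) \<ge> 0" by (simp add: sobolev_norm_def infsum_nonneg)
      ultimately show ?case using e by simp
    qed
  qed
qed

subsection \<open>Realizing a linear control by a nonlinear one\<close>

lemma cpow_cmult: "cpow m (\<lambda>k. a * c k) = (\<lambda>k. a ^ m * cpow m (c :: int \<Rightarrow> complex) k)"
proof (induction m)
  case (Suc m)
  have "conv (\<lambda>k. a * c k) (\<lambda>k. a ^ m * cpow m c k) k = a ^ Suc m * conv c (cpow m c) k" for k
  proof -
    have "(\<lambda>j. (a * c j) * (a ^ m * cpow m c (k - j))) = (\<lambda>j. a ^ Suc m * (c j * cpow m c (k - j)))" by (simp add: mult_ac)
    then show ?thesis unfolding conv_def by (simp only: infsum_cmult_right')
  qed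
  then show ?case unfolding cpow.simps Suc.IH by (intro ext)
qed auto

lemma pot_add_const: "pot (q + a *\<^sub>R axis 1 1) c k = pot q c k + of_real a * c k"
  by (simp add: pot_def axis_def algebra_simps)

lemma L2_control_pcont: assumes "pcont \<tau> p" shows "L2_control \<tau> p"
proof -
  obtain B S where B: "\<And>t. t \<in> {0..\<tau>} \<Longrightarrow> norm (p t) \<le> B" and S: "finite S" "\<And>t. t \<in> {0<..<\<tau>} - S \<Longrightarrow> isCont p t"
    using assms unfolding pcont_def by metis
  have "pcont \<tau> (\<lambda>t. (norm (p t))\<^sup>2)" unfolding pcont_def
  proof (intro conjI exI ballI)
    show "norm ((norm (p t))\<^sup>2) \<le> B\<^sup>2" if "t \<in> {0..\<tau>}" for t using B[OF that] by (simp add: power_mono)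
    show "finite S" by fact
    show "isCont (\<lambda>t. (norm (p t))\<^sup>2) t" if "t \<in> {0<..<\<tau>} - S" for t using S(2)[OF that] by (intro continuous_intros)
  qed
  then have "set_integrable lborel {0<..<\<tau>} (\<lambda>t. (norm (p t))\<^sup>2)"
    using set_integrable_subset[OF pcont_integrable] by (metis greaterThanLessThan_subseteq_atLeastAtMost_iff order_refl sets_lborel borel_open open_greaterThanLessThan)
  moreover have "set_integrable lborel {0<..<\<tau>} p"
    using assms set_integrable_subset[OF pcont_integrable] by (metis greaterThanLessThan_subseteq_atLeastAtMost_iff order_refl sets_lborel borel_open open_greaterThanLessThan)
  ultimately show ?thesis unfolding L2_control_def set_borel_measurable_def set_integrable_def by auto
qed

lemma mild_unique:
  assumes s: "s > 1/2" and N: "\<And>u k. N u k = \<nu> k * fourier_coeff (\<lambda>x. u x ^ m) k" and \<nu>: "\<And>k. cmod (\<nu> k) \<le> (real_of_int k)\<^sup>2"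
    and u0: "u0 \<in> sobolev_space s" and S: "finite S" "\<And>t. t \<in> {0<..<\<tau>} - S \<Longrightarrow> isCont p t" and p: "\<And>t i. \<bar>(p t::real^3) $ i\<bar> \<le> P"
    and u: "mild_solution N s u0 \<tau> p u" and v: "mild_solution N s u0 \<tau> p v" and t: "t \<in> {0..\<tau>}"
  shows "v t = u t"
proof -
  have ci: "continuous_into_sobolev s \<tau> u" "continuous_into_sobolev s \<tau> v" using u v by (auto simp: mild_solution_def)
  have eq: "\<forall>t\<in>{0..\<tau>}. \<forall>k. fourier_coeff (w t) k =
     of_real (exp (- t * real_of_int k ^ 4)) * fourier_coeff u0 k + duhamel_term \<nu> m p (\<lambda>t. fourier_coeff (w t)) t k"
    if "continuous_into_sobolev s \<tau> w" "mild_solution N s u0 \<tau> p w" for w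
    using mild_iff_coeff[OF s N \<nu> u0 that(1) S p] that(2) by blast
  have "fourier_coeff (v t) = fourier_coeff (u t)"
    by (rule coeff_equation_unique[OF continuous_into_sobolev_wcont[OF s ci(2)] continuous_into_sobolev_wcont[OF s ci(1)] S p \<nu> _ _ t])
      (use eq[OF ci(1) u] eq[OF ci(2) v] in auto)
  moreover have "u t \<in> per" "v t \<in> per" using ci t by (auto simp: continuous_into_sobolev_def sobolev_iff)
  ultimately have "v t x - u t x = 0" for x
    by (intro per_unique[of "\<lambda>x. v t x - u t x"]) (auto simp: fourier_coeff_diff per_diff)
  then show ?thesis by auto
qed

lemma duhamel_lebesgue:
  fixes y g :: "real \<Rightarrow> complex"
  assumes y: "continuous_on {0..\<tau>} y" and S: "finite S"
    and ode: "\<And>t. t \<in> {0<..<\<tau>} - S \<Longrightarrow> (y has_vector_derivative (- of_real \<alpha> * y t + g t)) (at t)"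
    and t: "t \<in> {0..\<tau>}" and i: "set_integrable lborel {0..t} (\<lambda>r. of_real (exp (- (t - r) * \<alpha>)) * g r)"
  shows "y t = of_real (exp (- t * \<alpha>)) * y 0 + (LINT r:{0..t}|lborel. of_real (exp (- (t - r) * \<alpha>)) * g r)"
proof -
  have e: "- (t - r) * \<alpha> = - (\<alpha> * (t - r))" "- t * \<alpha> = - (\<alpha> * t)" for r by (simp_all add: algebra_simps)
  show ?thesis using set_borel_integral_eq_integral(2)[OF i] integral_unique[OF duhamel[OF y S ode t]] unfolding e by simp
qed

text \<open>The scalar factor \<open>\<eta>\<close>, which falls quickly after the initial time and recovers just before the final
  one.  Outside the interval it equals 1, so that its bounds hold at all times.\<close>

definition dip :: "real \<Rightarrow> real \<Rightarrow> real \<Rightarrow> real" where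
  "dip M \<tau> t = exp (- (M * max 0 (min t (\<tau> - t))))"

lemma dip_pos [simp]: "dip M \<tau> t > 0" by (simp add: dip_def)

lemma dip_le1: "M \<ge> 0 \<Longrightarrow> dip M \<tau> t \<le> 1" by (simp add: dip_def)

lemma dip_cont: "continuous_on A (dip M \<tau>)" unfolding dip_def by (intro continuous_intros)

lemma dip_ends: "\<tau> \<ge> 0 \<Longrightarrow> dip M \<tau> 0 = 1" "\<tau> \<ge> 0 \<Longrightarrow> dip M \<tau> \<tau> = 1" by (simp_all add: dip_def)

lemma dip_le: assumes M: "M \<ge> 0" shows "dip M \<tau> r \<le> exp (- (M * r)) + exp (- (M * (\<tau> - r)))"
proof -
  have "M * max 0 (min r (\<tau> - r)) \<ge> M * r \<or> M * max 0 (min r (\<tau> - r)) \<ge> M * (\<tau> - r)"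
    using M by (cases "r \<le> \<tau> - r") (auto intro!: mult_left_mono)
  then have "dip M \<tau> r \<le> exp (- (M * r)) \<or> dip M \<tau> r \<le> exp (- (M * (\<tau> - r)))" by (simp add: dip_def)
  then show ?thesis using exp_gt_zero[of "- (M * r)"] exp_gt_zero[of "- (M * (\<tau> - r))"] by linarith
qed

lemma dip_derivative:
  assumes t: "t \<in> {0<..<\<tau>}" "t \<noteq> \<tau> / 2"
  shows "(dip M \<tau> has_real_derivative (if t < \<tau> / 2 then - M else M) * dip M \<tau> t) (at t)"
proof (cases "t < \<tau> / 2")
  case True
  have "((\<lambda>t. exp (- (M * t))) has_real_derivative - M * exp (- (M * t))) (at t)" by (auto intro!: derivative_eq_intros)
  then have "(dip M \<tau> has_real_derivative - M * exp (- (M * t))) (at t)"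
    by (rule has_field_derivative_transform_within_open[of _ _ _ "{0<..<\<tau>/2}"]) (use t True in \<open>auto simp: dip_def\<close>)
  moreover have "dip M \<tau> t = exp (- (M * t))" using t True by (auto simp: dip_def)
  ultimately show ?thesis using True by simp
next
  case False
  have "((\<lambda>t. exp (- (M * (\<tau> - t)))) has_real_derivative M * exp (- (M * (\<tau> - t)))) (at t)" by (auto intro!: derivative_eq_intros)
  then have "(dip M \<tau> has_real_derivative M * exp (- (M * (\<tau> - t)))) (at t)"
    by (rule has_field_derivative_transform_within_open[of _ _ _ "{\<tau>/2<..<\<tau>}"]) (use t False in \<open>auto simp: dip_def\<close>)
  moreover have "dip M \<tau> t = exp (- (M * (\<tau> - t)))" using t False by (auto simp: dip_def)
  ultimately show ?thesis using False by simp
qed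

text \<open>Multiplying by the factor adds its logarithmic derivative, \<open>- M\<close> and then \<open>M\<close>, to the constant
  component of the control and turns \<open>\<eta>\<^sup>m\<^sup>-\<^sup>1\<close> times the nonlinearity into the nonlinearity itself.\<close>

lemma dip_ode:
  assumes t: "t \<in> {0<..<\<tau>} - S" "t \<noteq> \<tau> / 2" and m: "m \<ge> 1"
    and c: "nlstep \<tau> q (\<lambda>t. dip M \<tau> t ^ (m - 1)) \<nu> m S c0 c c"
  shows "((\<lambda>t. of_real (dip M \<tau> t) * c t k) has_vector_derivative
     (- of_real (real_of_int k ^ 4) * (of_real (dip M \<tau> t) * c t k)
       + source_coeff \<nu> m (q t + (if t < \<tau> / 2 then - M else M) *\<^sub>R axis 1 1) (\<lambda>k. of_real (dip M \<tau> t) * c t k) k)) (at t)"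
proof -
  let ?\<eta> = "dip M \<tau>"
  define a where "a = (if t < \<tau> / 2 then - M else M)"
  have 1: "((\<lambda>t. complex_of_real (?\<eta> t)) has_vector_derivative of_real (a * ?\<eta> t)) (at t)"
    by (intro has_vector_derivative_of_real) (use dip_derivative[of t \<tau> M] t in \<open>simp add: has_real_derivative_iff_has_vector_derivative a_def\<close>)
  have 2: "((\<lambda>t. c t k) has_vector_derivative
        (- of_real (dsp k) * c t k + (pot (q t) (c t) k - of_real (?\<eta> t ^ (m - 1)) * (\<nu> k * cpow m (c t) k)))) (at t)"
    using c t unfolding nlstep_def by blast
  have pw: "complex_of_real (?\<eta> t) * of_real (?\<eta> t) ^ (m - 1) = of_real (?\<eta> t) ^ m" using m by (metis power_eq_if not_one_le_zero)
  have eq: "of_real (?\<eta> t) * (- of_real (dsp k) * c t k + (pot (q t) (c t) k - of_real (?\<eta> t ^ (m - 1)) * (\<nu> k * cpow m (c t) k))) + of_real (a * ?\<eta> t) * c t k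
    = - of_real (real_of_int k ^ 4) * (of_real (?\<eta> t) * c t k) + (of_real ((real_of_int k)\<^sup>2) * (of_real (?\<eta> t) * c t k)
      - \<nu> k * ((of_real (?\<eta> t) * of_real (?\<eta> t) ^ (m - 1)) * cpow m (c t) k) + of_real (?\<eta> t) * (pot (q t) (c t) k + of_real a * c t k))"
    by (simp add: dsp_def algebra_simps)
  note 3 = has_vector_derivative_mult[OF 1 2, unfolded eq pw]
  show ?thesis unfolding source_coeff_def cpow_cmult pot_add_const pot_cmult a_def[symmetric] by (rule 3)
qed

text \<open>The linear solution \<open>d\<close> is obtained from the same fixed point argument with \<open>\<mu> = 0\<close>.  The number \<open>M\<close> is
  chosen last, after all constants that depend on the data and on \<open>q\<close>; at the final time the factor
  is 1, so \<open>u\<close> and \<open>w\<close> coincide there.\<close>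

lemma realize_linear:
  fixes N :: "(real \<Rightarrow> real) \<Rightarrow> int \<Rightarrow> complex"
  assumes s: "s > 1/2" and m: "m \<ge> 2" and N: "\<And>u k. N u k = \<nu> k * fourier_coeff (\<lambda>x. u x ^ m) k"
    and \<nu>: "\<And>k. cmod (\<nu> k) \<le> (real_of_int k)\<^sup>2" "herm \<nu>"
    and u0: "u0 \<in> sobolev_space s" and \<tau>: "\<tau> > 0" and q: "pcont \<tau> q" and \<epsilon>: "\<epsilon> > 0"
  shows "\<exists>p u d. L2_control \<tau> p \<and> is_solution N s u0 \<tau> p u \<and> lin_sol \<tau> q d \<and> d 0 = fourier_coeff u0 \<and>
     hs s (\<lambda>k. cmod (fourier_coeff (u \<tau>) k - d \<tau> k)) \<epsilon>"
proof -
  obtain B S where B: "\<And>t. t \<in> {0..\<tau>} \<Longrightarrow> norm (q t) \<le> B" and S: "finite S" "\<And>t. t \<in> {0<..<\<tau>} - S \<Longrightarrow> isCont q t"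
    using q unfolding pcont_def by metis
  \<comment> \<open>the estimates ask for bounds at all times, so the control is set to zero outside the interval\<close>
  define q' where "q' t = (if t \<in> {0..\<tau>} then q t else 0)" for t
  define P where "P = \<bar>B\<bar>"
  have P: "P \<ge> 0" by (simp add: P_def)
  have qP: "\<bar>(q' t :: real^3) $ i\<bar> \<le> P" for t i
    using order_trans[OF component_le_norm_cart[of "q t" i] B[of t]] by (auto simp: q'_def P_def)
  have qc: "isCont q' t" if "t \<in> {0<..<\<tau>} - S" for t
  proof -
    have "\<forall>\<^sub>F t' in nhds t. q' t' = q t'" unfolding eventually_nhds
      by (rule exI[of _ "{0<..<\<tau>}"]) (use that in \<open>auto simp: q'_def\<close>)
    then show ?thesis using S(2)[OF that] isCont_cong by blast
  qed
  have qp: "pcont \<tau> q'" unfolding pcont_def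
  proof (intro conjI exI ballI)
    show "norm (q' t) \<le> B" if "t \<in> {0..\<tau>}" for t using B[OF that] that by (simp add: q'_def)
    show "finite S" by fact
    show "isCont q' t" if "t \<in> {0<..<\<tau>} - S" for t by (rule qc[OF that])
  qed
  define R0 where "R0 = sobolev_norm s u0"
  let ?c0 = "fourier_coeff u0"
  have c0: "hs s (\<lambda>k. cmod (?c0 k)) R0" unfolding R0_def by (rule hs_sobolev_norm[OF u0])
  have R0: "R0 \<ge> 0" by (rule hs_nonneg[OF c0])
  have h0: "herm ?c0" using u0 fourier_coeff_neg by (auto simp: herm_def sobolev_iff)
  define L where "L = 4 * P * nbc s + 1"
  have L0: "L \<ge> 0" using P nbc_pos[of s] by (simp add: L_def)
  have \<tau>0: "\<tau> \<ge> 0" and m1: "m \<ge> 1" using \<tau> m by auto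
  obtain \<kappa>0 where \<kappa>0: "\<kappa>0 > 0" and ex0: "\<forall>q \<mu> \<nu> S c0. finite S \<longrightarrow> pcont \<tau> q \<longrightarrow> (\<forall>t\<in>{0<..<\<tau>} - S. isCont q t) \<longrightarrow> (\<forall>t i. \<bar>(q t :: real^3) $ i\<bar> \<le> P) \<longrightarrow>
     continuous_on {0..\<tau>} \<mu> \<longrightarrow> (\<forall>t. \<mu> t \<ge> 0) \<longrightarrow> kbound \<tau> \<mu> \<kappa>0 \<longrightarrow>
     (\<forall>k. cmod (\<nu> k) \<le> (real_of_int k)\<^sup>2) \<longrightarrow> herm \<nu> \<longrightarrow> herm c0 \<longrightarrow> hs s (\<lambda>k. cmod (c0 k)) R0 \<longrightarrow>
     (\<exists>c. nlstep \<tau> q \<mu> \<nu> m S c0 c c \<and> tnorm s L \<tau> c (2 * R0) \<and> (\<forall>t\<in>{0..\<tau>}. herm (c t)))"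
    using nl_solution_exists[OF s R0 P L_def m1 \<tau>0] by (elim exE conjE) (rule that)
  have ex: "\<exists>c. nlstep \<tau> q' \<mu> \<nu> m S ?c0 c c \<and> tnorm s L \<tau> c (2 * R0) \<and> (\<forall>t\<in>{0..\<tau>}. herm (c t))"
    if "continuous_on {0..\<tau>} \<mu>" "\<And>t. \<mu> t \<ge> 0" "kbound \<tau> \<mu> \<kappa>0" for \<mu>
    by (rule ex0[rule_format]) (simp_all only: S(1) qp qc qP \<nu> h0 c0 that, (blast intro: qc)?)
  have R02: "2 * R0 \<ge> 0" using R0 by simp
  obtain Z where Z: "Z \<ge> 0" and cl0: "\<forall>q \<mu> \<nu> S c0 c d \<kappa>. finite S \<longrightarrow> (\<forall>t i. \<bar>(q t :: real^3) $ i\<bar> \<le> P) \<longrightarrow> (\<forall>t. \<mu> t \<ge> 0) \<longrightarrow> kbound \<tau> \<mu> \<kappa> \<longrightarrow> \<kappa> \<ge> 0 \<longrightarrow>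
     (\<forall>k. cmod (\<nu> k) \<le> (real_of_int k)\<^sup>2) \<longrightarrow> nlstep \<tau> q \<mu> \<nu> m S c0 c c \<longrightarrow> tnorm s L \<tau> c (2 * R0) \<longrightarrow>
     nlstep \<tau> q (\<lambda>_. 0) \<nu> m S c0 d d \<longrightarrow> tnorm s L \<tau> d (2 * R0) \<longrightarrow> hs s (\<lambda>k. cmod (c \<tau> k - d \<tau> k)) (Z * \<kappa>)"
    using nl_close[OF s R02 P L0 \<tau>0, of m] by (elim exE conjE) (rule that)
  note cl = cl0[rule_format, OF S(1) qP _ _ _ \<nu>(1)]
  define \<kappa> where "\<kappa> = min \<kappa>0 (\<epsilon> / (Z + 1))"
  have \<kappa>: "\<kappa> > 0" "\<kappa> \<le> \<kappa>0" "Z * \<kappa> \<le> \<epsilon>"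
  proof -
    show "\<kappa> > 0" "\<kappa> \<le> \<kappa>0" using \<kappa>0 \<epsilon> Z by (auto simp: \<kappa>_def)
    have "Z * \<kappa> \<le> (Z + 1) * (\<epsilon> / (Z + 1))" using Z \<epsilon> \<open>\<kappa> > 0\<close> by (intro mult_mono) (auto simp: \<kappa>_def)
    then show "Z * \<kappa> \<le> \<epsilon>" using Z by simp
  qed
  define A where "A = (\<tau> + 1) / 2 + 1"
  have A: "A > 0" unfolding A_def by (intro add_pos_pos divide_pos_pos \<tau> zero_less_one zero_less_numeral)
  define M where "M = (A / \<kappa>)\<^sup>2"
  have M: "M > 0" "A / sqrt M = \<kappa>" using A \<kappa> by (auto simp: M_def real_sqrt_abs)
  define \<eta> where "\<eta> = dip M \<tau>"
  define \<mu> where "\<mu> t = \<eta> t ^ (m - 1)" for t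
  have \<eta>: "\<eta> t > 0" "\<eta> t \<le> 1" for t using M by (auto simp: \<eta>_def dip_le1)
  have \<mu>0: "\<mu> t \<ge> 0" for t using \<eta>[of t] by (simp add: \<mu>_def)
  have \<mu>c: "continuous_on {0..\<tau>} \<mu>" unfolding \<mu>_def \<eta>_def by (intro continuous_intros dip_cont)
  have kb: "kbound \<tau> \<mu> \<kappa>"
  proof -
    have "\<mu> r \<le> exp (- (M * r)) + exp (- (M * (\<tau> - r)))" for r
    proof -
      have "\<mu> r \<le> \<eta> r ^ 1" unfolding \<mu>_def using \<eta>[of r] m by (intro power_decreasing) auto
      then show ?thesis using dip_le[of M \<tau> r] M by (simp add: \<eta>_def)
    qed
    from kbound_small[OF M(1) \<mu>c \<mu>0 this] show ?thesis using M(2) by (simp add: A_def)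
  qed
  have kb0: "kbound \<tau> \<mu> \<kappa>0" using kb \<kappa>(2) unfolding kbound_def by (meson order_trans)
  have kz: "kbound \<tau> (\<lambda>_. 0) \<kappa>0" unfolding kbound_def using \<kappa>0 by (auto intro!: exI[of _ 0])
  obtain c where c: "nlstep \<tau> q' \<mu> \<nu> m S ?c0 c c" "tnorm s L \<tau> c (2 * R0)" "\<And>t. t \<in> {0..\<tau>} \<Longrightarrow> herm (c t)"
    using ex[OF \<mu>c \<mu>0 kb0] by blast
  obtain d where d: "nlstep \<tau> q' (\<lambda>_. 0) \<nu> m S ?c0 d d" "tnorm s L \<tau> d (2 * R0)"
    using ex[OF continuous_on_const order_refl kz] by blast
  define p where "p t = q' t + (if t < \<tau> / 2 then - M else M) *\<^sub>R axis 1 1" for t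
  have pP: "\<bar>(p t :: real^3) $ i\<bar> \<le> P + M" for t i
    using qP[of t i] M(1) unfolding p_def by (auto simp: axis_def)
  have pc: "isCont p t" if t: "t \<in> {0<..<\<tau>} - insert (\<tau> / 2) S" for t
  proof -
    have "isCont (\<lambda>t. if t < \<tau> / 2 then - M else M) t"
    proof (cases "t < \<tau> / 2")
      case True
      then have "\<forall>\<^sub>F t' in nhds t. (if t' < \<tau> / 2 then - M else M) = - M" unfolding eventually_nhds by (intro exI[of _ "{..<\<tau>/2}"]) auto
      then show ?thesis using isCont_cong[of _ "\<lambda>_. - M"] by auto
    next
      case False
      then have "\<forall>\<^sub>F t' in nhds t. (if t' < \<tau> / 2 then - M else M) = M" unfolding eventually_nhds using t by (intro exI[of _ "{\<tau>/2<..}"]) auto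
      then show ?thesis using isCont_cong[of _ "\<lambda>_. M"] by auto
    qed
    then show ?thesis unfolding p_def using qc[of t] t by (intro continuous_intros) auto
  qed
  have S': "finite (insert (\<tau> / 2) S)" using S by simp
  have pp: "pcont \<tau> p"
  proof -
    have "norm (p t) \<le> P + P + P + 3 * M" for t
      using norm_le_l1_cart[of "p t"] sum_bounded_above[of UNIV "\<lambda>i. \<bar>p t $ i\<bar>" "P + M"] pP by force
    then show ?thesis unfolding pcont_def using S' pc by blast
  qed
  define e where "e t k = (if t \<in> {0..\<tau>} then of_real (\<eta> t) * c t k else 0)" for t k
  define u where "u t x = Re (synth (e t) x)" for t x
  obtain C where C: "\<And>k. C k \<ge> 0" "hs s C (2 * R0)" "\<And>t k. t \<in> {0..\<tau>} \<Longrightarrow> cmod (c t k) \<le> exp (L * t) * C k"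
    using c(2) unfolding tnorm_def by blast
  have D: "hs s (\<lambda>k. exp (L * \<tau>) * C k) (exp (L * \<tau>) * (2 * R0))" by (intro hs_cmult C) simp
  have eD: "cmod (e t k) \<le> exp (L * \<tau>) * C k" for t k
  proof (cases "t \<in> {0..\<tau>}")
    case True
    have "cmod (c t k) \<le> exp (L * \<tau>) * C k"
      using True L0 by (intro order_trans[OF C(3)[OF True]] mult_right_mono C) (auto intro: mult_left_mono)
    then have "cmod (e t k) \<le> 1 * (exp (L * \<tau>) * C k)"
      using True \<eta>[of t] unfolding e_def by (simp add: norm_mult del: mult_1) (metis mult_mono' mult_1 abs_of_pos norm_ge_zero abs_ge_zero)
    then show ?thesis by simp
  qed (use C(1) in \<open>auto simp: e_def\<close>)
  obtain K1 where K1: "K1 > 0" "\<And>C B. hs s C B \<Longrightarrow> l1 C \<and> l1n C \<le> K1 * B" using hs_l1[OF s] by blast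
  have el: "l1 (e t)" for t using l1_mono(1)[of "\<lambda>k. exp (L * \<tau>) * C k" "e t"] K1(2)[OF D] eD by blast
  have eh: "herm (e t)" for t using c(3)[of t] by (auto simp: herm_def e_def)
  have uc: "fourier_coeff (u t) = e t" for t
    unfolding u_def using fourier_coeff_synth[OF el[of t]] eh[of t] by (intro ext) (auto simp: herm_def)
  have ec: "continuous_on {0..\<tau>} (\<lambda>t. e t k)" for k
  proof -
    have "continuous_on {0..\<tau>} (\<lambda>t. of_real (\<eta> t) * c t k)" using c(1) unfolding nlstep_def \<eta>_def by (intro continuous_intros dip_cont) blast
    then show ?thesis by (rule continuous_on_eq) (simp add: e_def)
  qed
  have cis: "continuous_into_sobolev s \<tau> u"
  proof (rule continuous_into_sobolev_majorant[OF D])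
    show "u t \<in> per" for t unfolding u_def by (rule synth_per[OF el])
    show "cmod (fourier_coeff (u t) k) \<le> exp (L * \<tau>) * C k" for t k unfolding uc by (rule eD)
    show "continuous_on {0..\<tau>} (\<lambda>t. fourier_coeff (u t) k)" for k unfolding uc by (rule ec)
  qed
  have ode: "((\<lambda>t. e t k) has_vector_derivative (- of_real (real_of_int k ^ 4) * e t k + source_coeff \<nu> m (p t) (e t) k)) (at t)"
    if t: "t \<in> {0<..<\<tau>} - insert (\<tau> / 2) S" for t k
  proof -
    have et: "e t = (\<lambda>k. of_real (dip M \<tau> t) * c t k)" using t by (auto simp: e_def \<eta>_def)
    have "((\<lambda>t. of_real (dip M \<tau> t) * c t k) has_vector_derivative (- of_real (real_of_int k ^ 4) * e t k + source_coeff \<nu> m (p t) (e t) k)) (at t)"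
      unfolding et p_def by (rule dip_ode[OF _ _ m1 c(1)[unfolded \<mu>_def \<eta>_def]]) (use t in auto)
    then show ?thesis
      by (rule has_vector_derivative_transform_within_open[of _ _ _ "{0<..<\<tau>}"]) (use t in \<open>auto simp: e_def \<eta>_def\<close>)
  qed
  have wc: "wcont \<tau> e" using continuous_into_sobolev_wcont[OF s cis] by (simp add: uc)
  have e0: "e 0 = ?c0" using c(1) \<tau>0 by (auto simp: e_def \<eta>_def dip_ends nlstep_def)
  have mild: "mild_solution N s u0 \<tau> p u"
  proof (subst mild_iff_coeff[OF s N \<nu>(1) u0 cis S' pc pP], assumption, intro ballI allI)
    fix t k assume t: "t \<in> {0..\<tau>}"
    have i: "set_integrable lborel {0..t} (\<lambda>r. of_real (exp (- (t - r) * real_of_int k ^ 4)) * source_coeff \<nu> m (p r) (e r) k)"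
      by (rule source_coeff_integrable[OF wc S' pc pP t], assumption) (intro continuous_intros)
    show "fourier_coeff (u t) k = of_real (exp (- t * real_of_int k ^ 4)) * ?c0 k + duhamel_term \<nu> m p (\<lambda>t. fourier_coeff (u t)) t k"
      using duhamel_lebesgue[OF ec S' ode t i] unfolding uc duhamel_term_def e0 by simp
  qed
  have "is_solution N s u0 \<tau> p u"
    unfolding is_solution_def using mild mild_unique[OF s N \<nu>(1) u0 S' pc pP mild] by blast
  moreover have "lin_sol \<tau> q d"
  proof -
    obtain C where C: "\<And>k. C k \<ge> 0" "hs s C (2 * R0)" "\<And>t k. t \<in> {0..\<tau>} \<Longrightarrow> cmod (d t k) \<le> exp (L * t) * C k"
      using d(2) unfolding tnorm_def by blast
    have h: "hs 0 (\<lambda>k. exp (L * \<tau>) * C k) (exp (L * \<tau>) * (2 * R0))" by (rule hs_change[of s]) (use s in \<open>auto intro!: hs_cmult C\<close>)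
    have le: "cmod (d t k) \<le> exp (L * \<tau>) * C k" if "t \<in> {0..\<tau>}" for t k
      using order_trans[OF C(3)[OF that] mult_right_mono[OF _ C(1), of "exp (L * t)" "exp (L * \<tau>)"]] that L0 by (auto intro: mult_left_mono)
    have dv: "((\<lambda>t. d t k) has_vector_derivative (- of_real (dsp k) * d t k + pot (q t) (d t) k)) (at t)" if "t \<in> {0<..<\<tau>} - S" for t k
    proof -
      have "q' t = q t" using that by (simp add: q'_def)
      then show ?thesis using d(1) that unfolding nlstep_def by force
    qed
    show ?thesis unfolding lin_sol_def using d(1) h le dv S(1) unfolding nlstep_def by blast
  qed
  moreover have "d 0 = ?c0" using d(1) by (simp add: nlstep_def)
  moreover have "hs s (\<lambda>k. cmod (fourier_coeff (u \<tau>) k - d \<tau> k)) \<epsilon>"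
  proof -
    have "e \<tau> = c \<tau>" using \<tau>0 by (auto simp: e_def \<eta>_def dip_ends)
    then show ?thesis unfolding uc using hs_mono[OF cl[OF \<mu>0 kb less_imp_le[OF \<kappa>(1)] c(1,2) d] _ \<kappa>(3), of "\<lambda>k. cmod (c \<tau> k - d \<tau> k)"] by simp
  qed
  ultimately show ?thesis using L2_control_pcont[OF pp] by blast
qed

subsection \<open>Smoothing and exact arrival times\<close>

lemma dsp_ge: "dsp k \<ge> (real_of_int k)\<^sup>2 - 1"
proof -
  have "((real_of_int k)\<^sup>2 - 1)\<^sup>2 \<ge> 0" by simp
  then show ?thesis by (simp add: dsp_def power2_diff)
qed

text \<open>With \<open>z = 1 + k\<^sup>2\<close> the symbol is at least \<open>z - 2\<close>, and \<open>(s/2) ln z \<le> \<sigma> z + const\<close> follows from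
  \<open>ln x \<le> x - 1\<close> at \<open>x = 2 \<sigma> z / s\<close>.\<close>

lemma decay_smoothing:
  assumes s: "s > 0" and \<sigma>: "\<sigma> > 0"
  obtains K where "K > 0" "\<And>k. wt s k * cmod (decay \<sigma> k) \<le> K"
proof (rule that)
  let ?c = "2 * \<sigma> / s"
  let ?K = "exp (2 * \<sigma> - s / 2 * (1 + ln ?c))"
  show "?K > 0" by simp
  fix k
  define z where "z = 1 + (real_of_int k)\<^sup>2"
  have z: "z > 0" unfolding z_def by (smt (verit) zero_le_power2)
  have "ln (?c * z) \<le> ?c * z - 1" using z s \<sigma> by (intro ln_le_minus_one) simp
  moreover have "ln (?c * z) = ln ?c + ln z" using z s \<sigma> by (intro ln_mult_pos) auto
  ultimately have "ln ?c + ln z \<le> ?c * z - 1" by linarith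
  then have "s / 2 * (ln ?c + ln z) \<le> s / 2 * (?c * z - 1)" using s by (intro mult_left_mono) simp_all
  moreover have "s / 2 * (?c * z - 1) = \<sigma> * z - s / 2" using s by (simp add: field_simps)
  ultimately have 1: "s / 2 * ln z \<le> \<sigma> * z - s / 2 * (1 + ln ?c)" by (simp add: algebra_simps)
  have "\<sigma> * (z - 2) \<le> \<sigma> * dsp k" using dsp_ge[of k] \<sigma> by (intro mult_left_mono) (simp_all add: z_def)
  then have "s / 2 * ln z + - (\<sigma> * dsp k) \<le> 2 * \<sigma> - s / 2 * (1 + ln ?c)" using 1 by (simp add: algebra_simps)
  moreover have "wt s k * cmod (decay \<sigma> k) = exp (s / 2 * ln z + - (\<sigma> * dsp k))"
    unfolding exp_add decay_dsp wt_def z_def[symmetric] using z by (simp add: powr_def)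
  ultimately show "wt s k * cmod (decay \<sigma> k) \<le> ?K" by simp
qed

lemma hs_smoothing:
  assumes K: "\<And>k. wt s k * cmod (decay \<sigma> k) \<le> K" and h: "hs 0 C B" and f: "\<And>k. cmod (f k) \<le> cmod (decay \<sigma> k) * C k" and C: "\<And>k. C k \<ge> 0" and K0: "K \<ge> 0"
  shows "hs s (\<lambda>k. cmod (f k)) (K * B)"
  unfolding hs_def
proof (intro allI impI)
  fix F :: "int set" assume F: "finite F"
  have "wt s k * cmod (f k) \<le> K * C k" for k
  proof -
    have "wt s k * cmod (f k) \<le> wt s k * (cmod (decay \<sigma> k) * C k)" by (intro mult_left_mono f) simp
    also have "\<dots> = (wt s k * cmod (decay \<sigma> k)) * C k" by simp
    also have "\<dots> \<le> K * C k" by (intro mult_right_mono K C)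
    finally show ?thesis .
  qed
  then have "L2_set (\<lambda>k. wt s k * cmod (f k)) F \<le> L2_set (\<lambda>k. K * C k) F" by (intro L2_set_mono) auto
  also have "\<dots> = K * L2_set C F" by (rule L2_set_right_distrib[OF K0, symmetric])
  also have "\<dots> \<le> K * B" using h F K0 by (intro mult_left_mono) (auto simp: hs_def)
  finally show "L2_set (\<lambda>k. wt s k * cmod (f k)) F \<le> K * B" .
qed

lemma decay_hs_continuous:
  assumes C: "hs s (\<lambda>k. cmod (c k)) B" and e: "e > 0"
  shows "\<forall>\<^sub>F \<sigma> in at_right 0. hs s (\<lambda>k. cmod (decay \<sigma> k * c k - c k)) e"
proof (rule hs_dominated_null[OF hs_cmult[OF C, of 2] _ _ e])
  have "cmod (decay \<sigma> k * c k - c k) \<le> 2 * cmod (c k)" if "\<sigma> > 0" for \<sigma> k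
  proof -
    have "cmod (decay \<sigma> k * c k) \<le> 1 * cmod (c k)" unfolding norm_mult using that by (intro mult_right_mono norm_decay_le) auto
    then show ?thesis using norm_triangle_ineq4[of "decay \<sigma> k * c k" "c k"] by linarith
  qed
  then show "\<forall>\<^sub>F \<sigma> in at_right 0. \<forall>k. cmod (decay \<sigma> k * c k - c k) \<le> 2 * cmod (c k)"
    by (auto simp: eventually_at_filter)
  show "((\<lambda>\<sigma>. decay \<sigma> k * c k - c k) \<longlongrightarrow> 0) (at_right 0)" for k
  proof -
    have "isCont (\<lambda>\<sigma>. decay \<sigma> k * c k - c k) 0" unfolding decay_dsp by (intro continuous_intros)
    then show ?thesis unfolding isCont_def decay_dsp by (auto intro: tendsto_mono[OF at_le])
  qed
qed simp

lemma steerE: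
  assumes "steer T c d" "\<epsilon> > 0"
  obtains \<tau> q \<delta> where "0 < \<tau>" "\<tau> \<le> T" "pcont \<tau> q" "\<delta> > 0"
    "\<And>w. lin_sol \<tau> q w \<Longrightarrow> hs 0 (\<lambda>k. norm (w 0 k - c k)) \<delta> \<Longrightarrow> hs 0 (\<lambda>k. norm (w \<tau> k - d k)) \<epsilon>"
  using assms(1)[unfolded steer_def, rule_format, OF assms(2)] that by (elim exE conjE) blast

text \<open>Steering through an equilibrium \<open>e\<close> of the free evolution makes the arrival time exact, because the
  state can wait there.  The final free evolution of duration \<open>\<sigma>\<close> is what upgrades the
  approximation from \<open>L\<^sup>2\<close> to \<open>H\<^sup>s\<close>.\<close>

lemma steer_exact_time:
  assumes ce: "small c e" and ed: "small e d" and e: "\<And>t k. decay t k * e k = e k"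
    and s: "s > 0" and \<sigma>: "0 < \<sigma>" "\<sigma> < T" and \<epsilon>: "\<epsilon> > 0"
  shows "\<exists>q. pcont T q \<and> (\<forall>w. lin_sol T q w \<longrightarrow> w 0 = c \<longrightarrow> hs s (\<lambda>k. cmod (w T k - decay \<sigma> k * d k)) \<epsilon>)"
proof -
  obtain K where K: "K > 0" "\<And>k. wt s k * cmod (decay \<sigma> k) \<le> K" using decay_smoothing[OF s \<sigma>(1)] by blast
  define T' where "T' = T - \<sigma>"
  have T': "T' > 0" using \<sigma> by (simp add: T'_def)
  have st: "steer (T' / 4) c e" "steer (T' / 4) e d" using ce ed T' by (auto simp: small_def)
  have "\<epsilon> / K > 0" using \<epsilon> K by simp
  from steerE[OF st(2) this] obtain \<tau>2 q2 \<delta>2 where 2: "0 < \<tau>2" "\<tau>2 \<le> T' / 4" "pcont \<tau>2 q2" "\<delta>2 > 0"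
    "\<And>w. lin_sol \<tau>2 q2 w \<Longrightarrow> hs 0 (\<lambda>k. norm (w 0 k - e k)) \<delta>2 \<Longrightarrow> hs 0 (\<lambda>k. norm (w \<tau>2 k - d k)) (\<epsilon> / K)" by blast
  from steerE[OF st(1) 2(4)] obtain \<tau>1 q1 \<delta>1 where 1: "0 < \<tau>1" "\<tau>1 \<le> T' / 4" "pcont \<tau>1 q1" "\<delta>1 > 0"
    "\<And>w. lin_sol \<tau>1 q1 w \<Longrightarrow> hs 0 (\<lambda>k. norm (w 0 k - c k)) \<delta>1 \<Longrightarrow> hs 0 (\<lambda>k. norm (w \<tau>1 k - e k)) \<delta>2" by blast
  define \<rho> where "\<rho> = T' - \<tau>1 - \<tau>2"
  have \<rho>: "\<rho> > 0" using 1 2 T' by (simp add: \<rho>_def)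
  let ?q3 = "glue \<tau>2 q2 (\<lambda>_. 0)" let ?q2 = "glue \<rho> (\<lambda>_. 0) ?q3" let ?q = "glue \<tau>1 q1 ?q2"
  have T: "T = \<tau>1 + (\<rho> + (\<tau>2 + \<sigma>))" by (simp add: \<rho>_def T'_def)
  show ?thesis
  proof (intro exI[of _ ?q] conjI allI impI)
    show "pcont T ?q" unfolding T using 1 2 \<rho> \<sigma> by (intro pcont_glue pcont_const) auto
    fix w assume w: "lin_sol T ?q w" "w 0 = c"
    note w1 = lin_sol_split[OF w(1)[unfolded T] 1(1)]
    have p: "\<rho> + (\<tau>2 + \<sigma>) > 0" "\<tau>2 + \<sigma> > 0" using \<rho> 2 \<sigma> by auto
    have s1: "lin_sol \<tau>1 q1 w" "lin_sol (\<rho> + (\<tau>2 + \<sigma>)) ?q2 (\<lambda>t. w (\<tau>1 + t))" using w1 p by auto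
    have s2: "lin_sol \<rho> (\<lambda>_. 0) (\<lambda>t. w (\<tau>1 + t))" "lin_sol (\<tau>2 + \<sigma>) ?q3 (\<lambda>t. w (\<tau>1 + (\<rho> + t)))"
      using lin_sol_split[OF s1(2) \<rho> p(2)] by auto
    have s3: "lin_sol \<tau>2 q2 (\<lambda>t. w (\<tau>1 + (\<rho> + t)))" "lin_sol \<sigma> (\<lambda>_. 0) (\<lambda>t. w (\<tau>1 + (\<rho> + (\<tau>2 + t))))"
      using lin_sol_split[OF s2(2) 2(1) \<sigma>(1)] by auto
    have h1: "hs 0 (\<lambda>k. norm (w \<tau>1 k - e k)) \<delta>2" by (rule 1(5)[OF s1(1)]) (use w(2) 1(4) in auto)
    have wait: "w (\<tau>1 + \<rho>) k - e k = decay \<rho> k * (w \<tau>1 k - e k)" for k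
      using lin_sol_free[OF s2(1), of \<rho> k] \<rho> e by (simp add: right_diff_distrib)
    have h2: "hs 0 (\<lambda>k. norm (w (\<tau>1 + \<rho>) k - e k)) \<delta>2"
      by (rule hs_mono[OF h1]) (use \<rho> in \<open>simp_all add: wait norm_mult mult_left_le_one_le norm_decay_le\<close>)
    have h3: "hs 0 (\<lambda>k. norm (w (\<tau>1 + (\<rho> + \<tau>2)) k - d k)) (\<epsilon> / K)" using 2(5)[OF s3(1)] h2 by simp
    have fin: "w T k - decay \<sigma> k * d k = decay \<sigma> k * (w (\<tau>1 + (\<rho> + \<tau>2)) k - d k)" for k
      using lin_sol_free[OF s3(2), of \<sigma> k] \<sigma> unfolding T by (simp add: right_diff_distrib)
    have "hs s (\<lambda>k. cmod (w T k - decay \<sigma> k * d k)) (K * (\<epsilon> / K))"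
      by (rule hs_smoothing[OF K(2) h3]) (use K in \<open>auto simp: fin norm_mult\<close>)
    then show "hs s (\<lambda>k. cmod (w T k - decay \<sigma> k * d k)) \<epsilon>" using K by simp
  qed
qed

subsection \<open>Controllability\<close>

lemma is_solution_sobolev: "is_solution N s u0 \<tau> p u \<Longrightarrow> t \<in> {0..\<tau>} \<Longrightarrow> u t \<in> sobolev_space s"
  unfolding is_solution_def mild_solution_def continuous_into_sobolev_def by blast

lemma small_time_controllable:
  assumes s: "s > 1/2" and m: "m \<ge> 2" and N: "\<And>u k. N u k = \<nu> k * fourier_coeff (\<lambda>x. u x ^ m) k"
    and \<nu>: "\<And>k. cmod (\<nu> k) \<le> (real_of_int k)\<^sup>2" "herm \<nu>"
    and u0: "u0 \<in> sobolev_space s" and u1: "u1 \<in> sobolev_space s" and sg: "\<And>x. sgn (u0 x) = sgn (u1 x)"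
  shows "small_time_L2_approx_controllable N s u0 u1"
  unfolding small_time_L2_approx_controllable_def
proof (intro allI impI)
  fix T \<epsilon> :: real assume T: "T > 0" and \<epsilon>: "\<epsilon> > 0"
  have p: "u0 \<in> per" "u1 \<in> per" using u0 u1 by (auto simp: sobolev_iff)
  define e where "e = \<epsilon> / (4 * sqrt (2 * pi))"
  have e: "e > 0" using \<epsilon> by (simp add: e_def)
  have st: "steer T (fourier_coeff u0) (fourier_coeff u1)" using same_sign_small[OF p sg] T by (simp add: small_def)
  from steerE[OF st e] obtain \<tau> q \<delta> where q: "0 < \<tau>" "\<tau> \<le> T" "pcont \<tau> q" "\<delta> > 0"
    "\<And>w. lin_sol \<tau> q w \<Longrightarrow> hs 0 (\<lambda>k. norm (w 0 k - fourier_coeff u0 k)) \<delta> \<Longrightarrow> hs 0 (\<lambda>k. norm (w \<tau> k - fourier_coeff u1 k)) e" by blast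
  obtain p u d where pu: "L2_control \<tau> p" "is_solution N s u0 \<tau> p u" "lin_sol \<tau> q d" "d 0 = fourier_coeff u0"
     "hs s (\<lambda>k. cmod (fourier_coeff (u \<tau>) k - d \<tau> k)) e"
    using realize_linear[OF s m N \<nu> u0 q(1,3) e] by blast
  have us: "u \<tau> \<in> sobolev_space s" using is_solution_sobolev[OF pu(2), of \<tau>] q(1) by simp
  have up: "u \<tau> \<in> per" using us by (simp add: sobolev_iff)
  have "hs 0 (\<lambda>k. norm (d \<tau> k - fourier_coeff u1 k)) e" by (rule q(5)[OF pu(3)]) (use pu(4) q(4) in simp)
  from hs_norm_triangle[OF hs_change[OF pu(5)] this] have h: "hs 0 (\<lambda>k. norm (fourier_coeff (u \<tau>) k - fourier_coeff u1 k)) (e + e)" using s by simp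
  have "L2_norm (\<lambda>x. u \<tau> x - u1 x) \<le> sqrt (2*pi) * (e + e)"
    using L2_norm_le[OF per_diff[OF up p(2)] sobolev_l1[OF s sobolev_diff[OF us u1]]] h unfolding fourier_coeff_diff[OF up p(2)] by blast
  also have "\<dots> < \<epsilon>" using \<epsilon> by (simp add: e_def)
  finally show "\<exists>\<tau>\<in>{0<..T}. \<exists>p u. L2_control \<tau> p \<and> is_solution N s u0 \<tau> p u \<and> L2_norm (\<lambda>x. u \<tau> x - u1 x) < \<epsilon>"
    using q(1,2) pu(1,2) by (intro bexI[of _ \<tau>]) auto
qed

text \<open>The target is first replaced by its free evolution over a short time \<open>\<sigma>\<close>, which is close to it in
  \<open>H\<^sup>s\<close>; the equilibrium is a constant of the common sign.\<close>

lemma exact_time_controllable: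
  assumes s: "s > 1/2" and m: "m \<ge> 2" and N: "\<And>u k. N u k = \<nu> k * fourier_coeff (\<lambda>x. u x ^ m) k"
    and \<nu>: "\<And>k. cmod (\<nu> k) \<le> (real_of_int k)\<^sup>2" "herm \<nu>"
    and u0: "u0 \<in> sobolev_space s" and u1: "u1 \<in> sobolev_space s"
    and sg: "\<And>x. sgn (u0 x) = sgn a" "\<And>x. sgn (u1 x) = sgn a"
  shows "Hs_approx_controllable N s u0 u1"
  unfolding Hs_approx_controllable_def
proof (intro allI impI)
  fix T \<epsilon> :: real assume T: "T > 0" and \<epsilon>: "\<epsilon> > 0"
  have p: "u0 \<in> per" "u1 \<in> per" using u0 u1 by (auto simp: sobolev_iff)
  let ?e = "fourier_coeff (\<lambda>x. a)"
  have sm: "small (fourier_coeff u0) ?e" "small ?e (fourier_coeff u1)"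
    using sg by (auto intro!: same_sign_small p per_const)
  have eq: "decay t k * ?e k = ?e k" for t k
  proof (cases "k = 0")
    case False
    then show ?thesis using fcc_cis[of "of_real a" 0 k] by (simp add: fourier_coeff_eq per_const)
  qed (simp add: decay_def)
  have e: "\<epsilon> / 4 > 0" using \<epsilon> by simp
  have "\<forall>\<^sub>F \<sigma> in at_right 0. \<sigma> \<in> {0<..<T}" using T by (rule eventually_at_right_real)
  then have "\<forall>\<^sub>F \<sigma> in at_right 0. \<sigma> \<in> {0<..<T} \<and> hs s (\<lambda>k. cmod (decay \<sigma> k * fourier_coeff u1 k - fourier_coeff u1 k)) (\<epsilon> / 4)"
    using decay_hs_continuous[OF hs_sobolev_norm[OF u1] e] by (rule eventually_conj)
  then have "\<exists>\<sigma>. \<sigma> \<in> {0<..<T} \<and> hs s (\<lambda>k. cmod (decay \<sigma> k * fourier_coeff u1 k - fourier_coeff u1 k)) (\<epsilon> / 4)"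
    by (rule eventually_happens'[rotated]) simp
  then obtain \<sigma> where \<sigma>: "0 < \<sigma>" "\<sigma> < T" "hs s (\<lambda>k. cmod (decay \<sigma> k * fourier_coeff u1 k - fourier_coeff u1 k)) (\<epsilon> / 4)" by auto
  have s0: "s > 0" using s by simp
  obtain q where q: "pcont T q" "\<And>w. lin_sol T q w \<Longrightarrow> w 0 = fourier_coeff u0 \<Longrightarrow> hs s (\<lambda>k. cmod (w T k - decay \<sigma> k * fourier_coeff u1 k)) (\<epsilon> / 4)"
    using steer_exact_time[OF sm eq s0 \<sigma>(1,2) e] by blast
  obtain p u d where pu: "L2_control T p" "is_solution N s u0 T p u" "lin_sol T q d" "d 0 = fourier_coeff u0"
     "hs s (\<lambda>k. cmod (fourier_coeff (u T) k - d T k)) (\<epsilon> / 4)"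
    using realize_linear[OF s m N \<nu> u0 T q(1) e] by blast
  have up: "u T \<in> per" using is_solution_sobolev[OF pu(2), of T] T by (simp add: sobolev_iff)
  have "hs s (\<lambda>k. cmod (fourier_coeff (u T) k - fourier_coeff u1 k)) (\<epsilon> / 4 + (\<epsilon> / 4 + \<epsilon> / 4))"
    by (intro hs_norm_triangle[OF pu(5)] hs_norm_triangle[OF q(2)[OF pu(3,4)]] \<sigma>(3))
  then have "sobolev_norm s (\<lambda>x. u T x - u1 x) \<le> \<epsilon> / 4 + (\<epsilon> / 4 + \<epsilon> / 4)"
    by (intro sobolev_norm_le) (simp add: fourier_coeff_diff[OF up p(2)])
  also have "\<dots> < \<epsilon>" using \<epsilon> by simp
  finally show "\<exists>p u. L2_control T p \<and> is_solution N s u0 T p u \<and> sobolev_norm s (\<lambda>x. u T x - u1 x) < \<epsilon>"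
    using pu by blast
qed

lemma N_KS_eq: "N_KS u k = (\<i> * of_int k / 2) * fourier_coeff (\<lambda>x. u x ^ 2) k"
  by (simp add: N_KS_def dx_def)

lemma N_CH_eq: "N_CH u k = of_real ((real_of_int k)\<^sup>2) * fourier_coeff (\<lambda>x. u x ^ 3) k"
proof -
  have "N_CH u k = - (\<i> * \<i>) * (of_int k * of_int k * fourier_coeff (\<lambda>x. u x ^ 3) k)"
    by (simp only: N_CH_def dx_def mult_ac minus_mult_left)
  then show ?thesis by (simp add: power2_eq_square)
qed

theorem theorem1p1:
  fixes N :: "(real \<Rightarrow> real) \<Rightarrow> int \<Rightarrow> complex" and s :: real and u0 u1 :: "real \<Rightarrow> real"
  assumes "N = N_KS \<or> N = N_CH"
    and "s > 1/2"
    and "u0 \<in> sobolev_space s" and "u1 \<in> sobolev_space s"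
  shows "((\<forall>x. sgn (u0 x) = sgn (u1 x)) \<longrightarrow> small_time_L2_approx_controllable N s u0 u1) \<and>
    ((\<forall>x. u0 x > 0 \<and> u1 x > 0) \<or> (\<forall>x. u0 x < 0 \<and> u1 x < 0)
      \<longrightarrow> Hs_approx_controllable N s u0 u1)"
proof -
  obtain \<nu> and m :: nat where m: "m \<ge> 2" and N: "\<And>u k. N u k = \<nu> k * fourier_coeff (\<lambda>x. u x ^ m) k"
    and \<nu>: "\<And>k. cmod (\<nu> k) \<le> (real_of_int k)\<^sup>2" "herm \<nu>"
    using assms(1)
  proof
    assume "N = N_KS"
    moreover have "cmod (\<i> * of_int k / 2) \<le> (real_of_int k)\<^sup>2" for k
    proof -
      have "\<bar>k\<bar> \<le> k\<^sup>2" using self_le_power[of "\<bar>k\<bar>" 2] by (cases "k = 0") auto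
      then have "\<bar>real_of_int k\<bar> \<le> (real_of_int k)\<^sup>2" by (metis of_int_abs of_int_le_iff of_int_power)
      then show ?thesis by (simp add: norm_mult norm_divide)
    qed
    moreover have "herm (\<lambda>k. \<i> * of_int k / 2)" by (simp add: herm_def)
    ultimately show thesis using that[of 2 "\<lambda>k. \<i> * of_int k / 2"] N_KS_eq by simp
  next
    assume "N = N_CH"
    moreover have "herm (\<lambda>k. complex_of_real ((real_of_int k)\<^sup>2))" by (simp add: herm_def)
    ultimately show thesis using that[of 3 "\<lambda>k. of_real ((real_of_int k)\<^sup>2)"] N_CH_eq by (simp add: norm_power)
  qed
  note c = assms(2) m N \<nu> assms(3,4)
  show ?thesis
    using small_time_controllable[OF c] exact_time_controllable[OF c, of 1] exact_time_controllable[OF c, of "-1"] by auto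
qed

end
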